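(* Let $J\subset(0,\pi)$ be an interval such that $J\cap(J+\frac{\pi}{2})=\emptyset$. Let $r\in J$ be arbitrary and $\iota_r\colon\mathbb{S}^n\to\mathbb{S}^{n+1}$, $p\mapsto \sin r\,p-\cos r\,e_{n+2}$. Then $$\Psi\colon \mathrm{SO}_{n+2}\times_{\mathrm{SO}_{n+1}}\mathrm{Diff}_+(\mathbb{S}^n)\to\mathscr{F}(\mathbb{S}^{n+1};\cot J),\qquad [Q,g]\mapsto Q\circ\iota_r\circ g$$ is a weak homotopy equivalence.
   Context: Throughout, $n\ge2$ is an integer, manifolds are connected, oriented and smooth, maps between manifolds are smooth, and spaces of such maps carry the $C^\infty$-topology. $\mathbb{S}^{n+1}\subset\mathbb{R}^{n+2}$ is the unit sphere with the round metric; $\mathbb{S}^n\subset\mathbb{R}^{n+1}=\mathbb{R}^{n+1}\times\{0\}\subset\mathbb{R}^{n+2}$; $e_{n+2}$ is the last vector of the standard basis. Conventions: $(u_1,\dots,u_{n+1})$ is positively oriented in $T\mathbb{S}^{n+1}_p$ iff $(u_1,\dots,u_{n+1},p)$ is positively oriented in $\mathbb{R}^{n+2}$ (and analogously for $\mathbb{S}^n\subset\mathbb{R}^{n+1}$). The Gauss map $\nu$ of an immersion $f\colon N^n\to\mathbb{S}^{n+1}$ is the unit normal such that $(df(u_1),\dots,df(u_n),\nu)$ is a positively oriented orthonormal frame whenever $(u_1,\dots,u_n)$ is a positively oriented orthonormal frame of $N$; principal curvatures $\kappa$ are defined by $d\nu(u)=-\kappa\,df(u)$. For an interval $I\subset\mathbb{R}$,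 $\mathscr{F}(\mathbb{S}^{n+1};I)$ is the set of immersions $\mathbb{S}^n\to\mathbb{S}^{n+1}$ whose principal curvatures take values in $I$, with the $C^\infty$-topology; $\cot J=\{\cot\rho:\rho\in J\}$. $\mathrm{Diff}_+(\mathbb{S}^n)$ is the group of orientation-preserving diffeomorphisms of $\mathbb{S}^n$. $\mathrm{SO}_{n+1}$ is regarded as the subgroup of $\mathrm{SO}_{n+2}$ fixing $e_{n+2}$. The twisted product $\mathrm{SO}_{n+2}\times_{\mathrm{SO}_{n+1}}\mathrm{Diff}_+(\mathbb{S}^n)$ is the quotient of $\mathrm{SO}_{n+2}\times\mathrm{Diff}_+(\mathbb{S}^n)$ by the equivalence relation identifying $(Q,g)$ with $(QP,P^{-1}g)$ for $Q\in\mathrm{SO}_{n+2}$, $P\in\mathrm{SO}_{n+1}$, $g\in\mathrm{Diff}_+(\mathbb{S}^n)$; classes are denoted $[Q,g]$. *)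

theory Defs
  imports "HOL-Analysis.Analysis" "HOL-Algebra.Group"
begin

section \<open>Conventions\<close>

text \<open>
  The dimension \<open>n\<close> is the cardinality of a finite index type \<open>'n\<close>. Euclidean \<open>(n+1)\<close>-space is
  \<open>real^('n option)\<close> and Euclidean \<open>(n+2)\<close>-space is \<open>real^('n option option)\<close>. In both, the index
  \<open>None\<close> stands for the last coordinate, and \<open>Some\<close> includes the index set of the smaller space.
  A map defined on a sphere is a function that is \<open>extensional\<close>, i.e. \<open>undefined\<close> off that sphere.
\<close>

type_synonym 'n euc1 = "real^('n option)"
type_synonym 'n euc2 = "real^('n option option)"
type_synonym 'n mat2 = "real^('n option option)^('n option option)"

abbreviation usphere :: "'a::real_normed_vector set" where
  "usphere \<equiv> sphere 0 1"

definition incl :: "'n::finite euc1 \<Rightarrow> 'n euc2" where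
  "incl x = (\<chi> i. case i of None \<Rightarrow> 0 | Some j \<Rightarrow> x $ j)"

definition e_last :: "'n::finite euc2" where
  "e_last = axis None 1"


section \<open>Smooth maps\<close>

primrec iter_deriv :: "'a list \<Rightarrow> ('a::real_normed_vector \<Rightarrow> 'b::real_normed_vector) \<Rightarrow> 'a \<Rightarrow> 'b" where
  "iter_deriv [] f = f"
| "iter_deriv (v # vs) f = (\<lambda>x. frechet_derivative (iter_deriv vs f) (at x) v)"

definition smooth_on_open :: "'a::euclidean_space set \<Rightarrow> ('a \<Rightarrow> 'b::euclidean_space) \<Rightarrow> bool" where
  "smooth_on_open U f \<longleftrightarrow> open U \<and> (\<forall>vs. \<forall>x\<in>U. iter_deriv vs f differentiable (at x))"

text \<open>A map on an arbitrary subset of a Euclidean space is smooth if it locally extends to a smooth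
  map on an open set.\<close>

definition smooth_map_on :: "'a::euclidean_space set \<Rightarrow> ('a \<Rightarrow> 'b::euclidean_space) \<Rightarrow> bool" where
  "smooth_map_on S f \<longleftrightarrow>
     (\<forall>p\<in>S. \<exists>U F. p \<in> U \<and> smooth_on_open U F \<and> (\<forall>x\<in>S \<inter> U. F x = f x))"

definition diffeomorphism ::
    "'a::euclidean_space set \<Rightarrow> 'b::euclidean_space set \<Rightarrow> ('a \<Rightarrow> 'b) \<Rightarrow> ('b \<Rightarrow> 'a) \<Rightarrow> bool" where
  "diffeomorphism S T f g \<longleftrightarrow>
     smooth_map_on S f \<and> f ` S = T \<and> smooth_map_on T g \<and> g ` T = S \<and>
     (\<forall>x\<in>S. g (f x) = x) \<and> (\<forall>y\<in>T. f (g y) = y)"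

text \<open>The differential of a map defined on a sphere. A derivative within the sphere is unique only
  on vectors tangent to the sphere, and \<open>dS f p\<close> is only ever applied to those.\<close>

definition dS :: "('a::euclidean_space \<Rightarrow> 'b::euclidean_space) \<Rightarrow> 'a \<Rightarrow> 'a \<Rightarrow> 'b" where
  "dS f p = frechet_derivative f (at p within usphere)"

definition tangent :: "'a::euclidean_space \<Rightarrow> 'a set" where
  "tangent p = {u. u \<bullet> p = 0}"


section \<open>The smooth topology\<close>

text \<open>Local parametrizations, i.e. inverses of charts, of the \<open>n\<close>-sphere.\<close>

definition local_param :: "(real^'n) set \<Rightarrow> (real^'n \<Rightarrow> 'n::finite euc1) \<Rightarrow> bool" where
  "local_param U \<phi> \<longleftrightarrow>
     open U \<and> openin (top_of_set usphere) (\<phi> ` U) \<and> (\<exists>\<psi>. diffeomorphism U (\<phi> ` U) \<phi> \<psi>)"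

definition smooth_maps :: "('n::finite euc1 \<Rightarrow> 'b::euclidean_space) set" where
  "smooth_maps = {f \<in> usphere \<rightarrow>\<^sub>E usphere. smooth_map_on usphere f}"

text \<open>Uniform convergence of all derivatives in charts on compact sets.\<close>

definition smooth_nbhd ::
    "('n::finite euc1 \<Rightarrow> 'b::euclidean_space) \<Rightarrow> (real^'n \<Rightarrow> 'n euc1) \<Rightarrow> (real^'n) set
      \<Rightarrow> (real^'n) list \<Rightarrow> real \<Rightarrow> ('n euc1 \<Rightarrow> 'b) set" where
  "smooth_nbhd f \<phi> K vs \<epsilon> =
     {g \<in> smooth_maps. \<forall>x\<in>K. norm (iter_deriv vs (g \<circ> \<phi>) x - iter_deriv vs (f \<circ> \<phi>) x) < \<epsilon>}"

definition smooth_topology :: "('n::finite euc1 \<Rightarrow> 'b::euclidean_space) topology" where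
  "smooth_topology = topology_generated_by
     {smooth_nbhd f \<phi> K vs \<epsilon> | f \<phi> U K vs \<epsilon>.
        f \<in> smooth_maps \<and> local_param U \<phi> \<and> compact K \<and> K \<subseteq> U \<and> 0 < \<epsilon>}"


section \<open>Orientation, Gauss map and principal curvatures\<close>

definition orthonormal :: "('i \<Rightarrow> 'a::real_inner) \<Rightarrow> bool" where
  "orthonormal u \<longleftrightarrow> (\<forall>i j. u i \<bullet> u j = (if i = j then 1 else 0))"

text \<open>A positively oriented basis \<open>u\<close> of the tangent space of the unit sphere at \<open>p\<close>: appending
  \<open>p\<close> as the last vector gives a positively oriented basis of the ambient space. The vectors are
  the columns of the matrix.\<close>

definition pos_basis :: "real^('k option) \<Rightarrow> ('k::finite \<Rightarrow> real^('k option)) \<Rightarrow> bool" where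
  "pos_basis p u \<longleftrightarrow>
     (\<forall>k. u k \<in> tangent p) \<and>
     0 < det (\<chi> i j. (case j of None \<Rightarrow> p | Some k \<Rightarrow> u k) $ i)"

definition immersion :: "('n::finite euc1 \<Rightarrow> 'b::euclidean_space) \<Rightarrow> bool" where
  "immersion f \<longleftrightarrow> f \<in> smooth_maps \<and> (\<forall>p\<in>usphere. inj_on (dS f p) (tangent p))"

text \<open>Frames of the \<open>n\<close>-sphere are orthonormal with respect to the metric induced by \<open>f\<close>, i.e.
  their images under the differential are orthonormal. The family
  \<open>case_option \<nu> (\<lambda>i. dS f p (u i))\<close> lists the latter vectors followed by \<open>\<nu>\<close>.\<close>

definition gauss_map :: "('n::finite euc1 \<Rightarrow> 'n euc2) \<Rightarrow> 'n euc1 \<Rightarrow> 'n euc2" where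
  "gauss_map f p = (THE \<nu>. \<forall>u. pos_basis p u \<and> orthonormal (\<lambda>i. dS f p (u i)) \<longrightarrow>
     pos_basis (f p) (case_option \<nu> (\<lambda>i. dS f p (u i))) \<and>
     orthonormal (case_option \<nu> (\<lambda>i. dS f p (u i))))"

definition principal_curvature ::
    "('n::finite euc1 \<Rightarrow> 'n euc2) \<Rightarrow> 'n euc1 \<Rightarrow> real \<Rightarrow> bool" where
  "principal_curvature f p \<kappa> \<longleftrightarrow>
     (\<exists>u\<in>tangent p. u \<noteq> 0 \<and> dS (gauss_map f) p u = - \<kappa> *\<^sub>R dS f p u)"

definition immersion_space :: "real set \<Rightarrow> ('n::finite euc1 \<Rightarrow> 'n euc2) topology" where
  "immersion_space I = subtopology smooth_topology
     {f. immersion f \<and> (\<forall>p\<in>usphere. \<forall>\<kappa>. principal_curvature f p \<kappa> \<longrightarrow> \<kappa> \<in> I)}"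


section \<open>The twisted product\<close>

definition Diff_plus :: "('n::finite euc1 \<Rightarrow> 'n euc1) set" where
  "Diff_plus = {g \<in> usphere \<rightarrow>\<^sub>E usphere. (\<exists>h. diffeomorphism usphere usphere g h) \<and>
     (\<forall>p\<in>usphere. \<forall>u. pos_basis p u \<longrightarrow> pos_basis (g p) (\<lambda>i. dS g p (u i)))}"

definition SO2 :: "'n::finite mat2 set" where
  "SO2 = {Q. rotation_matrix Q}"

definition SO1 :: "'n::finite mat2 set" where
  "SO1 = {P \<in> SO2. P *v e_last = e_last}"

text \<open>\<open>g'\<close> is \<open>P\<inverse> \<circ> g\<close>, where \<open>P\<close> acts on the smaller space through its inclusion in the larger.\<close>

definition twist_rel ::
    "(('n::finite mat2 \<times> ('n euc1 \<Rightarrow> 'n euc1)) \<times> ('n mat2 \<times> ('n euc1 \<Rightarrow> 'n euc1))) set" where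
  "twist_rel = {((Q, g), (Q', g')).
     Q \<in> SO2 \<and> g \<in> Diff_plus \<and> Q' \<in> SO2 \<and> g' \<in> Diff_plus \<and>
     (\<exists>P\<in>SO1. Q' = Q ** P \<and> (\<forall>x\<in>usphere. incl (g' x) = matrix_inv P *v incl (g x)))}"

definition quotient_topology :: "'a topology \<Rightarrow> ('a \<times> 'a) set \<Rightarrow> 'a set topology" where
  "quotient_topology X R =
     topology (\<lambda>W. W \<subseteq> topspace X // R \<and> openin X {x \<in> topspace X. R `` {x} \<in> W})"

definition twisted_product :: "('n::finite mat2 \<times> ('n euc1 \<Rightarrow> 'n euc1)) set topology" where
  "twisted_product = quotient_topology
     (prod_topology (top_of_set SO2) (subtopology smooth_topology Diff_plus)) twist_rel"

definition iota :: "real \<Rightarrow> 'n::finite euc1 \<Rightarrow> 'n euc2" where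
  "iota r p = sin r *\<^sub>R incl p - cos r *\<^sub>R e_last"

text \<open>The value on a class is computed from any representative, see \<open>Psi_class\<close> below.\<close>

definition Psi :: "real \<Rightarrow> ('n::finite mat2 \<times> ('n euc1 \<Rightarrow> 'n euc1)) set \<Rightarrow> 'n euc1 \<Rightarrow> 'n euc2" where
  "Psi r C = the_elem ((\<lambda>(Q, g). restrict (\<lambda>p. Q *v iota r (g p)) usphere) ` C)"


section \<open>Weak homotopy equivalences\<close>

definition cube :: "nat \<Rightarrow> (nat \<Rightarrow> real) topology" where
  "cube k = subtopology (powertop_real UNIV) {t. (\<forall>i<k. t i \<in> {0..1}) \<and> (\<forall>i\<ge>k. t i = 0)}"

definition based_at :: "nat \<Rightarrow> 'a \<Rightarrow> ((nat \<Rightarrow> real) \<Rightarrow> 'a) \<Rightarrow> bool" where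
  "based_at k x0 h \<longleftrightarrow> (\<forall>t\<in>topspace (cube k). (\<exists>i<k. t i = 0 \<or> t i = 1) \<longrightarrow> h t = x0)"

definition hclass ::
    "nat \<Rightarrow> 'a topology \<Rightarrow> 'a \<Rightarrow> ((nat \<Rightarrow> real) \<Rightarrow> 'a) \<Rightarrow> ((nat \<Rightarrow> real) \<Rightarrow> 'a) set" where
  "hclass k X x0 g = {h. homotopic_with (based_at k x0) (cube k) X g h}"

definition concat_cube :: "((nat \<Rightarrow> real) \<Rightarrow> 'a) \<Rightarrow> ((nat \<Rightarrow> real) \<Rightarrow> 'a) \<Rightarrow> (nat \<Rightarrow> real) \<Rightarrow> 'a" where
  "concat_cube g h t = (if t 0 \<le> 1/2 then g (t(0 := 2 * t 0)) else h (t(0 := 2 * t 0 - 1)))"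

text \<open>The homotopy groups, for \<open>k \<ge> 1\<close>. The unions in the multiplication and in the induced maps
  range over representatives, and all their members coincide.\<close>

definition homotopy_group :: "nat \<Rightarrow> 'a topology \<Rightarrow> 'a \<Rightarrow> ((nat \<Rightarrow> real) \<Rightarrow> 'a) set monoid" where
  "homotopy_group k X x0 =
     \<lparr>carrier = {hclass k X x0 g | g. continuous_map (cube k) X g \<and> based_at k x0 g},
      mult = (\<lambda>A B. \<Union>g\<in>A. \<Union>h\<in>B. hclass k X x0 (concat_cube g h)),
      one = hclass k X x0 (\<lambda>_. x0)\<rparr>"

definition homotopy_induced ::
    "nat \<Rightarrow> 'b topology \<Rightarrow> ('a \<Rightarrow> 'b) \<Rightarrow> 'a \<Rightarrow> ((nat \<Rightarrow> real) \<Rightarrow> 'a) set \<Rightarrow> ((nat \<Rightarrow> real) \<Rightarrow> 'b) set" where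
  "homotopy_induced k Y f x0 A = (\<Union>g\<in>A. hclass k Y (f x0) (f \<circ> g))"

definition weak_homotopy_equivalence :: "'a topology \<Rightarrow> 'b topology \<Rightarrow> ('a \<Rightarrow> 'b) \<Rightarrow> bool" where
  "weak_homotopy_equivalence X Y f \<longleftrightarrow>
     continuous_map X Y f \<and>
     bij_betw (\<lambda>C. \<Union>x\<in>C. path_component_of_set Y (f x)) (path_components_of X) (path_components_of Y) \<and>
     (\<forall>k\<ge>1. \<forall>x0\<in>topspace X.
        homotopy_induced k Y f x0 \<in> iso (homotopy_group k X x0) (homotopy_group k Y (f x0)))"


section \<open>Well-definedness\<close>

lemma openin_quotient_topology:
  "openin (quotient_topology X R) W \<longleftrightarrow>
     W \<subseteq> topspace X // R \<and> openin X {x \<in> topspace X. R `` {x} \<in> W}"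
proof -
  have *: "istopology (\<lambda>W. W \<subseteq> topspace X // R \<and> openin X {x \<in> topspace X. R `` {x} \<in> W})"
    unfolding istopology_def
  proof (intro conjI allI impI)
    fix S T
    assume S: "S \<subseteq> topspace X // R \<and> openin X {x \<in> topspace X. R `` {x} \<in> S}"
      and T: "T \<subseteq> topspace X // R \<and> openin X {x \<in> topspace X. R `` {x} \<in> T}"
    have "{x \<in> topspace X. R `` {x} \<in> S \<inter> T} =
        {x \<in> topspace X. R `` {x} \<in> S} \<inter> {x \<in> topspace X. R `` {x} \<in> T}" by blast
    then show "openin X {x \<in> topspace X. R `` {x} \<in> S \<inter> T}" using S T by auto
    show "S \<inter> T \<subseteq> topspace X // R" using S by blast
  next
    fix \<K>
    assume K: "\<forall>K\<in>\<K>. K \<subseteq> topspace X // R \<and> openin X {x \<in> topspace X. R `` {x} \<in> K}"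
    have "{x \<in> topspace X. R `` {x} \<in> \<Union>\<K>} = \<Union>((\<lambda>K. {x \<in> topspace X. R `` {x} \<in> K}) ` \<K>)" by blast
    then show "openin X {x \<in> topspace X. R `` {x} \<in> \<Union>\<K>}" using K by auto
    show "\<Union>\<K> \<subseteq> topspace X // R" using K by blast
  qed
  show ?thesis unfolding quotient_topology_def topology_inverse'[OF *] ..
qed

lemma topspace_quotient_topology: "topspace (quotient_topology X R) = topspace X // R"
proof
  show "topspace (quotient_topology X R) \<subseteq> topspace X // R"
    using openin_topspace[of "quotient_topology X R"] unfolding openin_quotient_topology by blast
  have "{x \<in> topspace X. R `` {x} \<in> topspace X // R} = topspace X" by (auto simp: quotient_def)
  then have "openin (quotient_topology X R) (topspace X // R)"
    unfolding openin_quotient_topology by simp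
  then show "topspace X // R \<subseteq> topspace (quotient_topology X R)" by (rule openin_subset)
qed

lemma matrix_inv_SO2:
  assumes "P \<in> SO2"
  shows "P ** matrix_inv P = mat 1" "matrix_inv P ** P = mat 1" "matrix_inv P = transpose P"
proof -
  have o: "transpose P ** P = mat 1 \<and> P ** transpose P = mat 1"
    using assms by (auto simp: SO2_def rotation_matrix_def orthogonal_matrix_def)
  then have "\<exists>A. P ** A = mat 1 \<and> A ** P = mat 1" by blast
  then have s: "P ** matrix_inv P = mat 1 \<and> matrix_inv P ** P = mat 1"
    unfolding matrix_inv_def by (rule someI_ex)
  then show "P ** matrix_inv P = mat 1" "matrix_inv P ** P = mat 1" by auto
  show "matrix_inv P = transpose P"
    using s o by (metis matrix_mul_assoc matrix_mul_lid matrix_mul_rid)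
qed

lemma mat_1_SO1: "mat 1 \<in> SO1"
  by (simp add: SO1_def SO2_def rotation_matrix_def orthogonal_matrix_id)

lemma SO1_mult: "P \<in> SO1 \<Longrightarrow> P' \<in> SO1 \<Longrightarrow> P ** P' \<in> SO1"
  by (simp add: SO1_def SO2_def rotation_matrix_def orthogonal_matrix_mul det_mul
      flip: matrix_vector_mul_assoc)

lemma SO1_inv:
  assumes "P \<in> SO1"
  shows "matrix_inv P \<in> SO1"
proof -
  have P: "P \<in> SO2" "P *v e_last = e_last" using assms by (auto simp: SO1_def)
  have "matrix_inv P *v e_last = matrix_inv P *v (P *v e_last)" by (simp add: P)
  also have "\<dots> = e_last" by (simp add: matrix_vector_mul_assoc matrix_inv_SO2(2)[OF P(1)])
  finally show ?thesis using P by (simp add: SO1_def SO2_def matrix_inv_SO2 rotation_matrix_def det_transpose)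
qed

lemma equiv_twist_rel: "equiv (SO2 \<times> Diff_plus) twist_rel"
proof (rule equivI)
  show "twist_rel \<subseteq> (SO2 \<times> Diff_plus) \<times> (SO2 \<times> Diff_plus)"
    by (auto simp: twist_rel_def)
  have m: "matrix_inv (mat 1) = (mat 1 :: 'a mat2)"
    using matrix_inv_SO2(3)[of "mat 1 :: 'a mat2"] mat_1_SO1 by (auto simp: SO1_def transpose_mat)
  have "\<exists>P\<in>SO1. Q = Q ** P \<and> (\<forall>x\<in>usphere. incl (g x) = matrix_inv P *v incl (g x))"
    for Q :: "'a mat2" and g :: "'a euc1 \<Rightarrow> 'a euc1"
    by (rule bexI[OF _ mat_1_SO1]) (simp add: m)
  then show "refl_on (SO2 \<times> Diff_plus) (twist_rel :: (('a mat2 \<times> _) \<times> _) set)"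
    unfolding refl_on_def twist_rel_def by auto
  show "sym (twist_rel :: (('a mat2 \<times> _) \<times> _) set)"
  proof (rule symI, clarify)
    fix Q g Q' g' assume r: "((Q :: 'a mat2, g), Q', g') \<in> twist_rel"
    then obtain P where P: "P \<in> SO1" "Q' = Q ** P"
        "\<And>x. x \<in> usphere \<Longrightarrow> incl (g' x) = matrix_inv P *v incl (g x)"
      by (auto simp: twist_rel_def)
    have P2: "P \<in> SO2" "matrix_inv P \<in> SO2" using P SO1_inv by (auto simp: SO1_def)
    have ii: "matrix_inv (matrix_inv P) = P"
      using matrix_inv_SO2(3)[OF P2(2)] matrix_inv_SO2(3)[OF P2(1)] by (simp add: transpose_transpose)
    have "Q = Q' ** matrix_inv P"
      by (simp add: P matrix_inv_SO2(1)[OF P2(1)] flip: matrix_mul_assoc)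
    moreover have "incl (g x) = matrix_inv (matrix_inv P) *v incl (g' x)" if "x \<in> usphere" for x
      by (simp add: ii P(3)[OF that] matrix_vector_mul_assoc matrix_inv_SO2(1)[OF P2(1)])
    ultimately show "((Q', g'), Q, g) \<in> twist_rel"
      using r SO1_inv[OF P(1)] unfolding twist_rel_def by auto
  qed
  show "trans (twist_rel :: (('a mat2 \<times> _) \<times> _) set)"
  proof (rule transI, clarify)
    fix Q g Q1 g1 Q2 g2
    assume r: "((Q :: 'a mat2, g), Q1, g1) \<in> twist_rel" and s: "((Q1, g1), Q2, g2) \<in> twist_rel"
    obtain P where P: "P \<in> SO1" "Q1 = Q ** P"
        "\<And>x. x \<in> usphere \<Longrightarrow> incl (g1 x) = matrix_inv P *v incl (g x)"
      using r by (auto simp: twist_rel_def)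
    obtain P' where P': "P' \<in> SO1" "Q2 = Q1 ** P'"
        "\<And>x. x \<in> usphere \<Longrightarrow> incl (g2 x) = matrix_inv P' *v incl (g1 x)"
      using s by (auto simp: twist_rel_def)
    have PP: "P ** P' \<in> SO1" using P P' by (simp add: SO1_mult)
    have "matrix_inv (P ** P') = matrix_inv P' ** matrix_inv P"
      using matrix_inv_SO2(3)[of P] matrix_inv_SO2(3)[of P'] matrix_inv_SO2(3)[of "P ** P'"] P(1) P'(1) PP
      by (simp add: SO1_def matrix_transpose_mul)
    then have "Q2 = Q ** (P ** P') \<and> (\<forall>x\<in>usphere. incl (g2 x) = matrix_inv (P ** P') *v incl (g x))"
      using P P' by (simp add: matrix_mul_assoc matrix_vector_mul_assoc)
    then show "((Q, g), Q2, g2) \<in> twist_rel"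
      using r s PP unfolding twist_rel_def by auto
  qed
qed

lemma Psi_class:
  assumes "Q \<in> SO2" "g \<in> Diff_plus"
  shows "Psi r (twist_rel `` {(Q, g)}) = restrict (\<lambda>p. Q *v iota r (g p)) usphere"
proof -
  let ?F = "\<lambda>(Q, g). restrict (\<lambda>p. Q *v iota r (g p)) usphere"
  have "?F (Q', g') = ?F (Q, g)" if rel: "((Q, g), (Q', g')) \<in> twist_rel" for Q' g'
  proof -
    obtain P where P: "P \<in> SO1" "Q' = Q ** P"
        "\<And>x. x \<in> usphere \<Longrightarrow> incl (g' x) = matrix_inv P *v incl (g x)"
      using rel by (auto simp: twist_rel_def)
    then have P2: "P \<in> SO2" and e: "P *v e_last = e_last" by (auto simp: SO1_def)
    note i = matrix_inv_SO2(1)[OF P2]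
    have "Q' *v iota r (g' x) = Q *v iota r (g x)" if x: "x \<in> usphere" for x
    proof -
      have "P *v incl (g' x) = incl (g x)"
        by (simp only: P(3)[OF x] matrix_vector_mul_assoc i matrix_vector_mul_lid)
      then have "P *v iota r (g' x) = iota r (g x)"
        by (simp only: iota_def matrix_vector_mult_diff_distrib matrix_vector_mult_scaleR e)
      then show ?thesis by (simp only: P(2) matrix_vector_mul_assoc[symmetric])
    qed
    then have "restrict (\<lambda>p. Q' *v iota r (g' p)) usphere = restrict (\<lambda>p. Q *v iota r (g p)) usphere"
      by (intro restrict_ext)
    then show ?thesis by (simp only: prod.case)
  qed
  then have "?F y = ?F (Q, g)" if "y \<in> twist_rel `` {(Q, g)}" for y
    using that by (cases y) (simp only: Image_singleton_iff)
  moreover have "(Q, g) \<in> twist_rel `` {(Q, g)}"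
    using equiv_class_self[OF equiv_twist_rel] assms by blast
  ultimately have "?F ` (twist_rel `` {(Q, g)}) = {?F (Q, g)}"
    by blast
  then show ?thesis by (simp only: Psi_def the_elem_eq prod.case)
qed

end

(* Let a, b in J bound the curvature radii of an immersion f from both sides. Since b < a + pi/2, some
   parallel hypersurface cos s f + sin s nu is locally strictly convex. It is then globally strictly
   convex: sweep the sphere by hyperplanes turning about the tangent hyperplane at p; the component of p
   in the half space stays strictly convex, and strictness can be lost only at a double point on the
   boundary, which is impossible. Hence all the vectors kappa f + nu lie in one open half space, and the
   point of their convex hull nearest to the origin gives a centre c depending continuously on f.
   The dilations in the stereographic projection from -c are conformal, so applied to the parallel
   hypersurface at distance r they contract it to the point c while turning its unit normals isometrically;
   undoing the parallel shift deforms f, with curvature radii staying between r and the original ones,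
   to a round immersion, and round immersions stay fixed. So the round immersions are a deformation
   retract, and they are the homeomorphic image of the twisted product: an immersion of the sphere into
   itself is a diffeomorphism, by the same convexity theorem, and SO(n+2) has continuous local sections
   over the sphere of centres. *)
theory Submission
  imports Defs
begin

section \<open>Smooth maps depending continuously on a parameter\<close>

text \<open>The hypothesis on \<open>J\<close> says that two curvature radii never differ by
  \<open>pi / 2\<close> or more. It enters twice: it provides a shift bringing all radii into
  \<open>(0, pi / 2)\<close>, and it keeps \<open>cos (\<rho> - r)\<close> positive during the
  deformation. For \<open>k = cot \<rho>\<close> the vector \<open>k *\<^sub>R f p + \<nu> p\<close>
  is the focal point \<open>cos \<rho> *\<^sub>R f p + sin \<rho> *\<^sub>R \<nu> p\<close> divided
  by \<open>sin \<rho>\<close>, so the centre has positive inner product with all focal points. This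
  is what the deformation needs: it replaces \<open>tan (\<rho> - r)\<close> by
  \<open>k * sin (\<rho> - r) / E\<close>, where \<open>E\<close> is \<open>cos (\<rho> - r)\<close>
  plus \<open>t\<close> times the inner product of the focal point with \<open>c\<close>, so that
  the new radius stays between \<open>r\<close> and the old one. Two obstacles shape the set-up.
  Parallel hypersurfaces may be singular, and the last one is a point; hence the work is done with
  pairs of a map and a unit normal field. And all constructions must be continuous for the smooth
  topology; hence smooth families over an arbitrary parameter space, an explicit formula for the
  Gauss map, and normal curvatures in all directions instead of principal directions.\<close>

lemma continuous_map_compose_on:
  assumes "continuous_map X euclidean f" "continuous_on S h" "\<And>x. x \<in> topspace X \<Longrightarrow> f x \<in> S"
  shows "continuous_map X euclidean (\<lambda>x. h (f x))"
proof -
  have "continuous_map X (top_of_set S) f" using assms by (auto simp: continuous_map_in_subtopology)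
  moreover have "continuous_map (top_of_set S) euclidean h"
    using assms(2) by (simp add: continuous_map_iff_continuous)
  ultimately show ?thesis using continuous_map_compose[of X "top_of_set S" f euclidean h] by (simp add: o_def)
qed

lemma continuous_map_compose_on2:
  assumes "continuous_map X euclidean f" "continuous_map X euclidean g"
    and "continuous_on S (\<lambda>z. h (fst z) (snd z))"
    and "\<And>x. x \<in> topspace X \<Longrightarrow> (f x, g x) \<in> S"
  shows "continuous_map X euclidean (\<lambda>x. h (f x) (g x))"
proof -
  have "continuous_map X euclidean (\<lambda>x. (f x, g x))"
    using assms(1,2) continuous_map_pairedI[of X euclidean f euclidean g]
    by (simp flip: euclidean_product_topology)
  from continuous_map_compose_on[OF this assms(3)] assms(4) show ?thesis by simp
qed

lemma continuous_map_bilinear: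
  assumes "bounded_bilinear h" "continuous_map X euclidean f" "continuous_map X euclidean g"
  shows "continuous_map X euclidean (\<lambda>x. h (f x) (g x))"
  by (rule continuous_map_compose_on2[OF assms(2,3), where S=UNIV])
    (auto intro!: bounded_bilinear.continuous_on[OF assms(1)] continuous_intros)

lemma continuous_map_topcontinuous_iff:
  "continuous_map X euclidean f \<longleftrightarrow> (\<forall>x\<in>topspace X. \<forall>e>0. \<exists>W. openin X W \<and> x \<in> W \<and> (\<forall>y\<in>W. dist (f y) (f x) < e))"
  (is "?L \<longleftrightarrow> ?R")
proof
  assume ?L
  show ?R
  proof (intro ballI allI impI)
    fix x and e :: real assume "x \<in> topspace X" "e > 0"
    have "openin X {y \<in> topspace X. f y \<in> ball (f x) e}"
      by (rule openin_continuous_map_preimage[OF \<open>?L\<close>]) (simp flip: open_openin)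
    then show "\<exists>W. openin X W \<and> x \<in> W \<and> (\<forall>y\<in>W. dist (f y) (f x) < e)"
      using \<open>x \<in> topspace X\<close> \<open>e > 0\<close>
      by (intro exI[of _ "{y \<in> topspace X. f y \<in> ball (f x) e}"]) (auto simp: dist_commute)
  qed
next
  assume R: ?R
  show ?L
    unfolding continuous_map_def
  proof (intro conjI allI impI)
    fix U :: "'b set" assume "openin euclidean U"
    then have U: "open U" by (simp flip: open_openin)
    show "openin X {x \<in> topspace X. f x \<in> U}"
    proof (subst openin_subopen, intro ballI)
      fix x assume x: "x \<in> {x \<in> topspace X. f x \<in> U}"
      then obtain e where e: "e > 0" "ball (f x) e \<subseteq> U" using U open_contains_ball by blast
      obtain W where W: "openin X W" "x \<in> W" "\<forall>y\<in>W. dist (f y) (f x) < e"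
        using R x e(1) by blast
      then have "W \<subseteq> {x \<in> topspace X. f x \<in> U}"
        using e(2) openin_subset by (fastforce simp: dist_commute)
      then show "\<exists>T. openin X T \<and> x \<in> T \<and> T \<subseteq> {x \<in> topspace X. f x \<in> U}" using W by blast
    qed
  qed simp
qed

text \<open>\<open>T\<close> is an arbitrary space of parameters: later a mapping space, an interval
  or a single point. The order \<open>k\<close> counts derivatives in \<open>x\<close> only, all of
  them jointly continuous in \<open>(t, x)\<close>; derivatives along fixed vectors suffice in
  finite dimension. The recursion lets each closure property follow by induction, by expressing one
  derivative through families of lower order.\<close>

primrec csm :: "nat \<Rightarrow> 't topology \<Rightarrow> 'a::euclidean_space set \<Rightarrow> ('t \<Rightarrow> 'a \<Rightarrow> 'b::euclidean_space) \<Rightarrow> bool" where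
  "csm 0 T U u \<longleftrightarrow> continuous_map (prod_topology T (top_of_set U)) euclidean (\<lambda>z. u (fst z) (snd z))"
| "csm (Suc k) T U u \<longleftrightarrow> continuous_map (prod_topology T (top_of_set U)) euclidean (\<lambda>z. u (fst z) (snd z)) \<and>
     (\<forall>t\<in>topspace T. \<forall>x\<in>U. u t differentiable (at x)) \<and>
     (\<forall>v. csm k T U (\<lambda>t x. frechet_derivative (u t) (at x) v))"

definition csmooth :: "'t topology \<Rightarrow> 'a::euclidean_space set \<Rightarrow> ('t \<Rightarrow> 'a \<Rightarrow> 'b::euclidean_space) \<Rightarrow> bool" where
  "csmooth T U u \<longleftrightarrow> (\<forall>k. csm k T U u)"

lemma csm_cont: "csm k T U u \<Longrightarrow> continuous_map (prod_topology T (top_of_set U)) euclidean (\<lambda>z. u (fst z) (snd z))"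
  by (cases k) auto

lemma csm_deriv:
  "csm (Suc k) T U u \<Longrightarrow> t \<in> topspace T \<Longrightarrow> x \<in> U \<Longrightarrow> (u t has_derivative frechet_derivative (u t) (at x)) (at x)"
  by (simp add: frechet_derivative_works)

lemma frechet_derivative_cong_open:
  assumes "open U" "x \<in> U" "\<And>y. y \<in> U \<Longrightarrow> f y = g y"
  shows "frechet_derivative f (at x) = frechet_derivative g (at x)"
proof -
  have "(f has_derivative D) (at x) \<longleftrightarrow> (g has_derivative D) (at x)" for D
    using has_derivative_transform_within_open[OF _ assms(1,2), of f D UNIV g]
      has_derivative_transform_within_open[OF _ assms(1,2), of g D UNIV f] assms(3) by metis
  then show ?thesis by (simp add: frechet_derivative_def)
qed

lemma csm_cong:
  assumes "open U" "\<And>t x. t \<in> topspace T \<Longrightarrow> x \<in> U \<Longrightarrow> u t x = w t x" "csm k T U u"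
  shows "csm k T U w"
  using assms(2,3)
proof (induction k arbitrary: u w)
  case 0
  then show ?case by (auto elim!: continuous_map_eq)
next
  case (Suc k)
  have fd: "frechet_derivative (u t) (at x) = frechet_derivative (w t) (at x)"
    if "t \<in> topspace T" "x \<in> U" for t x
    using frechet_derivative_cong_open[OF assms(1) that(2), of "u t" "w t"] Suc.prems(1) that(1) by blast
  have "w t differentiable (at x)" if "t \<in> topspace T" "x \<in> U" for t x
    using csm_deriv[OF Suc.prems(2) that] has_derivative_transform_within_open[OF _ assms(1) that(2), of "u t" _ UNIV "w t"]
      Suc.prems(1) that(1) by (metis differentiableI)
  moreover have "csm k T U (\<lambda>t x. frechet_derivative (w t) (at x) v)" for v
    by (rule Suc.IH[of "\<lambda>t x. frechet_derivative (u t) (at x) v"]) (use fd Suc.prems(2) in auto)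
  moreover have "continuous_map (prod_topology T (top_of_set U)) euclidean (\<lambda>z. w (fst z) (snd z))"
    by (rule continuous_map_eq[OF csm_cont[OF Suc.prems(2)]]) (auto simp: Suc.prems(1))
  ultimately show ?case by auto
qed

text \<open>The closure properties exhibit the derivative by a formula, and \<open>csm_cong\<close>
  trades it for \<open>frechet_derivative\<close>.\<close>

lemma csm_SucI:
  assumes "open U"
    and "continuous_map (prod_topology T (top_of_set U)) euclidean (\<lambda>z. u (fst z) (snd z))"
    and d: "\<And>t x. t \<in> topspace T \<Longrightarrow> x \<in> U \<Longrightarrow> (u t has_derivative u' t x) (at x)"
    and "\<And>v. csm k T U (\<lambda>t x. u' t x v)"
  shows "csm (Suc k) T U u"
proof -
  have "csm k T U (\<lambda>t x. frechet_derivative (u t) (at x) v)" for v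
    by (rule csm_cong[OF assms(1) _ assms(4)[of v]]) (use frechet_derivative_at[OF d] in metis)
  moreover have "u t differentiable (at x)" if "t \<in> topspace T" "x \<in> U" for t x
    using d[OF that] by (rule differentiableI)
  ultimately show ?thesis using assms(2) by simp
qed

lemma csm_Suc_imp: "csm (Suc k) T U u \<Longrightarrow> csm k T U u"
  by (induction k arbitrary: u) auto

lemma csm_cont_compose:
  assumes "csm k T U u" "continuous_map P T s" "continuous_map P euclidean g" "\<And>z. z \<in> topspace P \<Longrightarrow> g z \<in> U"
  shows "continuous_map P euclidean (\<lambda>z. u (s z) (g z))"
proof -
  have "continuous_map P (top_of_set U) g" using assms(3,4) by (auto simp: continuous_map_in_subtopology)
  then have "continuous_map P (prod_topology T (top_of_set U)) (\<lambda>z. (s z, g z))"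
    using assms(2) by (intro continuous_map_pairedI)
  from continuous_map_compose[OF this csm_cont[OF assms(1)]] show ?thesis by (simp add: o_def)
qed

lemma continuous_map_snd_top_of_set:
  "continuous_map (prod_topology T (top_of_set U)) euclidean snd"
  using continuous_map_snd[of T "top_of_set U"] by (rule continuous_map_into_fulltopology)

lemma csm_subset:
  assumes "U' \<subseteq> U"
  shows "csm k T U u \<Longrightarrow> csm k T U' u"
proof (induction k arbitrary: u)
  have c: "continuous_map (prod_topology T (top_of_set U')) euclidean (\<lambda>z. u (fst z) (snd z))"
    if "csm k T U u" for k and u :: "_ \<Rightarrow> _ \<Rightarrow> 'c"
    using csm_cont_compose[OF that continuous_map_fst continuous_map_snd_top_of_set[of T U']] assms by fastforce
  { case 0 then show ?case using c[OF 0] by simp }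
  { case (Suc k) then show ?case using c[OF Suc.prems] assms by auto }
qed

lemma csm_param:
  assumes "continuous_map T' T s"
  shows "csm k T U u \<Longrightarrow> csm k T' U (\<lambda>t. u (s t))"
proof (induction k arbitrary: u)
  have s: "continuous_map (prod_topology T' (top_of_set U)) T (\<lambda>z. s (fst z))"
    using continuous_map_compose[OF continuous_map_fst assms] by (simp add: o_def)
  have st: "s t \<in> topspace T" if "t \<in> topspace T'" for t
    using assms that by (auto simp: continuous_map_def)
  { case 0
    then show ?case using csm_cont_compose[OF 0 s continuous_map_snd_top_of_set] by auto }
  { case (Suc k)
    then show ?case
      using csm_cont_compose[OF Suc.prems s continuous_map_snd_top_of_set] st
        Suc.IH[of "\<lambda>t x. frechet_derivative (u t) (at x) v" for v] by auto }
qed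

text \<open>Only continuity needs an argument: the product over \<open>V \<inter> U\<close> is an
  open subspace of the product over \<open>U\<close>, so neighbourhoods found there are
  neighbourhoods in the large space.\<close>

lemma csm_local:
  fixes u :: "'a \<Rightarrow> 'b::euclidean_space \<Rightarrow> 'c::euclidean_space"
  assumes "\<And>x. x \<in> U \<Longrightarrow> \<exists>V. open V \<and> x \<in> V \<and> csm k T (V \<inter> U) u"
  shows "csm k T U u"
  using assms
proof (induction k arbitrary: u)
  have c: "continuous_map (prod_topology T (top_of_set U)) euclidean (\<lambda>z. u (fst z) (snd z))"
    if *: "\<And>x. x \<in> U \<Longrightarrow> \<exists>V. open V \<and> x \<in> V \<and> csm k T (V \<inter> U) u" for k and u :: "'a \<Rightarrow> 'b \<Rightarrow> 'c"
    unfolding continuous_map_topcontinuous_iff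
  proof (intro ballI allI impI)
    fix z and e :: real assume z: "z \<in> topspace (prod_topology T (top_of_set U))" and e: "e > 0"
    then obtain V where V: "open V" "snd z \<in> V" "csm k T (V \<inter> U) u" using * by (cases z) auto
    have "z \<in> topspace (prod_topology T (top_of_set (V \<inter> U)))" using z V(2) by (cases z) simp
    then obtain W where W: "openin (prod_topology T (top_of_set (V \<inter> U))) W" "z \<in> W"
        "\<forall>y\<in>W. dist (u (fst y) (snd y)) (u (fst z) (snd z)) < e"
      using csm_cont[OF V(3)] e unfolding continuous_map_topcontinuous_iff by blast
    have eq: "U \<inter> (V \<inter> U) = V \<inter> U" by blast
    have "openin (top_of_set U) (V \<inter> U)" using V(1) by (simp add: openin_open_Int inf_commute)
    then have o: "openin (prod_topology T (top_of_set U)) (topspace T \<times> (V \<inter> U))"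
      by (simp add: openin_prod_Times_iff)
    have "prod_topology T (top_of_set (V \<inter> U)) =
       subtopology (prod_topology T (top_of_set U)) (topspace T \<times> (V \<inter> U))"
      by (simp only: subtopology_Times subtopology_subtopology subtopology_topspace eq)
    then have "openin (prod_topology T (top_of_set U)) W"
      using openin_trans_full[OF _ o] W(1) by simp
    then show "\<exists>W. openin (prod_topology T (top_of_set U)) W \<and> z \<in> W \<and>
        (\<forall>y\<in>W. dist (u (fst y) (snd y)) (u (fst z) (snd z)) < e)" using W(2,3) by blast
  qed
  { case 0 show ?case using c[OF 0] by simp }
  { case (Suc k)
    have "u t differentiable (at x)" if "t \<in> topspace T" "x \<in> U" for t x
      using Suc.prems[OF that(2)] that by auto
    moreover have "csm k T U (\<lambda>t x. frechet_derivative (u t) (at x) v)" for v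
    proof (rule Suc.IH)
      fix x assume "x \<in> U"
      then obtain V where "open V" "x \<in> V" "csm (Suc k) T (V \<inter> U) u" using Suc.prems by blast
      then show "\<exists>V. open V \<and> x \<in> V \<and> csm k T (V \<inter> U) (\<lambda>t x. frechet_derivative (u t) (at x) v)"
        by (intro exI[of _ V]) simp
    qed
    ultimately show ?case using c[OF Suc.prems] by simp }
qed

lemma csm_linear:
  fixes u :: "'a \<Rightarrow> 'b::euclidean_space \<Rightarrow> 'c::euclidean_space" and L :: "'c \<Rightarrow> 'd::euclidean_space"
  assumes "bounded_linear L" "open U"
  shows "csm k T U u \<Longrightarrow> csm k T U (\<lambda>t x. L (u t x))"
proof (induction k arbitrary: u)
  have c: "continuous_map (prod_topology T (top_of_set U)) euclidean (\<lambda>z. L (u (fst z) (snd z)))"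
    if "csm k T U u" for k and u :: "'a \<Rightarrow> 'b \<Rightarrow> 'c"
    using continuous_map_compose_on[OF csm_cont[OF that], of UNIV L] assms(1) by (simp add: linear_continuous_on)
  { case 0 show ?case using c[OF 0] by simp }
  { case (Suc k)
    show ?case
    proof (rule csm_SucI[where u'="\<lambda>t x v. L (frechet_derivative (u t) (at x) v)", OF assms(2) c[OF Suc.prems]])
      show "csm k T U (\<lambda>t x. L (frechet_derivative (u t) (at x) v))" for v
        by (rule Suc.IH) (use Suc.prems in simp)
    qed (rule bounded_linear.has_derivative[OF assms(1) csm_deriv[OF Suc.prems]]) }
qed

lemma csm_add:
  fixes u w :: "'a \<Rightarrow> 'b::euclidean_space \<Rightarrow> 'c::euclidean_space"
  assumes "open U"
  shows "csm k T U u \<Longrightarrow> csm k T U w \<Longrightarrow> csm k T U (\<lambda>t x. u t x + w t x)"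
proof (induction k arbitrary: u w)
  case 0 then show ?case by (auto intro: continuous_map_add)
next
  case (Suc k)
  show ?case
  proof (rule csm_SucI[where u'="\<lambda>t x v. frechet_derivative (u t) (at x) v + frechet_derivative (w t) (at x) v",
          OF assms continuous_map_add[OF csm_cont[OF Suc.prems(1)] csm_cont[OF Suc.prems(2)]]])
    show "csm k T U (\<lambda>t x. frechet_derivative (u t) (at x) v + frechet_derivative (w t) (at x) v)" for v
      by (rule Suc.IH) (use Suc.prems in simp_all)
  qed (rule has_derivative_add[OF csm_deriv[OF Suc.prems(1)] csm_deriv[OF Suc.prems(2)]])
qed

lemma csm_bilinear:
  fixes h :: "'c::euclidean_space \<Rightarrow> 'd::euclidean_space \<Rightarrow> 'e::euclidean_space" and U :: "'b::euclidean_space set"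
    and u :: "'a \<Rightarrow> 'b \<Rightarrow> 'c"
  assumes "bounded_bilinear h" "open U"
  shows "csm k T U u \<Longrightarrow> csm k T U w \<Longrightarrow> csm k T U (\<lambda>t x. h (u t x) (w t x))"
proof (induction k arbitrary: u w)
  case 0
  then show ?case using continuous_map_bilinear[OF assms(1)] by simp
next
  case (Suc k)
  have D: "csm k T U (\<lambda>t x. frechet_derivative (u t) (at x) v)" "csm k T U (\<lambda>t x. frechet_derivative (w t) (at x) v)" for v
    using Suc.prems by simp_all
  show ?case
  proof (rule csm_SucI[where u'="\<lambda>t x v. h (u t x) (frechet_derivative (w t) (at x) v) + h (frechet_derivative (u t) (at x) v) (w t x)"])
    show "csm k T U (\<lambda>t x. h (u t x) (frechet_derivative (w t) (at x) v) + h (frechet_derivative (u t) (at x) v) (w t x))" for v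
      by (intro csm_add[OF assms(2)] Suc.IH D csm_Suc_imp[OF Suc.prems(1)] csm_Suc_imp[OF Suc.prems(2)])
    show "((\<lambda>x. h (u t x) (w t x)) has_derivative
      (\<lambda>v. h (u t x) (frechet_derivative (w t) (at x) v) + h (frechet_derivative (u t) (at x) v) (w t x))) (at x)"
      if "t \<in> topspace T" "x \<in> U" for t x
      by (rule bounded_bilinear.FDERIV[OF assms(1) csm_deriv[OF Suc.prems(1) that] csm_deriv[OF Suc.prems(2) that]])
    show "continuous_map (prod_topology T (top_of_set U)) euclidean (\<lambda>z. h (u (fst z) (snd z)) (w (fst z) (snd z)))"
      by (intro continuous_map_bilinear[OF assms(1)] csm_cont[OF Suc.prems(1)] csm_cont[OF Suc.prems(2)])
  qed (rule assms)
qed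

lemma csm_zero: "open U \<Longrightarrow> csm k T U (\<lambda>t x. 0)"
proof (induction k)
  case (Suc k)
  show ?case
    by (rule csm_SucI[where u'="\<lambda>t x v. 0", OF Suc.prems]) (auto intro: Suc.IH[OF Suc.prems])
qed simp

lemma csm_time:
  assumes "open U" "continuous_map T euclidean c"
  shows "csm k T U (\<lambda>t x. c t)"
proof (cases k)
  have c: "continuous_map (prod_topology T (top_of_set U)) euclidean (\<lambda>z. c (fst z))"
    using continuous_map_compose[OF continuous_map_fst assms(2)] by (simp add: o_def)
  { case 0 then show ?thesis using c by simp }
  { case (Suc k)
    show ?thesis unfolding Suc
      by (rule csm_SucI[where u'="\<lambda>t x v. 0", OF assms(1) c]) (auto intro: csm_zero[OF assms(1)]) }
qed

lemma csm_const: "open U \<Longrightarrow> csm k T U (\<lambda>t x. c)"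
  by (rule csm_time) auto

lemma csm_ident: "open U \<Longrightarrow> csm k T U (\<lambda>t x. x)"
proof (cases k)
  case 0 then show ?thesis by (simp add: continuous_map_snd_top_of_set)
next
  case (Suc k)
  assume U: "open U"
  show ?thesis unfolding Suc
    by (rule csm_SucI[where u'="\<lambda>t x v. v", OF U continuous_map_snd_top_of_set]) (auto intro: csm_const[OF U])
qed

lemma csm_sum:
  assumes "open U"
  shows "(\<And>i. i \<in> I \<Longrightarrow> csm k T U (u i)) \<Longrightarrow> csm k T U (\<lambda>t x. \<Sum>i\<in>I. u i t x)"
proof (induction I rule: infinite_finite_induct)
  case (insert i I)
  then show ?case by (simp add: csm_add[OF assms])
qed (simp_all add: csm_zero[OF assms])

lemma csm_compose:
  fixes \<Phi> :: "'a \<Rightarrow> 'c::euclidean_space \<Rightarrow> 'd::euclidean_space" and u :: "'a \<Rightarrow> 'b::euclidean_space \<Rightarrow> 'c"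
  assumes "open U" "open V" "\<And>t x. t \<in> topspace T \<Longrightarrow> x \<in> U \<Longrightarrow> u t x \<in> V" "csm k T U u"
  shows "csm k T V \<Phi> \<Longrightarrow> csm k T U (\<lambda>t x. \<Phi> t (u t x))"
  using assms(4)
proof (induction k arbitrary: \<Phi>)
  have c: "continuous_map (prod_topology T (top_of_set U)) euclidean (\<lambda>z. \<Phi> (fst z) (u (fst z) (snd z)))"
    if "csm k T U u" "csm k T V \<Phi>" for k and \<Phi> :: "'a \<Rightarrow> 'c \<Rightarrow> 'd"
    by (rule csm_cont_compose[OF that(2) continuous_map_fst csm_cont[OF that(1)]]) (use assms(3) in auto)
  { case 0 show ?case using c[OF 0(2,1)] by simp }
  { case (Suc k)
    let ?du = "\<lambda>t x v. frechet_derivative (u t) (at x) v"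
    \<comment> \<open>The chain rule applies the derivative of \<open>\<Phi>\<close> to a vector
      that moves with \<open>x\<close>, whereas \<open>csm\<close> controls it along fixed vectors
      only; expanding in the basis separates the two.\<close>
    have eq: "frechet_derivative (\<Phi> t) (at y) v = (\<Sum>b\<in>Basis. (v \<bullet> b) *\<^sub>R frechet_derivative (\<Phi> t) (at y) b)"
      if "t \<in> topspace T" "y \<in> V" for t y v
    proof -
      have lin: "linear (frechet_derivative (\<Phi> t) (at y))"
        using csm_deriv[OF Suc.prems(1) that] by (rule has_derivative_linear)
      show ?thesis
        by (subst euclidean_representation[of v, symmetric]) (simp only: linear_sum[OF lin] linear_cmul[OF lin])
    qed
    show ?case
    proof (rule csm_SucI[where u'="\<lambda>t x v. frechet_derivative (\<Phi> t) (at (u t x)) (?du t x v)", OF assms(1) c[OF Suc.prems(2,1)]])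
      show "((\<lambda>x. \<Phi> t (u t x)) has_derivative (\<lambda>v. frechet_derivative (\<Phi> t) (at (u t x)) (?du t x v))) (at x)"
        if "t \<in> topspace T" "x \<in> U" for t x
        using diff_chain_at[OF csm_deriv[OF Suc.prems(2) that] csm_deriv[OF Suc.prems(1) that(1) assms(3)[OF that]]]
        by (simp add: o_def)
      fix v
      have "csm k T U (\<lambda>t x. \<Sum>b\<in>Basis. (?du t x v \<bullet> b) *\<^sub>R frechet_derivative (\<Phi> t) (at (u t x)) b)"
      proof (rule csm_sum[OF assms(1)], rule csm_bilinear[OF bounded_bilinear_scaleR assms(1)])
        fix b :: 'c
        show "csm k T U (\<lambda>t x. ?du t x v \<bullet> b)"
          by (rule csm_linear[OF bounded_linear_inner_left assms(1)]) (use Suc.prems(2) in simp)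
        show "csm k T U (\<lambda>t x. frechet_derivative (\<Phi> t) (at (u t x)) b)"
          by (rule Suc.IH) (use Suc.prems csm_Suc_imp in \<open>auto simp del: csm.simps(1)\<close>)
      qed
      then show "csm k T U (\<lambda>t x. frechet_derivative (\<Phi> t) (at (u t x)) (?du t x v))"
        by (rule csm_cong[OF assms(1), rotated]) (simp add: eq[OF _ assms(3)])
    qed }
qed

text \<open>The derivative is a polynomial in the inverse itself and in the derivative of
  \<open>u\<close>, so order \<open>k\<close> of the result bootstraps to order
  \<open>k + 1\<close>. The square root is treated in the same way.\<close>

lemma csm_inverse:
  assumes "open U"
  shows "(\<And>t x. t \<in> topspace T \<Longrightarrow> x \<in> U \<Longrightarrow> u t x \<noteq> (0::real)) \<Longrightarrow> csm k T U u \<Longrightarrow> csm k T U (\<lambda>t x. inverse (u t x))"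
proof (induction k arbitrary: u)
  have c: "continuous_map (prod_topology T (top_of_set U)) euclidean (\<lambda>z. inverse (u (fst z) (snd z)))"
    if "\<And>t x. t \<in> topspace T \<Longrightarrow> x \<in> U \<Longrightarrow> u t x \<noteq> (0::real)" "csm k T U u" for k and u :: "'b \<Rightarrow> 'a \<Rightarrow> real"
    by (rule continuous_map_compose_on[OF csm_cont[OF that(2)], of "-{0}" inverse])
      (use that(1) in \<open>auto intro!: continuous_intros\<close>)
  { case 0 then show ?case using c[OF 0] by simp }
  { case (Suc k)
    show ?case
    proof (rule csm_SucI[where u'="\<lambda>t x v. - (inverse (u t x) * frechet_derivative (u t) (at x) v * inverse (u t x))", OF assms c[OF Suc.prems]])
      show "((\<lambda>x. inverse (u t x)) has_derivative (\<lambda>v. - (inverse (u t x) * frechet_derivative (u t) (at x) v * inverse (u t x)))) (at x)"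
        if "t \<in> topspace T" "x \<in> U" for t x
        by (rule Deriv.has_derivative_inverse[OF Suc.prems(1)[OF that] csm_deriv[OF Suc.prems(2) that]])
      have i: "csm k T U (\<lambda>t x. inverse (u t x))"
        by (rule Suc.IH[OF Suc.prems(1) csm_Suc_imp[OF Suc.prems(2)]])
      show "csm k T U (\<lambda>t x. - (inverse (u t x) * frechet_derivative (u t) (at x) v * inverse (u t x)))" for v
        by (intro csm_linear[OF bounded_linear_minus[OF bounded_linear_ident] assms] csm_bilinear[OF bounded_bilinear_mult assms] i)
          (use Suc.prems(2) in simp)
    qed }
qed

lemma csm_sqrt:
  assumes "open U"
  shows "(\<And>t x. t \<in> topspace T \<Longrightarrow> x \<in> U \<Longrightarrow> 0 < u t x) \<Longrightarrow> csm k T U u \<Longrightarrow> csm k T U (\<lambda>t x. sqrt (u t x))"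
proof (induction k arbitrary: u)
  have c: "continuous_map (prod_topology T (top_of_set U)) euclidean (\<lambda>z. sqrt (u (fst z) (snd z)))"
    if "csm k T U u" for k and u :: "'b \<Rightarrow> 'a \<Rightarrow> real"
    by (rule continuous_map_compose_on[OF csm_cont[OF that], of UNIV sqrt]) (auto intro!: continuous_intros)
  { case 0 then show ?case using c[OF 0(2)] by simp }
  { case (Suc k)
    show ?case
    proof (rule csm_SucI[where u'="\<lambda>t x v. inverse (sqrt (u t x)) * (frechet_derivative (u t) (at x) v /\<^sub>R 2)", OF assms c[OF Suc.prems(2)]])
      show "((\<lambda>x. sqrt (u t x)) has_derivative (\<lambda>v. inverse (sqrt (u t x)) * (frechet_derivative (u t) (at x) v /\<^sub>R 2))) (at x)"
        if tx: "t \<in> topspace T" "x \<in> U" for t x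
        using has_derivative_real_sqrt[OF Suc.prems(1)[OF tx] csm_deriv[OF Suc.prems(2) tx]]
        by (simp add: field_simps)
      have i: "csm k T U (\<lambda>t x. inverse (sqrt (u t x)))"
        by (rule csm_inverse[OF assms _ Suc.IH[OF Suc.prems(1) csm_Suc_imp[OF Suc.prems(2)]]])
          (use Suc.prems(1) in fastforce)+
      show "csm k T U (\<lambda>t x. inverse (sqrt (u t x)) * (frechet_derivative (u t) (at x) v /\<^sub>R 2))" for v
        by (intro csm_linear[OF bounded_linear_scaleR_right assms] csm_bilinear[OF bounded_bilinear_mult assms] i)
          (use Suc.prems(2) in simp)
    qed }
qed

lemma csmooth_csm: "csmooth T U u \<Longrightarrow> csm k T U u"
  by (simp add: csmooth_def)

lemma csmooth_deriv: "csmooth T U u \<Longrightarrow> csmooth T U (\<lambda>t x. frechet_derivative (u t) (at x) v)"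
  unfolding csmooth_def
proof
  fix k assume "\<forall>k. csm k T U u"
  then have "csm (Suc k) T U u" by blast
  then show "csm k T U (\<lambda>t x. frechet_derivative (u t) (at x) v)" by simp
qed

lemma csmooth_has_derivative:
  "csmooth T U u \<Longrightarrow> t \<in> topspace T \<Longrightarrow> x \<in> U \<Longrightarrow> (u t has_derivative frechet_derivative (u t) (at x)) (at x)"
  by (rule csm_deriv[OF csmooth_csm])

lemmas csmooth_cont_compose = csm_cont_compose[OF csmooth_csm]

lemma csmooth_cong:
  "csmooth T U u \<Longrightarrow> open U \<Longrightarrow> (\<And>t x. t \<in> topspace T \<Longrightarrow> x \<in> U \<Longrightarrow> u t x = w t x) \<Longrightarrow> csmooth T U w"
  unfolding csmooth_def by (rule allI, rule csm_cong[of U T u]) simp_all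

lemma csmooth_subset: "csmooth T U u \<Longrightarrow> U' \<subseteq> U \<Longrightarrow> csmooth T U' u"
  by (simp add: csmooth_def csm_subset)

lemma csmooth_param: "csmooth T U u \<Longrightarrow> continuous_map T' T s \<Longrightarrow> csmooth T' U (\<lambda>t. u (s t))"
  by (simp add: csmooth_def csm_param)

lemma csmooth_Un:
  assumes "csmooth T U u" "csmooth T V u" "open U" "open V"
  shows "csmooth T (U \<union> V) u"
  unfolding csmooth_def
proof (rule allI, rule csm_local)
  fix k x assume "x \<in> U \<union> V"
  moreover have "U \<inter> (U \<union> V) = U" "V \<inter> (U \<union> V) = V" by auto
  ultimately show "\<exists>W. open W \<and> x \<in> W \<and> csm k T (W \<inter> (U \<union> V)) u"
    using assms csmooth_csm by (metis Un_iff)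
qed

lemma csmooth_linear:
  "csmooth T U u \<Longrightarrow> bounded_linear L \<Longrightarrow> open U \<Longrightarrow> csmooth T U (\<lambda>t x. L (u t x))"
  unfolding csmooth_def by (simp add: csm_linear)

lemma csmooth_bilinear:
  "bounded_bilinear h \<Longrightarrow> csmooth T U u \<Longrightarrow> csmooth T U w \<Longrightarrow> open U \<Longrightarrow> csmooth T U (\<lambda>t x. h (u t x) (w t x))"
  unfolding csmooth_def by (simp add: csm_bilinear)

lemma csmooth_add: "csmooth T U u \<Longrightarrow> csmooth T U w \<Longrightarrow> open U \<Longrightarrow> csmooth T U (\<lambda>t x. u t x + w t x)"
  unfolding csmooth_def by (simp add: csm_add)

lemma csmooth_time: "continuous_map T euclidean c \<Longrightarrow> open U \<Longrightarrow> csmooth T U (\<lambda>t x. c t)"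
  unfolding csmooth_def by (simp add: csm_time)

lemma csmooth_const: "open U \<Longrightarrow> csmooth T U (\<lambda>t x. c)"
  by (rule csmooth_time) auto

lemma csmooth_ident: "open U \<Longrightarrow> csmooth T U (\<lambda>t x. x)"
  unfolding csmooth_def by (simp add: csm_ident)

lemma csmooth_sum:
  "(\<And>i. i \<in> I \<Longrightarrow> csmooth T U (u i)) \<Longrightarrow> open U \<Longrightarrow> csmooth T U (\<lambda>t x. \<Sum>i\<in>I. u i t x)"
  unfolding csmooth_def by (simp add: csm_sum)

lemma csmooth_compose:
  "csmooth T V \<Phi> \<Longrightarrow> csmooth T U u \<Longrightarrow> (\<And>t x. t \<in> topspace T \<Longrightarrow> x \<in> U \<Longrightarrow> u t x \<in> V) \<Longrightarrow> open U \<Longrightarrow> open V \<Longrightarrow>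
    csmooth T U (\<lambda>t x. \<Phi> t (u t x))"
  unfolding csmooth_def by (rule allI, rule csm_compose[of U V T u]) simp_all

lemma csmooth_inverse:
  fixes u :: "'t \<Rightarrow> 'a::euclidean_space \<Rightarrow> real"
  shows "csmooth T U u \<Longrightarrow> (\<And>t x. t \<in> topspace T \<Longrightarrow> x \<in> U \<Longrightarrow> u t x \<noteq> 0) \<Longrightarrow> open U \<Longrightarrow> csmooth T U (\<lambda>t x. inverse (u t x))"
  unfolding csmooth_def by (simp add: csm_inverse)

lemma csmooth_sqrt:
  "csmooth T U u \<Longrightarrow> (\<And>t x. t \<in> topspace T \<Longrightarrow> x \<in> U \<Longrightarrow> 0 < u t x) \<Longrightarrow> open U \<Longrightarrow> csmooth T U (\<lambda>t x. sqrt (u t x))"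
  unfolding csmooth_def by (simp add: csm_sqrt)

lemma csmooth_minus: "csmooth T U u \<Longrightarrow> open U \<Longrightarrow> csmooth T U (\<lambda>t x. - u t x)"
  by (rule csmooth_linear[where L = uminus]) (auto intro: bounded_linear_minus bounded_linear_ident)

lemma csmooth_diff: "csmooth T U u \<Longrightarrow> csmooth T U w \<Longrightarrow> open U \<Longrightarrow> csmooth T U (\<lambda>t x. u t x - w t x)"
  using csmooth_add[OF _ csmooth_minus, of T U u w] by simp

lemmas csmooth_scaleR = csmooth_bilinear[OF bounded_bilinear_scaleR]
lemmas csmooth_mult = csmooth_bilinear[OF bounded_bilinear_mult[where 'a=real]]
lemmas csmooth_inner = csmooth_bilinear[OF bounded_bilinear_inner]

lemma csmooth_divide:
  fixes u w :: "'t \<Rightarrow> 'a::euclidean_space \<Rightarrow> real"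
  shows "csmooth T U u \<Longrightarrow> csmooth T U w \<Longrightarrow> (\<And>t x. t \<in> topspace T \<Longrightarrow> x \<in> U \<Longrightarrow> w t x \<noteq> 0) \<Longrightarrow> open U \<Longrightarrow>
    csmooth T U (\<lambda>t x. u t x / w t x)"
  unfolding divide_inverse by (intro csmooth_mult csmooth_inverse) auto

lemma csmooth_norm:
  "csmooth T U u \<Longrightarrow> (\<And>t x. t \<in> topspace T \<Longrightarrow> x \<in> U \<Longrightarrow> u t x \<noteq> 0) \<Longrightarrow> open U \<Longrightarrow> csmooth T U (\<lambda>t x. norm (u t x))"
  unfolding norm_eq_sqrt_inner by (intro csmooth_sqrt csmooth_inner) auto

lemma csmooth_prod:
  fixes u :: "'i \<Rightarrow> 't \<Rightarrow> 'a::euclidean_space \<Rightarrow> real"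
  assumes "open U"
  shows "(\<And>i. i \<in> I \<Longrightarrow> csmooth T U (u i)) \<Longrightarrow> csmooth T U (\<lambda>t x. \<Prod>i\<in>I. u i t x)"
proof (induction I rule: infinite_finite_induct)
  case (insert i I)
  then show ?case by (simp add: csmooth_mult assms)
qed (simp_all add: csmooth_const assms)

lemma csmooth_det:
  fixes A :: "'t \<Rightarrow> 'a::euclidean_space \<Rightarrow> real^'m^'m"
  assumes "open U" "\<And>i j. csmooth T U (\<lambda>t x. A t x $ i $ j)"
  shows "csmooth T U (\<lambda>t x. det (A t x))"
  unfolding det_def by (intro csmooth_sum csmooth_mult csmooth_const csmooth_prod assms)

lemma csmooth_vec:
  fixes u :: "'t \<Rightarrow> 'a::euclidean_space \<Rightarrow> real^'m"
  assumes "open U" "\<And>i. csmooth T U (\<lambda>t x. u t x $ i)"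
  shows "csmooth T U u"
proof (rule csmooth_cong)
  show "csmooth T U (\<lambda>t x. \<Sum>i\<in>UNIV. (u t x $ i) *\<^sub>R axis i 1)"
    by (intro csmooth_sum csmooth_scaleR csmooth_const assms)
qed (auto simp: assms basis_expansion scalar_mult_eq_scaleR[symmetric])

lemma csmooth_nth: "csmooth T U u \<Longrightarrow> open U \<Longrightarrow> csmooth T U (\<lambda>t x. u t x $ i)"
  by (rule csmooth_linear[where L = "\<lambda>x. x $ i"]) (auto intro: bounded_linear_vec_nth)

lemma csmooth_matrix_vector:
  fixes A :: "'t \<Rightarrow> real^'m^'k" and u :: "'t \<Rightarrow> 'a::euclidean_space \<Rightarrow> real^'m"
  assumes "continuous_map T euclidean A" "csmooth T U u" "open U"
  shows "csmooth T U (\<lambda>t x. A t *v u t x)"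
  by (rule csmooth_bilinear[where h="(*v)"])
   (auto intro: assms csmooth_time simp: bilinear_conv_bounded_bilinear[symmetric] bilinear_def matrix_vector_mul_linear
     matrix_vector_mult_add_rdistrib scaleR_matrix_vector_assoc[symmetric] intro!: linearI)

lemma iter_deriv_snoc: "iter_deriv (vs @ [v]) f = iter_deriv vs (\<lambda>x. frechet_derivative f (at x) v)"
  by (induction vs) auto

text \<open>This is the bridge to the seminorms in \<open>smooth_nbhd\<close>. The head of the list
  is the derivative taken last, whereas \<open>csm\<close> starts with the first one; hence both
  directions peel vectors off the end of the list.\<close>

lemma csmooth_iff_iter_deriv:
  "csmooth T U u \<longleftrightarrow> (\<forall>vs. continuous_map (prod_topology T (top_of_set U)) euclidean (\<lambda>z. iter_deriv vs (u (fst z)) (snd z)) \<and>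
    (\<forall>t\<in>topspace T. \<forall>x\<in>U. iter_deriv vs (u t) differentiable (at x)))" (is "_ \<longleftrightarrow> (\<forall>vs. ?P u vs)")
proof
  assume "csmooth T U u"
  then show "\<forall>vs. ?P u vs"
  proof (intro allI)
    fix vs assume "csmooth T U u"
    then show "?P u vs"
    proof (induction vs arbitrary: u rule: rev_induct)
      case Nil
      then show ?case using csmooth_csm[OF Nil, of 1] by simp
    next
      case (snoc v vs)
      show ?case unfolding iter_deriv_snoc by (rule snoc.IH[OF csmooth_deriv[OF snoc.prems, of v]])
    qed
  qed
next
  assume "\<forall>vs. ?P u vs"
  moreover have "csm k T U u" if "\<forall>vs. ?P u vs" for k and u :: "'a \<Rightarrow> 'b \<Rightarrow> 'c"
    using that
  proof (induction k arbitrary: u)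
    case 0
    from 0[rule_format, of "[]"] show ?case by simp
  next
    case (Suc k)
    have "\<forall>vs. ?P (\<lambda>t x. frechet_derivative (u t) (at x) v) vs" for v
    proof
      fix vs
      from Suc.prems[rule_format, of "vs @ [v]"] show "?P (\<lambda>t x. frechet_derivative (u t) (at x) v) vs"
        unfolding iter_deriv_snoc .
    qed
    then have "csm k T U (\<lambda>t x. frechet_derivative (u t) (at x) v)" for v by (rule Suc.IH)
    then show ?case using Suc.prems[rule_format, of "[]"] by simp
  qed
  ultimately show "csmooth T U u" by (simp add: csmooth_def)
qed

lemma csmooth_if_smooth_on_open:
  assumes "smooth_on_open U f"
  shows "csmooth T U (\<lambda>t. f)"
  unfolding csmooth_iff_iter_deriv
proof (intro allI conjI ballI)
  fix vs
  show d: "iter_deriv vs f differentiable (at x)" if "x \<in> U" for x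
    using assms that by (simp add: smooth_on_open_def)
  have "continuous_on U (iter_deriv vs f)"
    by (intro continuous_at_imp_continuous_on ballI differentiable_imp_continuous_within d)
  then have "continuous_map (top_of_set U) euclidean (iter_deriv vs f)" by simp
  from continuous_map_compose[OF continuous_map_snd[of T] this]
  show "continuous_map (prod_topology T (top_of_set U)) euclidean (\<lambda>z. iter_deriv vs f (snd z))"
    by (simp add: o_def)
qed

lemma smooth_on_open_if_csmooth:
  "csmooth T U u \<Longrightarrow> t \<in> topspace T \<Longrightarrow> open U \<Longrightarrow> smooth_on_open U (u t)"
  by (auto simp: csmooth_iff_iter_deriv smooth_on_open_def)

text \<open>A one-point parameter space makes every closure property of families available for
  single maps.\<close>

lemma smooth_on_open_iff: "smooth_on_open U f \<longleftrightarrow> open U \<and> csmooth (discrete_topology {()}) U (\<lambda>t. f)"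
proof
  assume f: "smooth_on_open U f"
  then have "open U" by (simp add: smooth_on_open_def)
  with csmooth_if_smooth_on_open[OF f] show "open U \<and> csmooth (discrete_topology {()}) U (\<lambda>t. f)" by blast
next
  assume "open U \<and> csmooth (discrete_topology {()}) U (\<lambda>t. f)"
  then show "smooth_on_open U f" using smooth_on_open_if_csmooth[of "discrete_topology {()}" U "\<lambda>_. f" "()"] by simp
qed

lemma csmooth_frechet_derivative_compose:
  assumes "csmooth T U u" "continuous_map P T s" "continuous_map P euclidean g" "\<And>z. z \<in> topspace P \<Longrightarrow> g z \<in> U"
    and "continuous_map P euclidean h"
  shows "continuous_map P euclidean (\<lambda>z. frechet_derivative (u (s z)) (at (g z)) (h z))"
proof (rule continuous_map_eq)
  show "continuous_map P euclidean (\<lambda>z. \<Sum>b\<in>Basis. (h z \<bullet> b) *\<^sub>R frechet_derivative (u (s z)) (at (g z)) b)"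
    by (intro continuous_map_sum continuous_map_bilinear[OF bounded_bilinear_scaleR] continuous_map_bilinear[OF bounded_bilinear_inner]
        csmooth_cont_compose[OF csmooth_deriv[OF assms(1)] assms(2,3,4)] assms(5)) auto
  fix z assume z: "z \<in> topspace P"
  then have "s z \<in> topspace T" using assms(2) by (auto simp: continuous_map_def)
  then have lin: "linear (frechet_derivative (u (s z)) (at (g z)))"
    using csmooth_has_derivative[OF assms(1) _ assms(4)[OF z]] has_derivative_linear by blast
  show "(\<Sum>b\<in>Basis. (h z \<bullet> b) *\<^sub>R frechet_derivative (u (s z)) (at (g z)) b) = frechet_derivative (u (s z)) (at (g z)) (h z)"
    by (subst (2) euclidean_representation[of "h z", symmetric]) (simp only: linear_sum[OF lin] linear_cmul[OF lin])
qed

text \<open>The second difference over a parallelogram: the mean value theorem is applied along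
  \<open>v\<close> to the difference in the direction \<open>w\<close>, and then along
  \<open>w\<close> to the derivative in the direction \<open>v\<close>.\<close>

lemma second_derivative_mean_value:
  fixes g :: "'a::euclidean_space \<Rightarrow> real"
  assumes "smooth_on_open U g" "s > 0"
    and sub: "\<And>a b. 0 \<le> a \<Longrightarrow> a \<le> s \<Longrightarrow> 0 \<le> b \<Longrightarrow> b \<le> s \<Longrightarrow> x + a *\<^sub>R v + b *\<^sub>R w \<in> U"
  shows "\<exists>a b. 0 < a \<and> a < s \<and> 0 < b \<and> b < s \<and>
    g (x + s *\<^sub>R v + s *\<^sub>R w) - g (x + s *\<^sub>R v) - g (x + s *\<^sub>R w) + g x = s * s * iter_deriv [w, v] g (x + a *\<^sub>R v + b *\<^sub>R w)"
proof -
  have d: "(iter_deriv vs g has_derivative frechet_derivative (iter_deriv vs g) (at y)) (at y)" if "y \<in> U" for vs y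
    using assms(1) that by (simp add: smooth_on_open_def flip: frechet_derivative_works)
  have chain: "((\<lambda>\<tau>. iter_deriv vs g (p + \<tau> *\<^sub>R q)) has_real_derivative iter_deriv (q # vs) g (p + \<tau> *\<^sub>R q)) (at \<tau>)"
    if "p + \<tau> *\<^sub>R q \<in> U" for vs p q \<tau>
  proof -
    have "((\<lambda>\<tau>. p + \<tau> *\<^sub>R q) has_derivative (\<lambda>\<tau>. \<tau> *\<^sub>R q)) (at \<tau>)"
      by (auto intro!: derivative_eq_intros)
    from diff_chain_at[OF this d[OF that, of vs]]
    have "((\<lambda>\<tau>. iter_deriv vs g (p + \<tau> *\<^sub>R q)) has_derivative (\<lambda>\<tau>'. frechet_derivative (iter_deriv vs g) (at (p + \<tau> *\<^sub>R q)) (\<tau>' *\<^sub>R q))) (at \<tau>)"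
      by (simp add: o_def)
    moreover have "frechet_derivative (iter_deriv vs g) (at (p + \<tau> *\<^sub>R q)) (\<tau>' *\<^sub>R q) = iter_deriv (q # vs) g (p + \<tau> *\<^sub>R q) * \<tau>'" for \<tau>'
      using linear_cmul[OF has_derivative_linear[OF d[OF that, of vs]], of \<tau>' q] by simp
    ultimately show ?thesis by (simp add: has_field_derivative_def)
  qed
  let ?\<phi> = "\<lambda>\<tau>. g (x + s *\<^sub>R w + \<tau> *\<^sub>R v) - g (x + \<tau> *\<^sub>R v)"
  have "(?\<phi> has_real_derivative iter_deriv [v] g (x + s *\<^sub>R w + \<tau> *\<^sub>R v) - iter_deriv [v] g (x + \<tau> *\<^sub>R v)) (at \<tau>)"
    if "0 \<le> \<tau>" "\<tau> \<le> s" for \<tau>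
    using chain[of "x + s *\<^sub>R w" \<tau> v "[]"] chain[of x \<tau> v "[]"] sub[of \<tau> s] sub[of \<tau> 0] that assms(2)
    by (auto intro!: DERIV_diff simp: algebra_simps)
  from MVT2[OF assms(2) this] obtain a where a: "0 < a" "a < s"
    "?\<phi> s - ?\<phi> 0 = s * (iter_deriv [v] g (x + s *\<^sub>R w + a *\<^sub>R v) - iter_deriv [v] g (x + a *\<^sub>R v))" by auto
  have "((\<lambda>\<tau>. iter_deriv [v] g (x + a *\<^sub>R v + \<tau> *\<^sub>R w)) has_real_derivative iter_deriv [w, v] g (x + a *\<^sub>R v + \<tau> *\<^sub>R w)) (at \<tau>)"
    if "0 \<le> \<tau>" "\<tau> \<le> s" for \<tau>
    using chain[of "x + a *\<^sub>R v" \<tau> w "[v]"] sub[of a \<tau>] a that by simp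
  from MVT2[OF assms(2) this] obtain b where b: "0 < b" "b < s"
    "iter_deriv [v] g (x + a *\<^sub>R v + s *\<^sub>R w) - iter_deriv [v] g (x + a *\<^sub>R v) = s * iter_deriv [w, v] g (x + a *\<^sub>R v + b *\<^sub>R w)"
    by auto
  show ?thesis
    using a b by (intro exI[of _ a] exI[of _ b]) (simp add: algebra_simps)
qed

text \<open>Both orders of differentiation compute the same second difference, at points close to
  \<open>x\<close>, so by continuity the two second derivatives agree at \<open>x\<close>.\<close>

lemma second_derivative_symmetric_real:
  fixes g :: "'a::euclidean_space \<Rightarrow> real"
  assumes g: "smooth_on_open U g" and x: "x \<in> U"
  shows "iter_deriv [v, w] g x = iter_deriv [w, v] g x"
proof (rule ccontr)
  assume ne: "iter_deriv [v, w] g x \<noteq> iter_deriv [w, v] g x"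
  define e where "e = \<bar>iter_deriv [v, w] g x - iter_deriv [w, v] g x\<bar> / 2"
  have e: "e > 0" using ne by (simp add: e_def)
  have "(iter_deriv vs g \<longlongrightarrow> iter_deriv vs g x) (nhds x)" for vs
    using g x differentiable_imp_continuous_within[of "iter_deriv vs g" x UNIV]
    by (simp add: smooth_on_open_def continuous_at tendsto_at_iff_tendsto_nhds)
  then have "\<forall>\<^sub>F y in nhds x. dist (iter_deriv vs g y) (iter_deriv vs g x) < e" for vs using e by (rule tendstoD)
  moreover have "\<forall>\<^sub>F y in nhds x. y \<in> U" using g x by (simp add: smooth_on_open_def eventually_nhds_in_open)
  ultimately have "\<forall>\<^sub>F y in nhds x. y \<in> U \<and> dist (iter_deriv [v, w] g y) (iter_deriv [v, w] g x) < e
      \<and> dist (iter_deriv [w, v] g y) (iter_deriv [w, v] g x) < e" by (intro eventually_conj)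
  then obtain d where d: "d > 0" "\<And>y. dist y x < d \<Longrightarrow> y \<in> U" "\<And>y. dist y x < d \<Longrightarrow> dist (iter_deriv [v, w] g y) (iter_deriv [v, w] g x) < e"
    "\<And>y. dist y x < d \<Longrightarrow> dist (iter_deriv [w, v] g y) (iter_deriv [w, v] g x) < e"
    unfolding eventually_nhds_metric by blast
  \<comment> \<open>With this side length the whole parallelogram stays in the ball of radius
    \<open>d\<close>.\<close>
  define s where "s = d / (norm v + norm w + 1)"
  have n1: "norm v + norm w + 1 > 0" by (simp add: add_nonneg_pos)
  then have s: "s > 0" "s * (norm v + norm w + 1) = d" using d(1) by (auto simp: s_def)
  have near: "dist (x + a *\<^sub>R v + b *\<^sub>R w) x < d" if "0 \<le> a" "a \<le> s" "0 \<le> b" "b \<le> s" for a b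
  proof -
    have "dist (x + a *\<^sub>R v + b *\<^sub>R w) x \<le> a * norm v + b * norm w"
      using norm_triangle_ineq[of "a *\<^sub>R v" "b *\<^sub>R w"] that by (simp add: dist_norm algebra_simps)
    also have "\<dots> \<le> s * norm v + s * norm w" using that by (intro add_mono mult_right_mono) auto
    also have "\<dots> < d" using s by (simp add: algebra_simps)
    finally show ?thesis .
  qed
  have swap: "x + a *\<^sub>R w + b *\<^sub>R v = x + b *\<^sub>R v + a *\<^sub>R w" for a b by (simp add: algebra_simps)
  obtain a b where ab: "0 < a" "a < s" "0 < b" "b < s"
    "g (x + s *\<^sub>R v + s *\<^sub>R w) - g (x + s *\<^sub>R v) - g (x + s *\<^sub>R w) + g x = s * s * iter_deriv [w, v] g (x + a *\<^sub>R v + b *\<^sub>R w)"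
    using second_derivative_mean_value[OF g s(1), of x v w] near d(2) by blast
  obtain a' b' where ab': "0 < a'" "a' < s" "0 < b'" "b' < s"
    "g (x + s *\<^sub>R v + s *\<^sub>R w) - g (x + s *\<^sub>R w) - g (x + s *\<^sub>R v) + g x = s * s * iter_deriv [v, w] g (x + b' *\<^sub>R v + a' *\<^sub>R w)"
    using second_derivative_mean_value[OF g s(1), of x w v] near d(2) unfolding swap by blast
  have "s * s * iter_deriv [w, v] g (x + a *\<^sub>R v + b *\<^sub>R w) = s * s * iter_deriv [v, w] g (x + b' *\<^sub>R v + a' *\<^sub>R w)"
    using ab(5) ab'(5) by linarith
  then have eq: "iter_deriv [w, v] g (x + a *\<^sub>R v + b *\<^sub>R w) = iter_deriv [v, w] g (x + b' *\<^sub>R v + a' *\<^sub>R w)"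
    using s(1) by simp
  have "dist (iter_deriv [w, v] g (x + a *\<^sub>R v + b *\<^sub>R w)) (iter_deriv [w, v] g x) < e"
    "dist (iter_deriv [v, w] g (x + b' *\<^sub>R v + a' *\<^sub>R w)) (iter_deriv [v, w] g x) < e"
    using d(3,4) near ab(1-4) ab'(1-4) by simp_all
  moreover have "\<not> (\<bar>z - p\<bar> < \<bar>q - p\<bar> / 2 \<and> \<bar>z - q\<bar> < \<bar>q - p\<bar> / 2)" for z p q :: real
    by argo
  ultimately show False unfolding eq dist_real_def e_def by blast
qed

lemma iter_deriv_inner:
  assumes "smooth_on_open U f" "x \<in> U"
  shows "iter_deriv vs (\<lambda>x. f x \<bullet> b) x = iter_deriv vs f x \<bullet> b"
  using assms(2)
proof (induction vs arbitrary: x)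
  case (Cons v vs)
  have U: "open U" and d: "(iter_deriv vs f has_derivative frechet_derivative (iter_deriv vs f) (at x)) (at x)"
    using assms(1) Cons.prems by (auto simp: smooth_on_open_def simp flip: frechet_derivative_works)
  have "frechet_derivative (iter_deriv vs (\<lambda>x. f x \<bullet> b)) (at x) = frechet_derivative (\<lambda>x. iter_deriv vs f x \<bullet> b) (at x)"
    by (rule frechet_derivative_cong_open[OF U Cons.prems Cons.IH])
  also have "\<dots> = (\<lambda>v. frechet_derivative (iter_deriv vs f) (at x) v \<bullet> b)"
    by (rule frechet_derivative_at[symmetric, OF has_derivative_inner_left[OF d]])
  finally show ?case by simp
qed simp

lemma second_derivative_symmetric:
  assumes f: "smooth_on_open U f" and x: "x \<in> U"
  shows "iter_deriv [v, w] f x = iter_deriv [w, v] f x"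
proof (rule euclidean_eqI)
  fix b
  have "smooth_on_open U (\<lambda>x. f x \<bullet> b)"
    using f unfolding smooth_on_open_iff by (auto intro!: csmooth_linear[where L = "\<lambda>x. x \<bullet> b"] bounded_linear_inner_left)
  from second_derivative_symmetric_real[OF this x, of v w]
  show "iter_deriv [v, w] f x \<bullet> b = iter_deriv [w, v] f x \<bullet> b"
    by (simp only: iter_deriv_inner[OF f x])
qed

section \<open>Maps on spheres\<close>

lemma csmooth_local:
  assumes "\<And>x. x \<in> U \<Longrightarrow> \<exists>V. open V \<and> x \<in> V \<and> csmooth T (V \<inter> U) u"
  shows "csmooth T U u"
  unfolding csmooth_def
proof (rule allI, rule csm_local)
  fix k x assume "x \<in> U"
  then obtain V where "open V" "x \<in> V" "csmooth T (V \<inter> U) u" using assms by blast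
  then show "\<exists>V. open V \<and> x \<in> V \<and> csm k T (V \<inter> U) u" by (intro exI[of _ V]) (simp add: csmooth_csm)
qed

lemma smooth_on_openI: "csmooth (discrete_topology {()}) U (\<lambda>t. f) \<Longrightarrow> open U \<Longrightarrow> smooth_on_open U f"
  by (simp add: smooth_on_open_iff)

text \<open>The extension of a map on the sphere that is constant on rays; on tangent vectors its derivative is
  that of the map.\<close>

definition hext :: "('a::real_normed_vector \<Rightarrow> 'b) \<Rightarrow> 'a \<Rightarrow> 'b" where
  "hext f x = f (x /\<^sub>R norm x)"

definition Dh :: "('a::real_normed_vector \<Rightarrow> 'b::real_normed_vector) \<Rightarrow> 'a \<Rightarrow> 'a \<Rightarrow> 'b" where
  "Dh f p = frechet_derivative (hext f) (at p)"

lemma normalize_sphere: "x \<noteq> 0 \<Longrightarrow> x /\<^sub>R norm x \<in> usphere"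
  by simp

lemma sphere_nonzero: "p \<in> usphere \<Longrightarrow> p \<noteq> 0"
  by auto

lemma hext_sphere: "p \<in> usphere \<Longrightarrow> hext f p = f p"
  by (simp add: hext_def)

lemma hext_scaleR: "c > 0 \<Longrightarrow> hext f (c *\<^sub>R x) = hext f x"
  by (simp add: hext_def divide_simps)

lemma open_punctured: "open (-{0::'a::euclidean_space})"
  by (simp add: open_Compl)

lemma csmooth_normalize: "csmooth T (-{0}) (\<lambda>t x::'a::euclidean_space. x /\<^sub>R norm x)"
  by (intro csmooth_scaleR csmooth_inverse csmooth_norm csmooth_ident open_punctured) auto

lemma smooth_map_on_open_iff:
  assumes "open U"
  shows "smooth_map_on U f \<longleftrightarrow> smooth_on_open U f"
proof
  assume "smooth_on_open U f"
  then show "smooth_map_on U f" unfolding smooth_map_on_def by blast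
next
  assume f: "smooth_map_on U f"
  have "csmooth (discrete_topology {()}) U (\<lambda>t. f)"
  proof (rule csmooth_local)
    fix p assume "p \<in> U"
    then obtain V F where V: "p \<in> V" "smooth_on_open V F" "\<forall>x\<in>U \<inter> V. F x = f x"
      using f unfolding smooth_map_on_def by blast
    then have "open V" by (simp add: smooth_on_open_def)
    have "csmooth (discrete_topology {()}) (V \<inter> U) (\<lambda>t. F)"
      by (rule csmooth_subset[OF csmooth_if_smooth_on_open[OF V(2)]]) simp
    then have "csmooth (discrete_topology {()}) (V \<inter> U) (\<lambda>t. f)"
      by (rule csmooth_cong) (use \<open>open V\<close> assms V(3) in auto)
    then show "\<exists>V. open V \<and> p \<in> V \<and> csmooth (discrete_topology {()}) (V \<inter> U) (\<lambda>t. f)"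
      using \<open>open V\<close> V(1) by blast
  qed
  then show "smooth_on_open U f" using assms by (rule smooth_on_openI)
qed

text \<open>A local extension \<open>F\<close> composed with the radial projection is smooth and
  equals \<open>hext f\<close> on an open cone; the cones cover the punctured space, and smoothness
  is local.\<close>

lemma smooth_map_on_sphere_iff:
  fixes f :: "'a::euclidean_space \<Rightarrow> 'b::euclidean_space"
  shows "smooth_map_on usphere f \<longleftrightarrow> smooth_on_open (-{0}) (hext f)"
proof
  assume "smooth_on_open (-{0}) (hext f)"
  then show "smooth_map_on usphere f"
    unfolding smooth_map_on_def by (intro ballI exI[of _ "-{0}"] exI[of _ "hext f"]) (auto simp: hext_sphere)
next
  assume f: "smooth_map_on usphere f"
  have "smooth_map_on (-{0}) (hext f)"
    unfolding smooth_map_on_def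
  proof
    fix x :: 'a assume x: "x \<in> -{0}"
    then obtain V F where V: "x /\<^sub>R norm x \<in> V" "smooth_on_open V F" "\<forall>x\<in>usphere \<inter> V. F x = f x"
      using f normalize_sphere[of x] unfolding smooth_map_on_def by blast
    then have "open V" by (simp add: smooth_on_open_def)
    define U where "U = (-{0}) \<inter> (\<lambda>x::'a. x /\<^sub>R norm x) -` V"
    have "open U" unfolding U_def
      by (rule continuous_open_preimage) (auto intro!: continuous_intros \<open>open V\<close> open_punctured)
    have "csmooth (discrete_topology {()}) U (\<lambda>t x. F (x /\<^sub>R norm x))"
      by (rule csmooth_compose[OF csmooth_if_smooth_on_open[OF V(2)] csmooth_subset[OF csmooth_normalize]])
        (use \<open>open U\<close> \<open>open V\<close> in \<open>auto simp: U_def\<close>)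
    then have "smooth_on_open U (\<lambda>x. F (x /\<^sub>R norm x))"
      using \<open>open U\<close> by (rule smooth_on_openI)
    moreover have "x \<in> U" using x V(1) by (simp add: U_def)
    moreover have "\<forall>y\<in>-{0} \<inter> U. F (y /\<^sub>R norm y) = hext f y"
      using V(3) by (simp add: U_def hext_def)
    ultimately show "\<exists>U F. x \<in> U \<and> smooth_on_open U F \<and> (\<forall>y\<in>-{0} \<inter> U. F y = hext f y)" by blast
  qed
  then show "smooth_on_open (-{0}) (hext f)" by (simp add: smooth_map_on_open_iff[OF open_punctured])
qed

lemma hext_has_derivative:
  "smooth_map_on usphere f \<Longrightarrow> x \<noteq> 0 \<Longrightarrow> (hext f has_derivative Dh f x) (at x)"
  unfolding smooth_map_on_sphere_iff Dh_def smooth_on_open_def frechet_derivative_works[symmetric]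
  by (metis ComplI iter_deriv.simps(1) singletonD)

lemma linear_Dh: "smooth_map_on usphere f \<Longrightarrow> x \<noteq> 0 \<Longrightarrow> linear (Dh f x)"
  using hext_has_derivative has_derivative_linear by blast

lemma has_derivative_hext_self:
  assumes "(hext f has_derivative D) (at p)" "p \<noteq> 0"
  shows "D p = 0"
proof -
  have "((\<lambda>s. (1 + s) *\<^sub>R p) has_derivative (\<lambda>s. s *\<^sub>R p)) (at (0::real))"
    by (auto intro!: derivative_eq_intros)
  then have "((\<lambda>s. hext f ((1 + s) *\<^sub>R p)) has_derivative (\<lambda>s. D (s *\<^sub>R p))) (at (0::real))"
    using diff_chain_at[of "\<lambda>s. (1 + s) *\<^sub>R p" "\<lambda>s. s *\<^sub>R p" 0 "hext f" D] assms by (simp add: o_def)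
  then have "((\<lambda>s::real. hext f p) has_derivative (\<lambda>s. D (s *\<^sub>R p))) (at 0)"
    by (rule has_derivative_transform_within_open[of _ _ _ _ "ball 0 1"]) (auto simp: hext_scaleR)
  moreover have "((\<lambda>s::real. hext f p) has_derivative (\<lambda>s. 0)) (at 0)" by simp
  ultimately have "(\<lambda>s::real. D (s *\<^sub>R p)) = (\<lambda>s. 0)" by (rule has_derivative_unique)
  from fun_cong[OF this, of 1] show ?thesis by simp
qed

lemma Dh_self: "smooth_map_on usphere f \<Longrightarrow> p \<noteq> 0 \<Longrightarrow> Dh f p p = 0"
  using has_derivative_hext_self hext_has_derivative by blast

lemma Dh_project:
  assumes "smooth_map_on usphere f" "p \<noteq> 0"
  shows "Dh f p (u - c *\<^sub>R p) = Dh f p u"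
  using linear_diff[OF linear_Dh[OF assms], of u "c *\<^sub>R p"] linear_cmul[OF linear_Dh[OF assms], of c p] Dh_self[OF assms] by simp

text \<open>The tangent line projected radially to the sphere: a test curve with velocity
  \<open>u\<close> at \<open>s = 0\<close>. For unit \<open>p\<close> and tangent \<open>u\<close>
  the vector \<open>p + s *\<^sub>R u\<close> has inner product 1 with \<open>p\<close>, so the
  quotient is defined for all \<open>s\<close>.\<close>

definition sphere_curve :: "'a::real_normed_vector \<Rightarrow> 'a \<Rightarrow> real \<Rightarrow> 'a" where
  "sphere_curve p u s = (p + s *\<^sub>R u) /\<^sub>R norm (p + s *\<^sub>R u)"

lemma tangent_add_nonzero: "p \<in> usphere \<Longrightarrow> u \<in> tangent p \<Longrightarrow> p + s *\<^sub>R u \<noteq> 0"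
  by (auto simp: tangent_def dot_square_norm inner_add_left dest!: arg_cong[of _ _ "\<lambda>x. x \<bullet> p"])

lemma sphere_curve_in: "p \<in> usphere \<Longrightarrow> u \<in> tangent p \<Longrightarrow> sphere_curve p u s \<in> usphere"
  unfolding sphere_curve_def by (rule normalize_sphere) (rule tangent_add_nonzero)

lemma sphere_curve_0: "p \<in> usphere \<Longrightarrow> sphere_curve p u 0 = p"
  by (simp add: sphere_curve_def)

lemma sphere_curve_has_derivative:
  assumes "p \<in> usphere" "u \<in> tangent p"
  shows "(sphere_curve p u has_derivative (\<lambda>s. s *\<^sub>R u)) (at 0)"
proof -
  have "((\<lambda>s. p + s *\<^sub>R u) has_derivative (\<lambda>s. s *\<^sub>R u)) (at (0::real))"
    by (auto intro!: derivative_eq_intros)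
  moreover have "((\<lambda>s::real. norm (p + s *\<^sub>R u)) has_derivative (\<lambda>s. 0)) (at 0)"
  proof -
    have "p \<noteq> 0" using assms(1) by auto
    then have "((\<lambda>s::real. norm (p + s *\<^sub>R u)) has_derivative (\<lambda>s. (s *\<^sub>R u) \<bullet> sgn p)) (at 0)"
      using diff_chain_at[OF \<open>((\<lambda>s. p + s *\<^sub>R u) has_derivative (\<lambda>s. s *\<^sub>R u)) (at 0)\<close>, of norm "\<lambda>v. v \<bullet> sgn p"] has_derivative_norm[of p]
      by (simp add: o_def)
    moreover have "(\<lambda>s::real. (s *\<^sub>R u) \<bullet> sgn p) = (\<lambda>s. 0)" using assms by (simp add: tangent_def sgn_div_norm)
    ultimately show ?thesis by simp
  qed
  then have "((\<lambda>s::real. inverse (norm (p + s *\<^sub>R u))) has_derivative (\<lambda>s. 0)) (at 0)"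
    using Deriv.has_derivative_inverse[of "\<lambda>s. norm (p + s *\<^sub>R u)" 0 "\<lambda>s. 0" UNIV] sphere_nonzero[OF assms(1)] by simp
  ultimately show ?thesis
    using \<open>((\<lambda>s. p + s *\<^sub>R u) has_derivative (\<lambda>s. s *\<^sub>R u)) (at 0)\<close> has_derivative_scaleR[of "\<lambda>s. inverse (norm (p + s *\<^sub>R u))" "\<lambda>s. 0" 0 UNIV "\<lambda>s. p + s *\<^sub>R u" "\<lambda>s. s *\<^sub>R u"] assms
    unfolding sphere_curve_def by simp
qed

text \<open>A derivative within the sphere is not unique, so \<open>dS\<close> is an arbitrary
  choice off the tangent space. Restricted to \<open>sphere_curve p u\<close>, two such derivatives
  become derivatives of one function of a real variable, and these are unique.\<close>

lemma dS_eq_Dh: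
  fixes f :: "'a::euclidean_space \<Rightarrow> 'b::euclidean_space"
  assumes f: "smooth_map_on usphere f" and p: "p \<in> usphere" and u: "u \<in> tangent p"
  shows "dS f p u = Dh f p u"
proof -
  have "(hext f has_derivative Dh f p) (at p within usphere)"
    using hext_has_derivative[OF f sphere_nonzero[OF p]] by (rule has_derivative_at_withinI)
  then have D: "(f has_derivative Dh f p) (at p within usphere)"
    by (rule has_derivative_transform_within[of _ _ _ _ 1]) (use p in \<open>auto simp: hext_sphere\<close>)
  then have "(f has_derivative dS f p) (at p within usphere)"
    unfolding dS_def using differentiableI frechet_derivative_works by blast
  moreover have "((\<lambda>s. f (sphere_curve p u s)) has_derivative (\<lambda>s. D (s *\<^sub>R u))) (at 0)"
    if "(f has_derivative D) (at p within usphere)" for D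
  proof -
    have "(f has_derivative D) (at (sphere_curve p u 0) within range (sphere_curve p u))"
      using that has_derivative_subset sphere_curve_in[OF p u] sphere_curve_0[OF p] by (metis image_subsetI)
    then show ?thesis
      using diff_chain_within[OF sphere_curve_has_derivative[OF p u], of f D] by (simp add: o_def)
  qed
  ultimately have "(\<lambda>s::real. dS f p (s *\<^sub>R u)) = (\<lambda>s. Dh f p (s *\<^sub>R u))"
    using D has_derivative_unique by blast
  from fun_cong[OF this, of 1] show ?thesis by simp
qed

lemma hext_cong: "(\<And>x. x \<in> usphere \<Longrightarrow> f x = g x) \<Longrightarrow> x \<noteq> 0 \<Longrightarrow> hext f x = hext g x"
  unfolding hext_def using normalize_sphere by blast

lemma Dh_cong:
  fixes f g :: "'a::euclidean_space \<Rightarrow> 'b::real_normed_vector"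
  assumes "\<And>x. x \<in> usphere \<Longrightarrow> f x = g x" "x \<noteq> 0"
  shows "Dh f x = Dh g x"
  unfolding Dh_def by (rule frechet_derivative_cong_open[OF open_punctured]) (use assms hext_cong in auto)

subsection \<open>Stereographic projection\<close>

text \<open>Inverse stereographic projection from the pole with last coordinate \<open>- s\<close>;
  the values \<open>s = 1\<close> and \<open>s = -1\<close> give two charts that cover the
  sphere.\<close>

definition stereo_inv :: "real \<Rightarrow> real^'n \<Rightarrow> 'n::finite euc1" where
  "stereo_inv s y = (\<chi> i. case i of None \<Rightarrow> s * (1 - y \<bullet> y) / (1 + y \<bullet> y) | Some j \<Rightarrow> 2 * y $ j / (1 + y \<bullet> y))"

definition stereo :: "real \<Rightarrow> 'n::finite euc1 \<Rightarrow> real^'n" where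
  "stereo s x = (\<chi> j. x $ Some j / (1 + s * x $ None))"

lemma sum_UNIV_option: "(\<Sum>i\<in>UNIV. g i) = g None + (\<Sum>j\<in>UNIV. g (Some j))" for g :: "'n::finite option \<Rightarrow> 'b::comm_monoid_add"
  by (simp add: UNIV_option_conv sum.reindex)

lemma inner_euc1: "x \<bullet> y = x $ None * y $ None + (\<Sum>j\<in>UNIV. x $ Some j * y $ Some j)" for x y :: "'n::finite euc1"
  by (simp add: inner_vec_def sum_UNIV_option)

lemma stereo_inv_props:
  assumes "s * s = 1"
  shows "stereo_inv s y \<in> usphere" "1 + s * stereo_inv s y $ None = 2 / (1 + y \<bullet> y)" "stereo s (stereo_inv s y) = y"
proof -
  have pos: "1 + y \<bullet> y > 0" by (simp add: add_pos_nonneg)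
  let ?q = "1 + y \<bullet> y"
  have "(\<Sum>j\<in>UNIV. stereo_inv s y $ Some j * stereo_inv s y $ Some j) = (\<Sum>j\<in>UNIV. y $ j * y $ j) * (4 / (?q * ?q))"
    unfolding sum_distrib_right by (intro sum.cong) (simp_all add: stereo_inv_def)
  also have "\<dots> = 4 * (y \<bullet> y) / (?q * ?q)" by (simp add: inner_vec_def)
  finally have sm: "(\<Sum>j\<in>UNIV. stereo_inv s y $ Some j * stereo_inv s y $ Some j) = 4 * (y \<bullet> y) / (?q * ?q)" .
  have "stereo_inv s y $ None = s * (1 - y \<bullet> y) / ?q" by (simp add: stereo_inv_def)
  then have "stereo_inv s y \<bullet> stereo_inv s y = (s * s) * ((1 - y \<bullet> y) * (1 - y \<bullet> y)) / (?q * ?q) + 4 * (y \<bullet> y) / (?q * ?q)"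
    unfolding inner_euc1 sm by (simp add: mult_ac)
  also have "\<dots> = (?q * ?q) / (?q * ?q)"
    unfolding assms add_divide_distrib[symmetric] by (rule arg_cong[where f = "\<lambda>z. z / (?q * ?q)"]) (simp add: algebra_simps)
  finally have "stereo_inv s y \<bullet> stereo_inv s y = 1" using pos by simp
  then show "stereo_inv s y \<in> usphere" by (simp add: norm_eq_1)
  have "s * stereo_inv s y $ None = (s * s) * (1 - y \<bullet> y) / ?q" by (simp add: stereo_inv_def)
  then show d: "1 + s * stereo_inv s y $ None = 2 / ?q" unfolding assms using pos by (simp add: field_simps)
  have "stereo s (stereo_inv s y) $ j = y $ j" for j
    using pos by (simp add: stereo_def d) (simp add: stereo_inv_def)
  then show "stereo s (stereo_inv s y) = y" by (simp add: vec_eq_iff)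
qed

lemma stereo_inv_stereo:
  assumes s: "s * s = 1" and x: "x \<in> usphere" "1 + s * x $ None \<noteq> 0"
  shows "stereo_inv s (stereo s x) = x"
proof -
  let ?d = "1 + s * x $ None"
  have "x \<bullet> x = 1" using x by (simp add: norm_eq_1)
  then have sm: "(\<Sum>j\<in>UNIV. x $ Some j * x $ Some j) = 1 - x $ None * x $ None"
    by (simp add: inner_euc1)
  have "stereo s x \<bullet> stereo s x = (\<Sum>j\<in>UNIV. x $ Some j * x $ Some j) * (1 / (?d * ?d))"
    unfolding sum_distrib_right by (simp add: inner_vec_def stereo_def)
  also have "\<dots> = (1 - (s * s) * (x $ None * x $ None)) / (?d * ?d)" unfolding sm s by simp
  also have "\<dots> = ((1 - s * x $ None) * ?d) / (?d * ?d)" by (simp add: algebra_simps)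
  also have "\<dots> = (1 - s * x $ None) / ?d" by (rule mult_divide_mult_cancel_right[OF x(2)])
  finally have q: "stereo s x \<bullet> stereo s x = (1 - s * x $ None) / ?d" .
  have gen: "1 + (1 - z) / (1 + z) = 2 / (1 + z)" "1 - (1 - z) / (1 + z) = 2 * z / (1 + z)" if "1 + z \<noteq> 0" for z :: real
    using that by (simp_all add: field_simps)
  have q1: "1 + stereo s x \<bullet> stereo s x = 2 / ?d" unfolding q by (rule gen(1)[OF x(2)])
  have q2: "1 - stereo s x \<bullet> stereo s x = 2 * (s * x $ None) / ?d" unfolding q by (rule gen(2)[OF x(2)])
  have "s * (2 * (s * x $ None) / ?d) / (2 / ?d) = (s * s) * x $ None"
    using x(2) by simp
  then have "stereo_inv s (stereo s x) $ None = x $ None" using s by (simp add: stereo_inv_def q1 q2)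
  moreover have "stereo_inv s (stereo s x) $ Some j = x $ Some j" for j
    unfolding stereo_inv_def using x(2) by (simp add: q1) (simp add: stereo_def field_simps)
  ultimately show ?thesis by (metis (full_types) vec_eq_iff option.exhaust)
qed

lemma csmooth_stereo_inv: "csmooth T UNIV (\<lambda>t. stereo_inv s :: real^'n \<Rightarrow> 'n::finite euc1)"
proof (rule csmooth_vec)
  have pos: "1 + y \<bullet> y \<noteq> 0" for y :: "real^'n" using inner_ge_zero[of y] by linarith
  show "csmooth T UNIV (\<lambda>t x. (stereo_inv s x :: 'n euc1) $ i)" for i
  proof (cases i)
    case None
    show ?thesis unfolding None stereo_inv_def
      by (simp, intro csmooth_divide csmooth_add csmooth_mult csmooth_diff csmooth_const csmooth_inner csmooth_ident pos open_UNIV)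
  next
    case (Some j)
    show ?thesis unfolding Some stereo_inv_def
      by (simp, intro csmooth_divide csmooth_add csmooth_mult csmooth_const csmooth_inner csmooth_ident csmooth_nth pos open_UNIV)
  qed
qed simp

lemma open_stereo_domain: "open {x :: 'n::finite euc1. 1 + s * x $ None \<noteq> 0}"
  by (rule open_Collect_neq) (auto intro!: continuous_intros)

lemma csmooth_stereo: "csmooth T {x. 1 + s * x $ None \<noteq> 0} (\<lambda>t. stereo s :: 'n::finite euc1 \<Rightarrow> real^'n)"
proof (rule csmooth_vec)
  show "csmooth T {x. 1 + s * x $ None \<noteq> 0} (\<lambda>t x. stereo s x $ i)" for i :: 'n
    unfolding stereo_def vec_lambda_beta
    by (intro csmooth_divide csmooth_add csmooth_mult csmooth_const csmooth_ident csmooth_nth open_stereo_domain) simp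
qed (rule open_stereo_domain)

lemma range_stereo_inv:
  assumes "s * s = 1"
  shows "range (stereo_inv s :: real^'n \<Rightarrow> 'n::finite euc1) = usphere \<inter> {x. 1 + s * x $ None \<noteq> 0}"
proof (intro equalityI subsetI)
  fix x :: "'n euc1" assume "x \<in> range (stereo_inv s)"
  then obtain y where y: "x = stereo_inv s y" by blast
  have "1 + y \<bullet> y > 0" by (simp add: add_pos_nonneg)
  then have "1 + s * stereo_inv s y $ None \<noteq> 0" unfolding stereo_inv_props(2)[OF assms] by simp
  then show "x \<in> usphere \<inter> {x. 1 + s * x $ None \<noteq> 0}"
    using stereo_inv_props(1)[OF assms, of y] unfolding y by blast
next
  fix x :: "'n euc1" assume "x \<in> usphere \<inter> {x. 1 + s * x $ None \<noteq> 0}"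
  then have "x = stereo_inv s (stereo s x)" using stereo_inv_stereo[OF assms, of x] by simp
  then show "x \<in> range (stereo_inv s)" by (rule range_eqI)
qed

lemma local_param_stereo_inv:
  assumes "s * s = 1"
  shows "local_param UNIV (stereo_inv s :: real^'n \<Rightarrow> 'n::finite euc1)"
proof -
  let ?V = "{x :: 'n euc1. 1 + s * x $ None \<noteq> 0}"
  have "smooth_map_on UNIV (stereo_inv s :: real^'n \<Rightarrow> 'n euc1)"
    unfolding smooth_map_on_open_iff[OF open_UNIV] by (rule smooth_on_openI[OF csmooth_stereo_inv open_UNIV])
  moreover have "smooth_on_open ?V (stereo s)"
    by (rule smooth_on_openI[OF csmooth_stereo open_stereo_domain])
  then have "smooth_map_on (usphere \<inter> ?V) (stereo s)"
    unfolding smooth_map_on_def by (intro ballI exI[of _ ?V] exI[of _ "stereo s"]) simp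
  moreover have "stereo s ` (usphere \<inter> ?V) = UNIV"
  proof (intro equalityI subsetI)
    fix y :: "real^'n"
    have "stereo_inv s y \<in> usphere \<inter> ?V" unfolding range_stereo_inv[OF assms, symmetric] by simp
    then show "y \<in> stereo s ` (usphere \<inter> ?V)"
      by (rule image_eqI[rotated]) (simp add: stereo_inv_props(3)[OF assms])
  qed simp
  moreover have "\<forall>x\<in>UNIV. stereo s (stereo_inv s x) = x"
    by (simp add: stereo_inv_props(3)[OF assms])
  moreover have "\<forall>y\<in>usphere \<inter> ?V. stereo_inv s (stereo s y) = y"
    using stereo_inv_stereo[OF assms] by blast
  ultimately have "diffeomorphism UNIV (usphere \<inter> ?V) (stereo_inv s) (stereo s)"
    unfolding diffeomorphism_def using range_stereo_inv[OF assms] by blast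
  moreover have "openin (top_of_set usphere) (usphere \<inter> ?V)"
    by (rule openin_open_Int[OF open_stereo_domain])
  ultimately show ?thesis
    unfolding local_param_def range_stereo_inv[OF assms] by blast
qed

subsection \<open>Continuity into the smooth topology\<close>

lemma smooth_maps_iff: "f \<in> smooth_maps \<longleftrightarrow> f \<in> usphere \<rightarrow>\<^sub>E usphere \<and> smooth_on_open (-{0}) (hext f)"
  by (simp add: smooth_maps_def smooth_map_on_sphere_iff)

lemma smooth_maps_smooth: "f \<in> smooth_maps \<Longrightarrow> smooth_map_on usphere f"
  by (simp add: smooth_maps_def)

lemma topspace_smooth_topology: "topspace (smooth_topology :: ('n::finite euc1 \<Rightarrow> 'b::euclidean_space) topology) = smooth_maps"
proof -
  have "f \<in> smooth_nbhd f \<phi> {} [] 1" if "f \<in> smooth_maps" for f :: "'n euc1 \<Rightarrow> 'b" and \<phi> :: "real^'n \<Rightarrow> 'n euc1"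
    using that by (simp add: smooth_nbhd_def)
  moreover have "local_param UNIV (stereo_inv 1 :: real^'n \<Rightarrow> 'n euc1)" by (rule local_param_stereo_inv) simp
  ultimately show ?thesis
    unfolding smooth_topology_def topology_generated_by_topspace
    by (intro equalityI subsetI) (force simp: smooth_nbhd_def, blast intro: zero_less_one compact_empty)
qed

lemma smooth_map_param:
  fixes s :: "'t \<Rightarrow> 'n::finite euc1 \<Rightarrow> 'b::euclidean_space"
  assumes "csmooth T (-{0}) (\<lambda>t. hext (s t))" "local_param U \<phi>"
  shows "csmooth T U (\<lambda>t. s t \<circ> \<phi>)"
proof -
  have U: "open U" and \<phi>: "smooth_on_open U \<phi>" and im: "\<phi> ` U \<subseteq> usphere"
    using assms(2) openin_imp_subset smooth_map_on_open_iff[of U \<phi>] unfolding local_param_def diffeomorphism_def by blast+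
  have "csmooth T U (\<lambda>t x. hext (s t) (\<phi> x))"
    by (rule csmooth_compose[OF assms(1) csmooth_if_smooth_on_open[OF \<phi>]]) (use im U open_punctured in auto)
  then show ?thesis
    by (rule csmooth_cong[OF _ U]) (use im in \<open>auto simp: hext_sphere image_subset_iff\<close>)
qed

lemma csmooth_hext_const: "f \<in> smooth_maps \<Longrightarrow> csmooth T (-{0}) (\<lambda>t. hext f)"
  by (rule csmooth_if_smooth_on_open) (simp add: smooth_maps_iff)

text \<open>The topology uses compact sets in all charts, but the two stereographic charts already
  determine \<open>hext\<close>. From left to right, a closed ball around a point of a chart turns
  uniform closeness into joint continuity. From right to left, the set where a seminorm inequality
  fails is closed, and so is its projection along the compact factor \<open>K\<close>. Later
  continuity claims about spaces of maps rest on this criterion.\<close>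

theorem continuous_map_smooth_topology:
  fixes s :: "'t \<Rightarrow> 'n::finite euc1 \<Rightarrow> 'b::euclidean_space"
  shows "continuous_map T smooth_topology s \<longleftrightarrow> (\<forall>t\<in>topspace T. s t \<in> smooth_maps) \<and> csmooth T (-{0}) (\<lambda>t. hext (s t))"
proof (intro iffI conjI)
  assume s: "continuous_map T smooth_topology s"
  then show sm: "\<forall>t\<in>topspace T. s t \<in> smooth_maps" by (auto simp: continuous_map_def topspace_smooth_topology)
  have loc: "csmooth T U (\<lambda>t. s t \<circ> \<phi>)" if \<phi>: "local_param U \<phi>" for U \<phi>
    unfolding csmooth_iff_iter_deriv
  proof (intro allI conjI ballI)
    have U: "open U" using \<phi> by (simp add: local_param_def)
    have c1: "csmooth (discrete_topology {()}) U (\<lambda>_. s t \<circ> \<phi>)" if "t \<in> topspace T" for t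
      using smooth_map_param[of "discrete_topology {()}" "\<lambda>_. s t"] csmooth_hext_const sm that \<phi> by blast
    fix vs
    show d: "iter_deriv vs (s t \<circ> \<phi>) differentiable (at x)" if "t \<in> topspace T" "x \<in> U" for t x
      using c1[OF that(1)] that(2) unfolding csmooth_iff_iter_deriv by simp
    show "continuous_map (prod_topology T (top_of_set U)) euclidean (\<lambda>z. iter_deriv vs (s (fst z) \<circ> \<phi>) (snd z))"
      unfolding continuous_map_topcontinuous_iff
    proof (intro ballI allI impI)
      fix z and e :: real assume z: "z \<in> topspace (prod_topology T (top_of_set U))" and e: "e > 0"
      obtain t0 x0 where z0: "z = (t0, x0)" by (cases z)
      have tx: "t0 \<in> topspace T" "x0 \<in> U" using z by (auto simp: z0)
      obtain r where r: "r > 0" "cball x0 r \<subseteq> U" using U tx(2) open_contains_cball by blast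
      let ?N = "smooth_nbhd (s t0) \<phi> (cball x0 r) vs (e / 2)"
      have "openin smooth_topology ?N"
        unfolding smooth_topology_def
        by (rule topology_generated_by_Basis) (use sm tx(1) \<phi> r(2) e in \<open>auto intro!: exI\<close>)
      then have W1: "openin T {t \<in> topspace T. s t \<in> ?N}" by (rule openin_continuous_map_preimage[OF s])
      have "continuous (at x0) (iter_deriv vs (s t0 \<circ> \<phi>))"
        using d[OF tx] differentiable_imp_continuous_within by blast
      then obtain d where d: "d > 0" "\<And>x. dist x x0 < d \<Longrightarrow> dist (iter_deriv vs (s t0 \<circ> \<phi>) x) (iter_deriv vs (s t0 \<circ> \<phi>) x0) < e / 2"
        using e unfolding continuous_at_eps_delta by (metis half_gt_zero)
      let ?W = "{t \<in> topspace T. s t \<in> ?N} \<times> (U \<inter> (ball x0 r \<inter> ball x0 d))"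
      have "openin (top_of_set U) (U \<inter> (ball x0 r \<inter> ball x0 d))" by (simp add: openin_open_Int open_Int)
      then have "openin (prod_topology T (top_of_set U)) ?W"
        using W1 by (simp add: openin_prod_Times_iff)
      moreover have "z \<in> ?W"
        using tx r d e sm by (simp add: z0 smooth_nbhd_def)
      moreover have "dist (iter_deriv vs (s t \<circ> \<phi>) x) (iter_deriv vs (s t0 \<circ> \<phi>) x0) < e"
        if "s t \<in> ?N" "x \<in> U \<inter> (ball x0 r \<inter> ball x0 d)" for t x
      proof -
        have "dist (iter_deriv vs (s t \<circ> \<phi>) x) (iter_deriv vs (s t0 \<circ> \<phi>) x) < e / 2"
          using that by (auto simp: smooth_nbhd_def dist_norm)
        moreover have "dist (iter_deriv vs (s t0 \<circ> \<phi>) x) (iter_deriv vs (s t0 \<circ> \<phi>) x0) < e / 2"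
          using that(2) by (intro d(2)) (simp add: dist_commute)
        ultimately show ?thesis by (metis dist_triangle_half_r dist_commute)
      qed
      ultimately show "\<exists>W. openin (prod_topology T (top_of_set U)) W \<and> z \<in> W \<and>
          (\<forall>y\<in>W. dist (iter_deriv vs (s (fst y) \<circ> \<phi>) (snd y)) (iter_deriv vs (s (fst z) \<circ> \<phi>) (snd z)) < e)"
        unfolding z0 by (intro exI conjI) auto
    qed
  qed
  \<comment> \<open>The open cone over the domain of the chart \<open>stereo e\<close>; the cones
    for \<open>1\<close> and \<open>-1\<close> cover the punctured space.\<close>
  define \<Omega> where "\<Omega> e = {x :: 'n euc1. x \<noteq> 0 \<and> 1 + e * (x /\<^sub>R norm x) $ None \<noteq> 0}" for e
  have \<Omega>_eq: "\<Omega> e = (-{0}) \<inter> (\<lambda>x. x /\<^sub>R norm x) -` {x. 1 + e * x $ None \<noteq> 0}" for e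
    by (auto simp: \<Omega>_def)
  have open\<Omega>: "open (\<Omega> e)" for e
    unfolding \<Omega>_eq by (rule continuous_open_preimage) (auto intro!: continuous_intros open_stereo_domain open_punctured)
  have part: "csmooth T (\<Omega> e) (\<lambda>t. hext (s t))" if e: "e * e = 1" for e
  proof -
    have st: "csmooth T (\<Omega> e) (\<lambda>t x. stereo e (x /\<^sub>R norm x))"
      by (rule csmooth_compose[OF csmooth_stereo csmooth_subset[OF csmooth_normalize]]) (auto simp: open\<Omega> open_stereo_domain, auto simp: \<Omega>_def)
    have "csmooth T (\<Omega> e) (\<lambda>t x. (s t \<circ> stereo_inv e) (stereo e (x /\<^sub>R norm x)))"
      by (rule csmooth_compose[OF loc[OF local_param_stereo_inv[OF e]] st]) (auto simp: open\<Omega>)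
    then show ?thesis
      by (rule csmooth_cong[OF _ open\<Omega>]) (auto simp: hext_def \<Omega>_def stereo_inv_stereo[OF e])
  qed
  have "\<Omega> 1 \<union> \<Omega> (-1) = -{0}" by (auto simp: \<Omega>_def)
  then show "csmooth T (-{0}) (\<lambda>t. hext (s t))"
    using csmooth_Un[OF part[of 1] part[of "-1"] open\<Omega> open\<Omega>] by simp
next
  assume R: "(\<forall>t\<in>topspace T. s t \<in> smooth_maps) \<and> csmooth T (-{0}) (\<lambda>t. hext (s t))"
  show "continuous_map T smooth_topology s"
    unfolding smooth_topology_def
  proof (rule continuous_on_generated_topo)
    show "s ` topspace T \<subseteq> \<Union> {smooth_nbhd f \<phi> K vs \<epsilon> | f \<phi> U K vs \<epsilon>. f \<in> smooth_maps \<and> local_param U \<phi> \<and> compact K \<and> K \<subseteq> U \<and> 0 < \<epsilon>}"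
      using R topspace_smooth_topology[where 'n='n and 'b='b] unfolding smooth_topology_def topology_generated_by_topspace
      by (metis (no_types, lifting) image_subsetI)
  next
    fix N :: "('n euc1 \<Rightarrow> 'b) set" assume "N \<in> {smooth_nbhd f \<phi> K vs \<epsilon> | f \<phi> U K vs \<epsilon>. f \<in> smooth_maps \<and> local_param U \<phi> \<and> compact K \<and> K \<subseteq> U \<and> 0 < \<epsilon>}"
    then obtain f \<phi> U K vs \<epsilon> where N: "N = smooth_nbhd f \<phi> K vs \<epsilon>" "f \<in> smooth_maps" "local_param U \<phi>" "compact K" "K \<subseteq> U" "0 < \<epsilon>"
      by blast
    have K: "continuous_map (prod_topology T (top_of_set K)) euclidean (\<lambda>z. iter_deriv vs (g (fst z) \<circ> \<phi>) (snd z))"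
      if "csmooth T (-{0}) (\<lambda>t. hext (g t))" for g :: "'t \<Rightarrow> 'n euc1 \<Rightarrow> 'b"
      using csmooth_subset[OF smooth_map_param[OF that N(3)] N(5)] unfolding csmooth_iff_iter_deriv by blast
    let ?h = "\<lambda>z. norm (iter_deriv vs (s (fst z) \<circ> \<phi>) (snd z) - iter_deriv vs (f \<circ> \<phi>) (snd z))"
    let ?A = "{z \<in> topspace (prod_topology T (top_of_set K)). ?h z \<in> {\<epsilon>..}}"
    have "continuous_map (prod_topology T (top_of_set K)) euclidean ?h"
      using R K[of s] K[of "\<lambda>_. f"] csmooth_hext_const[OF N(2)] by (intro continuous_map_norm continuous_map_diff) auto
    then have "closedin (prod_topology T (top_of_set K)) ?A"
      by (rule closedin_continuous_map_preimage) (simp flip: closed_closedin)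
    then have "closedin T (fst ` ?A)"
      using Abstract_Topological_Spaces.closed_map_fst[of "top_of_set K" T] N(4) unfolding closed_map_def
      by (simp add: compact_space_subtopology flip: compactin_euclidean_iff)
    then have "openin T (topspace T - fst ` ?A)" by blast
    moreover have "s -` N \<inter> topspace T = topspace T - fst ` ?A"
      using R unfolding N(1) smooth_nbhd_def by (force simp: not_le)
    ultimately show "openin T (s -` N \<inter> topspace T)" by simp
  qed
qed

section \<open>Locally convex hypersurfaces of the sphere are globally convex\<close>

lemma Dh_scaleR:
  fixes f :: "'a::euclidean_space \<Rightarrow> 'b::euclidean_space"
  assumes f: "smooth_map_on usphere f" and x: "x \<noteq> 0" and c: "c > 0"
  shows "Dh f (c *\<^sub>R x) v = Dh f x v /\<^sub>R c"
proof -
  have "(hext f has_derivative Dh f (c *\<^sub>R x)) (at (c *\<^sub>R x))"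
    using hext_has_derivative[OF f] x c by simp
  moreover have "((\<lambda>y. c *\<^sub>R y) has_derivative (\<lambda>v. c *\<^sub>R v)) (at x)" by (auto intro!: derivative_eq_intros)
  ultimately have "(hext f \<circ> (\<lambda>y. c *\<^sub>R y) has_derivative Dh f (c *\<^sub>R x) \<circ> (\<lambda>v. c *\<^sub>R v)) (at x)"
    by (rule diff_chain_at[rotated])
  moreover have "hext f \<circ> (\<lambda>y. c *\<^sub>R y) = hext f" using hext_scaleR[OF c] by (auto simp: o_def)
  ultimately have "Dh f (c *\<^sub>R x) \<circ> (\<lambda>v. c *\<^sub>R v) = Dh f x"
    using hext_has_derivative[OF f x] has_derivative_unique by metis
  then have "Dh f (c *\<^sub>R x) (c *\<^sub>R (v /\<^sub>R c)) = Dh f x (v /\<^sub>R c)" by (metis comp_apply)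
  then show ?thesis using c linear_cmul[OF linear_Dh[OF f x]] by (simp add: divide_inverse)
qed

lemma Dh_continuous_on:
  fixes f :: "'a::euclidean_space \<Rightarrow> 'b::euclidean_space"
  assumes "smooth_map_on usphere f"
  shows "continuous_on ((-{0}) \<times> UNIV) (\<lambda>z. Dh f (fst z) (snd z))"
proof -
  have "continuous_map (top_of_set ((-{0::'a}) \<times> UNIV)) euclidean (\<lambda>z. frechet_derivative ((\<lambda>_. hext f) ()) (at (fst z)) (snd z))"
    using assms unfolding smooth_map_on_sphere_iff
    by (intro csmooth_frechet_derivative_compose[OF csmooth_if_smooth_on_open[of "-{0}" "hext f" "discrete_topology {()}"], where s="\<lambda>_. ()"])
      (auto intro!: continuous_on_fst continuous_on_snd continuous_on_id)
  then show ?thesis by (simp add: Dh_def)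
qed

lemma hext_continuous_on:
  fixes f :: "'a::euclidean_space \<Rightarrow> 'b::euclidean_space"
  assumes "smooth_map_on usphere f"
  shows "continuous_on (-{0}) (hext f)"
  using hext_has_derivative[OF assms] has_derivative_continuous
  by (blast intro: continuous_at_imp_continuous_on)

lemma sphere_continuous_on:
  fixes f :: "'a::euclidean_space \<Rightarrow> 'b::euclidean_space"
  assumes "smooth_map_on usphere f"
  shows "continuous_on usphere f"
  by (rule continuous_on_eq[OF continuous_on_subset[OF hext_continuous_on[OF assms]]]) (auto simp: hext_sphere)

lemma curve_has_derivative:
  fixes f :: "'a::euclidean_space \<Rightarrow> 'b::euclidean_space"
  assumes f: "smooth_map_on usphere f" and p: "p \<in> usphere" and u: "u \<in> tangent p"
  shows "((\<lambda>s. f (sphere_curve p u s)) has_derivative (\<lambda>s. s *\<^sub>R Dh f p u)) (at 0)"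
proof -
  have "(hext f has_derivative Dh f p) (at (sphere_curve p u 0))"
    using hext_has_derivative[OF f sphere_nonzero[OF p]] sphere_curve_0[OF p] by metis
  from diff_chain_at[OF sphere_curve_has_derivative[OF p u] this]
  have "((\<lambda>s. hext f (sphere_curve p u s)) has_derivative (\<lambda>s. Dh f p (s *\<^sub>R u))) (at 0)" by (simp add: o_def)
  then show ?thesis
    unfolding hext_sphere[OF sphere_curve_in[OF p u]] linear_cmul[OF linear_Dh[OF f sphere_nonzero[OF p]]] .
qed

lemma curve_inner_derivative:
  fixes f :: "'a::euclidean_space \<Rightarrow> 'b::euclidean_space"
  assumes "smooth_map_on usphere f" "p \<in> usphere" "u \<in> tangent p"
  shows "((\<lambda>s. f (sphere_curve p u s) \<bullet> m) has_real_derivative (Dh f p u \<bullet> m)) (at 0)"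
  using has_derivative_inner_left[OF curve_has_derivative[OF assms], of m]
  by (simp add: has_field_derivative_def mult.commute[of _ "Dh f p u \<bullet> m"])

lemma nonneg_derivative_right:
  fixes h :: "real \<Rightarrow> real"
  assumes "(h has_real_derivative D) (at 0)" "h 0 = 0" "d > 0" "\<And>s. 0 < s \<Longrightarrow> s < d \<Longrightarrow> 0 \<le> h s"
  shows "0 \<le> D"
proof (rule ccontr)
  assume "\<not> 0 \<le> D"
  then obtain e where e: "e > 0" "\<And>s. 0 < s \<Longrightarrow> s < e \<Longrightarrow> h (0 + s) < h 0"
    using DERIV_neg_dec_right[OF assms(1)] by force
  have "min d e / 2 < e" "min d e / 2 < d" "0 < min d e / 2" using assms(3) e(1) by (auto simp: min_def)
  then show False using e(2)[of "min d e / 2"] assms(4)[of "min d e / 2"] assms(2) by simp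
qed

lemma tangent_project: "p \<in> usphere \<Longrightarrow> u - (u \<bullet> p) *\<^sub>R p \<in> tangent p"
  by (simp add: tangent_def inner_diff_left dot_square_norm)

lemma subspace_tangent: "subspace (tangent p)"
  unfolding tangent_def subspace_def by (auto simp: inner_add_left)

lemma tangent_eq: "tangent p = {x. p \<bullet> x = 0}"
  by (auto simp: tangent_def inner_commute)

lemma dim_tangent: "p \<noteq> 0 \<Longrightarrow> dim (tangent p) = DIM('a) - 1" for p :: "'a::euclidean_space"
  unfolding tangent_eq by (rule dim_hyperplane)

lemma const_inner_derivative:
  fixes f g :: "'a::euclidean_space \<Rightarrow> 'b::euclidean_space"
  assumes f: "smooth_map_on usphere f" and g: "smooth_map_on usphere g"
    and c: "\<And>x. x \<in> usphere \<Longrightarrow> f x \<bullet> g x = c" and p: "p \<in> usphere"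
  shows "Dh f p u \<bullet> g p = - (f p \<bullet> Dh g p u)"
proof -
  have p0: "p \<noteq> 0" using p by auto
  have "((\<lambda>x. hext f x \<bullet> hext g x) has_derivative (\<lambda>u. hext f p \<bullet> Dh g p u + Dh f p u \<bullet> hext g p)) (at p)"
    by (rule bounded_bilinear.FDERIV[OF bounded_bilinear_inner hext_has_derivative[OF f p0] hext_has_derivative[OF g p0]])
  moreover have "((\<lambda>x. hext f x \<bullet> hext g x) has_derivative (\<lambda>u. 0)) (at p)"
    by (rule has_derivative_transform_within_open[OF has_derivative_const[of c] open_punctured])
      (use p0 c normalize_sphere in \<open>auto simp: hext_def\<close>)
  ultimately have "(\<lambda>u. hext f p \<bullet> Dh g p u + Dh f p u \<bullet> hext g p) = (\<lambda>u. 0)" by (rule has_derivative_unique)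
  from fun_cong[OF this, of u] show ?thesis by (simp add: hext_sphere[OF p])
qed

lemma sphere_curve_neq:
  assumes p: "p \<in> usphere" and u: "u \<in> tangent p" "u \<noteq> 0" "s \<noteq> 0"
  shows "sphere_curve p u s \<noteq> p"
proof
  assume eq: "sphere_curve p u s = p"
  have nz: "norm (p + s *\<^sub>R u) \<noteq> 0" using tangent_add_nonzero[OF p u(1)] by simp
  have "norm (p + s *\<^sub>R u) *\<^sub>R p = norm (p + s *\<^sub>R u) *\<^sub>R sphere_curve p u s" by (simp only: eq)
  also have "\<dots> = p + s *\<^sub>R u" using nz by (simp add: sphere_curve_def)
  finally have e: "norm (p + s *\<^sub>R u) *\<^sub>R p = p + s *\<^sub>R u" .
  then have "(norm (p + s *\<^sub>R u) *\<^sub>R p) \<bullet> p = (p + s *\<^sub>R u) \<bullet> p" by (rule arg_cong)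
  then have "norm (p + s *\<^sub>R u) = 1" using u(1) p by (simp add: tangent_def inner_add_left norm_eq_1)
  then show False using e u by simp
qed

lemma sphere_curve_near:
  assumes "p \<in> usphere" "u \<in> tangent p" "e > 0"
  obtains d where "d > 0" "\<And>s. \<bar>s\<bar> < d \<Longrightarrow> dist (sphere_curve p u s) p < e"
proof -
  have "isCont (sphere_curve p u) 0" by (rule has_derivative_continuous[OF sphere_curve_has_derivative[OF assms(1,2)]])
  then obtain d where "d > 0" "\<And>s. dist s 0 < d \<Longrightarrow> dist (sphere_curve p u s) p < e"
    using assms(3) unfolding continuous_at_eps_delta sphere_curve_0[OF assms(1)] by (metis dist_commute)
  then show ?thesis using that[of d] by simp
qed

lemma tangent_add: "u \<in> tangent p \<Longrightarrow> v \<in> tangent p \<Longrightarrow> u + v \<in> tangent p"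
  and tangent_scaleR: "u \<in> tangent p \<Longrightarrow> c *\<^sub>R u \<in> tangent p"
  and tangent_minus: "u \<in> tangent p \<Longrightarrow> - u \<in> tangent p"
  by (simp_all add: tangent_def inner_add_left)

definition unit_tangents :: "('a::euclidean_space \<times> 'a) set" where
  "unit_tangents = {(p, u). p \<in> usphere \<and> u \<in> usphere \<and> u \<in> tangent p}"

lemma compact_unit_tangents: "compact (unit_tangents :: ('a::euclidean_space \<times> 'a) set)"
proof -
  have eq: "unit_tangents = (usphere \<times> usphere) \<inter> {z::'a\<times>'a. snd z \<bullet> fst z = 0}"
    by (auto simp: unit_tangents_def tangent_def)
  show ?thesis
    unfolding eq by (intro compact_Int_closed compact_Times compact_sphere closed_Collect_eq continuous_intros)
qed

lemma tangent_image:
  fixes q :: "'a::euclidean_space"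
  assumes q: "q \<in> usphere" and x: "x \<in> usphere" and d: "dist x q < 1"
  obtains u where "u \<in> tangent q" "norm u \<le> 2 * dist x q" "sphere_curve q u 1 = x"
proof -
  define c where "c = x \<bullet> q"
  have n: "x \<bullet> x = 1" "q \<bullet> q = 1" "x \<bullet> q = c" "q \<bullet> x = c"
    using q x by (simp_all add: norm_eq_1 c_def inner_commute)
  have dc: "(dist x q)\<^sup>2 = 2 - 2 * c"
    using n by (simp add: dist_norm power2_norm_eq_inner inner_diff_left inner_diff_right)
  have c: "1 / 2 < c" "c \<le> 1" using power_strict_mono[OF d, of 2] zero_le_power2[of "dist x q"] dc by simp_all
  \<comment> \<open>The ray through \<open>x\<close> meets the affine tangent plane at
    \<open>q\<close> in \<open>q + u\<close>. Distance below 1 means \<open>c > 1 / 2\<close>, which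
    accounts for the factor 2 in the bound.\<close>
  define u where "u = x /\<^sub>R c - q"
  have "u \<bullet> u = (1 - c) * (1 + c) / c\<^sup>2"
    using c n by (simp add: u_def inner_diff_left inner_diff_right power2_eq_square field_simps)
  also have "\<dots> \<le> (2 * dist x q)\<^sup>2"
  proof -
    have "c * 4 \<le> c * (c * 8)" using c by (intro mult_left_mono) auto
    then have "1 + c \<le> 8 * c\<^sup>2" using c unfolding power2_eq_square by linarith
    then have "(1 - c) * (1 + c) \<le> (1 - c) * (8 * c\<^sup>2)" using c by (intro mult_left_mono) auto
    then show ?thesis using c unfolding power_mult_distrib dc by (simp add: divide_simps algebra_simps)
  qed
  finally have "norm u \<le> 2 * dist x q" by (simp add: norm_le_square power2_eq_square)
  moreover have "u \<in> tangent q" using c n by (simp add: u_def tangent_def inner_diff_left)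
  moreover have "sphere_curve q u 1 = x" using c x by (simp add: u_def sphere_curve_def)
  ultimately show ?thesis using that by blast
qed

text \<open>A contact (Legendrian) pair: a map with a unit normal field, where the map itself may be
  singular. Parallel hypersurfaces and their conformal images need not be immersed, yet they remain
  fronts.\<close>

locale front =
  fixes f \<nu> :: "'a::euclidean_space \<Rightarrow> 'b::euclidean_space"
  assumes sf: "smooth_map_on usphere f" and s\<nu>: "smooth_map_on usphere \<nu>"
    and nf: "\<And>p. p \<in> usphere \<Longrightarrow> f p \<bullet> f p = 1" and n\<nu>: "\<And>p. p \<in> usphere \<Longrightarrow> \<nu> p \<bullet> \<nu> p = 1"
    and f\<nu>: "\<And>p. p \<in> usphere \<Longrightarrow> f p \<bullet> \<nu> p = 0"
    and contact: "\<And>p u. p \<in> usphere \<Longrightarrow> u \<in> tangent p \<Longrightarrow> Dh f p u \<bullet> \<nu> p = 0"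
begin

lemma contact': "p \<in> usphere \<Longrightarrow> Dh f p u \<bullet> \<nu> p = 0"
  using contact[OF _ tangent_project[of p u]] Dh_project[OF sf sphere_nonzero, of p u "u \<bullet> p"] by metis

lemma Df_f: "p \<in> usphere \<Longrightarrow> Dh f p u \<bullet> f p = 0"
  using const_inner_derivative[OF sf sf nf, of p u] by (simp add: inner_commute)

lemma D\<nu>_\<nu>: "p \<in> usphere \<Longrightarrow> Dh \<nu> p u \<bullet> \<nu> p = 0"
  using const_inner_derivative[OF s\<nu> s\<nu> n\<nu>, of p u] by (simp add: inner_commute)

lemma D\<nu>_f: "p \<in> usphere \<Longrightarrow> Dh \<nu> p u \<bullet> f p = 0"
  using const_inner_derivative[OF sf s\<nu> f\<nu>, of p u] contact'[of p u] by (simp add: inner_commute)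

lemma contact_hext: "x \<noteq> 0 \<Longrightarrow> Dh f x u \<bullet> hext \<nu> x = 0"
  using contact'[OF normalize_sphere, of x u] Dh_scaleR[OF sf, of x "inverse (norm x)" u] by (simp add: hext_def)

end

locale immersed_front = front f \<nu> for f \<nu> :: "'a::euclidean_space \<Rightarrow> 'b::euclidean_space" +
  assumes inj: "\<And>p u. p \<in> usphere \<Longrightarrow> u \<in> tangent p \<Longrightarrow> Dh f p u = 0 \<Longrightarrow> u = 0"
    and dims: "DIM('b::euclidean_space) = DIM('a::euclidean_space) + 1"
begin

text \<open>Dimension count: the image of the tangent space has dimension \<open>DIM('a) - 1\<close>
  and is orthogonal to \<open>f p\<close> and \<open>\<nu> p\<close>, so it fills their orthogonal
  complement.\<close>

lemma decompose:
  assumes p: "p \<in> usphere"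
  obtains w where "w \<in> tangent p" "v = (v \<bullet> f p) *\<^sub>R f p + (v \<bullet> \<nu> p) *\<^sub>R \<nu> p + Dh f p w"
proof -
  have p0: "p \<noteq> 0" using p by auto
  have lin: "linear (Dh f p)" using linear_Dh[OF sf p0] .
  have "inj_on (Dh f p) (tangent p)"
    using linear_inj_on_iff_eq_0[OF lin subspace_tangent, of p] inj[OF p] by blast
  then have d1: "dim (Dh f p ` tangent p) = DIM('a) - 1"
    using dim_image_eq[OF lin, of "tangent p"] dim_tangent[OF p0] by (simp add: span_eq_iff[THEN iffD2, OF subspace_tangent])
  let ?N = "span {f p, \<nu> p}"
  have ne: "f p \<noteq> \<nu> p" "f p \<noteq> 0" "\<nu> p \<noteq> 0" using nf[OF p] n\<nu>[OF p] f\<nu>[OF p] by auto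
  have "independent {f p, \<nu> p}"
    by (rule pairwise_orthogonal_independent) (use ne f\<nu>[OF p] in \<open>auto simp: pairwise_def orthogonal_def inner_commute\<close>)
  then have "dim ?N = card {f p, \<nu> p}" by (simp add: dim_eq_card_independent dim_span)
  then have dN: "dim ?N = 2" using ne by simp
  let ?O = "{y \<in> UNIV. \<forall>x \<in> ?N. orthogonal x y}"
  have "dim ?O + dim ?N = dim (UNIV :: 'b set)"
    by (rule dim_subspace_orthogonal_to_vectors) auto
  then have dO: "dim ?O = DIM('a) - 1" using dN dims by simp
  have sO: "subspace ?O" unfolding subspace_def by (auto simp: orthogonal_def inner_add_right)
  have mem: "y \<in> ?O" if "y \<bullet> f p = 0" "y \<bullet> \<nu> p = 0" for y
  proof -
    have "orthogonal y x" if "x \<in> ?N" for x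
      by (rule orthogonal_to_span[OF that]) (use \<open>y \<bullet> f p = 0\<close> \<open>y \<bullet> \<nu> p = 0\<close> in \<open>auto simp: orthogonal_def\<close>)
    then show ?thesis by (simp add: orthogonal_commute)
  qed
  have "Dh f p ` tangent p \<subseteq> ?O"
    using mem Df_f[OF p] contact[OF p] by (auto simp del: mem_Collect_eq)
  then have eq: "Dh f p ` tangent p = ?O"
    using subspace_dim_equal[OF linear_subspace_image[OF lin subspace_tangent] sO] d1 dO by simp
  let ?r = "v - (v \<bullet> f p) *\<^sub>R f p - (v \<bullet> \<nu> p) *\<^sub>R \<nu> p"
  have "?r \<bullet> f p = 0" "?r \<bullet> \<nu> p = 0"
    using nf[OF p] n\<nu>[OF p] f\<nu>[OF p] trans[OF inner_commute f\<nu>[OF p]] by (simp_all add: inner_diff_left)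
  then have "?r \<in> Dh f p ` tangent p" unfolding eq by (rule mem)
  then obtain w where w: "w \<in> tangent p" "?r = Dh f p w" by blast
  show ?thesis by (rule that[OF w(1)]) (simp flip: w(2))
qed

lemma span_normal:
  assumes p: "p \<in> usphere" and "\<And>u. u \<in> tangent p \<Longrightarrow> Dh f p u \<bullet> v = 0"
  shows "v = (v \<bullet> f p) *\<^sub>R f p + (v \<bullet> \<nu> p) *\<^sub>R \<nu> p"
proof -
  obtain w where w: "w \<in> tangent p" "v = (v \<bullet> f p) *\<^sub>R f p + (v \<bullet> \<nu> p) *\<^sub>R \<nu> p + Dh f p w"
    using decompose[OF p] by blast
  have "Dh f p w \<bullet> Dh f p w = Dh f p w \<bullet> v"
    by (rule trans[OF _ arg_cong[OF w(2), of "inner (Dh f p w)", symmetric]]) (simp add: inner_add_right Df_f[OF p] contact[OF p w(1)])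
  then have "Dh f p w = 0" using assms(2)[OF w(1)] by simp
  then show ?thesis by (intro trans[OF w(2)]) simp
qed

end

text \<open>\<open>pos\<close> is positive definiteness of the second fundamental form
  \<open>- (Dh f p u \<bullet> Dh \<nu> p u)\<close>. The bound \<open>dim3\<close> makes the sphere
  at least two-dimensional, so that small discs stay connected when their centre is removed.\<close>

locale convex_front = front f \<nu> for f \<nu> :: "'a::euclidean_space \<Rightarrow> 'b::euclidean_space" +
  assumes pos: "\<And>p u. p \<in> usphere \<Longrightarrow> u \<in> tangent p \<Longrightarrow> u \<noteq> 0 \<Longrightarrow> Dh f p u \<bullet> Dh \<nu> p u < 0"
    and dims': "DIM('b::euclidean_space) = DIM('a::euclidean_space) + 1" and dim3: "DIM('a) \<ge> 3"

sublocale convex_front \<subseteq> immersed_front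
  by unfold_locales (use pos dims' in fastforce)+

context convex_front
begin

text \<open>Along the segment from \<open>p\<close> in a tangential direction \<open>u\<close>, the height over the tangent hyperplane has
  derivative \<open>Df u \<bullet> \<nu> p\<close>, which by contact and the mean value theorem is a negative multiple of a value
  of \<open>Df u \<bullet> D\<nu> u\<close>, taken at nearby points.\<close>

lemma locally_convex:
  obtains \<delta> where "\<delta> > 0" "\<And>p x. p \<in> usphere \<Longrightarrow> x \<in> usphere \<Longrightarrow> x \<noteq> p \<Longrightarrow> dist x p < \<delta> \<Longrightarrow> 0 < f x \<bullet> \<nu> p"
proof -
  define pt where "pt = (\<lambda>s (z::'a \<times> 'a). fst z + s *\<^sub>R snd z)"
  define A where "A = {z. pt (fst (fst z)) (snd z) \<noteq> 0 \<and> pt (snd (fst z)) (snd z) \<noteq> 0}"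
  \<comment> \<open>Separate parameters for the two base points, since the mean value theorem will
    evaluate the derivatives of \<open>f\<close> and of \<open>\<nu>\<close> at different points of
    the segment.\<close>
  define \<Phi> where "\<Phi> = (\<lambda>z. Dh f (pt (fst (fst z)) (snd z)) (snd (snd z)) \<bullet> Dh \<nu> (pt (snd (fst z)) (snd z)) (snd (snd z)))"
  have oA: "open A" unfolding A_def pt_def by (intro open_Collect_conj open_Collect_neq continuous_intros)
  have "continuous_on A (\<lambda>z. Dh g (pt (h (fst z)) (snd z)) (snd (snd z)))"
    if "smooth_map_on usphere g" "continuous_on UNIV h" "\<And>z. z \<in> A \<Longrightarrow> pt (h (fst z)) (snd z) \<noteq> 0" for g :: "'a \<Rightarrow> 'b" and h
  proof -
    have "continuous_on A (\<lambda>z. (pt (h (fst z)) (snd z), snd (snd z)))"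
      unfolding pt_def by (intro continuous_intros continuous_on_compose2[OF that(2)]) auto
    moreover have "(\<lambda>z. (pt (h (fst z)) (snd z), snd (snd z))) ` A \<subseteq> (-{0}) \<times> UNIV" using that(3) by auto
    ultimately show ?thesis using continuous_on_compose2[OF Dh_continuous_on[OF that(1)], of A "\<lambda>z. (pt (h (fst z)) (snd z), snd (snd z))"] by simp
  qed
  note cD = this
  have "continuous_on A \<Phi>"
    unfolding \<Phi>_def by (intro continuous_on_inner cD sf s\<nu>) (auto simp: A_def intro!: continuous_intros)
  then have "open (A \<inter> \<Phi> -` {..<0})" using oA by (intro continuous_open_preimage) auto
  moreover have "((0, 0), z) \<in> A \<inter> \<Phi> -` {..<0}" if "z \<in> unit_tangents" for z
    using that pos[of "fst z" "snd z"] by (cases "snd z = 0") (auto simp: A_def \<Phi>_def pt_def unit_tangents_def)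
  then have "{(0, 0)} \<times> unit_tangents \<subseteq> A \<inter> \<Phi> -` {..<0}" by blast
  ultimately have "\<exists>X0. (0, 0) \<in> X0 \<and> open X0 \<and> X0 \<times> unit_tangents \<subseteq> A \<inter> \<Phi> -` {..<0}"
    by (rule Elementary_Topology.tube_lemma[OF compact_unit_tangents])
  then obtain X0 where X0: "(0, 0) \<in> X0" "open X0" "X0 \<times> unit_tangents \<subseteq> A \<inter> \<Phi> -` {..<0}" by blast
  obtain e where e: "e > 0" "ball (0, 0) e \<subseteq> X0" using X0(1,2) open_contains_ball by blast
  have key: "p + s *\<^sub>R u \<noteq> 0" "Dh f (p + s *\<^sub>R u) u \<bullet> Dh \<nu> (p + t *\<^sub>R u) u < 0"
    if "(p, u) \<in> unit_tangents" "\<bar>s\<bar> < e / 2" "\<bar>t\<bar> < e / 2" for p u s t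
  proof -
    have "norm (s, t) < e" using norm_Pair_le[of s t] that(2,3) by simp
    then have "(s, t) \<in> X0" using e(2) mem_ball_0[of "(s, t)" e] unfolding zero_prod_def[symmetric] by blast
    then have "((s, t), (p, u)) \<in> A \<inter> \<Phi> -` {..<0}" using X0(3) that(1) by blast
    then show "p + s *\<^sub>R u \<noteq> 0" "Dh f (p + s *\<^sub>R u) u \<bullet> Dh \<nu> (p + t *\<^sub>R u) u < 0" by (auto simp: A_def \<Phi>_def pt_def)
  qed
  show ?thesis
  proof (rule that[of "min 1 (e / 4)"])
    fix p x :: 'a assume p: "p \<in> usphere" and x: "x \<in> usphere" and ne: "x \<noteq> p" and d: "dist x p < min 1 (e / 4)"
    obtain v where v: "v \<in> tangent p" "norm v \<le> 2 * dist x p" "sphere_curve p v 1 = x"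
      using tangent_image[OF p x] d by auto
    define s where "s = norm v"
    define u where "u = v /\<^sub>R s"
    have "v \<noteq> 0" using v(3) ne sphere_curve_0[OF p, of v] by (auto simp: sphere_curve_def)
    then have s: "0 < s" "s < e / 2" and su: "s *\<^sub>R u = v" and u: "(p, u) \<in> unit_tangents"
      using v(1,2) d p by (auto simp: s_def u_def unit_tangents_def tangent_scaleR)
    have nz: "p + a *\<^sub>R u \<noteq> 0" if "0 \<le> a" "a \<le> s" for a using key(1)[OF u, of a 0] that s by simp
    have chain: "((\<lambda>a. hext g (p + a *\<^sub>R u) \<bullet> b) has_real_derivative Dh g (p + a *\<^sub>R u) u \<bullet> b) (at a)"
      if a: "0 \<le> a" "a \<le> s" and g: "smooth_map_on usphere g" for g :: "'a \<Rightarrow> 'b" and b a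
    proof -
      have "((\<lambda>a. p + a *\<^sub>R u) has_derivative (\<lambda>a. a *\<^sub>R u)) (at a)" by (auto intro!: derivative_eq_intros)
      from has_derivative_inner_left[OF diff_chain_at[OF this hext_has_derivative[OF g nz[OF a]]], of b] show ?thesis
        using linear_cmul[OF linear_Dh[OF g nz[OF a]]]
        by (simp add: o_def has_field_derivative_def mult.commute[of _ "Dh g (p + a *\<^sub>R u) u \<bullet> b"])
    qed
    have h0: "hext g (p + 0 *\<^sub>R u) = g p" for g :: "'a \<Rightarrow> 'b" using hext_sphere[OF p, of g] by simp
    obtain a where a: "0 < a" "a < s" "hext f (p + s *\<^sub>R u) \<bullet> \<nu> p - hext f (p + 0 *\<^sub>R u) \<bullet> \<nu> p = (s - 0) * (Dh f (p + a *\<^sub>R u) u \<bullet> \<nu> p)"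
      using MVT2[OF s(1) chain[OF _ _ sf, of _ "\<nu> p"]] by blast
    let ?w = "Dh f (p + a *\<^sub>R u) u"
    obtain c where c: "0 < c" "c < a" "hext \<nu> (p + a *\<^sub>R u) \<bullet> ?w - hext \<nu> (p + 0 *\<^sub>R u) \<bullet> ?w = (a - 0) * (Dh \<nu> (p + c *\<^sub>R u) u \<bullet> ?w)"
      using MVT2[OF a(1) chain[OF _ _ s\<nu>, of _ ?w]] a(2) by auto
    have "hext \<nu> (p + a *\<^sub>R u) \<bullet> ?w = 0" using contact_hext[OF nz[of a]] a by (simp add: inner_commute)
    moreover have "a * (Dh \<nu> (p + c *\<^sub>R u) u \<bullet> ?w) < 0"
      using key(2)[OF u, of a c] a c s by (intro mult_pos_neg) (auto simp: inner_commute)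
    ultimately have "0 < ?w \<bullet> \<nu> p" using c(3) unfolding h0 by (simp add: inner_commute)
    then have "0 < hext f (p + s *\<^sub>R u) \<bullet> \<nu> p" using a(3) s(1) f\<nu>[OF p] unfolding h0 by simp
    moreover have "hext f (p + s *\<^sub>R u) = f x" using v(3) by (simp add: su hext_def sphere_curve_def)
    ultimately show "0 < f x \<bullet> \<nu> p" by simp
  qed (use e in simp)
qed

definition radius :: real where
  "radius = (SOME \<delta>. \<delta> > 0 \<and> (\<forall>p\<in>usphere. \<forall>x\<in>usphere. x \<noteq> p \<longrightarrow> dist x p < \<delta> \<longrightarrow> 0 < f x \<bullet> \<nu> p))"

lemma radius: "radius > 0" "p \<in> usphere \<Longrightarrow> x \<in> usphere \<Longrightarrow> x \<noteq> p \<Longrightarrow> dist x p < radius \<Longrightarrow> 0 < f x \<bullet> \<nu> p"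
proof -
  have "\<exists>\<delta>. \<delta> > 0 \<and> (\<forall>p\<in>usphere. \<forall>x\<in>usphere. x \<noteq> p \<longrightarrow> dist x p < \<delta> \<longrightarrow> 0 < f x \<bullet> \<nu> p)"
    using locally_convex by metis
  from someI_ex[OF this, folded radius_def] show "radius > 0"
    "p \<in> usphere \<Longrightarrow> x \<in> usphere \<Longrightarrow> x \<noteq> p \<Longrightarrow> dist x p < radius \<Longrightarrow> 0 < f x \<bullet> \<nu> p" by simp_all
qed

end

section \<open>Pieces of the sphere that are mapped into a half space\<close>

lemma closure_dist: "q \<in> closure U \<Longrightarrow> e > 0 \<Longrightarrow> \<exists>y\<in>U. dist y q < e"
  for q :: "'a::metric_space" by (simp add: closure_approachable)

lemma closureI_dist: "(\<And>e. e > 0 \<Longrightarrow> \<exists>y\<in>U. dist y q < e) \<Longrightarrow> q \<in> closure U"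
  for q :: "'a::metric_space" by (simp add: closure_approachable)

lemma clopen_connected_subset:
  assumes "openin (top_of_set X) U" "closedin (top_of_set X) U" "connected N" "N \<subseteq> X" "N \<inter> U \<noteq> {}"
  shows "N \<subseteq> U"
proof -
  obtain T where T: "open T" "U = X \<inter> T" using assms(1) by (auto simp: openin_open)
  obtain V where V: "closed V" "U = X \<inter> V" using assms(2) by (auto simp: closedin_closed)
  have "N \<inter> U = N \<inter> T" "N \<inter> U = N \<inter> V" using T V assms(4) by auto
  then have "openin (top_of_set N) (N \<inter> U)" "closedin (top_of_set N) (N \<inter> U)"
    using T(1) V(1) by (metis openin_open_Int, metis closedin_closed_Int)
  then have "N \<inter> U = N" using assms(3,5) unfolding connected_clopen by blast
  then show ?thesis by blast
qed

lemma isCont_normalize: "q \<in> usphere \<Longrightarrow> isCont (\<lambda>x::'a::euclidean_space. x /\<^sub>R norm x) q"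
  by (intro continuous_intros) auto

lemma normalize_near:
  fixes q :: "'a::euclidean_space"
  assumes "q \<in> usphere" "e > 0"
  obtains r where "r > 0" "r < 1" "\<And>x. dist x q < r \<Longrightarrow> dist (x /\<^sub>R norm x) q < e"
proof -
  have "q /\<^sub>R norm q = q" using assms(1) by simp
  then obtain r where r: "r > 0" "\<And>x. dist x q < r \<Longrightarrow> dist (x /\<^sub>R norm x) q < e"
    using isCont_normalize[OF assms(1)] assms(2) unfolding continuous_at_eps_delta by (metis dist_commute)
  show ?thesis by (rule that[of "min r (1/2)"]) (use r in auto)
qed

lemma near_sphere_nonzero: "q \<in> usphere \<Longrightarrow> dist x q < 1 \<Longrightarrow> x \<noteq> (0::'a::euclidean_space)"
  by (auto simp: dist_norm)

text \<open>A punctured disc of the sphere, written as an image of the punctured tangent disc so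
  that its connectedness comes from that of a punctured convex set.\<close>

definition punctured_nbhd :: "'a::euclidean_space \<Rightarrow> real \<Rightarrow> 'a set" where
  "punctured_nbhd q r = (\<lambda>u. sphere_curve q u 1) ` ((tangent q \<inter> ball 0 r) - {0})"

lemma connected_punctured_nbhd:
  fixes q :: "'a::euclidean_space"
  assumes q: "q \<in> usphere" and dim: "DIM('a) \<ge> 3"
  shows "connected (punctured_nbhd q r)"
  unfolding punctured_nbhd_def
proof (rule connected_continuous_image)
  have conv: "convex (tangent q \<inter> ball 0 r)"
    by (intro convex_Int convex_ball subspace_imp_convex subspace_tangent)
  show "connected ((tangent q \<inter> ball 0 r) - {0})"
  proof (cases "r > 0")
    case True
    have "0 \<in> tangent q \<inter> ball 0 r" using True by (simp add: tangent_def)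
    then have "aff_dim (tangent q \<inter> ball 0 r) = aff_dim (tangent q)"
      by (intro aff_dim_convex_Int_open subspace_imp_convex subspace_tangent open_ball) blast
    also have "\<dots> = int (DIM('a) - 1)"
      using dim_tangent[OF sphere_nonzero[OF q]] aff_dim_subspace[OF subspace_tangent] by metis
    finally have "aff_dim (tangent q \<inter> ball 0 r) \<noteq> 1" using dim by simp
    then show ?thesis by (rule connected_punctured_convex[OF conv])
  next
    case False
    then have "ball (0::'a) r = {}" by simp
    then show ?thesis by (simp only: Int_empty_right empty_Diff connected_empty)
  qed
  show "continuous_on (tangent q \<inter> ball 0 r - {0}) (\<lambda>u. sphere_curve q u 1)"
    unfolding sphere_curve_def using tangent_add_nonzero[OF q, of _ 1]
    by (intro continuous_intros) auto
qed

lemma punctured_nbhd_sphere: "q \<in> usphere \<Longrightarrow> x \<in> punctured_nbhd q r \<Longrightarrow> x \<in> usphere"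
  unfolding punctured_nbhd_def using sphere_curve_in by blast

lemma punctured_nbhd_neq:
  assumes q: "q \<in> usphere"
  shows "q \<notin> punctured_nbhd q r"
proof
  assume "q \<in> punctured_nbhd q r"
  then obtain u where u: "u \<in> tangent q" "u \<noteq> 0" "q = sphere_curve q u 1" unfolding punctured_nbhd_def by blast
  moreover have "norm (q + u) \<noteq> 0" using tangent_add_nonzero[OF q u(1), of 1] by simp
  ultimately have "norm (q + u) *\<^sub>R q = norm (q + u) *\<^sub>R ((q + u) /\<^sub>R norm (q + u))" by (simp only: sphere_curve_def scaleR_one)
  then have "norm (q + u) *\<^sub>R q = q + u" using \<open>norm (q + u) \<noteq> 0\<close> by simp
  then have "(norm (q + u) *\<^sub>R q) \<bullet> q = (q + u) \<bullet> q" by simp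
  then have "norm (q + u) = 1" using u(1) q by (simp add: tangent_def inner_add_left norm_eq_1)
  then show False using \<open>norm (q + u) *\<^sub>R q = q + u\<close> u(2) by simp
qed

lemma punctured_nbhd_small:
  fixes q :: "'a::euclidean_space"
  assumes q: "q \<in> usphere" and e: "e > 0"
  obtains r where "r > 0" "\<And>x. x \<in> punctured_nbhd q r \<Longrightarrow> dist x q < e"
proof -
  obtain r where r: "r > 0" "r < 1" "\<And>x. dist x q < r \<Longrightarrow> dist (x /\<^sub>R norm x) q < e"
    using normalize_near[OF q e] by blast
  show ?thesis by (rule that[OF r(1)]) (use r(3) in \<open>auto simp: punctured_nbhd_def sphere_curve_def dist_norm\<close>)
qed

lemma punctured_nbhd_contains:
  fixes q :: "'a::euclidean_space"
  assumes q: "q \<in> usphere" and r: "r > 0"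
  obtains e where "e > 0" "\<And>x. x \<in> usphere \<Longrightarrow> dist x q < e \<Longrightarrow> x \<noteq> q \<Longrightarrow> x \<in> punctured_nbhd q r"
proof (rule that[of "min 1 (r / 2)"])
  fix x assume x: "x \<in> usphere" "dist x q < min 1 (r / 2)" "x \<noteq> q"
  then obtain u where u: "u \<in> tangent q" "norm u \<le> 2 * dist x q" "sphere_curve q u 1 = x" using tangent_image[OF q x(1)] by auto
  then have "u \<noteq> 0" using x(3) q by (auto simp: sphere_curve_def)
  then show "x \<in> punctured_nbhd q r" unfolding punctured_nbhd_def using u x(2) by (intro image_eqI[of _ _ u]) auto
qed (use r in simp)

lemma Dh_continuous_on1:
  fixes f :: "'a::euclidean_space \<Rightarrow> 'b::euclidean_space"
  assumes "smooth_map_on usphere f"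
  shows "continuous_on (-{0}) (\<lambda>x. Dh f x z)"
proof -
  have "continuous_on (-{0}) (\<lambda>x. (\<lambda>w. Dh f (fst w) (snd w)) (x, z))"
    by (rule continuous_on_compose2[OF Dh_continuous_on[OF assms]]) (auto intro!: continuous_intros)
  then show ?thesis by simp
qed

text \<open>The height \<open>hext f x \<bullet> m\<close> increases along \<open>z\<close> at
  \<open>q\<close>, hence along all short segments in this direction near \<open>q\<close>. After
  the full step \<open>s\<close> it is positive whatever its sign was at the start, by continuity
  from the value at \<open>q\<close>.\<close>

lemma push_to_positive:
  fixes f :: "'a::euclidean_space \<Rightarrow> 'b::euclidean_space"
  assumes f: "smooth_map_on usphere f" and q: "q \<in> usphere" and q0: "f q \<bullet> m = 0" and z: "Dh f q z \<bullet> m > 0"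
  obtains R s where "R > 0" "s > 0" "\<And>x \<tau>. dist x q < R \<Longrightarrow> 0 \<le> \<tau> \<Longrightarrow> \<tau> \<le> s \<Longrightarrow> x + \<tau> *\<^sub>R z \<noteq> 0"
    "\<And>x \<tau>. dist x q < R \<Longrightarrow> 0 < \<tau> \<Longrightarrow> \<tau> \<le> s \<Longrightarrow> 0 \<le> hext f x \<bullet> m \<Longrightarrow> 0 < hext f (x + \<tau> *\<^sub>R z) \<bullet> m"
    "\<And>x. dist x q < R \<Longrightarrow> 0 < hext f (x + s *\<^sub>R z) \<bullet> m"
proof -
  have "continuous_on (-{0}) (\<lambda>x. Dh f x z \<bullet> m)" by (intro continuous_intros Dh_continuous_on1[OF f])
  then have "isCont (\<lambda>x. Dh f x z \<bullet> m) q" using sphere_nonzero[OF q] continuous_on_eq_continuous_at[OF open_punctured] by blast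
  then obtain R1 where R1: "R1 > 0" "\<And>x. dist x q < R1 \<Longrightarrow> dist (Dh f x z \<bullet> m) (Dh f q z \<bullet> m) < Dh f q z \<bullet> m"
    using z unfolding continuous_at_eps_delta by (metis dist_commute)
  define R0 where "R0 = min R1 1"
  have R0: "R0 > 0" "\<And>x. dist x q < R0 \<Longrightarrow> x \<noteq> 0" "\<And>x. dist x q < R0 \<Longrightarrow> 0 < Dh f x z \<bullet> m"
    using R1 near_sphere_nonzero[OF q] by (auto simp: R0_def dist_real_def abs_less_iff)
  define s where "s = R0 / 2 / (norm z + 1)"
  have "norm z + 1 > 0" by (simp add: add_nonneg_pos)
  then have s: "s > 0" "s * (norm z + 1) = R0 / 2" using R0(1) unfolding s_def by (auto simp del: divide_divide_eq_left)
  have near: "dist (x + \<sigma> *\<^sub>R z) q < R0" if "dist x q < R0 / 2" "0 \<le> \<sigma>" "\<sigma> \<le> s" for x \<sigma>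
  proof -
    have "dist (x + \<sigma> *\<^sub>R z) q \<le> dist x q + \<sigma> * norm z"
      using norm_triangle_ineq[of "x - q" "\<sigma> *\<^sub>R z"] that by (simp add: dist_norm algebra_simps)
    moreover have "\<sigma> * norm z \<le> s * norm z" using that by (intro mult_right_mono) auto
    ultimately show ?thesis using s that(1) by (simp add: algebra_simps)
  qed
  have up: "hext f x \<bullet> m < hext f (x + \<tau> *\<^sub>R z) \<bullet> m" if x: "dist x q < R0 / 2" and \<tau>: "0 < \<tau>" "\<tau> \<le> s" for x \<tau>
  proof -
    have "hext f (x + 0 *\<^sub>R z) \<bullet> m < hext f (x + \<tau> *\<^sub>R z) \<bullet> m"
    proof (rule DERIV_pos_imp_increasing[OF \<tau>(1)])
      fix \<sigma> assume "0 \<le> \<sigma>" "\<sigma> \<le> \<tau>"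
      then have d: "dist (x + \<sigma> *\<^sub>R z) q < R0" using near[OF x] \<tau>(2) by simp
      have "((\<lambda>\<sigma>. x + \<sigma> *\<^sub>R z) has_derivative (\<lambda>\<sigma>. \<sigma> *\<^sub>R z)) (at \<sigma>)" by (auto intro!: derivative_eq_intros)
      from has_derivative_inner_left[OF diff_chain_at[OF this hext_has_derivative[OF f R0(2)[OF d]]], of m]
      have "((\<lambda>\<sigma>. hext f (x + \<sigma> *\<^sub>R z) \<bullet> m) has_real_derivative Dh f (x + \<sigma> *\<^sub>R z) z \<bullet> m) (at \<sigma>)"
        using linear_cmul[OF linear_Dh[OF f R0(2)[OF d]]]
        by (simp add: o_def has_field_derivative_def mult.commute[of _ "Dh f (x + \<sigma> *\<^sub>R z) z \<bullet> m"])
      then show "\<exists>y. ((\<lambda>\<sigma>. hext f (x + \<sigma> *\<^sub>R z) \<bullet> m) has_real_derivative y) (at \<sigma>) \<and> 0 < y" using R0(3)[OF d] by blast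
    qed
    then show ?thesis by simp
  qed
  have q1: "0 < hext f (q + s *\<^sub>R z) \<bullet> m" using up[of q s] R0(1) s(1) q0 hext_sphere[OF q, of f] by simp
  have "isCont (\<lambda>x. hext f (x + s *\<^sub>R z) \<bullet> m) q"
  proof -
    have "q + s *\<^sub>R z \<noteq> 0" using R0(1,2) near[of q s] s(1) by simp
    then have "isCont (hext f) (q + s *\<^sub>R z)" by (rule has_derivative_continuous[OF hext_has_derivative[OF f]])
    moreover have "isCont (\<lambda>x. x + s *\<^sub>R z) q" by (intro continuous_intros)
    ultimately have "isCont (\<lambda>x. hext f (x + s *\<^sub>R z)) q" by (rule isCont_o2[rotated])
    then show ?thesis by (intro continuous_intros)
  qed
  then obtain R2 where R2: "R2 > 0" "\<And>x. dist x q < R2 \<Longrightarrow> dist (hext f (x + s *\<^sub>R z) \<bullet> m) (hext f (q + s *\<^sub>R z) \<bullet> m) < hext f (q + s *\<^sub>R z) \<bullet> m"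
    using q1 unfolding continuous_at_eps_delta by (metis dist_commute)
  show ?thesis
  proof (rule that[of "min (R0 / 2) R2" s])
    show "x + \<tau> *\<^sub>R z \<noteq> 0" if "dist x q < min (R0 / 2) R2" "0 \<le> \<tau>" "\<tau> \<le> s" for x \<tau>
      using R0(2) near that by simp
    show "0 < hext f (x + \<tau> *\<^sub>R z) \<bullet> m" if "dist x q < min (R0 / 2) R2" "0 < \<tau>" "\<tau> \<le> s" "0 \<le> hext f x \<bullet> m" for x \<tau>
      using up[of x \<tau>] that by simp
    show "0 < hext f (x + s *\<^sub>R z) \<bullet> m" if "dist x q < min (R0 / 2) R2" for x
      using R2(2)[of x] that by (simp add: dist_real_def abs_less_iff)
  qed (use R0(1) R2(1) s(1) in auto)
qed

context convex_front
begin

definition cap :: "'b \<Rightarrow> 'a set" where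
  "cap m = {x \<in> usphere. 0 < f x \<bullet> m}"

definition strict :: "'a set \<Rightarrow> bool" where
  "strict A \<longleftrightarrow> (\<forall>p\<in>A. \<forall>x\<in>A. x \<noteq> p \<longrightarrow> 0 < f x \<bullet> \<nu> p)"

text \<open>\<open>U\<close> is a union of components of the cap, expressed by being clopen. This is
  wider than a single component: it also admits the union of the swept sets with \<open>p\<close>
  removed, at the end of \<open>globally_convex\<close>.\<close>

definition good_cap :: "'b \<Rightarrow> 'a set \<Rightarrow> bool" where
  "good_cap m U \<longleftrightarrow> m \<bullet> m = 1 \<and> openin (top_of_set (cap m)) U \<and> closedin (top_of_set (cap m)) U"

lemma strictD: "strict A \<Longrightarrow> p \<in> A \<Longrightarrow> x \<in> A \<Longrightarrow> x \<noteq> p \<Longrightarrow> 0 < f x \<bullet> \<nu> p"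
  by (simp add: strict_def)

lemma continuous_on_f: "continuous_on usphere f" and continuous_on_\<nu>: "continuous_on usphere \<nu>"
  using sphere_continuous_on sf s\<nu> by auto

lemma sphere_approx:
  fixes g :: "'a \<Rightarrow> real"
  assumes "continuous_on usphere g" "q \<in> usphere" "e > 0"
  obtains d where "d > 0" "\<And>x. x \<in> usphere \<Longrightarrow> dist x q < d \<Longrightarrow> \<bar>g x - g q\<bar> < e"
  using assms unfolding continuous_on_iff dist_real_def by metis

lemma openin_cap: "openin (top_of_set usphere) (cap m)"
proof -
  have "openin (top_of_set usphere) (usphere \<inter> (\<lambda>x. f x \<bullet> m) -` {0<..})"
    by (intro continuous_openin_preimage_gen continuous_intros continuous_on_f)
  moreover have "usphere \<inter> (\<lambda>x. f x \<bullet> m) -` {0<..} = cap m" by (auto simp: cap_def)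
  ultimately show ?thesis by simp
qed

lemma good_cap_open:
  assumes "good_cap m U" "q \<in> U"
  obtains r where "r > 0" "\<And>x. x \<in> usphere \<Longrightarrow> dist x q < r \<Longrightarrow> x \<in> U"
proof -
  have "openin (top_of_set usphere) U"
    using assms(1) openin_cap openin_trans unfolding good_cap_def by blast
  then obtain r where "r > 0" "\<forall>x\<in>usphere. dist x q < r \<longrightarrow> x \<in> U"
    using assms(2) unfolding openin_euclidean_subtopology_iff by blast
  then show ?thesis using that by blast
qed

lemma good_cap_sub: "good_cap m U \<Longrightarrow> U \<subseteq> cap m"
  unfolding good_cap_def using openin_imp_subset by blast

lemma good_cap_closure:
  assumes "good_cap m U" "q \<in> closure U"
  shows "q \<in> usphere" "0 \<le> f q \<bullet> m" "0 < f q \<bullet> m \<Longrightarrow> q \<in> U"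
proof -
  have "closed (usphere \<inter> (\<lambda>x. f x \<bullet> m) -` {0..})"
    by (intro continuous_closed_preimage continuous_intros continuous_on_f closed_sphere closed_atLeast)
  moreover have "U \<subseteq> usphere \<inter> (\<lambda>x. f x \<bullet> m) -` {0..}"
    using good_cap_sub[OF assms(1)] by (auto simp: cap_def)
  ultimately have "closure U \<subseteq> usphere \<inter> (\<lambda>x. f x \<bullet> m) -` {0..}" by (rule closure_minimal[rotated])
  then show q: "q \<in> usphere" "0 \<le> f q \<bullet> m" using assms(2) by auto
  obtain V where V: "closed V" "U = cap m \<inter> V" using assms(1) by (auto simp: good_cap_def closedin_closed)
  then have "q \<in> V" using assms(2) closure_minimal[of U V] by auto
  then show "q \<in> U" if "0 < f q \<bullet> m" using V(2) q that by (auto simp: cap_def)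
qed

text \<open>If no tangential direction raises the height at a boundary point, then \<open>m\<close>
  is normal to \<open>f\<close> there, so it is \<open>\<nu> p\<close> or \<open>- \<nu> p\<close>.
  The latter is impossible: nearby points of \<open>U\<close> would lie strictly below the tangent
  hyperplane, against local convexity.\<close>

lemma boundary_cases:
  assumes U: "good_cap m U" and p: "p \<in> closure U"
  obtains (interior) "0 < f p \<bullet> m" | (pole) "f p \<bullet> m = 0" "\<nu> p = m"
    | (regular) z where "f p \<bullet> m = 0" "z \<in> tangent p" "0 < Dh f p z \<bullet> m"
proof -
  have pS: "p \<in> usphere" and ge: "0 \<le> f p \<bullet> m" using good_cap_closure[OF U p] by auto
  show ?thesis
  proof (cases "0 < f p \<bullet> m \<or> (\<exists>z\<in>tangent p. 0 < Dh f p z \<bullet> m)")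
    case True
    then show ?thesis using interior regular ge by force
  next
    case False
    then have p0: "f p \<bullet> m = 0" using ge by simp
    have "Dh f p u \<bullet> m = 0" if u: "u \<in> tangent p" for u
    proof -
      have "Dh f p (- u) = - Dh f p u" by (rule linear_neg[OF linear_Dh[OF sf sphere_nonzero[OF pS]]])
      then show ?thesis using False u tangent_minus[OF u] by (metis inner_minus_left neg_0_less_iff_less linorder_neqE_linordered_idom)
    qed
    then have "m = (m \<bullet> f p) *\<^sub>R f p + (m \<bullet> \<nu> p) *\<^sub>R \<nu> p" by (rule span_normal[OF pS])
    then have m: "m = (m \<bullet> \<nu> p) *\<^sub>R \<nu> p" using p0 by (simp add: inner_commute)
    moreover have "m \<bullet> m = 1" using U by (simp add: good_cap_def)
    ultimately have "(m \<bullet> \<nu> p) * (m \<bullet> \<nu> p) = 1" using n\<nu>[OF pS] by (metis inner_scaleR_left inner_commute)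
    then have "m \<bullet> \<nu> p = 1 \<or> m \<bullet> \<nu> p = -1" by (simp add: square_eq_1_iff)
    then show ?thesis
    proof
      assume "m \<bullet> \<nu> p = 1"
      then show ?thesis using m pole p0 by (metis scaleR_one)
    next
      assume "m \<bullet> \<nu> p = -1"
      then have m': "m = - \<nu> p" using m by (metis scaleR_minus1_left)
      obtain y where y: "y \<in> U" "dist y p < radius" using closure_dist[OF p radius(1)] by blast
      then have yc: "y \<in> usphere" "0 < f y \<bullet> m" using good_cap_sub[OF U] by (auto simp: cap_def)
      then have "y \<noteq> p" using p0 by auto
      then show ?thesis using radius(2)[OF pS yc(1) _ y(2)] yc(2) m' by simp
    qed
  qed
qed

lemma good_cap_absorb: "good_cap m U \<Longrightarrow> connected N \<Longrightarrow> N \<subseteq> cap m \<Longrightarrow> N \<inter> U \<noteq> {} \<Longrightarrow> N \<subseteq> U"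
  unfolding good_cap_def using clopen_connected_subset by metis

text \<open>Near a regular boundary point, any two points on the positive side can be joined
  by first moving both of them further to the positive side.\<close>

lemma good_cap_nbhd:
  assumes U: "good_cap m U" and q: "q \<in> closure U"
  obtains r where "r > 0" "\<And>y. y \<in> usphere \<Longrightarrow> dist y q < r \<Longrightarrow> 0 \<le> f y \<bullet> m \<Longrightarrow> y \<in> closure U"
proof -
  have qS: "q \<in> usphere" using good_cap_closure[OF U q] by auto
  have US: "y \<in> usphere" "0 < f y \<bullet> m" if "y \<in> U" for y using good_cap_sub[OF U] that by (auto simp: cap_def)
  show ?thesis
  proof (cases rule: boundary_cases[OF U q])
    case 1
    then have "q \<in> U" using good_cap_closure(3)[OF U q] by simp
    then obtain r where "r > 0" "\<And>x. x \<in> usphere \<Longrightarrow> dist x q < r \<Longrightarrow> x \<in> U" using good_cap_open[OF U] by blast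
    then show ?thesis using that closure_subset by blast
  next
    case 2
    obtain r where r: "r > 0" "\<And>x. x \<in> punctured_nbhd q r \<Longrightarrow> dist x q < radius"
      using punctured_nbhd_small[OF qS radius(1)] by blast
    obtain e where e: "e > 0" "\<And>x. x \<in> usphere \<Longrightarrow> dist x q < e \<Longrightarrow> x \<noteq> q \<Longrightarrow> x \<in> punctured_nbhd q r"
      using punctured_nbhd_contains[OF qS r(1)] by blast
    \<comment> \<open>At a pole the half space is the convex side of the tangent hyperplane, so a
      whole punctured disc lies in the cap; being connected and meeting \<open>U\<close>, it lies in
      \<open>U\<close>.\<close>
    have "x \<in> cap m" if x: "x \<in> punctured_nbhd q r" for x
      using radius(2)[OF qS punctured_nbhd_sphere[OF qS x] _ r(2)[OF x]] punctured_nbhd_sphere[OF qS x] punctured_nbhd_neq[OF qS, of r] x 2(2)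
      by (auto simp: cap_def)
    then have "punctured_nbhd q r \<subseteq> cap m" by blast
    moreover obtain y where y: "y \<in> U" "dist y q < e" using closure_dist[OF q e(1)] by blast
    then have "y \<in> punctured_nbhd q r" using US[OF y(1)] 2(1) by (intro e(2)) auto
    ultimately have PU: "punctured_nbhd q r \<subseteq> U" using good_cap_absorb[OF U connected_punctured_nbhd[OF qS dim3]] y(1) by blast
    have "x \<in> closure U" if "x \<in> usphere" "dist x q < e" for x
      using e(2)[OF that] PU q closure_subset[of U] by (cases "x = q") auto
    then show ?thesis using that[OF e(1)] by blast
  next
    case (3 z)
    obtain R s where R: "R > 0" "s > 0" "\<And>x \<tau>. dist x q < R \<Longrightarrow> 0 \<le> \<tau> \<Longrightarrow> \<tau> \<le> s \<Longrightarrow> x + \<tau> *\<^sub>R z \<noteq> 0"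
        "\<And>x \<tau>. dist x q < R \<Longrightarrow> 0 < \<tau> \<Longrightarrow> \<tau> \<le> s \<Longrightarrow> 0 \<le> hext f x \<bullet> m \<Longrightarrow> 0 < hext f (x + \<tau> *\<^sub>R z) \<bullet> m"
        "\<And>x. dist x q < R \<Longrightarrow> 0 < hext f (x + s *\<^sub>R z) \<bullet> m"
      using push_to_positive[OF sf qS 3(1,3)] by blast
    define P where "P x = x /\<^sub>R norm x" for x :: 'a
    have absorb: "P ` N \<subseteq> U" if N: "connected N" "\<And>x. x \<in> N \<Longrightarrow> x \<noteq> 0 \<and> 0 < hext f x \<bullet> m" "x \<in> N" "P x \<in> U" for N x
    proof (rule good_cap_absorb[OF U])
      show "connected (P ` N)"
        unfolding P_def using N(1,2) by (intro connected_continuous_image continuous_intros) auto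
      show "P ` N \<subseteq> cap m" using N(2) normalize_sphere by (auto simp: cap_def P_def hext_def)
    qed (use N(3,4) in blast)
    have push: "0 < hext f (x + \<tau> *\<^sub>R z) \<bullet> m" if "x \<in> usphere" "dist x q < R" "0 \<le> f x \<bullet> m" "0 < \<tau>" "\<tau> \<le> s" for x \<tau>
      using R(4)[OF that(2,4,5)] that hext_sphere[OF that(1), of f] by simp
    obtain y where y: "y \<in> U" "dist y q < R" using closure_dist[OF q R(1)] by blast
    have "P ` (\<lambda>\<tau>. y + \<tau> *\<^sub>R z) ` {0..s} \<subseteq> U"
    proof (rule absorb)
      show "connected ((\<lambda>\<tau>. y + \<tau> *\<^sub>R z) ` {0..s})" by (intro connected_continuous_image continuous_intros connected_Icc)
      show "y + 0 *\<^sub>R z \<in> (\<lambda>\<tau>. y + \<tau> *\<^sub>R z) ` {0..s}" using R(2) by (intro imageI) simp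
      show "P (y + 0 *\<^sub>R z) \<in> U" using y(1) US(1)[OF y(1)] by (simp add: P_def)
      fix x assume "x \<in> (\<lambda>\<tau>. y + \<tau> *\<^sub>R z) ` {0..s}"
      then obtain \<tau> where \<tau>: "0 \<le> \<tau>" "\<tau> \<le> s" "x = y + \<tau> *\<^sub>R z" by auto
      show "x \<noteq> 0 \<and> 0 < hext f x \<bullet> m"
        using R(3)[OF y(2) \<tau>(1,2)] push[OF US(1)[OF y(1)] y(2) _ _ \<tau>(2)] US[OF y(1)] \<tau>(1) hext_sphere[of y f]
        unfolding \<tau>(3) by (cases "\<tau> = 0") auto
    qed
    then have ys: "P (y + s *\<^sub>R z) \<in> U" using R(2) by (auto simp: image_subset_iff)
    have "P ` (\<lambda>x. x + s *\<^sub>R z) ` ball q R \<subseteq> U"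
    proof (rule absorb[OF _ _ _ ys])
      show "connected ((\<lambda>x. x + s *\<^sub>R z) ` ball q R)"
        by (intro connected_continuous_image continuous_intros convex_connected convex_ball)
    qed (use R y(2) in \<open>auto simp: dist_commute\<close>)
    then have xs: "P (x + s *\<^sub>R z) \<in> U" if "dist x q < R" for x using that by (auto simp: image_subset_iff dist_commute)
    show ?thesis
    proof (rule that[OF R(1)])
      fix x assume x: "x \<in> usphere" "dist x q < R" "0 \<le> f x \<bullet> m"
      have "P ` (\<lambda>\<tau>. x + \<tau> *\<^sub>R z) ` {0<..s} \<subseteq> U"
      proof (rule absorb[OF _ _ _ xs[OF x(2)]])
        show "connected ((\<lambda>\<tau>. x + \<tau> *\<^sub>R z) ` {0<..s})" by (intro connected_continuous_image continuous_intros connected_Ioc)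
      qed (use R(2,3) x(2) push[OF x] in auto)
      then have "(\<lambda>\<tau>. P (x + \<tau> *\<^sub>R z)) ` {0<..s} \<subseteq> closure U" using closure_subset by (auto simp: image_subset_iff)
      moreover have "continuous_on {0..s} (\<lambda>\<tau>. P (x + \<tau> *\<^sub>R z))"
        unfolding P_def using R(3)[OF x(2)] by (intro continuous_intros) auto
      ultimately have "(\<lambda>\<tau>. P (x + \<tau> *\<^sub>R z)) ` {0..s} \<subseteq> closure U"
        using image_closure_subset[of "{0<..s}" "\<lambda>\<tau>. P (x + \<tau> *\<^sub>R z)" "closure U"] R(2) by simp
      then have "P (x + 0 *\<^sub>R z) \<in> closure U" using R(2) by (auto simp: image_subset_iff simp del: scaleR_zero_left)
      then show "x \<in> closure U" using x(1) by (simp add: P_def)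
    qed
  qed
qed

text \<open>Directions in which \<open>p\<close> can be left without leaving the closure. They give
  access to one-sided derivatives of functions that are nonnegative on the closure.\<close>

lemma good_cap_curve:
  assumes U: "good_cap m U" and p: "p \<in> closure U" and v: "v \<in> tangent p"
    and c: "0 < f p \<bullet> m \<or> \<nu> p = m \<or> 0 < Dh f p v \<bullet> m"
  obtains d where "d > 0" "\<And>s. 0 < s \<Longrightarrow> s < d \<Longrightarrow> sphere_curve p v s \<in> closure U"
proof -
  have pS: "p \<in> usphere" and ge: "0 \<le> f p \<bullet> m" using good_cap_closure[OF U p] by auto
  have S: "sphere_curve p v s \<in> usphere" for s by (rule sphere_curve_in[OF pS v])
  obtain r where r: "r > 0" "\<And>y. y \<in> usphere \<Longrightarrow> dist y p < r \<Longrightarrow> 0 \<le> f y \<bullet> m \<Longrightarrow> y \<in> closure U"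
    using good_cap_nbhd[OF U p] by blast
  obtain d1 where d1: "d1 > 0" "\<And>s. \<bar>s\<bar> < d1 \<Longrightarrow> dist (sphere_curve p v s) p < r" using sphere_curve_near[OF pS v r(1)] by blast
  obtain d2 where d2: "d2 > 0" "\<And>s. 0 < s \<Longrightarrow> s < d2 \<Longrightarrow> 0 \<le> f (sphere_curve p v s) \<bullet> m"
    using c
  proof (elim disjE)
    assume True: "0 < f p \<bullet> m"
    obtain d0 where d0: "d0 > 0" "\<And>x. x \<in> usphere \<Longrightarrow> dist x p < d0 \<Longrightarrow> \<bar>f x \<bullet> m - f p \<bullet> m\<bar> < f p \<bullet> m"
      using sphere_approx[OF continuous_on_inner[OF continuous_on_f continuous_on_const[of _ m]] pS True] by blast
    obtain d where d: "d > 0" "\<And>s. \<bar>s\<bar> < d \<Longrightarrow> dist (sphere_curve p v s) p < d0" using sphere_curve_near[OF pS v d0(1)] by blast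
    have "0 \<le> f (sphere_curve p v s) \<bullet> m" if "0 < s" "s < d" for s
      using d0(2)[OF S d(2), of s] that by (simp add: abs_less_iff)
    then show ?thesis using that d(1) by blast
  next
    assume True: "\<nu> p = m"
    obtain d where d: "d > 0" "\<And>s. \<bar>s\<bar> < d \<Longrightarrow> dist (sphere_curve p v s) p < radius" using sphere_curve_near[OF pS v radius(1)] by blast
    have "0 \<le> f (sphere_curve p v s) \<bullet> m" if "0 < s" "s < d" for s
      using radius(2)[OF pS S _ d(2), of s] that True ge by (cases "sphere_curve p v s = p") (auto simp: less_imp_le)
    then show ?thesis using that d(1) by blast
  next
    assume "0 < Dh f p v \<bullet> m"
    then obtain d where "d > 0" "\<And>s. 0 < s \<Longrightarrow> s < d \<Longrightarrow> f (sphere_curve p v s) \<bullet> m > f (sphere_curve p v 0) \<bullet> m"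
      using DERIV_pos_inc_right[OF curve_inner_derivative[OF sf pS v]] by auto
    then show ?thesis using that[of d] ge sphere_curve_0[OF pS] by (metis dual_order.strict_trans2 less_imp_le)
  qed
  show ?thesis
    by (rule that[of "min d1 d2"]) (use d1 d2 r(2)[OF S] in auto)
qed

lemma closure_nonneg:
  assumes U: "good_cap m U" and st: "strict U" and p: "p \<in> closure U" and x: "x \<in> closure U"
  shows "0 \<le> f x \<bullet> \<nu> p"
proof -
  obtain P where P: "\<And>n. P n \<in> U" "P \<longlonglongrightarrow> p" using p by (auto simp: closure_sequential)
  obtain X where X: "\<And>n. X n \<in> U" "X \<longlonglongrightarrow> x" using x by (auto simp: closure_sequential)
  have US: "U \<subseteq> usphere" using good_cap_sub[OF U] by (auto simp: cap_def)
  have pS: "p \<in> usphere" "x \<in> usphere" using good_cap_closure(1)[OF U] p x by auto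
  have "(\<lambda>n. f (X n)) \<longlonglongrightarrow> f x" "(\<lambda>n. \<nu> (P n)) \<longlonglongrightarrow> \<nu> p"
    using continuous_on_tendsto_compose[OF continuous_on_f X(2) pS(2)] continuous_on_tendsto_compose[OF continuous_on_\<nu> P(2) pS(1)] X(1) P(1) US
    by (auto simp: subset_iff)
  then have "(\<lambda>n. f (X n) \<bullet> \<nu> (P n)) \<longlonglongrightarrow> f x \<bullet> \<nu> p" by (rule tendsto_inner)
  moreover have "0 \<le> f (X n) \<bullet> \<nu> (P n)" for n
    using strictD[OF st P(1)[of n] X(1)[of n]] f\<nu>[of "P n"] P(1)[of n] US by (cases "X n = P n") (auto simp: subset_iff less_imp_le)
  ultimately show ?thesis by (intro LIMSEQ_le_const) auto
qed

end

lemma nonneg_if_perturbed_nonneg: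
  fixes a b :: real
  assumes "\<And>e. e > 0 \<Longrightarrow> 0 \<le> a + e * b"
  shows "0 \<le> a"
proof (rule ccontr)
  assume "\<not> 0 \<le> a"
  define c where "c = 2 * (\<bar>b\<bar> + 1)"
  have c: "c > 0" by (simp add: c_def add_nonneg_pos)
  have "0 \<le> a + (- a / c) * b" using \<open>\<not> 0 \<le> a\<close> c by (intro assms divide_pos_pos) auto
  also have "\<dots> \<le> a + (- a / c) * (c / 2)"
    using \<open>\<not> 0 \<le> a\<close> c by (intro add_left_mono mult_left_mono) (auto simp: c_def divide_nonpos_pos)
  also have "\<dots> = a / 2" using c by (simp add: field_simps)
  finally show False using \<open>\<not> 0 \<le> a\<close> by simp
qed

lemma tangent_nonzero_exists:
  fixes p :: "'a::euclidean_space"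
  assumes "p \<noteq> 0" "DIM('a) \<ge> 3"
  obtains v where "v \<in> tangent p" "v \<noteq> 0"
proof -
  have "dim (tangent p) \<noteq> 0" using dim_tangent[OF assms(1)] assms(2) by simp
  then show ?thesis using that by (metis dim_eq_0 subsetI singletonI)
qed

context convex_front
begin

lemma near_point:
  assumes U: "good_cap m U" and p: "p \<in> closure U" and e: "e > 0"
  obtains q where "q \<in> closure U" "q \<noteq> p" "dist q p < e"
proof -
  have pS: "p \<in> usphere" using good_cap_closure[OF U p] by auto
  obtain v where v: "v \<in> tangent p" "v \<noteq> 0" "0 < f p \<bullet> m \<or> \<nu> p = m \<or> 0 < Dh f p v \<bullet> m"
  proof (cases rule: boundary_cases[OF U p])
    case (3 z)
    then have "z \<noteq> 0" using linear_0[OF linear_Dh[OF sf sphere_nonzero[OF pS]]] by auto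
    then show ?thesis using that 3 by blast
  qed (use tangent_nonzero_exists[OF sphere_nonzero[OF pS] dim3] that in blast)+
  obtain d where d: "d > 0" "\<And>s. 0 < s \<Longrightarrow> s < d \<Longrightarrow> sphere_curve p v s \<in> closure U"
    using good_cap_curve[OF U p v(1,3)] by blast
  obtain d' where d': "d' > 0" "\<And>s. \<bar>s\<bar> < d' \<Longrightarrow> dist (sphere_curve p v s) p < e"
    using sphere_curve_near[OF pS v(1) e] by blast
  define s where "s = min d d' / 2"
  have s: "0 < s" "s < d" "\<bar>s\<bar> < d'" using d(1) d'(1) by (auto simp: s_def)
  show ?thesis using that[OF d(2)[OF s(1,2)] sphere_curve_neq[OF pS v(1,2)] d'(2)[OF s(3)]] s(1) by simp
qed

text \<open>The function \<open>q \<mapsto> f x \<bullet> \<nu> q\<close> is nonnegative on the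
  closure and vanishes at \<open>p\<close>, so its one-sided derivatives
  \<open>Dh \<nu> p v \<bullet> f x\<close> are nonnegative. For the \<open>v\<close> whose image is
  the tangential part of \<open>f x\<close> this contradicts convexity unless that part is zero;
  then \<open>f x\<close> is \<open>f p\<close> or \<open>- f p\<close>.\<close>

lemma touching:
  assumes U: "good_cap m U" and st: "strict U" and p: "p \<in> closure U" and x: "x \<in> closure U" and t: "f x \<bullet> \<nu> p = 0"
  shows "f x = f p"
proof -
  have pS: "p \<in> usphere" and xS: "x \<in> usphere" and xm: "0 \<le> f x \<bullet> m" using good_cap_closure[OF U] p x by auto
  obtain w where w: "w \<in> tangent p" "f x = (f x \<bullet> f p) *\<^sub>R f p + (f x \<bullet> \<nu> p) *\<^sub>R \<nu> p + Dh f p w"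
    using decompose[OF pS] by blast
  then have fx: "f x = (f x \<bullet> f p) *\<^sub>R f p + Dh f p w" using t by simp
  have lin: "linear (Dh \<nu> p)" "linear (Dh f p)" using linear_Dh sf s\<nu> sphere_nonzero[OF pS] by auto
  have ge: "0 \<le> Dh \<nu> p v \<bullet> f x" if v: "v \<in> tangent p" "0 < f p \<bullet> m \<or> \<nu> p = m \<or> 0 < Dh f p v \<bullet> m" for v
  proof -
    obtain d where d: "d > 0" "\<And>s. 0 < s \<Longrightarrow> s < d \<Longrightarrow> sphere_curve p v s \<in> closure U"
      using good_cap_curve[OF U p v] by blast
    show ?thesis
    proof (rule nonneg_derivative_right[OF curve_inner_derivative[OF s\<nu> pS v(1), of "f x"] _ d(1)])
      show "\<nu> (sphere_curve p v 0) \<bullet> f x = 0" using t sphere_curve_0[OF pS] by (simp add: inner_commute)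
      show "0 \<le> \<nu> (sphere_curve p v s) \<bullet> f x" if "0 < s" "s < d" for s
        using closure_nonneg[OF U st d(2)[OF that] x] by (simp add: inner_commute)
    qed
  qed
  have wge: "0 \<le> Dh \<nu> p w \<bullet> f x"
  proof (cases rule: boundary_cases[OF U p])
    case (3 z)
    have "f x \<bullet> m = Dh f p w \<bullet> m" by (rule trans[OF arg_cong[OF fx, of "\<lambda>y. y \<bullet> m"]]) (simp add: inner_add_left 3)
    then have wm: "0 \<le> Dh f p w \<bullet> m" using xm by simp
    \<comment> \<open>At a regular boundary point \<open>w\<close> is only weakly admissible: the
      height does not decrease along it. Adding a small multiple of \<open>z\<close> makes it
      strictly admissible, and the multiple tends to zero.\<close>
    show ?thesis
    proof (rule nonneg_if_perturbed_nonneg)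
      fix e :: real assume e: "e > 0"
      have "0 < Dh f p (w + e *\<^sub>R z) \<bullet> m"
        using wm 3(3) e by (simp add: linear_add[OF lin(2)] linear_cmul[OF lin(2)] inner_add_left add_nonneg_pos)
      then have "0 \<le> Dh \<nu> p (w + e *\<^sub>R z) \<bullet> f x"
        using ge[of "w + e *\<^sub>R z"] tangent_add[OF w(1) tangent_scaleR[OF 3(2)]] by blast
      then show "0 \<le> Dh \<nu> p w \<bullet> f x + e * (Dh \<nu> p z \<bullet> f x)"
        by (simp add: linear_add[OF lin(1)] linear_cmul[OF lin(1)] inner_add_left)
    qed
  qed (use ge[OF w(1)] in blast)+
  have "Dh \<nu> p w \<bullet> f x = Dh \<nu> p w \<bullet> Dh f p w"
    by (rule trans[OF arg_cong[OF fx, of "inner (Dh \<nu> p w)"]]) (simp add: inner_add_right D\<nu>_f[OF pS])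
  then have "w = 0" using wge pos[OF pS w(1)] by (auto simp: inner_commute)
  then have fx': "f x = (f x \<bullet> f p) *\<^sub>R f p" using fx linear_0[OF lin(2)] by (metis add.right_neutral)
  then have "(f x \<bullet> f p) * (f x \<bullet> f p) = 1" using nf[OF pS] nf[OF xS] by (metis inner_scaleR_right)
  then have "f x \<bullet> f p = 1 \<or> f x \<bullet> f p = -1" by (simp add: square_eq_1_iff)
  then show ?thesis
  proof
    assume "f x \<bullet> f p = 1" then show ?thesis using fx' by (metis scaleR_one)
  next
    assume "f x \<bullet> f p = -1"
    \<comment> \<open>The antipodal value is excluded by a neighbour \<open>q\<close> of
      \<open>p\<close> in the closure: \<open>f p \<bullet> \<nu> q\<close> is positive by local
      convexity, yet \<open>f x \<bullet> \<nu> q\<close> is nonnegative.\<close>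
    then have neg: "f x = - f p" using fx' by (metis scaleR_minus1_left)
    obtain q where q: "q \<in> closure U" "q \<noteq> p" "dist q p < radius" using near_point[OF U p radius(1)] by blast
    have "0 < f p \<bullet> \<nu> q" using radius(2)[OF good_cap_closure(1)[OF U q(1)] pS] q(2,3) by (simp add: dist_commute)
    moreover have "0 \<le> f x \<bullet> \<nu> q" by (rule closure_nonneg[OF U st q(1) x])
    ultimately show ?thesis using neg by simp
  qed
qed

text \<open>Near \<open>x\<close> the height over the hyperplane of \<open>m\<close> takes both
  signs on a connected punctured disc, so it vanishes somewhere on it; local convexity puts this
  zero strictly above the tangent hyperplane at \<open>x\<close>.\<close>

lemma boundary_neighbour:
  assumes U: "good_cap m U" and x: "x \<in> closure U" and x0: "f x \<bullet> m = 0" and z: "z \<in> tangent x" "0 < Dh f x z \<bullet> m"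
  obtains y where "y \<in> closure U" "f y \<bullet> m = 0" "0 < f y \<bullet> \<nu> x"
proof -
  have xS: "x \<in> usphere" using good_cap_closure[OF U] x by auto
  obtain r where r: "r > 0" "\<And>y. y \<in> usphere \<Longrightarrow> dist y x < r \<Longrightarrow> 0 \<le> f y \<bullet> m \<Longrightarrow> y \<in> closure U"
    using good_cap_nbhd[OF U x] by blast
  have "min r radius > 0" using r radius(1) by simp
  then obtain r' where r': "r' > 0" "\<And>y. y \<in> punctured_nbhd x r' \<Longrightarrow> dist y x < min r radius"
    using punctured_nbhd_small[OF xS] by blast
  obtain e where e: "e > 0" "\<And>y. y \<in> usphere \<Longrightarrow> dist y x < e \<Longrightarrow> y \<noteq> x \<Longrightarrow> y \<in> punctured_nbhd x r'"
    using punctured_nbhd_contains[OF xS r'(1)] by blast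
  obtain y1 where y1: "y1 \<in> U" "dist y1 x < e" using closure_dist[OF x e(1)] by blast
  then have y1': "y1 \<in> usphere" "0 < f y1 \<bullet> m" using good_cap_sub[OF U] by (auto simp: cap_def)
  then have y1P: "y1 \<in> punctured_nbhd x r'" using x0 y1(2) by (intro e(2)) auto
  have z0: "z \<noteq> 0" using z(2) linear_0[OF linear_Dh[OF sf sphere_nonzero[OF xS]]] by auto
  obtain d where d: "d > 0" "\<And>s. 0 < s \<Longrightarrow> s < d \<Longrightarrow> f (sphere_curve x z (0 - s)) \<bullet> m < f (sphere_curve x z 0) \<bullet> m"
    using DERIV_pos_inc_left[OF curve_inner_derivative[OF sf xS z(1)] z(2)] by auto
  obtain d' where d': "d' > 0" "\<And>s. \<bar>s\<bar> < d' \<Longrightarrow> dist (sphere_curve x z s) x < e"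
    using sphere_curve_near[OF xS z(1) e(1)] by blast
  define s where "s = min d d' / 2"
  have s: "0 < s" "s < d" "\<bar>- s\<bar> < d'" using d(1) d'(1) by (auto simp: s_def)
  have y2: "sphere_curve x z (- s) \<in> punctured_nbhd x r'" "f (sphere_curve x z (- s)) \<bullet> m < 0"
    using e(2)[OF sphere_curve_in[OF xS z(1)] d'(2)[OF s(3)] sphere_curve_neq[OF xS z(1) z0]] d(2)[OF s(1,2)] s(1) x0 sphere_curve_0[OF xS]
    by simp_all
  let ?P = "(\<lambda>y. f y \<bullet> m) ` punctured_nbhd x r'"
  have "connected ?P"
    by (intro connected_continuous_image connected_punctured_nbhd[OF xS dim3] continuous_intros continuous_on_subset[OF continuous_on_f])
      (use punctured_nbhd_sphere[OF xS] in blast)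
  then have "0 \<in> ?P" using connected_contains_Icc[OF _ imageI[OF y2(1)] imageI[OF y1P]] y1'(2) y2(2) by fastforce
  then obtain y where y: "y \<in> punctured_nbhd x r'" "f y \<bullet> m = 0" by auto
  have yS: "y \<in> usphere" and yd: "dist y x < r" "dist y x < radius" using punctured_nbhd_sphere[OF xS y(1)] r'(2)[OF y(1)] by auto
  have "y \<noteq> x" using y(1) punctured_nbhd_neq[OF xS] by blast
  then show ?thesis using that[OF r(2)[OF yS yd(1)] y(2) radius(2)[OF xS yS _ yd(2)]] y(2) by simp
qed

text \<open>The cylinder over \<open>f\<close> in the direction \<open>d\<close> covers a
  neighbourhood of the common value, so a point \<open>q\<close> of \<open>U\<close> near
  \<open>p\<close> has \<open>f q = norm Y *\<^sub>R f y + b *\<^sub>R d\<close> with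
  \<open>y\<close> near \<open>x\<close>. Convexity at \<open>q\<close> forces
  \<open>b \<le> 0\<close> and convexity at \<open>y\<close> forces \<open>b \<ge> 0\<close>. Hence
  \<open>f y = f q\<close> for distinct points of \<open>U\<close>, against strictness.\<close>

lemma no_double_point:
  assumes U: "good_cap m U" and st: "strict U" and p: "p \<in> closure U" and x: "x \<in> closure U" and ne: "x \<noteq> p"
    and eq: "f x = f p" and p0: "f p \<bullet> m = 0" and d: "0 < d \<bullet> \<nu> x" "0 < d \<bullet> \<nu> p" "\<nu> x = m \<or> d \<bullet> m = 0"
  shows False
proof -
  have pS: "p \<in> usphere" and xS: "x \<in> usphere" using good_cap_closure[OF U] p x by auto
  have x0: "f x \<bullet> m = 0" using eq p0 by auto
  have lin: "linear (Dh f x)" using linear_Dh sf sphere_nonzero[OF xS] by auto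
  define \<rho>0 where "\<rho>0 = dist x p / 2"
  have \<rho>0: "\<rho>0 > 0" using ne by (simp add: \<rho>0_def)
  have cd: "continuous_on usphere (\<lambda>y. d \<bullet> \<nu> y)" by (intro continuous_intros continuous_on_\<nu>)
  obtain \<rho>1 where \<rho>1: "\<rho>1 > 0" "\<And>y. y \<in> usphere \<Longrightarrow> dist y x < \<rho>1 \<Longrightarrow> \<bar>d \<bullet> \<nu> y - d \<bullet> \<nu> x\<bar> < d \<bullet> \<nu> x"
    using sphere_approx[OF cd xS d(1)] by blast
  obtain \<rho>2 where \<rho>2: "\<rho>2 > 0" "\<And>y. y \<in> usphere \<Longrightarrow> dist y p < \<rho>2 \<Longrightarrow> \<bar>d \<bullet> \<nu> y - d \<bullet> \<nu> p\<bar> < d \<bullet> \<nu> p"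
    using sphere_approx[OF cd pS d(2)] by blast
  obtain r where r: "r > 0" "\<And>y. y \<in> usphere \<Longrightarrow> dist y x < r \<Longrightarrow> 0 \<le> f y \<bullet> m \<Longrightarrow> y \<in> closure U"
    using good_cap_nbhd[OF U x] by blast
  define \<rho> where "\<rho> = min (min \<rho>0 \<rho>1) (min r radius)"
  have \<rho>: "\<rho> > 0" "\<rho> \<le> \<rho>0" "\<rho> \<le> \<rho>1" "\<rho> \<le> r" "\<rho> \<le> radius" using \<rho>0 \<rho>1 r radius(1) by (auto simp: \<rho>_def)
  obtain R where R: "R > 0" "R < 1" "\<And>Y. dist Y x < R \<Longrightarrow> dist (Y /\<^sub>R norm Y) x < \<rho>" using normalize_near[OF xS \<rho>(1)] by blast
  \<comment> \<open>The norm of the first component scales \<open>f\<close>, the second component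
    adds a multiple of \<open>d\<close>; the latter is transversal because
    \<open>0 < d \<bullet> \<nu> x\<close>.\<close>
  define \<Xi> where "\<Xi> z = norm (fst z) *\<^sub>R hext f (fst z) + snd z *\<^sub>R d" for z :: "'a \<times> real"
  define T where "T = ball x R \<times> (UNIV :: real set)"
  have TS: "fst z \<noteq> 0" if "z \<in> T" for z using that near_sphere_nonzero[OF xS, of "fst z"] R(2) by (auto simp: T_def dist_commute)
  have openT: "open T" by (auto simp: T_def intro!: open_Times)
  have "f x \<in> interior (\<Xi> ` T)"
  proof -
    let ?L = "\<lambda>v::'a \<times> real. (fst v \<bullet> x) *\<^sub>R f x + Dh f x (fst v) + snd v *\<^sub>R d"
    have x1: "x \<noteq> 0" "norm x = 1" using xS by auto
    have h1: "((\<lambda>z::'a \<times> real. norm (fst z)) has_derivative (\<lambda>v. fst v \<bullet> x)) (at (x, 0))"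
      using diff_chain_at[of fst fst "(x, 0::real)" norm "\<lambda>v. v \<bullet> sgn x"] has_derivative_norm[OF x1(1)] x1(2)
      by (simp add: o_def has_derivative_fst has_derivative_ident sgn_div_norm)
    have h2: "((\<lambda>z::'a \<times> real. hext f (fst z)) has_derivative (\<lambda>v. Dh f x (fst v))) (at (x, 0))"
      using diff_chain_at[of fst fst "(x, 0::real)" "hext f" "Dh f x"] hext_has_derivative[OF sf x1(1)]
      by (simp add: o_def has_derivative_fst has_derivative_ident)
    have h3: "((\<lambda>z::'a \<times> real. snd z *\<^sub>R d) has_derivative (\<lambda>v. snd v *\<^sub>R d)) (at (x, 0))"
      by (auto intro!: derivative_eq_intros)
    have der: "(\<Xi> has_derivative ?L) (at (x, 0))"
      unfolding \<Xi>_def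
      by (rule has_derivative_eq_rhs[OF has_derivative_add[OF has_derivative_scaleR[OF h1 h2] h3]])
        (simp add: fun_eq_iff x1(2) hext_sphere[OF xS] add.commute)
    have linL: "linear ?L" using der has_derivative_linear by blast
    have "surj ?L"
      unfolding surj_def
    proof
      fix v
      define b where "b = (v \<bullet> \<nu> x) / (d \<bullet> \<nu> x)"
      have b: "(v - b *\<^sub>R d) \<bullet> \<nu> x = 0" using d(1) by (simp add: b_def inner_diff_left)
      obtain w where w: "w \<in> tangent x" "v - b *\<^sub>R d = ((v - b *\<^sub>R d) \<bullet> f x) *\<^sub>R f x + ((v - b *\<^sub>R d) \<bullet> \<nu> x) *\<^sub>R \<nu> x + Dh f x w"
        using decompose[OF xS] by blast
      define \<alpha> where "\<alpha> = (v - b *\<^sub>R d) \<bullet> f x"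
      have w2: "v - b *\<^sub>R d = \<alpha> *\<^sub>R f x + Dh f x w" using w(2) b by (simp add: \<alpha>_def)
      have "Dh f x (\<alpha> *\<^sub>R x + w) = Dh f x w"
        using linear_add[OF lin] linear_cmul[OF lin] Dh_self[OF sf x1(1)] by simp
      moreover have "(\<alpha> *\<^sub>R x + w) \<bullet> x = \<alpha>" using w(1) x1(2) by (simp add: tangent_def inner_add_left norm_eq_1)
      ultimately have "?L (\<alpha> *\<^sub>R x + w, b) = v" using w2 by (simp add: algebra_simps)
      then show "\<exists>z. v = ?L z" by (intro exI[of _ "(\<alpha> *\<^sub>R x + w, b)"]) (rule sym)
    qed
    then obtain g' where g': "linear g'" "?L \<circ> g' = id" using linear_surjective_right_inverse[OF linL] by blast
    \<comment> \<open>Openness at the single point \<open>(x, 0)\<close> is enough, and a right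
      inverse of the derivative at this point yields it.\<close>
    have "\<Xi> (x, 0) \<in> interior (\<Xi> ` T)"
    proof (rule sussmann_open_mapping[OF openT _ _ der _ g'(2)])
      show "continuous_on T \<Xi>" unfolding \<Xi>_def
        by (intro continuous_intros continuous_on_compose2[OF hext_continuous_on[OF sf], of T fst]) (use TS in auto)
      show "(x, 0) \<in> T" "(x, 0) \<in> interior T" using R(1) interior_open[OF openT] by (auto simp: T_def)
      show "bounded_linear g'" using g'(1) by (simp add: linear_conv_bounded_linear)
    qed simp
    then show ?thesis using x1(2) by (simp add: \<Xi>_def hext_sphere[OF xS])
  qed
  then obtain \<eta> where \<eta>: "\<eta> > 0" "ball (f p) \<eta> \<subseteq> \<Xi> ` T" using eq by (auto simp: mem_interior)
  obtain e1 where e1: "e1 > 0" "\<And>q. q \<in> usphere \<Longrightarrow> dist q p < e1 \<Longrightarrow> dist (f q) (f p) < \<eta>"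
    using continuous_on_f pS \<eta>(1) unfolding continuous_on_iff by blast
  have "min e1 (min \<rho>0 \<rho>2) > 0" using e1 \<rho>0 \<rho>2 by simp
  then obtain q where q: "q \<in> U" "dist q p < min e1 (min \<rho>0 \<rho>2)" using closure_dist[OF p] by blast
  have qc: "q \<in> usphere" "0 < f q \<bullet> m" using good_cap_sub[OF U] q(1) by (auto simp: cap_def)
  have "f q \<in> \<Xi> ` T" using e1(2)[OF qc(1)] q(2) \<eta>(2) by (auto simp: dist_commute)
  then obtain z where z: "z \<in> T" "f q = \<Xi> z" by blast
  obtain Y b where Yb: "z = (Y, b)" by (cases z)
  have Y: "dist Y x < R" "f q = norm Y *\<^sub>R hext f Y + b *\<^sub>R d" "Y \<noteq> 0"
    using z TS[OF z(1)] by (simp_all add: Yb T_def \<Xi>_def dist_commute)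
  define y where "y = Y /\<^sub>R norm Y"
  have yS: "y \<in> usphere" unfolding y_def by (rule normalize_sphere[OF Y(3)])
  have yx: "dist y x < \<rho>" using R(3)[OF Y(1)] by (simp add: y_def)
  have fq: "f q = norm Y *\<^sub>R f y + b *\<^sub>R d" using Y(2) by (simp add: y_def hext_def)
  have nY: "norm Y > 0" using Y(3) by simp
  \<comment> \<open>Here the last condition on \<open>d\<close> enters: either the half space is
    tangent at \<open>x\<close>, or \<open>d\<close> is parallel to its boundary. Both put
    \<open>y\<close> into the closure of \<open>U\<close>.\<close>
  have "0 \<le> f y \<bullet> m"
    using d(3)
  proof
    assume "\<nu> x = m"
    then show ?thesis using radius(2)[OF xS yS] yx \<rho>(5) x0 by (cases "y = x") (auto simp: less_imp_le)
  next
    assume "d \<bullet> m = 0"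
    then have "f q \<bullet> m = norm Y * (f y \<bullet> m)" unfolding fq by (simp add: inner_add_left)
    then show ?thesis using qc(2) nY by (simp add: zero_less_mult_iff)
  qed
  then have yU: "y \<in> closure U" using r(2)[OF yS] yx \<rho>(4) by simp
  have qU: "q \<in> closure U" using q(1) closure_subset by blast
  have dq: "0 < d \<bullet> \<nu> q" using \<rho>2(2)[OF qc(1)] q(2) by (simp add: abs_less_iff)
  have dy: "0 < d \<bullet> \<nu> y" using \<rho>1(2)[OF yS] yx \<rho>(3) by (simp add: abs_less_iff)
  have "0 = norm Y * (f y \<bullet> \<nu> q) + b * (d \<bullet> \<nu> q)"
    using f\<nu>[OF qc(1)] arg_cong[OF fq, of "\<lambda>v. v \<bullet> \<nu> q"] by (simp add: inner_add_left)
  moreover have "0 \<le> norm Y * (f y \<bullet> \<nu> q)" using closure_nonneg[OF U st qU yU] nY by simp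
  ultimately have "b * (d \<bullet> \<nu> q) \<le> 0" by linarith
  then have "b \<le> 0" using dq by (simp add: mult_le_0_iff)
  moreover have "0 \<le> b * (d \<bullet> \<nu> y)"
    using closure_nonneg[OF U st yU qU] f\<nu>[OF yS] arg_cong[OF fq, of "\<lambda>v. v \<bullet> \<nu> y"] by (simp add: inner_add_left)
  then have "0 \<le> b" using dy by (simp add: zero_le_mult_iff)
  ultimately have fqy: "f q = norm Y *\<^sub>R f y" using fq by simp
  then have "(norm Y)^2 = 1" using nf[OF qc(1)] nf[OF yS] by (simp add: power2_eq_square)
  then have "norm Y = 1" using nY by (simp add: power2_eq_1_iff)
  then have fyq: "f y = f q" using fqy by simp
  have "y \<in> U" using good_cap_closure(3)[OF U yU] fyq qc(2) by simp
  moreover have "y \<noteq> q"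
  proof
    assume "y = q"
    then have "dist x p < \<rho>0 + \<rho>0" using dist_triangle[of x p q] yx \<rho>(2) q(2) by (simp add: dist_commute)
    then show False by (simp add: \<rho>0_def)
  qed
  ultimately have "0 < f y \<bullet> \<nu> q" using strictD[OF st q(1)] by blast
  then show False using fyq f\<nu>[OF qc(1)] by simp
qed

text \<open>By \<open>touching\<close>, a failure is a double point over the boundary hyperplane,
  and \<open>no_double_point\<close> asks for a direction \<open>d\<close> pointing to both convex
  sides. The sum of the two normals, or of their normalized parts orthogonal to \<open>m\<close>, is
  such a direction unless the summands are opposite.\<close>

lemma strict_closure:
  assumes U: "good_cap m U" and st: "strict U"
  shows "strict (closure U)"
  unfolding strict_def
proof (intro ballI impI)
  fix p x assume p: "p \<in> closure U" and x: "x \<in> closure U" and ne: "x \<noteq> p"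
  have pS: "p \<in> usphere" and xS: "x \<in> usphere" using good_cap_closure[OF U] p x by auto
  have mm: "m \<bullet> m = 1" using U by (simp add: good_cap_def)
  show "0 < f x \<bullet> \<nu> p"
  proof (rule ccontr)
    assume "\<not> 0 < f x \<bullet> \<nu> p"
    then have t: "f x \<bullet> \<nu> p = 0" using closure_nonneg[OF U st p x] by simp
    have eq: "f x = f p" by (rule touching[OF U st p x t])
    have p0: "f p \<bullet> m = 0"
    proof (rule ccontr)
      assume "f p \<bullet> m \<noteq> 0"
      then have "0 < f p \<bullet> m" "0 < f x \<bullet> m" using good_cap_closure(2)[OF U p] eq by auto
      then have "p \<in> U" "x \<in> U" using good_cap_closure(3)[OF U] p x by auto
      then show False using strictD[OF st _ _ ne] t by simp
    qed
    have nopole: "\<exists>z\<in>tangent y. 0 < Dh f y z \<bullet> m" if "y \<in> closure U" "f y \<bullet> m = 0" "\<nu> y \<noteq> m" for y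
      by (cases rule: boundary_cases[OF U that(1)]) (use that in auto)
    have unit: "0 < (v + w) \<bullet> v" "0 < (v + w) \<bullet> w" if "v \<bullet> v = 1" "w \<bullet> w = 1" "w \<noteq> - v" for v w :: 'b
    proof -
      have "(v + w) \<bullet> (v + w) > 0" using that(3) by (simp add: eq_neg_iff_add_eq_0 add.commute)
      then show "0 < (v + w) \<bullet> v" "0 < (v + w) \<bullet> w" using that(1,2) by (auto simp: inner_add_left inner_add_right inner_commute)
    qed
    \<comment> \<open>If the half space is tangent at one of the points, take
      \<open>d = m + \<nu> y'\<close>. The summands are not opposite: \<open>\<nu> y' = - m\<close>
      would leave no tangential direction at \<open>y'\<close> that raises the height, although
      \<open>y'\<close> would not be a pole.\<close>
    have pole: False if y: "y \<in> closure U" "y' \<in> closure U" "y \<noteq> y'" "f y = f y'" "f y' \<bullet> m = 0" "\<nu> y = m" for y y'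
    proof -
      have y'S: "y' \<in> usphere" using good_cap_closure[OF U y(2)] by simp
      have "\<nu> y' \<noteq> - m"
      proof
        assume *: "\<nu> y' = - m"
        then have "\<nu> y' \<noteq> m" using mm by (metis inner_minus_left one_neq_neg_one)
        then obtain z where z: "z \<in> tangent y'" "0 < Dh f y' z \<bullet> m" using nopole[OF y(2,5)] by blast
        then show False using contact[OF y'S z(1)] * by simp
      qed
      then show False
        using no_double_point[OF U st y(2,1,3,4,5), of "m + \<nu> y'"] unit[OF mm n\<nu>[OF y'S]] y(6) by simp
    qed
    have "\<nu> x \<noteq> m" "\<nu> p \<noteq> m" using pole[OF x p ne eq p0] pole[OF p x ne[symmetric] eq[symmetric]] eq p0 by auto
    then obtain zx zp where zx: "zx \<in> tangent x" "0 < Dh f x zx \<bullet> m" and zp: "zp \<in> tangent p" "0 < Dh f p zp \<bullet> m"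
      using nopole[OF x] nopole[OF p] p0 eq by metis
    define n where "n y = \<nu> y - (\<nu> y \<bullet> m) *\<^sub>R m" for y
    have nm: "n y \<bullet> m = 0" for y using mm by (simp add: n_def inner_diff_left)
    have n0: "n y \<noteq> 0" if y: "y \<in> usphere" "z \<in> tangent y" "0 < Dh f y z \<bullet> m" for y z
    proof
      assume "n y = 0"
      then have *: "\<nu> y = (\<nu> y \<bullet> m) *\<^sub>R m" by (simp add: n_def)
      have "(\<nu> y \<bullet> m) * (Dh f y z \<bullet> m) = 0" using contact[OF y(1,2)] arg_cong[OF *, of "inner (Dh f y z)"] by simp
      then show False using * n\<nu>[OF y(1)] y(3) by simp
    qed
    note nx = n0[OF xS zx] and np = n0[OF pS zp]
    define u where "u y = n y /\<^sub>R norm (n y)" for y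
    have nu: "n y = norm (n y) *\<^sub>R u y" if "n y \<noteq> 0" for y using that by (simp add: u_def)
    have uu: "u y \<bullet> u y = 1" if "n y \<noteq> 0" for y using that by (simp add: u_def dot_square_norm power2_eq_square)
    have um: "u y \<bullet> m = 0" for y using nm by (simp add: u_def)
    have dn: "d \<bullet> \<nu> y = norm (n y) * (d \<bullet> u y)" if "d \<bullet> m = 0" "n y \<noteq> 0" for d y
      using arg_cong[OF nu[OF that(2)], of "inner d"] that(1) by (simp add: n_def inner_diff_right)
    show False
    proof (cases "u p = - u x")
      case False
      have dm: "(u x + u p) \<bullet> m = 0" using um by (simp add: inner_add_left)
      show False
        using no_double_point[OF U st p x ne eq p0, of "u x + u p"] unit[OF uu[OF nx] uu[OF np] False] dm nx np dn[OF dm] by simp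
    next
      case True
      \<comment> \<open>With opposite normal parts, a boundary point strictly above the tangent
        hyperplane at \<open>x\<close> lies strictly below the one at \<open>p\<close>.\<close>
      obtain y where y: "y \<in> closure U" "f y \<bullet> m = 0" "0 < f y \<bullet> \<nu> x"
        using boundary_neighbour[OF U x _ zx] eq p0 by metis
      have "0 \<le> f y \<bullet> \<nu> p" by (rule closure_nonneg[OF U st p y(1)])
      then show False using dn[OF y(2) np] dn[OF y(2) nx] y(3) np nx True
        by (simp add: zero_le_mult_iff zero_less_mult_iff mult_le_0_iff)
    qed
  qed
qed

text \<open>The unit normals turn in the plane of \<open>f p\<close> and \<open>\<nu> p\<close>, so
  all these hyperplanes contain the image of the tangent space at \<open>p\<close>. At
  \<open>t = 0\<close> the half space is the wrong side of the tangent hyperplane and excludes all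
  points near \<open>p\<close>, at \<open>t = pi\<close> it is the convex side, and strictly in
  between it contains \<open>f p\<close>.\<close>

definition sweep :: "'a \<Rightarrow> real \<Rightarrow> 'b" where
  "sweep p t = sin t *\<^sub>R f p - cos t *\<^sub>R \<nu> p"

definition swept :: "'a \<Rightarrow> real \<Rightarrow> 'a set" where
  "swept p t = connected_component_set (cap (sweep p t)) p"

lemma swept_sub: "swept p t \<subseteq> cap (sweep p t)"
  unfolding swept_def by (rule connected_component_subset)

lemma swept_connected: "connected (swept p t)"
  unfolding swept_def by (rule connected_connected_component)

lemma sweep_continuous: "continuous_on UNIV (sweep p)"
  unfolding sweep_def by (intro continuous_intros)

lemma cap_sweep: "p \<in> usphere \<Longrightarrow> 0 < t \<Longrightarrow> t < pi \<Longrightarrow> p \<in> cap (sweep p t)"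
  by (simp add: cap_def sweep_def inner_diff_right nf f\<nu> sin_gt_zero)

lemma swept_self: "p \<in> usphere \<Longrightarrow> 0 < t \<Longrightarrow> t < pi \<Longrightarrow> p \<in> swept p t"
  unfolding swept_def using cap_sweep by (simp add: connected_component_refl)

lemma swept_maximal: "connected N \<Longrightarrow> N \<subseteq> cap (sweep p t) \<Longrightarrow> y \<in> N \<Longrightarrow> y \<in> swept p t \<Longrightarrow> N \<subseteq> swept p t"
  unfolding swept_def
  by (metis connected_component_eq connected_component_maximal mem_Collect_eq)

lemma good_cap_swept:
  assumes p: "p \<in> usphere"
  shows "good_cap (sweep p t) (swept p t)"
proof -
  have "sweep p t \<bullet> sweep p t = sin t * sin t + cos t * cos t"
    using f\<nu>[OF p] inner_commute[of "\<nu> p" "f p"] by (simp add: sweep_def inner_diff_left inner_diff_right nf[OF p] n\<nu>[OF p])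
  then have "sweep p t \<bullet> sweep p t = 1" using sin_cos_squared_add3[of t] by (simp add: add.commute)
  moreover have "locally connected (cap (sweep p t))"
    by (rule locally_open_subset[OF locally_path_connected_imp_locally_connected[OF locally_path_connected_sphere] openin_cap])
  ultimately show ?thesis
    unfolding good_cap_def swept_def
    using openin_connected_component_locally_connected closedin_connected_component by blast
qed

lemma swept_compact:
  assumes x: "x \<in> swept p t"
  obtains C where "compact C" "connected C" "p \<in> C" "x \<in> C" "C \<subseteq> cap (sweep p t)"
proof -
  have "locally path_connected (cap (sweep p t))"
    by (rule locally_open_subset[OF locally_path_connected_sphere openin_cap])
  then have "path_component (cap (sweep p t)) p x"
    using x path_component_eq_connected_component unfolding swept_def by (metis mem_Collect_eq)
  then obtain g where g: "path g" "path_image g \<subseteq> cap (sweep p t)" "pathstart g = p" "pathfinish g = x"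
    unfolding path_component_def by blast
  show ?thesis
    by (rule that[of "path_image g"])
      (use g compact_path_image connected_path_image pathstart_in_path_image[of g] pathfinish_in_path_image[of g] in auto)
qed

text \<open>Tube lemma over the compact set \<open>C\<close>. The sign \<open>c\<close> lets it
  serve both for keeping points in a half space and for keeping points out.\<close>

lemma sweep_stable:
  assumes C: "compact C" "C \<subseteq> usphere" and pos: "\<And>x. x \<in> C \<Longrightarrow> 0 < c * (f x \<bullet> sweep p t)"
  obtains e where "e > 0" "\<And>t' x. \<bar>t' - t\<bar> < e \<Longrightarrow> x \<in> C \<Longrightarrow> 0 < c * (f x \<bullet> sweep p t')"
proof -
  define A where "A = (UNIV \<times> -{0} :: (real \<times> 'a) set)"
  define h where "h z = c * (hext f (snd z) \<bullet> sweep p (fst z))" for z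
  have "open A" by (auto simp: A_def intro!: open_Times)
  moreover have "continuous_on A h" unfolding h_def A_def
    by (intro continuous_intros continuous_on_compose2[OF hext_continuous_on[OF sf]] continuous_on_compose2[OF sweep_continuous]) auto
  ultimately have "open (A \<inter> h -` {0<..})" by (intro continuous_open_preimage) auto
  moreover have "{t} \<times> C \<subseteq> A \<inter> h -` {0<..}" using pos C(2) by (auto simp: A_def h_def hext_sphere subset_iff)
  ultimately have "\<exists>X. t \<in> X \<and> open X \<and> X \<times> C \<subseteq> A \<inter> h -` {0<..}" by (rule Elementary_Topology.tube_lemma[OF C(1)])
  then obtain X where X: "t \<in> X" "open X" "X \<times> C \<subseteq> A \<inter> h -` {0<..}" by blast
  then obtain e where e: "e > 0" "ball t e \<subseteq> X" using open_contains_ball by blast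
  show ?thesis
  proof (rule that[OF e(1)])
    fix t' x assume t': "\<bar>t' - t\<bar> < e" and x: "x \<in> C"
    have "t' \<in> X" using e(2) t' by (auto simp: dist_real_def)
    then have "0 < h (t', x)" using X(3) x by auto
    moreover have "x \<in> usphere" using x C(2) by blast
    ultimately show "0 < c * (f x \<bullet> sweep p t')" by (simp add: h_def hext_sphere)
  qed
qed

lemma swept_stable:
  assumes x: "x \<in> swept p t"
  obtains e where "e > 0" "\<And>t'. \<bar>t' - t\<bar> < e \<Longrightarrow> x \<in> swept p t'"
proof -
  obtain C where C: "compact C" "connected C" "p \<in> C" "x \<in> C" "C \<subseteq> cap (sweep p t)"
    using swept_compact[OF x] by blast
  obtain e where e: "e > 0" "\<And>t' x. \<bar>t' - t\<bar> < e \<Longrightarrow> x \<in> C \<Longrightarrow> 0 < 1 * (f x \<bullet> sweep p t')"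
  proof -
    have "C \<subseteq> usphere" "\<And>x. x \<in> C \<Longrightarrow> 0 < 1 * (f x \<bullet> sweep p t)" using C(5) by (auto simp: cap_def)
    from sweep_stable[OF C(1) this] show ?thesis using that by blast
  qed
  show ?thesis
  proof (rule that[OF e(1)])
    fix t' assume "\<bar>t' - t\<bar> < e"
    then have "C \<subseteq> cap (sweep p t')" using e(2) C(5) by (auto simp: cap_def)
    then show "x \<in> swept p t'" unfolding swept_def using connected_component_maximal[OF C(3,2)] C(4) by blast
  qed
qed

text \<open>Pairs closer than \<open>radius\<close> are harmless by local convexity. The remote
  pairs that violate convexity form a closed set \<open>K\<close>, which keeps a positive distance
  from \<open>Q \<times> Q\<close>.\<close>

lemma strict_nbhd:
  assumes Q: "compact Q" "Q \<noteq> {}" "Q \<subseteq> usphere" and st: "strict Q"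
  obtains e where "e > 0" "strict {x \<in> usphere. infdist x Q < e}"
proof -
  define K where "K = ((usphere \<times> usphere) \<inter> (\<lambda>z. f (snd z) \<bullet> \<nu> (fst z)) -` {..0}) \<inter> {z. radius \<le> dist (snd z) (fst z)}"
  have "continuous_on (usphere \<times> usphere) (\<lambda>z. f (snd z) \<bullet> \<nu> (fst z))"
    by (intro continuous_intros continuous_on_compose2[OF continuous_on_f] continuous_on_compose2[OF continuous_on_\<nu>]) auto
  then have K: "closed K"
    unfolding K_def by (intro closed_Int[OF continuous_closed_preimage[OF _ closed_Times[OF closed_sphere closed_sphere] closed_atMost]]
        closed_Collect_le continuous_on_dist continuous_on_fst continuous_on_snd continuous_on_id continuous_on_const)
  have "(Q \<times> Q) \<inter> K = {}" using strictD[OF st] radius(1) by (force simp: K_def)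
  then obtain d where d: "d > 0" "\<And>y z. y \<in> Q \<times> Q \<Longrightarrow> z \<in> K \<Longrightarrow> d \<le> dist y z"
    using separate_compact_closed[OF compact_Times[OF Q(1,1)] K] by blast
  have near: "\<exists>y\<in>Q. dist y x < d / 2" if "infdist x Q < d / 2" for x
    using infdist_attains_inf[OF compact_imp_closed[OF Q(1)] Q(2), of x] that by (metis dist_commute)
  have "0 < f x \<bullet> \<nu> p" if p: "p \<in> usphere" "infdist p Q < d / 2" and x: "x \<in> usphere" "infdist x Q < d / 2" and "x \<noteq> p" for p x
  proof (rule ccontr)
    assume "\<not> ?thesis"
    then have "(p, x) \<in> K" using radius(2)[OF p(1) x(1) \<open>x \<noteq> p\<close>] p x by (auto simp: K_def not_less[symmetric])
    moreover obtain p' x' where y: "p' \<in> Q" "dist p' p < d / 2" "x' \<in> Q" "dist x' x < d / 2" using near p(2) x(2) by meson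
    moreover have "dist (p', x') (p, x) \<le> dist p' p + dist x' x"
      using dist_triangle[of "(p', x')" "(p, x)" "(p, x')"] by (simp add: dist_Pair_Pair)
    ultimately show False using d(2)[of "(p', x')" "(p, x)"] by simp
  qed
  then show ?thesis using that[of "d / 2"] d(1) by (simp add: strict_def)
qed

lemma connected_below:
  fixes h :: "'a \<Rightarrow> real"
  assumes "connected N" "continuous_on N h" "p \<in> N" "h p < e" "\<And>x. x \<in> N \<Longrightarrow> h x \<noteq> e" "x \<in> N"
  shows "h x < e"
proof (rule ccontr)
  assume "\<not> h x < e"
  then have "e \<in> {h p..h x}" using assms(4) by simp
  moreover have "{h p..h x} \<subseteq> h ` N"
    by (rule connected_contains_Icc[OF connected_continuous_image[OF assms(2,1)]]) (use assms in auto)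
  ultimately show False using assms(5) by blast
qed

text \<open>At distance \<open>radius / 3\<close> from \<open>p\<close> all points are strictly
  outside the half space with \<open>t = 0\<close>, hence also for small \<open>t\<close>, so the
  connected swept set cannot leave this disc. Any two of its points are then closer than
  \<open>radius\<close>.\<close>

lemma swept_strict_start:
  assumes p: "p \<in> usphere"
  obtains t where "0 < t" "t < pi" "strict (swept p t)"
proof -
  define B where "B = usphere \<inter> sphere p (radius / 3)"
  have B: "compact B" "B \<subseteq> usphere" unfolding B_def by (auto intro: compact_Int)
  have pos: "0 < (-1) * (f x \<bullet> sweep p 0)" if "x \<in> B" for x
  proof -
    have "x \<noteq> p" "dist x p < radius" using that radius(1) by (auto simp: B_def dist_commute)
    then have "0 < f x \<bullet> \<nu> p" using radius(2)[OF p] that by (auto simp: B_def)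
    then show ?thesis by (simp add: sweep_def)
  qed
  obtain e where e: "e > 0" "\<And>t' x. \<bar>t' - 0\<bar> < e \<Longrightarrow> x \<in> B \<Longrightarrow> 0 < (-1) * (f x \<bullet> sweep p t')"
    using sweep_stable[OF B pos] by blast
  define t where "t = min e pi / 2"
  have t: "0 < t" "t < pi" "\<bar>t - 0\<bar> < e" using e(1) pi_gt_zero unfolding t_def by linarith+
  have S: "x \<in> usphere" "0 < f x \<bullet> sweep p t" if "x \<in> swept p t" for x
    using swept_sub[of p t] that unfolding cap_def by blast+
  have small: "dist x p < radius / 3" if x: "x \<in> swept p t" for x
  proof (rule connected_below[OF swept_connected _ swept_self[OF p t(1,2)] _ _ x])
    show "continuous_on (swept p t) (\<lambda>x. dist x p)" by (intro continuous_intros)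
    show "dist p p < radius / 3" using radius(1) by simp
    fix y assume y: "y \<in> swept p t"
    show "dist y p \<noteq> radius / 3"
    proof
      assume "dist y p = radius / 3"
      then have "y \<in> B" using S(1)[OF y] by (simp add: B_def dist_commute)
      then show False using e(2)[OF t(3)] S(2)[OF y] by fastforce
    qed
  qed
  have "strict (swept p t)"
    unfolding strict_def
  proof (intro ballI impI)
    fix q x assume qx: "q \<in> swept p t" "x \<in> swept p t" "x \<noteq> q"
    have "dist x q < radius" using small[OF qx(1)] small[OF qx(2)] dist_triangle2[of x q p] radius(1) by linarith
    then show "0 < f x \<bullet> \<nu> q" using radius(2)[OF S(1)[OF qx(1)] S(1)[OF qx(2)] qx(3)] by simp
  qed
  then show ?thesis using that t by blast
qed

text \<open>The closure \<open>Q\<close> is strict by \<open>strict_closure\<close>, hence so is a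
  neighbourhood of it. As \<open>Q\<close> has positive distance from the rest of the closed half
  space, the height is negative at distance exactly \<open>e\<close> from \<open>Q\<close>, also for
  nearby \<open>t'\<close>, so the connected swept set stays within distance
  \<open>e\<close>.\<close>

lemma swept_strict_open:
  assumes p: "p \<in> usphere" and t: "0 < t" "t < pi" and st: "strict (swept p t)"
  obtains e where "e > 0" "\<And>t'. \<bar>t' - t\<bar> < e \<Longrightarrow> 0 < t' \<Longrightarrow> t' < pi \<Longrightarrow> strict (swept p t')"
proof -
  define Q where "Q = closure (swept p t)"
  have U: "good_cap (sweep p t) (swept p t)" by (rule good_cap_swept[OF p])
  have QS: "Q \<subseteq> usphere" unfolding Q_def using good_cap_closure(1)[OF U] by blast
  have pQ: "p \<in> Q" unfolding Q_def using swept_self[OF p t] closure_subset by blast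
  have Q: "compact Q" "Q \<noteq> {}" using QS pQ bounded_subset[OF bounded_sphere QS] by (auto simp: Q_def compact_eq_bounded_closed)
  have stQ: "strict Q" unfolding Q_def by (rule strict_closure[OF U st])
  obtain e1 where e1: "e1 > 0" "strict {x \<in> usphere. infdist x Q < e1}" using strict_nbhd[OF Q QS stQ] by blast
  define Z where "Z = {x \<in> usphere. 0 \<le> f x \<bullet> sweep p t}"
  have Zc: "closed Z"
  proof -
    have "closed (usphere \<inter> (\<lambda>x. f x \<bullet> sweep p t) -` {0..})"
      by (intro continuous_closed_preimage continuous_intros continuous_on_f closed_sphere closed_atLeast)
    moreover have "usphere \<inter> (\<lambda>x. f x \<bullet> sweep p t) -` {0..} = Z" by (auto simp: Z_def)
    ultimately show ?thesis by simp
  qed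
  \<comment> \<open>By \<open>good_cap_nbhd\<close> every point of the closed half space near a
    point of \<open>Q\<close> belongs to \<open>Q\<close>, so the rest cannot accumulate
    there.\<close>
  have "closed (Z - Q)"
    unfolding closed_limpt
  proof (intro allI impI)
    fix x assume x: "x islimpt (Z - Q)"
    have xZ: "x \<in> Z" using Zc x islimpt_subset[OF x, of Z] by (auto simp: closed_limpt)
    show "x \<in> Z - Q"
    proof (rule ccontr)
      assume "x \<notin> Z - Q"
      then have "x \<in> closure (swept p t)" using xZ by (simp add: Q_def)
      then obtain r where r: "r > 0" "\<And>y. y \<in> usphere \<Longrightarrow> dist y x < r \<Longrightarrow> 0 \<le> f y \<bullet> sweep p t \<Longrightarrow> y \<in> closure (swept p t)"
        using good_cap_nbhd[OF U] by blast
      obtain y where "y \<in> Z - Q" "dist y x < r" using x r(1) unfolding islimpt_approachable by blast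
      then show False using r(2)[of y] by (simp add: Z_def Q_def)
    qed
  qed
  then obtain e2 where e2: "e2 > 0" "\<And>x y. x \<in> Q \<Longrightarrow> y \<in> Z - Q \<Longrightarrow> e2 \<le> dist x y"
    using separate_compact_closed[OF Q(1), of "Z - Q"] by blast
  define e where "e = min e1 e2 / 2"
  have e: "e > 0" "e < e1" "e < e2" using e1(1) e2(1) by (auto simp: e_def)
  define B where "B = usphere \<inter> (\<lambda>x. infdist x Q) -` {e}"
  have "closed B" unfolding B_def by (intro continuous_closed_preimage continuous_intros closed_sphere closed_singleton)
  then have B: "compact B" "B \<subseteq> usphere"
    using bounded_subset[OF bounded_sphere, of B 0 1] by (auto simp: B_def compact_eq_bounded_closed)
  have pos: "0 < (-1) * (f x \<bullet> sweep p t)" if x: "x \<in> B" for x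
  proof (rule ccontr)
    assume "\<not> ?thesis"
    then have xZ: "x \<in> Z" using x by (simp add: Z_def B_def)
    have xe: "infdist x Q = e" using x by (simp add: B_def)
    then have "x \<notin> Q" using e(1) infdist_zero by force
    then obtain y where "y \<in> Q" "infdist x Q = dist x y" using infdist_attains_inf[OF compact_imp_closed[OF Q(1)] Q(2)] by blast
    then show False using e2(2)[of y x] xZ \<open>x \<notin> Q\<close> xe e(3) by (simp add: dist_commute)
  qed
  obtain e' where e': "e' > 0" "\<And>t' x. \<bar>t' - t\<bar> < e' \<Longrightarrow> x \<in> B \<Longrightarrow> 0 < (-1) * (f x \<bullet> sweep p t')"
    using sweep_stable[OF B pos] by blast
  show ?thesis
  proof (rule that[OF e'(1)])
    fix t' assume t': "\<bar>t' - t\<bar> < e'" "0 < t'" "t' < pi"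
    have S: "x \<in> usphere" "0 < f x \<bullet> sweep p t'" if "x \<in> swept p t'" for x
      using swept_sub[of p t'] that unfolding cap_def by blast+
    have "infdist x Q < e" if x: "x \<in> swept p t'" for x
    proof (rule connected_below[OF swept_connected _ swept_self[OF p t'(2,3)] _ _ x])
      show "continuous_on (swept p t') (\<lambda>x. infdist x Q)" by (intro continuous_intros)
      show "infdist p Q < e" using pQ e(1) by simp
      fix y assume y: "y \<in> swept p t'"
      show "infdist y Q \<noteq> e"
      proof
        assume "infdist y Q = e"
        then have "y \<in> B" using S(1)[OF y] by (simp add: B_def)
        then show False using e'(2)[OF t'(1)] S(2)[OF y] by fastforce
      qed
    qed
    then have "swept p t' \<subseteq> {x \<in> usphere. infdist x Q < e1}" using S(1) e(2) by fastforce
    then show "strict (swept p t')" using e1(2) unfolding strict_def by blast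
  qed
qed

text \<open>Strictness is open in \<open>t\<close>, and so is its failure, since two offending
  points stay in the swept set; the interval is connected and strictness holds for some
  \<open>t\<close>.\<close>

lemma swept_strict:
  assumes p: "p \<in> usphere" and t: "0 < t" "t < pi"
  shows "strict (swept p t)"
proof -
  define I where "I = {t \<in> {0<..<pi}. strict (swept p t)}"
  define J where "J = {t \<in> {0<..<pi}. \<not> strict (swept p t)}"
  have "open I"
    unfolding open_dist
  proof
    fix s assume "s \<in> I"
    then have s: "0 < s" "s < pi" "strict (swept p s)" by (auto simp: I_def)
    obtain e where e: "e > 0" "\<And>t'. \<bar>t' - s\<bar> < e \<Longrightarrow> 0 < t' \<Longrightarrow> t' < pi \<Longrightarrow> strict (swept p t')"
      using swept_strict_open[OF p s] by blast
    show "\<exists>e>0. \<forall>y. dist y s < e \<longrightarrow> y \<in> I"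
      by (rule exI[of _ "min e (min s (pi - s))"]) (use e s in \<open>auto simp: I_def dist_real_def abs_less_iff\<close>)
  qed
  moreover have "open J"
    unfolding open_dist
  proof
    fix s assume "s \<in> J"
    then have s: "0 < s" "s < pi" "\<not> strict (swept p s)" by (auto simp: J_def)
    then obtain q x where qx: "q \<in> swept p s" "x \<in> swept p s" "x \<noteq> q" "\<not> 0 < f x \<bullet> \<nu> q" unfolding strict_def by blast
    obtain e where e: "e > 0" "\<And>t'. \<bar>t' - s\<bar> < e \<Longrightarrow> q \<in> swept p t'" using swept_stable[OF qx(1)] by blast
    obtain e' where e': "e' > 0" "\<And>t'. \<bar>t' - s\<bar> < e' \<Longrightarrow> x \<in> swept p t'" using swept_stable[OF qx(2)] by blast
    have "\<not> strict (swept p t')" if "\<bar>t' - s\<bar> < e" "\<bar>t' - s\<bar> < e'" for t'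
      using strictD[OF _ e(2)[OF that(1)] e'(2)[OF that(2)] qx(3)] qx(4) by blast
    then show "\<exists>e>0. \<forall>y. dist y s < e \<longrightarrow> y \<in> J"
      by (intro exI[of _ "min (min e e') (min s (pi - s))"]) (use e e' s in \<open>auto simp: J_def dist_real_def abs_less_iff\<close>)
  qed
  moreover have "connected {0<..<pi}" by simp
  moreover have "I \<inter> J \<inter> {0<..<pi} = {}" "{0<..<pi} \<subseteq> I \<union> J" by (auto simp: I_def J_def)
  moreover obtain t0 where "0 < t0" "t0 < pi" "strict (swept p t0)" using swept_strict_start[OF p] by blast
  then have "t0 \<in> I \<inter> {0<..<pi}" by (simp add: I_def)
  ultimately have "J \<inter> {0<..<pi} = {}" using connectedD[of "{0<..<pi}" I J] by blast
  then show ?thesis using t by (auto simp: J_def)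
qed

text \<open>Strictness makes \<open>f x \<bullet> \<nu> p\<close> nonnegative on the swept set, and
  up to positive factors turning from \<open>t\<close> to \<open>t'\<close> adds a nonnegative
  multiple of it to the height.\<close>

lemma swept_mono:
  assumes p: "p \<in> usphere" and t: "0 < t" "t \<le> t'" "t' < pi"
  shows "swept p t \<subseteq> swept p t'"
proof -
  have st: "strict (swept p t)" and ps: "p \<in> swept p t" using swept_strict[OF p] swept_self[OF p] t by auto
  have "swept p t \<subseteq> cap (sweep p t')"
  proof
    fix x assume x: "x \<in> swept p t"
    have xS: "x \<in> usphere" and xt: "0 < f x \<bullet> sweep p t" using swept_sub[of p t] x unfolding cap_def by blast+
    have b: "0 \<le> f x \<bullet> \<nu> p" using strictD[OF st ps x] f\<nu>[OF p] by (cases "x = p") (auto simp: less_imp_le)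
    have "sin t * (f x \<bullet> sweep p t') = sin t' * (f x \<bullet> sweep p t) + (f x \<bullet> \<nu> p) * sin (t' - t)"
      by (simp add: sweep_def inner_diff_right sin_diff algebra_simps)
    moreover have "0 < sin t' * (f x \<bullet> sweep p t)" using xt t by (intro mult_pos_pos sin_gt_zero) auto
    moreover have "0 \<le> (f x \<bullet> \<nu> p) * sin (t' - t)" using b t by (intro mult_nonneg_nonneg sin_ge_zero) auto
    ultimately have "0 < sin t * (f x \<bullet> sweep p t')" by linarith
    then have "0 < f x \<bullet> sweep p t'" using sin_gt_zero[of t] t by (simp add: zero_less_mult_iff)
    then show "x \<in> cap (sweep p t')" using xS by (simp add: cap_def)
  qed
  then show ?thesis using swept_maximal[OF swept_connected _ ps swept_self[OF p]] t by simp
qed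

text \<open>The union \<open>U\<close> of the swept sets is open and strict. Without
  \<open>p\<close> it is a good cap for the limiting half space at \<open>t = pi\<close>, so
  \<open>strict_closure\<close> applies once more; this shows that \<open>U\<close> is also closed,
  hence the whole sphere.\<close>

theorem globally_convex:
  assumes pS: "p \<in> usphere" and xS: "x \<in> usphere" and ne: "x \<noteq> p"
  shows "0 < f x \<bullet> \<nu> p"
proof -
  define U where "U = (\<Union>t\<in>{0<..<pi}. swept p t)"
  define V where "V = U - {p}"
  have half: "0 < pi / 2" "pi / 2 < pi" by auto
  have pU: "p \<in> U" unfolding U_def using swept_self[OF pS half] half by (intro UN_I[of "pi/2"]) auto
  have Ut: "\<exists>t. 0 < t \<and> t < pi \<and> y \<in> swept p t" if "y \<in> U" for y using that by (auto simp: U_def)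
  have stU: "strict U"
    unfolding strict_def
  proof (intro ballI impI)
    fix q y assume "q \<in> U" "y \<in> U" and ne: "y \<noteq> q"
    then obtain t t' where t: "0 < t" "t < pi" "q \<in> swept p t" "0 < t'" "t' < pi" "y \<in> swept p t'" using Ut by meson
    have m: "0 < max t t'" "max t t' < pi" using t by auto
    have "q \<in> swept p (max t t')" "y \<in> swept p (max t t')"
      using swept_mono[OF pS t(1), of "max t t'"] swept_mono[OF pS t(4), of "max t t'"] m(2) t(3,6) by auto
    then show "0 < f y \<bullet> \<nu> q" using strictD[OF swept_strict[OF pS m]] ne by blast
  qed
  have openU: "openin (top_of_set usphere) U"
    unfolding U_def
  proof (intro openin_Union ballI)
    fix A assume "A \<in> swept p ` {0<..<pi}"
    then obtain t where A: "A = swept p t" by blast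
    have "openin (top_of_set (cap (sweep p t))) A" unfolding A using good_cap_swept[OF pS] by (simp add: good_cap_def)
    then show "openin (top_of_set usphere) A" using openin_cap by (rule openin_trans)
  qed
  have US: "U \<subseteq> usphere" using openU openin_imp_subset by blast
  have openV: "openin (top_of_set usphere) V"
    unfolding V_def by (intro openin_diff openU closed_subset) (use pS in auto)
  have Vcap: "V \<subseteq> cap (\<nu> p)"
    using strictD[OF stU pU] US by (auto simp: V_def cap_def)
  \<comment> \<open>Around a point \<open>z\<close> strictly inside the half space of
    \<open>\<nu> p\<close>, a connected neighbourhood lies in all half spaces with \<open>t\<close>
    close to \<open>pi\<close>. Since it meets some swept set, monotonicity puts it into a later
    one.\<close>
  have closedV: "closedin (top_of_set (cap (\<nu> p))) V"
  proof -
    have "cap (\<nu> p) \<inter> closure V \<subseteq> V"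
    proof
      fix z assume "z \<in> cap (\<nu> p) \<inter> closure V"
      then have zS: "z \<in> usphere" and zb: "0 < f z \<bullet> \<nu> p" and zc: "z \<in> closure V" by (auto simp: cap_def)
      obtain d where d: "d > 0" "\<And>y. y \<in> usphere \<Longrightarrow> dist y z < d \<Longrightarrow> \<bar>f y \<bullet> \<nu> p - f z \<bullet> \<nu> p\<bar> < f z \<bullet> \<nu> p"
        using sphere_approx[OF continuous_on_inner[OF continuous_on_f continuous_on_const[of _ "\<nu> p"]] zS zb] by blast
      define C where "C = usphere \<inter> cball z (d / 2)"
      have C: "compact C" "C \<subseteq> usphere" by (auto simp: C_def)
      have "0 < 1 * (f y \<bullet> sweep p pi)" if "y \<in> C" for y
        using d(2)[of y] d(1) that by (simp add: C_def sweep_def dist_commute abs_less_iff)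
      then obtain e where e: "e > 0" "\<And>t y. \<bar>t - pi\<bar> < e \<Longrightarrow> y \<in> C \<Longrightarrow> 0 < 1 * (f y \<bullet> sweep p t)"
        using sweep_stable[OF C] by blast
      define t1 where "t1 = max (pi - e / 2) (pi / 2)"
      have t1: "0 < t1" "t1 < pi" "pi - e < t1" using e(1) pi_gt_zero unfolding t1_def by (auto simp: max_def)
      obtain N where N: "openin (top_of_set usphere) N" "connected N" "z \<in> N" "N \<subseteq> usphere \<inter> ball z (d / 2)"
        using locally_path_connected_imp_locally_connected[OF locally_path_connected_sphere] zS d(1)
        unfolding locally_connected by (metis IntI centre_in_ball half_gt_zero open_ball openin_open_Int)
      obtain d' where d': "d' > 0" "\<forall>y\<in>usphere. dist y z < d' \<longrightarrow> y \<in> N"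
        using N(1,3) unfolding openin_euclidean_subtopology_iff by blast
      obtain y where y: "y \<in> V" "dist y z < d'" using closure_dist[OF zc d'(1)] by blast
      then have yN: "y \<in> N" using d'(2) US by (auto simp: V_def)
      obtain t where t: "0 < t" "t < pi" "y \<in> swept p t" using Ut y(1) by (auto simp: V_def)
      have m: "0 < max t t1" "max t t1 < pi" "t1 \<le> max t t1" using t t1 by auto
      have "y \<in> swept p (max t t1)" using swept_mono[OF pS t(1), of "max t t1"] m(2) t(3) by auto
      moreover have "N \<subseteq> cap (sweep p (max t t1))"
      proof
        fix w assume "w \<in> N"
        then have "w \<in> C" using N(4) by (auto simp: C_def)
        moreover have "\<bar>max t t1 - pi\<bar> < e" using m t1(3) by (simp add: abs_less_iff)
        ultimately show "w \<in> cap (sweep p (max t t1))" using e(2) C(2) by (auto simp: cap_def)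
      qed
      ultimately have "N \<subseteq> swept p (max t t1)" using swept_maximal[OF N(2) _ yN] by blast
      then have "z \<in> U" unfolding U_def using N(3) m by (intro UN_I[of "max t t1"]) auto
      moreover have "z \<noteq> p" using zb f\<nu>[OF pS] by auto
      ultimately show "z \<in> V" by (simp add: V_def)
    qed
    then have "V = cap (\<nu> p) \<inter> closure V" using Vcap closure_subset[of V] by blast
    then show ?thesis unfolding closedin_closed by blast
  qed
  have gV: "good_cap (\<nu> p) V"
    unfolding good_cap_def using n\<nu>[OF pS] closedV openin_subset_trans[OF openV Vcap] openin_imp_subset[OF openin_cap] by blast
  have stV: "strict V" using stU unfolding strict_def V_def by blast
  have stcl: "strict (closure V)" by (rule strict_closure[OF gV stV])
  have pcl: "p \<in> closure V"
  proof (rule closureI_dist)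
    fix e :: real assume e: "e > 0"
    obtain d where d: "d > 0" "\<forall>y\<in>usphere. dist y p < d \<longrightarrow> y \<in> U"
      using openU pU unfolding openin_euclidean_subtopology_iff by blast
    obtain v where v: "v \<in> tangent p" "v \<noteq> 0" using tangent_nonzero_exists[OF sphere_nonzero[OF pS] dim3] by blast
    have "min d e > 0" using d(1) e by simp
    then obtain d' where d': "d' > 0" "\<And>s. \<bar>s\<bar> < d' \<Longrightarrow> dist (sphere_curve p v s) p < min d e"
      using sphere_curve_near[OF pS v(1)] by blast
    have s: "\<bar>d'/2\<bar> < d'" "d' / 2 \<noteq> 0" using d'(1) by auto
    have "sphere_curve p v (d'/2) \<in> V"
      unfolding V_def using d(2) d'(2)[OF s(1)] sphere_curve_in[OF pS v(1)] sphere_curve_neq[OF pS v s(2)] by auto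
    then show "\<exists>y\<in>V. dist y p < e" using d'(2)[OF s(1)] by auto
  qed
  \<comment> \<open>Strictness of the closure at its point \<open>p\<close> puts every other limit
    point strictly inside the half space of \<open>\<nu> p\<close>, where \<open>V\<close> is
    relatively closed.\<close>
  have "closure V \<subseteq> U"
  proof
    fix z assume z: "z \<in> closure V"
    show "z \<in> U"
    proof (cases "z = p")
      case False
      have "0 < f z \<bullet> \<nu> p" by (rule strictD[OF stcl pcl z False])
      then have "z \<in> V" by (rule good_cap_closure(3)[OF gV z])
      then show ?thesis by (simp add: V_def)
    qed (use pU in simp)
  qed
  moreover have "U \<subseteq> closure V" using pcl closure_subset[of V] by (auto simp: V_def)
  ultimately have "closed U" by (metis closed_closure subset_antisym)
  then have "closedin (top_of_set usphere) U" using US by (simp add: closed_subset)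
  moreover have "connected (usphere :: 'a set)" using connected_sphere[of "0::'a" 1] dim3 by simp
  ultimately have "U = usphere" using openU pU unfolding connected_clopen by blast
  then show ?thesis using strictD[OF stU pU] xS ne by blast
qed

end

section \<open>The Gauss map\<close>

definition bordered :: "real^'m^'m \<Rightarrow> real^('m::finite option)^('m option)" where
  "bordered A = (\<chi> i j. case i of None \<Rightarrow> (case j of None \<Rightarrow> 1 | Some _ \<Rightarrow> 0)
     | Some i' \<Rightarrow> (case j of None \<Rightarrow> 0 | Some j' \<Rightarrow> A $ i' $ j'))"

lemma prod_UNIV_option: "(\<Prod>i\<in>UNIV. g i) = g None * (\<Prod>j\<in>UNIV. g (Some j))" for g :: "'n::finite option \<Rightarrow> 'b::comm_monoid_mult"
  by (simp add: UNIV_option_conv prod.reindex)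

lemma bordered_nth [simp]:
  "bordered A $ None $ None = 1" "bordered A $ None $ Some j = 0" "bordered A $ Some i $ None = 0" "bordered A $ Some i $ Some j = A $ i $ j"
  by (simp_all add: bordered_def)

lemma option_vec_eqI: "x $ None = y $ None \<Longrightarrow> (\<And>i. x $ Some i = y $ Some i) \<Longrightarrow> x = y" for x y :: "'b^('n::finite option)"
  by (metis (full_types) vec_eq_iff option.exhaust)

lemma matrix_mult_option:
  "((A :: real^('k::finite option)^'l) ** B) $ i $ j = A $ i $ None * B $ None $ j + (\<Sum>k\<in>UNIV. A $ i $ Some k * B $ Some k $ j)"
  by (simp add: matrix_matrix_mult_def sum_UNIV_option)

lemma matrix_vector_option:
  "((A :: real^('k::finite option)^'l) *v c) $ i = A $ i $ None * c $ None + (\<Sum>k\<in>UNIV. A $ i $ Some k * c $ Some k)"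
  by (simp add: matrix_vector_mult_def sum_UNIV_option)

lemma bordered_mult: "bordered (A ** B) = bordered A ** bordered B"
  by (intro option_vec_eqI; simp add: matrix_matrix_mult_def sum_UNIV_option)

lemma det_elementary:
  fixes c :: real and m n :: "'n::finite"
  assumes "m \<noteq> n"
  shows "det (\<chi> i j. if i = m \<and> j = n then c else of_bool (i = j) :: real^'n^'n) = 1"
proof -
  have "(\<chi> i j. if i = m \<and> j = n then c else of_bool (i = j) :: real^'n^'n) =
      (\<chi> k. if k = m then row m (mat 1 :: real^'n^'n) + c *s row n (mat 1) else row k (mat 1))"
    using assms by (simp add: vec_eq_iff row_def mat_def)
  then show ?thesis using det_row_operation[OF assms, of "mat 1 :: real^'n^'n" c] by (simp only: det_I)
qed

lemma det_swap_columns: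
  fixes m n :: "'n::finite"
  assumes "m \<noteq> n"
  shows "det (\<chi> i j. (mat 1 :: real^'n^'n) $ i $ Transposition.transpose m n j) = -1"
  using det_permute_columns[OF permutes_swap_id[of m UNIV n], of "mat 1 :: real^'n^'n"] assms by (simp add: sign_swap_id)

text \<open>Both sides are multiplicative, so it suffices to compare them on elementary matrices;
  this avoids relating permutations of the two index types.\<close>

lemma det_bordered: "det (bordered A) = det A"
proof (induction A rule: induct_matrix_elementary)
  case (1 A B)
  then show ?case by (simp add: bordered_mult det_mul)
next
  case (2 A i)
  have "row (Some i) (bordered A) = 0"
    using 2 by (intro option_vec_eqI) (simp_all add: row_def vec_eq_iff)
  then show ?case using 2 by (simp add: det_zero_row)
next
  case (3 A)
  have "bordered A $ i $ j = 0" if "i \<noteq> j" for i j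
    using that 3 by (cases i; cases j) auto
  then show ?case using 3 by (simp add: det_diagonal prod_UNIV_option)
next
  case (4 m n)
  have "bordered (\<chi> i j. mat 1 $ i $ Transposition.transpose m n j) =
      (\<chi> i j. mat 1 $ i $ Transposition.transpose (Some m) (Some n) j)"
    by (intro option_vec_eqI) (auto simp: mat_def Transposition.transpose_def)
  then show ?case using det_swap_columns[OF 4] det_swap_columns[of "Some m" "Some n"] 4 by simp
next
  case (5 m n c)
  have "bordered (\<chi> i j. if i = m \<and> j = n then c else of_bool (i = j)) =
      (\<chi> i j. if i = Some m \<and> j = Some n then c else of_bool (i = j))"
    by (intro option_vec_eqI) auto
  then show ?case using det_elementary[OF 5, of c] det_elementary[of "Some m" "Some n" c] 5 by simp
qed

definition det_cols :: "('m::finite \<Rightarrow> real^'m) \<Rightarrow> real" where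
  "det_cols R = det (\<chi> i j. R j $ i)"

lemma det_cols_rows: "det_cols R = det (\<chi> j. R j)"
proof -
  have "transpose (\<chi> j. R j) = (\<chi> i j. R j $ i)" by (simp add: vec_eq_iff transpose_def)
  then show ?thesis unfolding det_cols_def by (metis det_transpose)
qed

lemma linear_det_cols: "linear (\<lambda>w. det_cols (R(k := w)))"
proof (rule linearI)
  have eq: "(\<chi> j. (R(k := w)) j) = (\<chi> j. if j = k then (\<lambda>_. w) j else R j)" for w by (simp add: vec_eq_iff)
  show "det_cols (R(k := v + w)) = det_cols (R(k := v)) + det_cols (R(k := w))" for v w
    unfolding det_cols_rows eq using det_row_add[of k "\<lambda>_. v" "\<lambda>_. w" R] by simp
  show "det_cols (R(k := c *\<^sub>R w)) = c *\<^sub>R det_cols (R(k := w))" for c w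
    unfolding det_cols_rows eq using det_row_mul[of k c "\<lambda>_. w" R, unfolded scalar_mult_eq_scaleR] by simp
qed

lemma det_cols_identical: "i \<noteq> j \<Longrightarrow> R i = R j \<Longrightarrow> det_cols R = 0"
  unfolding det_cols_rows by (rule det_identical_rows[of i j]) (simp_all add: row_def)

lemma det_cols_nonzero:
  assumes "\<And>c. (\<Sum>j\<in>UNIV. c $ j *\<^sub>R R j) = 0 \<Longrightarrow> c = 0"
  shows "det_cols R \<noteq> 0"
proof -
  have "(\<chi> i j. R j $ i) *v c = (\<Sum>j\<in>UNIV. c $ j *\<^sub>R R j)" for c
    by (simp add: matrix_vector_mult_def vec_eq_iff mult.commute)
  then have "\<exists>B. B ** (\<chi> i j. R j $ i) = mat 1"
    unfolding matrix_left_invertible_ker using assms by simp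
  then show ?thesis unfolding det_cols_def by (simp flip: invertible_det_nz invertible_left_inverse)
qed

lemma orthonormal_sum_inner:
  fixes R :: "'i::finite \<Rightarrow> 'a::real_inner"
  assumes "orthonormal R"
  shows "(\<Sum>j\<in>UNIV. c j *\<^sub>R R j) \<bullet> R k = c k"
proof -
  have "R j \<bullet> R k = (if j = k then 1 else 0)" for j using assms unfolding orthonormal_def by blast
  then have "(\<Sum>j\<in>UNIV. c j *\<^sub>R R j) \<bullet> R k = (\<Sum>j\<in>UNIV. if j = k then c j else 0)"
    unfolding inner_sum_left by (intro sum.cong) auto
  then show ?thesis by simp
qed

lemma det_cols_orthonormal:
  assumes "orthonormal R"
  shows "det_cols R \<noteq> 0"
proof (rule det_cols_nonzero)
  fix c assume c: "(\<Sum>j\<in>UNIV. c $ j *\<^sub>R R j) = 0"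
  have "c $ k = (\<Sum>j\<in>UNIV. c $ j *\<^sub>R R j) \<bullet> R k" for k
    by (rule orthonormal_sum_inner[OF assms, symmetric])
  then show "c = 0" using c by (simp add: vec_eq_iff)
qed

lemma det_eq_0_kernel:
  fixes A :: "real^'m^'m"
  assumes "A *v c = 0" "c \<noteq> 0"
  shows "det A = 0"
proof (rule ccontr)
  assume "det A \<noteq> 0"
  then have "\<exists>B. B ** A = mat 1" by (simp flip: invertible_det_nz invertible_left_inverse)
  then show False unfolding matrix_left_invertible_ker using assms by blast
qed

text \<open>Apart from its last column \<open>f p\<close>, this is the matrix of
  \<open>v \<mapsto> Dh f p v + (p \<bullet> v) *\<^sub>R w\<close> on the ambient space, which is
  the differential on tangent vectors and sends \<open>p\<close> to \<open>w\<close>. No frame of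
  the sphere is chosen, so the determinant is globally smooth.\<close>

definition frame_matrix :: "('n::finite euc1 \<Rightarrow> 'n euc2) \<Rightarrow> 'n euc1 \<Rightarrow> 'n euc2 \<Rightarrow> 'n mat2" where
  "frame_matrix f p w = (\<chi> i j. (case j of None \<Rightarrow> f p | Some k \<Rightarrow> Dh f p (axis k 1) + (p $ k) *\<^sub>R w) $ i)"

definition orient :: "('n::finite euc1 \<Rightarrow> 'n euc2) \<Rightarrow> 'n euc1 \<Rightarrow> 'n euc2 \<Rightarrow> real" where
  "orient f p w = det (frame_matrix f p w)"

definition frame_cols :: "('n::finite euc1 \<Rightarrow> 'n euc2) \<Rightarrow> 'n euc1 \<Rightarrow> ('n \<Rightarrow> 'n euc1) \<Rightarrow> 'n euc2 \<Rightarrow> 'n option option \<Rightarrow> 'n euc2" where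
  "frame_cols f p u w = case_option (f p) (case_option w (\<lambda>k. Dh f p (u k)))"

lemma frame_sum:
  fixes D :: "'k::finite \<Rightarrow> real^'l" and p c :: "real^'k"
  shows "(\<Sum>k\<in>UNIV. (D k + (p $ k) *\<^sub>R w) $ i * c $ k) = (\<Sum>k\<in>UNIV. c $ k *\<^sub>R D k) $ i + (p \<bullet> c) * w $ i"
proof -
  have "(D k + (p $ k) *\<^sub>R w) $ i * c $ k = c $ k * D k $ i + (p $ k * c $ k) * w $ i" for k
    by (simp add: algebra_simps)
  then show ?thesis by (simp add: inner_vec_def sum.distrib sum_distrib_right)
qed

lemma euc_expand: "(\<Sum>k\<in>UNIV. c $ k *\<^sub>R axis k 1) = c" for c :: "real^'m"
  using basis_expansion[of c] by (simp add: scalar_mult_eq_scaleR)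

text \<open>Multiplying the frame matrix on the right by the bordered matrix of \<open>u\<close> and
  \<open>p\<close> produces the columns \<open>Dh f p (u k)\<close>, \<open>w\<close> and
  \<open>f p\<close>. Hence the sign of \<open>orient\<close> decides orientation for all positive
  \<open>u\<close> at once.\<close>

lemma orient_frame:
  fixes f :: "'n::finite euc1 \<Rightarrow> 'n euc2"
  assumes f: "smooth_map_on usphere f" and p: "p \<in> usphere" and u: "\<And>k. u k \<in> tangent p"
  shows "det_cols (frame_cols f p u w) = orient f p w * det_cols (case_option p u)"
proof -
  let ?U = "(\<chi> i j. (case_option p u j) $ i) :: real^'n option^'n option"
  have lin: "linear (Dh f p)" by (rule linear_Dh[OF f sphere_nonzero[OF p]])
  have "frame_matrix f p w ** bordered ?U = (\<chi> i j. frame_cols f p u w j $ i)"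
  proof (simp only: vec_eq_iff, intro allI)
    fix i j
    show "(frame_matrix f p w ** bordered ?U) $ i $ j = (\<chi> i j. frame_cols f p u w j $ i) $ i $ j"
    proof (cases j)
      case None
      then show ?thesis by (simp add: matrix_mult_option frame_matrix_def frame_cols_def)
    next
      case (Some l)
      let ?c = "case_option p u l"
      have "(frame_matrix f p w ** bordered ?U) $ i $ Some l = (\<Sum>k\<in>UNIV. (Dh f p (axis k 1) + (p $ k) *\<^sub>R w) $ i * ?c $ k)"
        by (simp add: matrix_mult_option frame_matrix_def)
      also have "\<dots> = (\<Sum>k\<in>UNIV. ?c $ k *\<^sub>R Dh f p (axis k 1)) $ i + (p \<bullet> ?c) * w $ i"
        by (rule frame_sum)
      also have "(\<Sum>k\<in>UNIV. ?c $ k *\<^sub>R Dh f p (axis k 1)) = Dh f p ?c"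
        using arg_cong[OF euc_expand[of ?c], of "Dh f p"] by (simp add: linear_sum[OF lin] linear_cmul[OF lin])
      also have "Dh f p ?c $ i + (p \<bullet> ?c) * w $ i = frame_cols f p u w (Some l) $ i"
      proof (cases l)
        case None
        then show ?thesis using Dh_self[OF f sphere_nonzero[OF p]] p by (simp add: frame_cols_def dot_square_norm)
      next
        case (Some k)
        then show ?thesis using u[of k] by (simp add: frame_cols_def tangent_def inner_commute)
      qed
      finally show ?thesis unfolding Some by simp
    qed
  qed
  then have "det_cols (frame_cols f p u w) = det (frame_matrix f p w ** bordered ?U)" by (simp add: det_cols_def)
  also have "\<dots> = orient f p w * det_cols (case_option p u)"
    by (simp add: det_mul det_bordered orient_def det_cols_def)
  finally show ?thesis .
qed

lemma pos_basis_iff: "pos_basis p u \<longleftrightarrow> (\<forall>k. u k \<in> tangent p) \<and> 0 < det_cols (case_option p u)"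
  by (simp add: pos_basis_def det_cols_def)

text \<open>Frames are orthonormal in the induced metric, so an orthonormal basis of the image is
  pulled back, and one vector is reversed if the orientation is wrong.\<close>

lemma exists_frame:
  fixes g :: "'n::finite euc1 \<Rightarrow> 'b::euclidean_space"
  assumes p: "p \<in> usphere" and lin: "linear g" and inj: "\<And>u. u \<in> tangent p \<Longrightarrow> g u = 0 \<Longrightarrow> u = 0"
  obtains u where "pos_basis p u" "orthonormal (\<lambda>i. g (u i))"
proof -
  have p0: "p \<noteq> 0" using p by auto
  have "inj_on g (tangent p)"
    using linear_inj_on_iff_eq_0[OF lin subspace_tangent, of p] inj by blast
  then have d: "dim (g ` tangent p) = CARD('n)"
    using dim_image_eq[OF lin, of "tangent p"] dim_tangent[OF p0] by (simp add: span_eq_iff[THEN iffD2, OF subspace_tangent])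
  obtain B where B: "B \<subseteq> g ` tangent p" "pairwise orthogonal B" "\<And>x. x \<in> B \<Longrightarrow> norm x = 1" "independent B" "card B = dim (g ` tangent p)" "span B = g ` tangent p"
    by (rule orthonormal_basis_subspace[OF linear_subspace_image[OF lin subspace_tangent[of p]]]) (rule that, assumption+)
  have "finite B" using B(4) independent_imp_finite by blast
  then obtain h where h: "bij_betw h (UNIV :: 'n set) B" using B(5) d finite_same_card_bij[of "UNIV :: 'n set" B] by auto
  have hB: "h i \<in> B" for i by (rule bij_betw_apply[OF h UNIV_I])
  have "\<exists>u. u \<in> tangent p \<and> g u = h i" for i
    using subsetD[OF B(1) hB[of i]] by (rule imageE) (intro exI conjI, assumption, simp)
  then obtain u where u: "\<And>i. u i \<in> tangent p" "\<And>i. g (u i) = h i" by metis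
  have "h i \<bullet> h j = (if i = j then 1 else 0)" for i j
  proof (cases "i = j")
    case True then show ?thesis using B(3)[OF hB[of i]] by (simp add: norm_eq_1)
  next
    case False
    then have "h i \<noteq> h j" using inj_on_eq_iff[OF bij_betw_imp_inj_on[OF h], of i j] by simp
    then show ?thesis using B(2) hB[of i] hB[of j] False unfolding pairwise_def orthogonal_def by simp
  qed
  then have on: "orthonormal (\<lambda>i. g (u i))" unfolding orthonormal_def u(2) by blast
  have nz: "det_cols (case_option p u) \<noteq> 0"
  proof (rule det_cols_nonzero)
    fix c :: "'n euc1" assume "(\<Sum>j\<in>UNIV. c $ j *\<^sub>R case_option p u j) = 0"
    then have c: "c $ None *\<^sub>R p + (\<Sum>j\<in>UNIV. c $ Some j *\<^sub>R u j) = 0" by (simp add: sum_UNIV_option)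
    have "(\<Sum>j\<in>UNIV. c $ Some j *\<^sub>R u j) \<bullet> p = 0" using u(1) by (simp add: inner_sum_left tangent_def)
    then have c0: "c $ None = 0" using arg_cong[OF c, of "\<lambda>x. x \<bullet> p"] p0 by (simp add: inner_add_left)
    then have "(\<Sum>j\<in>UNIV. c $ Some j *\<^sub>R u j) = 0" using c by simp
    from arg_cong[OF this, of g] have "(\<Sum>j\<in>UNIV. c $ Some j *\<^sub>R g (u j)) = 0"
      by (simp add: linear_sum[OF lin] linear_cmul[OF lin] linear_0[OF lin])
    from arg_cong[OF this, of "\<lambda>x. x \<bullet> g (u k)" for k] have "c $ Some k = 0" for k
      by (simp only: orthonormal_sum_inner[OF on] inner_zero_left)
    then show "c = 0" using c0 by (intro option_vec_eqI) auto
  qed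
  show ?thesis
  proof (cases "det_cols (case_option p u) > 0")
    case True
    then show ?thesis using that[of u] u(1) on by (simp add: pos_basis_iff)
  next
    case False
    obtain k0 :: 'n where True by blast
    define u' where "u' = u(k0 := - u k0)"
    have "case_option p u' = (case_option p u)(Some k0 := - u k0)" by (auto simp: u'_def fun_eq_iff split: option.split)
    moreover have "det_cols ((case_option p u)(Some k0 := - u k0)) = - det_cols ((case_option p u)(Some k0 := u k0))"
      by (rule linear_neg[OF linear_det_cols])
    moreover have "(case_option p u)(Some k0 := u k0) = case_option p u" by (auto simp: fun_eq_iff split: option.split)
    ultimately have "det_cols (case_option p u') = - det_cols (case_option p u)" by simp
    then have "pos_basis p u'" using False nz u(1) tangent_minus[OF u(1)[of k0]] by (simp add: pos_basis_iff u'_def)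
    moreover have "orthonormal (\<lambda>i. g (u' i))"
      using on linear_neg[OF lin] unfolding orthonormal_def u'_def by (auto split: if_splits)
    ultimately show ?thesis by (rule that)
  qed
qed

section \<open>The Gauss map as a normalized cross product\<close>

lemma immersion_smooth: "immersion f \<Longrightarrow> smooth_map_on usphere f"
  by (simp add: immersion_def smooth_maps_def)

lemma smooth_maps_norm: "f \<in> smooth_maps \<Longrightarrow> p \<in> usphere \<Longrightarrow> norm (f p) = 1"
  by (auto simp: smooth_maps_def PiE_iff)

lemma immersion_iff:
  fixes f :: "'n::finite euc1 \<Rightarrow> 'b::euclidean_space"
  shows "immersion f \<longleftrightarrow> f \<in> smooth_maps \<and> (\<forall>p\<in>usphere. \<forall>u\<in>tangent p. Dh f p u = 0 \<longrightarrow> u = 0)"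
proof -
  have "inj_on (dS f p) (tangent p) \<longleftrightarrow> (\<forall>u\<in>tangent p. Dh f p u = 0 \<longrightarrow> u = 0)" if f: "f \<in> smooth_maps" and p: "p \<in> usphere" for p
  proof -
    have "inj_on (dS f p) (tangent p) \<longleftrightarrow> inj_on (Dh f p) (tangent p)"
      by (rule inj_on_cong) (rule dS_eq_Dh[OF smooth_maps_smooth[OF f] p])
    then show ?thesis using linear_inj_on_iff_eq_0[OF linear_Dh[OF smooth_maps_smooth[OF f] sphere_nonzero[OF p]] subspace_tangent] by simp
  qed
  then show ?thesis unfolding immersion_def by blast
qed

text \<open>The generalized cross product, read off from the linear functional
  \<open>orient f p\<close>. It replaces the description by \<open>THE\<close> in
  \<open>gauss_map\<close> by a formula in the first derivatives of \<open>f\<close>.\<close>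

definition cross_normal :: "('n::finite euc1 \<Rightarrow> 'n euc2) \<Rightarrow> 'n euc1 \<Rightarrow> 'n euc2" where
  "cross_normal f p = (\<chi> i. orient f p (axis i 1))"

context
  fixes f :: "'n::finite euc1 \<Rightarrow> 'n euc2" and p :: "'n euc1"
  assumes imm: "immersion f" and p: "p \<in> usphere"
begin

private lemma f: "smooth_map_on usphere f" "norm (f p) = 1" "f p \<bullet> f p = 1"
  using immersion_smooth[OF imm] smooth_maps_norm[OF _ p, of f] imm by (simp_all add: immersion_def norm_eq_1)

private lemma inj: "u \<in> tangent p \<Longrightarrow> Dh f p u = 0 \<Longrightarrow> u = 0"
  using imm p unfolding immersion_iff by blast

private lemma lin: "linear (Dh f p)"
  by (rule linear_Dh[OF f(1) sphere_nonzero[OF p]])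

private lemma frame_cols_upd: "frame_cols f p u w = (frame_cols f p u 0)(Some None := w)"
  by (auto simp: frame_cols_def fun_eq_iff split: option.split)

text \<open>In \<open>frame_matrix\<close> the vector \<open>w\<close> enters many columns, but by
  \<open>orient_frame\<close> it enters a single column of the frame, which makes the dependence
  linear.\<close>

lemma orient_inner: "orient f p w = cross_normal f p \<bullet> w"
proof -
  obtain u where u: "pos_basis p u" "orthonormal (\<lambda>i. Dh f p (u i))" using exists_frame[OF p lin inj] by blast
  then have uT: "\<And>k. u k \<in> tangent p" and d: "det_cols (case_option p u) > 0" by (auto simp: pos_basis_iff)
  have eq: "orient f p w = det_cols (frame_cols f p u w) / det_cols (case_option p u)" for w
    using orient_frame[OF f(1) p uT] d by simp
  define R0 where "R0 = frame_cols f p u 0"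
  define d where "d = det_cols (case_option p u)"
  have eq': "orient f p w = det_cols (R0(Some None := w)) / d" for w
    by (simp only: eq frame_cols_upd[of u w] R0_def d_def)
  have l: "linear (\<lambda>w. orient f p w)"
    by (rule linearI) (simp_all only: eq' linear_add[OF linear_det_cols] linear_cmul[OF linear_det_cols] add_divide_distrib,
      simp)
  have "orient f p w = orient f p (\<Sum>k\<in>UNIV. w $ k *\<^sub>R axis k 1)" by (simp add: euc_expand)
  also have "\<dots> = cross_normal f p \<bullet> w"
    by (simp add: linear_sum[OF l] linear_cmul[OF l] cross_normal_def inner_vec_def mult.commute)
  finally show ?thesis .
qed

text \<open>For \<open>w\<close> in the span of the other columns the frame matrix is singular. The
  kernel vectors are explicit: \<open>p\<close> with last entry \<open>-1\<close> for
  \<open>w = f p\<close>, and \<open>p - u\<close> with last entry \<open>0\<close> for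
  \<open>w = Dh f p u\<close>.\<close>

lemma cross_normal_orthogonal:
  shows cross_normal_f: "cross_normal f p \<bullet> f p = 0"
    and cross_normal_Dh: "u \<in> tangent p \<Longrightarrow> cross_normal f p \<bullet> Dh f p u = 0"
proof -
  have mv: "frame_matrix f p w *v c = Dh f p (\<chi> k. c $ Some k) + (p \<bullet> (\<chi> k. c $ Some k)) *\<^sub>R w + c $ None *\<^sub>R f p" for w c
  proof -
    have "Dh f p (\<chi> k. c $ Some k) = (\<Sum>k\<in>UNIV. c $ Some k *\<^sub>R Dh f p (axis k 1))"
      by (subst euc_expand[symmetric]) (simp only: linear_sum[OF lin] linear_cmul[OF lin] vec_lambda_beta)
    then show ?thesis
      using frame_sum[of "\<lambda>k. Dh f p (axis k 1)" p w _ "\<chi> k. c $ Some k"]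
      by (simp add: vec_eq_iff matrix_vector_option frame_matrix_def)
  qed
  have "frame_matrix f p (f p) *v (\<chi> k. case k of None \<Rightarrow> -1 | Some k \<Rightarrow> p $ k) = 0"
    unfolding mv using Dh_self[OF f(1) sphere_nonzero[OF p]] p by (simp add: dot_square_norm)
  then have "det (frame_matrix f p (f p)) = 0"
    by (rule det_eq_0_kernel) (auto simp: vec_eq_iff intro!: exI[of _ None])
  then show "cross_normal f p \<bullet> f p = 0" by (simp add: orient_def flip: orient_inner)
  assume u: "u \<in> tangent p"
  have "frame_matrix f p (Dh f p u) *v (\<chi> k. case k of None \<Rightarrow> 0 | Some k \<Rightarrow> (p - u) $ k) = 0"
  proof -
    have "(\<chi> k. (p - u) $ k) = p - u" by (simp add: vec_eq_iff)
    moreover have "p \<bullet> (p - u) = 1" using u p by (simp add: tangent_def inner_diff_right inner_commute dot_square_norm)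
    ultimately show ?thesis
      unfolding mv using Dh_self[OF f(1) sphere_nonzero[OF p]] by (simp add: linear_diff[OF lin])
  qed
  moreover have "p - u \<noteq> 0" using u p by (auto simp: tangent_def dot_square_norm)
  then have "(\<chi> k. case k of None \<Rightarrow> 0 | Some k \<Rightarrow> (p - u) $ k) \<noteq> (0 :: 'n euc2)"
    by (auto simp: vec_eq_iff split: option.splits)
  ultimately have "det (frame_matrix f p (Dh f p u)) = 0" by (rule det_eq_0_kernel)
  then show "cross_normal f p \<bullet> Dh f p u = 0" by (simp add: orient_def flip: orient_inner)
qed

lemma Dh_tangent_f: "Dh f p u \<bullet> f p = 0"
proof -
  have "f x \<bullet> f x = 1" if "x \<in> usphere" for x
    using smooth_maps_norm[OF _ that, of f] imm by (simp add: immersion_def norm_eq_1)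
  from const_inner_derivative[OF f(1) f(1) this p, of u] show ?thesis by (simp add: inner_commute)
qed

lemma orient_nonzero:
  assumes "z \<bullet> f p = 0" "\<And>u. u \<in> tangent p \<Longrightarrow> z \<bullet> Dh f p u = 0" "z \<noteq> 0"
  shows "orient f p z \<noteq> 0"
proof -
  obtain u where u: "pos_basis p u" "orthonormal (\<lambda>i. Dh f p (u i))" by (rule exists_frame[OF p lin inj])
  have uT: "\<And>k. u k \<in> tangent p" using u(1) by (simp add: pos_basis_iff)
  define y where "y = z /\<^sub>R norm z"
  have y: "y \<bullet> y = 1" "y \<bullet> f p = 0" "\<And>k. y \<bullet> Dh f p (u k) = 0"
    using assms(1,3) assms(2)[OF uT] by (simp_all add: y_def dot_square_norm power2_eq_square)
  have "orthonormal (frame_cols f p u y)"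
    using u(2) y f(3) Dh_tangent_f unfolding orthonormal_def frame_cols_def
    by (auto split: option.split simp: inner_commute)
  from det_cols_orthonormal[OF this] have "cross_normal f p \<bullet> y \<noteq> 0"
    using orient_frame[OF f(1) p uT, where w=y] by (simp add: orient_inner)
  then show ?thesis by (simp add: orient_inner y_def)
qed

lemma cross_normal_nonzero: "cross_normal f p \<noteq> 0"
proof -
  have p0: "p \<noteq> 0" using p by auto
  define V where "V = span (insert (f p) (Dh f p ` tangent p))"
  have s: "subspace (Dh f p ` tangent p)" by (rule linear_subspace_image[OF lin subspace_tangent])
  have "dim (insert (f p) (Dh f p ` tangent p)) \<le> dim (Dh f p ` tangent p) + 1"
    by (simp add: dim_insert)
  also have "dim (Dh f p ` tangent p) \<le> dim (tangent p)" by (rule dim_image_le[OF lin])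
  finally have "dim V < DIM('n euc2)" using dim_tangent[OF p0] by (simp add: V_def)
  then obtain z where z: "z \<noteq> 0" "\<And>y. y \<in> V \<Longrightarrow> orthogonal z y"
    using orthogonal_to_subspace_exists[of "V"] by (metis (no_types, lifting) V_def span_span)
  have "z \<bullet> f p = 0" "\<And>u. u \<in> tangent p \<Longrightarrow> z \<bullet> Dh f p u = 0"
    using z(2) unfolding V_def by (auto simp: orthogonal_def intro: span_base)
  from orient_nonzero[OF this z(1)] show ?thesis by (auto simp: orient_inner)
qed

lemma unit_normal_eq:
  assumes "\<nu> \<bullet> f p = 0" "\<And>u. u \<in> tangent p \<Longrightarrow> \<nu> \<bullet> Dh f p u = 0" "\<nu> \<bullet> \<nu> = 1" "orient f p \<nu> > 0"
  shows "\<nu> = cross_normal f p /\<^sub>R norm (cross_normal f p)"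
proof -
  define N where "N = cross_normal f p /\<^sub>R norm (cross_normal f p)"
  have N: "N \<bullet> N = 1" "N \<bullet> f p = 0" "\<And>u. u \<in> tangent p \<Longrightarrow> N \<bullet> Dh f p u = 0"
    using cross_normal_nonzero cross_normal_f cross_normal_Dh by (simp_all add: N_def dot_square_norm power2_eq_square)
  have cN: "cross_normal f p = norm (cross_normal f p) *\<^sub>R N" using cross_normal_nonzero by (simp add: N_def)
  have oN: "orient f p w = norm (cross_normal f p) * (N \<bullet> w)" for w
    unfolding orient_inner by (subst cN) simp
  define z where "z = \<nu> - (\<nu> \<bullet> N) *\<^sub>R N"
  have "orient f p z = 0" unfolding oN using N(1) by (simp add: z_def inner_diff_right inner_commute)
  moreover have "z \<bullet> f p = 0" "\<And>u. u \<in> tangent p \<Longrightarrow> z \<bullet> Dh f p u = 0"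
    using assms(1,2) N by (simp_all add: z_def inner_diff_left)
  ultimately have "z = 0" using orient_nonzero[of z] by blast
  then have e: "\<nu> = (\<nu> \<bullet> N) *\<^sub>R N" by (simp add: z_def)
  have "0 < N \<bullet> \<nu>" using assms(4) unfolding oN using cross_normal_nonzero by (simp add: zero_less_mult_iff)
  moreover have "(\<nu> \<bullet> N) * (\<nu> \<bullet> N) = 1"
    using arg_cong[OF e, of "\<lambda>x. x \<bullet> \<nu>"] assms(3) by (simp add: inner_commute)
  ultimately have "\<nu> \<bullet> N = 1" by (simp add: inner_commute square_eq_1_iff)
  then show ?thesis using e by (simp add: N_def)
qed

text \<open>The condition that defines the Gauss map is stated for a frame, but means the same for
  each of them: \<open>\<nu>\<close> is the unit normal on the positive side. Hence
  \<open>THE\<close> is unambiguous.\<close>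

lemma frame_condition_iff:
  assumes u: "pos_basis p u" "orthonormal (\<lambda>i. dS f p (u i))"
  shows "pos_basis (f p) (case_option \<nu> (\<lambda>i. dS f p (u i))) \<and> orthonormal (case_option \<nu> (\<lambda>i. dS f p (u i)))
    \<longleftrightarrow> \<nu> \<bullet> f p = 0 \<and> (\<forall>u\<in>tangent p. \<nu> \<bullet> Dh f p u = 0) \<and> \<nu> \<bullet> \<nu> = 1 \<and> orient f p \<nu> > 0"
proof -
  have uT: "\<And>k. u k \<in> tangent p" and d: "det_cols (case_option p u) > 0" using u(1) by (auto simp: pos_basis_iff)
  have dS: "dS f p (u i) = Dh f p (u i)" for i by (rule dS_eq_Dh[OF f(1) p uT])
  have "case_option (f p) (case_option \<nu> (\<lambda>k. Dh f p (u k))) = frame_cols f p u \<nu>" by (simp add: frame_cols_def)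
  then have 1: "pos_basis (f p) (case_option \<nu> (\<lambda>i. dS f p (u i))) \<longleftrightarrow> \<nu> \<bullet> f p = 0 \<and> orient f p \<nu> > 0"
    unfolding pos_basis_iff dS using orient_frame[OF f(1) p uT, where w=\<nu>] d
    by (auto simp: tangent_def Dh_tangent_f zero_less_mult_iff split: option.split)
  have 2: "orthonormal (case_option \<nu> (\<lambda>i. dS f p (u i))) \<longleftrightarrow> \<nu> \<bullet> \<nu> = 1 \<and> (\<forall>k. \<nu> \<bullet> Dh f p (u k) = 0)"
    using u(2) unfolding dS orthonormal_def split_option_all by (auto simp: inner_commute)
  have 3: "(\<forall>k. \<nu> \<bullet> Dh f p (u k) = 0) \<longleftrightarrow> (\<forall>u\<in>tangent p. \<nu> \<bullet> Dh f p u = 0)"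
  proof
    assume z: "\<forall>k. \<nu> \<bullet> Dh f p (u k) = 0"
    show "\<forall>u\<in>tangent p. \<nu> \<bullet> Dh f p u = 0"
    proof
      fix v assume v: "v \<in> tangent p"
      define A where "A = (\<chi> i j. (case_option p u j) $ i)"
      have "invertible A" using d by (simp add: A_def det_cols_def invertible_det_nz)
      then obtain B where B: "A ** B = mat 1" unfolding invertible_def by blast
      define c where "c = B *v v"
      have "A *v c = v" by (simp add: c_def matrix_vector_mul_assoc B)
      then have "v = (\<Sum>j\<in>UNIV. c $ j *\<^sub>R case_option p u j)"
        by (auto simp: A_def matrix_vector_mult_def vec_eq_iff mult.commute)
      then have v': "v = c $ None *\<^sub>R p + (\<Sum>j\<in>UNIV. c $ Some j *\<^sub>R u j)" by (simp add: sum_UNIV_option)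
      have "Dh f p v = (\<Sum>j\<in>UNIV. c $ Some j *\<^sub>R Dh f p (u j))"
        using arg_cong[OF v', of "Dh f p"] Dh_self[OF f(1) sphere_nonzero[OF p]]
        by (simp only: linear_add[OF lin] linear_sum[OF lin] linear_cmul[OF lin]) simp
      then show "\<nu> \<bullet> Dh f p v = 0" using z by (simp add: inner_sum_right)
    qed
  qed (use uT in blast)
  show ?thesis using 1 2 3 by blast
qed

lemma gauss_map_eq: "gauss_map f p = cross_normal f p /\<^sub>R norm (cross_normal f p)"
proof -
  define N where "N = cross_normal f p /\<^sub>R norm (cross_normal f p)"
  have N: "N \<bullet> f p = 0 \<and> (\<forall>u\<in>tangent p. N \<bullet> Dh f p u = 0) \<and> N \<bullet> N = 1 \<and> orient f p N > 0"
    using cross_normal_nonzero cross_normal_f cross_normal_Dh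
    by (auto simp: N_def dot_square_norm power2_eq_square orient_inner)
  obtain u where u: "pos_basis p u" "orthonormal (\<lambda>i. Dh f p (u i))" by (rule exists_frame[OF p lin inj])
  have uT: "\<And>k. u k \<in> tangent p" using u(1) by (simp add: pos_basis_iff)
  have u': "orthonormal (\<lambda>i. dS f p (u i))" using u(2) by (simp add: dS_eq_Dh[OF f(1) p uT])
  show ?thesis unfolding gauss_map_def N_def[symmetric]
  proof (rule the_equality)
    fix \<nu>
    assume "\<forall>u. pos_basis p u \<and> orthonormal (\<lambda>i. dS f p (u i)) \<longrightarrow>
      pos_basis (f p) (case_option \<nu> (\<lambda>i. dS f p (u i))) \<and> orthonormal (case_option \<nu> (\<lambda>i. dS f p (u i)))"
    then have "\<nu> \<bullet> f p = 0 \<and> (\<forall>u\<in>tangent p. \<nu> \<bullet> Dh f p u = 0) \<and> \<nu> \<bullet> \<nu> = 1 \<and> orient f p \<nu> > 0"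
      using frame_condition_iff[OF u(1) u'] u(1) u' by blast
    then show "\<nu> = N" unfolding N_def by (intro unit_normal_eq) auto
  next
    show "\<forall>u. pos_basis p u \<and> orthonormal (\<lambda>i. dS f p (u i)) \<longrightarrow>
      pos_basis (f p) (case_option N (\<lambda>i. dS f p (u i))) \<and> orthonormal (case_option N (\<lambda>i. dS f p (u i)))"
      using frame_condition_iff N by blast
  qed
qed

lemma gauss_map_props:
  "gauss_map f p \<bullet> f p = 0" "u \<in> tangent p \<Longrightarrow> gauss_map f p \<bullet> Dh f p u = 0"
  "norm (gauss_map f p) = 1" "orient f p (gauss_map f p) > 0"
  using cross_normal_nonzero cross_normal_f cross_normal_Dh[of u]
  by (auto simp: gauss_map_eq orient_inner dot_square_norm power2_eq_square)

lemma gauss_map_unique: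
  assumes "\<nu> \<bullet> f p = 0" "\<And>u. u \<in> tangent p \<Longrightarrow> \<nu> \<bullet> Dh f p u = 0" "\<nu> \<bullet> \<nu> = 1" "orient f p \<nu> > 0"
  shows "gauss_map f p = \<nu>"
  unfolding gauss_map_eq by (rule unit_normal_eq[symmetric]) (use assms in auto)

end

lemma csmooth_cross_normal:
  fixes s :: "'t \<Rightarrow> 'n::finite euc1 \<Rightarrow> 'n euc2"
  assumes s: "csmooth T (-{0}) (\<lambda>t. hext (s t))" and imm: "\<And>t. t \<in> topspace T \<Longrightarrow> immersion (s t)"
  shows "csmooth T (-{0}) (\<lambda>t. hext (cross_normal (s t)))"
proof -
  define M :: "'n option option \<Rightarrow> 't \<Rightarrow> 'n euc1 \<Rightarrow> 'n mat2" where
    "M = (\<lambda>i t x. \<chi> l j. (case j of None \<Rightarrow> hext (s t) x | Some k \<Rightarrow> frechet_derivative (hext (s t)) (at x) (axis k 1) + (x $ k) *\<^sub>R axis i 1) $ l)"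
  have o: "open (-{0} :: 'n euc1 set)" by (rule open_punctured)
  have "csmooth T (-{0}) (\<lambda>t x. M i t x $ l $ j)" for i l j
  proof (cases j)
    case None
    then show ?thesis unfolding M_def by (simp add: csmooth_nth[OF s o])
  next
    case (Some k)
    have "csmooth T (-{0}) (\<lambda>t x. (frechet_derivative (hext (s t)) (at x) (axis k 1) + (x $ k) *\<^sub>R axis i 1) $ l)"
      by (intro csmooth_nth csmooth_add csmooth_deriv s csmooth_scaleR csmooth_const csmooth_ident o)
    then show ?thesis unfolding M_def Some by simp
  qed
  then have det: "csmooth T (-{0}) (\<lambda>t x. det (M i t x))" for i by (rule csmooth_det[OF o])
  then have "csmooth T (-{0}) (\<lambda>t x. \<chi> i. det (M i t x))" by (intro csmooth_vec[OF o]) simp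
  \<comment> \<open>Off the unit sphere \<open>M\<close> is not the homogeneous extension, hence the
    composition with the radial projection.\<close>
  then have "csmooth T (-{0}) (\<lambda>t x. \<chi> i. det (M i t (x /\<^sub>R norm x)))"
    by (rule csmooth_compose[OF _ csmooth_normalize]) (auto simp: o)
  then show ?thesis
  proof (rule csmooth_cong)
    fix t and x :: "'n euc1" assume "t \<in> topspace T" and x: "x \<in> - {0}"
    have "hext (s t) (x /\<^sub>R norm x) = s t (x /\<^sub>R norm x)" using x by (intro hext_sphere normalize_sphere) simp
    then show "(\<chi> i. det (M i t (x /\<^sub>R norm x))) = hext (cross_normal (s t)) x"
      by (simp add: hext_def[of "cross_normal (s t)"] cross_normal_def orient_def frame_matrix_def M_def Dh_def cong: option.case_cong)
  qed (rule o)
qed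

lemma csmooth_hext_gauss_map:
  fixes s :: "'t \<Rightarrow> 'n::finite euc1 \<Rightarrow> 'n euc2"
  assumes s: "csmooth T (-{0}) (\<lambda>t. hext (s t))" and imm: "\<And>t. t \<in> topspace T \<Longrightarrow> immersion (s t)"
  shows "csmooth T (-{0}) (\<lambda>t. hext (gauss_map (s t)))"
proof -
  have nz: "hext (cross_normal (s t)) x \<noteq> 0" if "t \<in> topspace T" "x \<noteq> 0" for t x
    unfolding hext_def by (rule cross_normal_nonzero[OF imm[OF that(1)] normalize_sphere[OF that(2)]])
  have "csmooth T (-{0}) (\<lambda>t x. hext (cross_normal (s t)) x /\<^sub>R norm (hext (cross_normal (s t)) x))"
    by (rule csmooth_compose[OF csmooth_normalize csmooth_cross_normal[OF s imm]]) (auto simp: nz open_punctured)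
  then show ?thesis
  proof (rule csmooth_cong)
    fix t and x :: "'n euc1" assume "t \<in> topspace T" and x: "x \<in> - {0}"
    then show "hext (cross_normal (s t)) x /\<^sub>R norm (hext (cross_normal (s t)) x) = hext (gauss_map (s t)) x"
      by (simp add: hext_def gauss_map_eq[OF imm normalize_sphere])
  qed (rule open_punctured)
qed

lemma gauss_map_smooth:
  assumes "immersion f"
  shows "smooth_map_on usphere (gauss_map f)"
proof -
  have "csmooth (discrete_topology {()}) (-{0}) (\<lambda>_. hext f)"
    using immersion_smooth[OF assms] by (simp add: smooth_map_on_sphere_iff csmooth_if_smooth_on_open)
  from csmooth_hext_gauss_map[OF this] assms
  have "csmooth (discrete_topology {()}) (-{0}) (\<lambda>_. hext (gauss_map f))" by simp
  then have "smooth_on_open (-{0}) (hext (gauss_map f))" by (rule smooth_on_open_if_csmooth) (auto simp: open_punctured)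
  then show ?thesis by (simp add: smooth_map_on_sphere_iff)
qed

lemma immersed_front_gauss_map:
  assumes "immersion f"
  shows "immersed_front f (gauss_map f)"
proof
  show "smooth_map_on usphere f" by (rule immersion_smooth[OF assms])
  show "smooth_map_on usphere (gauss_map f)" by (rule gauss_map_smooth[OF assms])
  show "f p \<bullet> f p = 1" if "p \<in> usphere" for p
    using smooth_maps_norm[OF _ that, of f] assms by (simp add: immersion_def norm_eq_1)
  show "gauss_map f p \<bullet> gauss_map f p = 1" if "p \<in> usphere" for p
    using gauss_map_props(3)[OF assms that] by (simp add: norm_eq_1)
  show "f p \<bullet> gauss_map f p = 0" if "p \<in> usphere" for p
    using gauss_map_props(1)[OF assms that] by (simp add: inner_commute)
  show "Dh f p u \<bullet> gauss_map f p = 0" if "p \<in> usphere" "u \<in> tangent p" for p u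
    using gauss_map_props(2)[OF assms that] by (simp add: inner_commute)
  show "u = 0" if "p \<in> usphere" "u \<in> tangent p" "Dh f p u = 0" for p u
    using assms that unfolding immersion_iff by blast
qed simp

section \<open>Principal curvatures\<close>

lemma smooth_map_on_lincomb:
  fixes f g :: "'a::euclidean_space \<Rightarrow> 'b::euclidean_space"
  assumes "smooth_map_on usphere f" "smooth_map_on usphere g"
  shows "smooth_map_on usphere (\<lambda>x. a *\<^sub>R f x + b *\<^sub>R g x)"
proof -
  have "hext (\<lambda>x. a *\<^sub>R f x + b *\<^sub>R g x) = (\<lambda>x. a *\<^sub>R hext f x + b *\<^sub>R hext g x)" by (simp add: hext_def fun_eq_iff)
  then show ?thesis
    using assms unfolding smooth_map_on_sphere_iff smooth_on_open_iff
    by (auto intro!: csmooth_add csmooth_scaleR csmooth_const)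
qed

lemma Dh_lincomb:
  fixes f g :: "'a::euclidean_space \<Rightarrow> 'b::euclidean_space"
  assumes "smooth_map_on usphere f" "smooth_map_on usphere g" "p \<noteq> 0"
  shows "Dh (\<lambda>x. a *\<^sub>R f x + b *\<^sub>R g x) p u = a *\<^sub>R Dh f p u + b *\<^sub>R Dh g p u"
proof -
  have e: "hext (\<lambda>x. a *\<^sub>R f x + b *\<^sub>R g x) = (\<lambda>x. a *\<^sub>R hext f x + b *\<^sub>R hext g x)" by (simp add: hext_def fun_eq_iff)
  have "((\<lambda>x. a *\<^sub>R hext f x + b *\<^sub>R hext g x) has_derivative (\<lambda>u. a *\<^sub>R Dh f p u + b *\<^sub>R Dh g p u)) (at p)"
    by (intro has_derivative_add has_derivative_scaleR_right hext_has_derivative assms)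
  from fun_cong[OF frechet_derivative_at[OF this], of u] show ?thesis
    unfolding Dh_def[of "\<lambda>x. a *\<^sub>R f x + b *\<^sub>R g x"] e by (rule sym)
qed

text \<open>Passing from \<open>u\<close> to \<open>u + t *\<^sub>R v\<close> changes the form by
  \<open>2 * t * b + t\<^sup>2 * B\<close>, which becomes negative for small \<open>t\<close> of the
  sign opposite to \<open>b\<close>. The choice \<open>t = - b / (B + 1)\<close> avoids a division
  by \<open>B = 0\<close>.\<close>

lemma psd_kernel:
  fixes P N :: "'a::real_vector \<Rightarrow> 'b::real_inner"
  assumes lin: "linear P" "linear N" and V: "subspace V"
    and sym: "\<And>v w. v \<in> V \<Longrightarrow> w \<in> V \<Longrightarrow> P v \<bullet> N w = P w \<bullet> N v"
    and psd: "\<And>v. v \<in> V \<Longrightarrow> 0 \<le> N v \<bullet> P v"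
    and u: "u \<in> V" "N u \<bullet> P u = 0" and v: "v \<in> V"
  shows "N u \<bullet> P v = 0"
proof (rule ccontr)
  define b where "b = N u \<bullet> P v"
  define B where "B = N v \<bullet> P v"
  assume "N u \<bullet> P v \<noteq> 0"
  then have b: "b \<noteq> 0" by (simp add: b_def)
  have B: "0 \<le> B" using psd[OF v] by (simp add: B_def)
  define q where "q = B + 1"
  define t where "t = - b / q"
  have "0 \<le> N (u + t *\<^sub>R v) \<bullet> P (u + t *\<^sub>R v)"
    using psd V u(1) v by (auto intro!: subspace_add subspace_scale)
  also have "\<dots> = 2 * t * b + t\<^sup>2 * B"
    using u(2) sym[OF u(1) v]
    by (simp add: linear_add[OF lin(1)] linear_add[OF lin(2)] linear_cmul[OF lin(1)] linear_cmul[OF lin(2)] inner_add_left inner_add_right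
      b_def B_def power2_eq_square algebra_simps inner_commute)
  also have "\<dots> = b\<^sup>2 / q * (B / q - 2)"
    by (simp add: t_def power2_eq_square right_diff_distrib)
  also have "\<dots> < 0"
  proof (rule mult_pos_neg)
    show "0 < b\<^sup>2 / q" using b B by (simp add: q_def)
    have "B / q \<le> 1" using B by (simp add: q_def)
    then show "B / q - 2 < 0" by linarith
  qed
  finally show False by simp
qed

context immersed_front
begin

text \<open>Differentiating the contact identity \<open>Dh f x u \<bullet> hext \<nu> x = 0\<close>
  in the direction \<open>v\<close> expresses the form by a second derivative of \<open>f\<close>,
  which is symmetric.\<close>

lemma second_form_symmetric:
  assumes p: "p \<in> usphere"
  shows "Dh f p u \<bullet> Dh \<nu> p v = Dh f p v \<bullet> Dh \<nu> p u"
proof -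
  have p0: "p \<noteq> 0" using p by auto
  have so: "smooth_on_open (-{0}) (hext f)" using sf by (simp add: smooth_map_on_sphere_iff)
  have "iter_deriv [v, u] (hext f) p \<bullet> \<nu> p + Dh f p u \<bullet> Dh \<nu> p v = 0" for u v
  proof -
    have "iter_deriv [u] (hext f) differentiable (at p)" using so p0 unfolding smooth_on_open_def by blast
    then have d: "((\<lambda>x. Dh f x u) has_derivative (\<lambda>v. iter_deriv [v, u] (hext f) p)) (at p)"
      by (simp add: frechet_derivative_works Dh_def)
    have "((\<lambda>x. Dh f x u \<bullet> hext \<nu> x) has_derivative (\<lambda>v. Dh f p u \<bullet> Dh \<nu> p v + iter_deriv [v, u] (hext f) p \<bullet> hext \<nu> p)) (at p)"
      by (rule bounded_bilinear.FDERIV[OF bounded_bilinear_inner d hext_has_derivative[OF s\<nu> p0]])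
    moreover have "((\<lambda>x. Dh f x u \<bullet> hext \<nu> x) has_derivative (\<lambda>u. 0)) (at p)"
      by (rule has_derivative_transform_within_open[OF has_derivative_const[of 0] open_punctured])
        (use p0 contact_hext in auto)
    ultimately have "(\<lambda>v. Dh f p u \<bullet> Dh \<nu> p v + iter_deriv [v, u] (hext f) p \<bullet> hext \<nu> p) = (\<lambda>u. 0)" by (rule has_derivative_unique)
    from fun_cong[OF this, of v] show ?thesis by (simp only: hext_sphere[OF p] add.commute)
  qed
  from this[of v u] this[of u v] second_derivative_symmetric[OF so, of p u v] p0 show ?thesis by simp
qed

lemma normal_combination:
  assumes p: "p \<in> usphere"
  obtains w where "w \<in> tangent p" "a *\<^sub>R Dh f p u + b *\<^sub>R Dh \<nu> p u = Dh f p w"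
proof -
  obtain w where w: "w \<in> tangent p"
    "a *\<^sub>R Dh f p u + b *\<^sub>R Dh \<nu> p u = ((a *\<^sub>R Dh f p u + b *\<^sub>R Dh \<nu> p u) \<bullet> f p) *\<^sub>R f p +
      ((a *\<^sub>R Dh f p u + b *\<^sub>R Dh \<nu> p u) \<bullet> \<nu> p) *\<^sub>R \<nu> p + Dh f p w"
    by (rule decompose[OF p])
  then show ?thesis using that[of w] by (simp add: inner_add_left Df_f[OF p] D\<nu>_f[OF p] contact'[OF p] D\<nu>_\<nu>[OF p])
qed

text \<open>An extremal direction of the normal curvature lies in the kernel of the semidefinite
  form \<open>N v \<bullet> Dh f p v\<close>. Since \<open>N u\<close> is itself tangential, it
  vanishes. The sign \<open>c\<close> is \<open>1\<close> for a minimum and \<open>-1\<close> for a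
  maximum.\<close>

lemma principal_direction:
  assumes p: "p \<in> usphere" and u: "u \<in> tangent p" and c: "c \<noteq> 0"
    and le: "\<And>v. v \<in> tangent p \<Longrightarrow> k * (Dh f p v \<bullet> Dh f p v) \<le> - c * (Dh f p v \<bullet> Dh \<nu> p v)"
    and eq: "k * (Dh f p u \<bullet> Dh f p u) = - c * (Dh f p u \<bullet> Dh \<nu> p u)"
  shows "Dh \<nu> p u = - (k / c) *\<^sub>R Dh f p u"
proof -
  have lin: "linear (Dh f p)" "linear (Dh \<nu> p)" using linear_Dh[OF sf] linear_Dh[OF s\<nu>] sphere_nonzero[OF p] by auto
  define N where "N = (\<lambda>v. (- k) *\<^sub>R Dh f p v + (- c) *\<^sub>R Dh \<nu> p v)"
  have N: "linear N" unfolding N_def by (intro linear_compose_add linear_compose_scale_right lin)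
  obtain w where w: "w \<in> tangent p" "N u = Dh f p w" unfolding N_def by (rule normal_combination[OF p])
  have "N u \<bullet> Dh f p w = 0"
  proof (rule psd_kernel[OF lin(1) N subspace_tangent])
    show "Dh f p v \<bullet> N w = Dh f p w \<bullet> N v" for v w
      using second_form_symmetric[OF p, of v w] by (simp add: N_def inner_diff_right inner_commute)
    show "0 \<le> N v \<bullet> Dh f p v" if "v \<in> tangent p" for v
      using le[OF that] by (simp add: N_def inner_diff_left inner_diff_right inner_commute)
    show "N u \<bullet> Dh f p u = 0" using eq by (simp add: N_def inner_diff_left inner_diff_right inner_commute)
  qed (use u w in auto)
  then have "N u = 0" by (simp add: w(2))
  then have "c *\<^sub>R Dh \<nu> p u = - (k *\<^sub>R Dh f p u)" by (simp add: N_def)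
  then have "(inverse c * c) *\<^sub>R Dh \<nu> p u = - ((inverse c * k) *\<^sub>R Dh f p u)" by (metis scaleR_scaleR scaleR_minus_right)
  then show ?thesis using c by (simp add: divide_inverse mult.commute)
qed

text \<open>The operator inequality \<open>(S - l) (S - m) \<le> 0\<close> for the shape operator
  \<open>S\<close>, without diagonalization: the semidefinite form of \<open>S - l\<close> is tested
  on \<open>u - s *\<^sub>R w\<close>, where \<open>w\<close> represents \<open>(S - l) u\<close>
  and \<open>s = 1 / (m - l)\<close> is the optimal step.\<close>

lemma shape_bound:
  assumes p: "p \<in> usphere" and u: "u \<in> tangent p" and lm: "l < m"
    and l: "\<And>v. v \<in> tangent p \<Longrightarrow> l * (Dh f p v \<bullet> Dh f p v) \<le> - (Dh f p v \<bullet> Dh \<nu> p v)"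
    and m: "\<And>v. v \<in> tangent p \<Longrightarrow> - (Dh f p v \<bullet> Dh \<nu> p v) \<le> m * (Dh f p v \<bullet> Dh f p v)"
  shows "Dh \<nu> p u \<bullet> Dh \<nu> p u \<le> - (l + m) * (Dh f p u \<bullet> Dh \<nu> p u) - l * m * (Dh f p u \<bullet> Dh f p u)"
proof -
  have lin: "linear (Dh f p)" "linear (Dh \<nu> p)" using linear_Dh[OF sf] linear_Dh[OF s\<nu>] sphere_nonzero[OF p] by auto
  obtain w where w: "w \<in> tangent p" "(- l) *\<^sub>R Dh f p u + (- 1) *\<^sub>R Dh \<nu> p u = Dh f p w" by (rule normal_combination[OF p])
  define s where "s = 1 / (m - l)"
  have s: "s > 0" "s * (m - l) = 1" using lm by (simp_all add: s_def)
  define PP PN NN WW WN where d: "PP = Dh f p u \<bullet> Dh f p u" "PN = Dh f p u \<bullet> Dh \<nu> p u" "NN = Dh \<nu> p u \<bullet> Dh \<nu> p u"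
    "WW = Dh f p w \<bullet> Dh f p w" "WN = Dh f p w \<bullet> Dh \<nu> p w"
  have 1: "u - s *\<^sub>R w \<in> tangent p" using u w(1) by (simp add: tangent_def inner_diff_left)
  have sy: "Dh f p u \<bullet> Dh \<nu> p w = Dh f p w \<bullet> Dh \<nu> p u" by (rule second_form_symmetric[OF p])
  have wu: "Dh f p w \<bullet> Dh f p w = - l * (Dh f p w \<bullet> Dh f p u) - (Dh f p w \<bullet> Dh \<nu> p u)"
    by (subst (2) w(2)[symmetric]) (simp add: inner_diff_right)
  have ww: "WW = NN + 2 * l * PN + l\<^sup>2 * PP"
    unfolding d w(2)[symmetric] by (simp add: inner_diff_left inner_diff_right inner_commute power2_eq_square algebra_simps)
  have "0 \<le> - (Dh f p (u - s *\<^sub>R w) \<bullet> Dh \<nu> p (u - s *\<^sub>R w)) - l * (Dh f p (u - s *\<^sub>R w) \<bullet> Dh f p (u - s *\<^sub>R w))"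
    using l[OF 1] by simp
  also have "\<dots> = (- PN - l * PP) + 2 * s * (Dh f p w \<bullet> Dh \<nu> p u + l * (Dh f p w \<bullet> Dh f p u)) + s\<^sup>2 * (- WN - l * WW)"
    using sy unfolding d
    by (simp add: linear_diff[OF lin(1)] linear_diff[OF lin(2)] linear_cmul[OF lin(1)] linear_cmul[OF lin(2)] inner_diff_left inner_diff_right
      inner_commute power2_eq_square algebra_simps)
  also have "\<dots> = (- PN - l * PP) - 2 * s * WW + s\<^sup>2 * (- WN - l * WW)"
    unfolding d wu by (simp add: algebra_simps)
  also have "\<dots> \<le> (- PN - l * PP) - 2 * s * WW + s\<^sup>2 * ((m - l) * WW)"
    using m[OF w(1)] by (intro add_left_mono mult_left_mono) (auto simp: d algebra_simps)
  also have "\<dots> = (- PN - l * PP) - s * WW"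
  proof -
    have "s\<^sup>2 * ((m - l) * WW) = s * (s * (m - l)) * WW" by (simp only: power2_eq_square mult.assoc)
    then show ?thesis unfolding s(2) by simp
  qed
  finally have "0 \<le> (m - l) * ((- PN - l * PP) - s * WW)" using lm by simp
  also have "\<dots> = (m - l) * (- PN - l * PP) - (s * (m - l)) * WW" by (simp add: algebra_simps)
  finally have "WW \<le> (m - l) * (- PN - l * PP)" by (simp add: s(2))
  then show ?thesis unfolding ww d[symmetric] by (simp add: power2_eq_square algebra_simps)
qed

end

section \<open>Extremal normal curvatures and parallel hypersurfaces\<close>

lemma unit_tangents_nonempty:
  assumes "DIM('a::euclidean_space) \<ge> 2"
  shows "(unit_tangents :: ('a \<times> 'a) set) \<noteq> {}"
proof -
  obtain p :: 'a where p: "p \<in> Basis" using nonempty_Basis by blast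
  have "\<not> Basis \<subseteq> {p}" using card_mono[of "{p}" "Basis :: 'a set"] assms by auto
  then obtain u :: 'a where "u \<in> Basis" "u \<noteq> p" by blast
  then have "(p, u) \<in> unit_tangents" using p by (simp add: unit_tangents_def tangent_def inner_not_same_Basis)
  then show ?thesis by blast
qed

text \<open>The normal curvature in the direction \<open>u\<close>. The metric induced by
  \<open>f\<close> stands in the denominator, so the value depends on the line of \<open>u\<close>
  only.\<close>

definition ncurv :: "('a::euclidean_space \<Rightarrow> 'b::euclidean_space) \<Rightarrow> ('a \<Rightarrow> 'b) \<Rightarrow> 'a \<times> 'a \<Rightarrow> real" where
  "ncurv f \<nu> z = - (Dh f (fst z) (snd z) \<bullet> Dh \<nu> (fst z) (snd z)) / (Dh f (fst z) (snd z) \<bullet> Dh f (fst z) (snd z))"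

context immersed_front
begin

lemma ncurv_mult:
  assumes "p \<in> usphere" "u \<in> tangent p"
  shows "ncurv f \<nu> (p, u) * (Dh f p u \<bullet> Dh f p u) = - (Dh f p u \<bullet> Dh \<nu> p u)"
  using inj[OF assms] by (cases "Dh f p u = 0") (auto simp: ncurv_def)

lemma ncurv_normalize:
  assumes p: "p \<in> usphere" and u: "u \<in> tangent p" "u \<noteq> 0"
  shows "(p, u /\<^sub>R norm u) \<in> unit_tangents" "ncurv f \<nu> (p, u /\<^sub>R norm u) = ncurv f \<nu> (p, u)"
  using assms linear_cmul[OF linear_Dh[OF sf sphere_nonzero[OF p]]] linear_cmul[OF linear_Dh[OF s\<nu> sphere_nonzero[OF p]]]
  by (auto simp: unit_tangents_def tangent_scaleR ncurv_def)

lemma ncurv_eigen: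
  assumes p: "p \<in> usphere" and u: "u \<in> tangent p" "u \<noteq> 0" and e: "Dh \<nu> p u = - k *\<^sub>R Dh f p u"
  shows "ncurv f \<nu> (p, u) = k"
  using inj[OF p u(1)] u(2) by (auto simp: ncurv_def e)

lemma ncurv_continuous_on: "continuous_on unit_tangents (ncurv f \<nu>)"
proof -
  have *: "continuous_on unit_tangents (\<lambda>z. Dh g (fst z) (snd z))" if "smooth_map_on usphere g" for g :: "'a \<Rightarrow> 'b"
    by (rule continuous_on_subset[OF Dh_continuous_on[OF that]]) (auto simp: unit_tangents_def)
  have "Dh f (fst z) (snd z) \<noteq> 0" if "z \<in> unit_tangents" for z
    using inj[of "fst z" "snd z"] that by (auto simp: unit_tangents_def)
  then show ?thesis unfolding ncurv_def[abs_def] by (intro continuous_intros * sf s\<nu>) simp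
qed

text \<open>The normal curvature attains its extrema on the compact unit tangent bundle, and
  extremal directions are principal. So a constraint on the principal curvatures bounds the whole
  second fundamental form.\<close>

lemma curvature_range:
  assumes "DIM('a) \<ge> 2"
  obtains k1 p1 u1 k2 p2 u2 where "p1 \<in> usphere" "u1 \<in> tangent p1" "u1 \<noteq> 0" "Dh \<nu> p1 u1 = - k1 *\<^sub>R Dh f p1 u1"
    "p2 \<in> usphere" "u2 \<in> tangent p2" "u2 \<noteq> 0" "Dh \<nu> p2 u2 = - k2 *\<^sub>R Dh f p2 u2"
    "\<And>p u. p \<in> usphere \<Longrightarrow> u \<in> tangent p \<Longrightarrow> k1 * (Dh f p u \<bullet> Dh f p u) \<le> - (Dh f p u \<bullet> Dh \<nu> p u)"
    "\<And>p u. p \<in> usphere \<Longrightarrow> u \<in> tangent p \<Longrightarrow> - (Dh f p u \<bullet> Dh \<nu> p u) \<le> k2 * (Dh f p u \<bullet> Dh f p u)"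
proof -
  note cont = compact_unit_tangents unit_tangents_nonempty[OF assms] ncurv_continuous_on
  obtain z1 where z1: "z1 \<in> unit_tangents" "\<And>z. z \<in> unit_tangents \<Longrightarrow> ncurv f \<nu> z1 \<le> ncurv f \<nu> z"
    using continuous_attains_inf[OF cont] by blast
  obtain z2 where z2: "z2 \<in> unit_tangents" "\<And>z. z \<in> unit_tangents \<Longrightarrow> ncurv f \<nu> z \<le> ncurv f \<nu> z2"
    using continuous_attains_sup[OF cont] by blast
  obtain p1 u1 p2 u2 where z: "z1 = (p1, u1)" "z2 = (p2, u2)" by (cases z1; cases z2)
  have m1: "p1 \<in> usphere" "u1 \<in> tangent p1" "u1 \<noteq> 0" and m2: "p2 \<in> usphere" "u2 \<in> tangent p2" "u2 \<noteq> 0"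
    using z1(1) z2(1) by (auto simp: z unit_tangents_def)
  define k1 where "k1 = ncurv f \<nu> z1"
  define k2 where "k2 = ncurv f \<nu> z2"
  have b1: "k1 * (Dh f p u \<bullet> Dh f p u) \<le> - (Dh f p u \<bullet> Dh \<nu> p u)"
    and b2: "- (Dh f p u \<bullet> Dh \<nu> p u) \<le> k2 * (Dh f p u \<bullet> Dh f p u)" if "p \<in> usphere" "u \<in> tangent p" for p u
  proof -
    have "k1 \<le> ncurv f \<nu> (p, u) \<and> ncurv f \<nu> (p, u) \<le> k2" if "u \<noteq> 0"
      using z1(2) z2(2) ncurv_normalize[OF \<open>p \<in> usphere\<close> \<open>u \<in> tangent p\<close> that] unfolding k1_def k2_def by metis
    then have "k1 * (Dh f p u \<bullet> Dh f p u) \<le> ncurv f \<nu> (p, u) * (Dh f p u \<bullet> Dh f p u) \<and> ncurv f \<nu> (p, u) * (Dh f p u \<bullet> Dh f p u) \<le> k2 * (Dh f p u \<bullet> Dh f p u)"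
      using linear_0[OF linear_Dh[OF sf sphere_nonzero[OF that(1)]]]
      by (cases "u = 0") (auto intro!: mult_right_mono)
    then show "k1 * (Dh f p u \<bullet> Dh f p u) \<le> - (Dh f p u \<bullet> Dh \<nu> p u)" "- (Dh f p u \<bullet> Dh \<nu> p u) \<le> k2 * (Dh f p u \<bullet> Dh f p u)"
      by (simp_all add: ncurv_mult[OF that])
  qed
  have "Dh \<nu> p1 u1 = - (k1 / 1) *\<^sub>R Dh f p1 u1"
    by (rule principal_direction) (use m1 b1[OF m1(1)] ncurv_mult[OF m1(1,2)] in \<open>auto simp: k1_def z\<close>)
  moreover have "Dh \<nu> p2 u2 = - (- k2 / - 1) *\<^sub>R Dh f p2 u2"
  proof (rule principal_direction[OF m2(1,2)])
    show "- k2 * (Dh f p2 v \<bullet> Dh f p2 v) \<le> - (- 1) * (Dh f p2 v \<bullet> Dh \<nu> p2 v)" if "v \<in> tangent p2" for v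
      using b2[OF m2(1) that] by simp
    show "- k2 * (Dh f p2 u2 \<bullet> Dh f p2 u2) = - (- 1) * (Dh f p2 u2 \<bullet> Dh \<nu> p2 u2)"
      using ncurv_mult[OF m2(1,2)] by (simp add: k2_def z)
  qed simp
  ultimately show ?thesis using b1 b2 m1 m2 by (intro that[of p1 u1 k1 p2 u2 k2]) simp_all
qed

end

text \<open>A parallel shift by \<open>s\<close> turns a curvature radius \<open>x\<close> into
  \<open>x - s\<close>; the two expressions are \<open>sin (x - s) / sin x\<close> and
  \<open>cos (x - s) / sin x\<close>.\<close>

lemma cot_shift:
  assumes "0 < x" "x < pi" "s < x" "x < s + pi / 2"
  shows "0 < cos s - cot x * sin s" "0 < cot x * cos s + sin s"
proof -
  have sx: "sin x > 0" using assms by (intro sin_gt_zero) auto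
  have "cos s - cot x * sin s = sin (x - s) / sin x" "cot x * cos s + sin s = cos (x - s) / sin x"
    using sx by (simp_all add: cot_def sin_diff cos_diff field_simps)
  moreover have "sin (x - s) > 0" "cos (x - s) > 0" using assms by (auto intro!: sin_gt_zero cos_gt_zero_pi)
  ultimately show "0 < cos s - cot x * sin s" "0 < cot x * cos s + sin s" using sx by simp_all
qed

lemma cot_less:
  assumes "0 < x" "x < y" "y < pi"
  shows "cot y < cot x"
proof -
  have s: "sin x > 0" "sin y > 0" "sin (y - x) > 0" using assms by (auto intro!: sin_gt_zero)
  have "cot x - cot y = sin (y - x) / (sin x * sin y)" using s by (simp add: cot_def sin_diff field_simps)
  then show ?thesis using s by (metis diff_gt_0_iff_gt divide_pos_pos mult_pos_pos)
qed

lemma shifted_front: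
  assumes "front f \<nu>"
  shows "front (\<lambda>p. cos s *\<^sub>R f p + sin s *\<^sub>R \<nu> p) (\<lambda>p. (- sin s) *\<^sub>R f p + cos s *\<^sub>R \<nu> p)"
proof -
  interpret front f \<nu> by (rule assms)
  have sc: "cos s * cos s + sin s * sin s = 1" "sin s * sin s + cos s * cos s = 1"
    using sin_cos_squared_add[of s] by (simp_all add: power2_eq_square)
  show ?thesis
  proof (unfold_locales, goal_cases)
    case 1 show ?case by (rule smooth_map_on_lincomb[OF sf s\<nu>])
  next
    case 2 show ?case by (rule smooth_map_on_lincomb[OF sf s\<nu>])
  next
    case (3 p) then show ?case using nf[OF 3] n\<nu>[OF 3] f\<nu>[OF 3] sc by (simp add: inner_add_left inner_add_right inner_commute)
  next
    case (4 p) then show ?case using nf[OF 4] n\<nu>[OF 4] f\<nu>[OF 4] sc by (simp add: inner_diff_left inner_diff_right inner_commute)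
  next
    case (5 p) then show ?case using nf[OF 5] n\<nu>[OF 5] f\<nu>[OF 5] by (simp add: inner_add_left inner_add_right inner_diff_right inner_commute)
  next
    case (6 p u) then show ?case
      by (simp only: Dh_lincomb[OF sf s\<nu> sphere_nonzero[OF 6(1)]])
        (simp add: inner_add_left inner_diff_right Df_f D\<nu>_f contact' D\<nu>_\<nu>)
  qed
qed

section \<open>Convex hulls of the hypersurface and of its normals\<close>

context convex_front
begin

lemma infinite_usphere: "infinite (usphere :: 'a set)"
proof
  assume fin: "finite (usphere :: 'a set)"
  have "connected (usphere :: 'a set)" using dim3 by (intro connected_sphere) auto
  then obtain a where a: "(usphere :: 'a set) \<subseteq> {a}" using connected_finite_iff_sing[of "usphere :: 'a set"] fin by (auto simp del: sphere_eq_empty)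
  obtain b :: 'a where b: "b \<in> Basis" using nonempty_Basis by blast
  then have "b \<in> usphere" "- b \<in> usphere" by auto
  then have "b = - b" using a by blast
  then show False using b nonzero_Basis by (simp add: eq_neg_iff_add_eq_0 flip: scaleR_2)
qed

lemma hull_inner_nonneg:
  assumes "a \<in> convex hull (f ` usphere)" "b \<in> convex hull (\<nu> ` usphere)"
  shows "0 \<le> a \<bullet> b"
proof -
  have 0: "0 \<le> f x \<bullet> \<nu> p" if "x \<in> usphere" "p \<in> usphere" for x p
    using globally_convex[OF that(2,1)] f\<nu>[OF that(2)] by (cases "x = p") auto
  have "convex hull (\<nu> ` usphere) \<subseteq> {y. 0 \<le> f x \<bullet> y}" if "x \<in> usphere" for x
    by (rule hull_minimal) (use 0[OF that] convex_halfspace_ge[of 0 "f x"] in auto)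
  then have 1: "0 \<le> f x \<bullet> b" if "x \<in> usphere" for x using that assms(2) by blast
  have "convex hull (f ` usphere) \<subseteq> {y. 0 \<le> b \<bullet> y}"
    by (rule hull_minimal) (use 1 convex_halfspace_ge[of 0 b] in \<open>auto simp: inner_commute\<close>)
  then show ?thesis using assms(1) by (auto simp: inner_commute)
qed

text \<open>The products \<open>f x \<bullet> \<nu> p\<close> are positive except for
  \<open>x = p\<close>. A convex combination involves finitely many points, so some \<open>p\<close>
  of the infinite sphere avoids them all and gives a positive inner product.\<close>

lemma zero_notin_hull: "0 \<notin> convex hull (f ` usphere)" "0 \<notin> convex hull (\<nu> ` usphere)"
proof -
  have *: "0 \<notin> convex hull (g ` usphere)" if pos: "\<And>p x. p \<in> usphere \<Longrightarrow> x \<in> usphere \<Longrightarrow> x \<noteq> p \<Longrightarrow> 0 < g x \<bullet> h p"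
    for g h :: "'a \<Rightarrow> 'b"
  proof
    assume "0 \<in> convex hull (g ` usphere)"
    then obtain S u where S: "finite S" "S \<subseteq> g ` usphere" "\<And>x. x \<in> S \<Longrightarrow> 0 \<le> u x" "sum u S = 1" "(\<Sum>v\<in>S. u v *\<^sub>R v) = (0::real)*\<^sub>R 0"
      unfolding convex_hull_explicit by auto
    obtain X where X: "X \<subseteq> usphere" "finite X" "S = g ` X" using finite_subset_image[OF S(1,2)] by blast
    obtain p where p: "p \<in> usphere" "p \<notin> X" using infinite_usphere X(2) by (meson finite_subset subsetI)
    have pos': "0 < v \<bullet> h p" if vS: "v \<in> S" for v
    proof -
      obtain x where x: "x \<in> X" "v = g x" using vS unfolding X(3) by (rule imageE)
      show ?thesis unfolding x(2) by (rule pos[OF p(1)]) (use x(1) X(1) p(2) in auto)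
    qed
    obtain v where v: "v \<in> S" "u v \<noteq> 0" using S(4) by (metis sum.neutral zero_neq_one)
    have "0 < (\<Sum>v\<in>S. u v * (v \<bullet> h p))"
      by (rule sum_pos2[OF S(1) v(1)]) (use S(3) pos' v in \<open>auto simp: less_le intro: mult_nonneg_nonneg\<close>)
    also have "\<dots> = (\<Sum>v\<in>S. u v *\<^sub>R v) \<bullet> h p" by (simp add: inner_sum_left)
    finally show False using S(5) by simp
  qed
  show "0 \<notin> convex hull (f ` usphere)" by (rule *[of f \<nu>]) (rule globally_convex)
  show "0 \<notin> convex hull (\<nu> ` usphere)" by (rule *[of \<nu> f]) (metis globally_convex inner_commute)
qed

text \<open>Were 0 in the joint hull, then \<open>0 = u *\<^sub>R a + v *\<^sub>R b\<close> with
  \<open>a\<close> and \<open>b\<close> in the two hulls and \<open>a \<bullet> b \<ge> 0\<close>.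
  This forces both terms to vanish, although neither hull contains 0. Compactness then gives a
  separating hyperplane.\<close>

lemma common_half_space:
  obtains m where "\<And>p. p \<in> usphere \<Longrightarrow> 0 < f p \<bullet> m" "\<And>p. p \<in> usphere \<Longrightarrow> 0 < \<nu> p \<bullet> m"
proof -
  let ?A = "convex hull (f ` usphere)" and ?B = "convex hull (\<nu> ` usphere)"
  let ?C = "convex hull (f ` usphere \<union> \<nu> ` usphere)"
  have ne: "usphere \<noteq> ({} :: 'a set)" using infinite_usphere by auto
  have "0 \<notin> ?C"
  proof
    assume "0 \<in> ?C"
    also have "?C = {u *\<^sub>R a + v *\<^sub>R b | u v a b. u \<ge> 0 \<and> v \<ge> 0 \<and> u + v = 1 \<and> a \<in> ?A \<and> b \<in> ?B}"
    proof -
      have "?C = convex hull (?A \<union> ?B)" by (rule hull_Un) (simp add: convex_Inter)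
      also have "\<dots> = {u *\<^sub>R a + v *\<^sub>R b | u v a b. u \<ge> 0 \<and> v \<ge> 0 \<and> u + v = 1 \<and> a \<in> ?A \<and> b \<in> ?B}"
        by (rule convex_hull_union_two) (use ne in \<open>auto simp: convex_convex_hull\<close>)
      finally show ?thesis .
    qed
    finally obtain u v a b where uv: "0 = u *\<^sub>R a + v *\<^sub>R b" "u \<ge> 0" "v \<ge> 0" "u + v = 1" "a \<in> ?A" "b \<in> ?B" by blast
    have ab: "0 \<le> a \<bullet> b" by (rule hull_inner_nonneg[OF uv(5,6)])
    have nz: "a \<noteq> 0" "b \<noteq> 0" using zero_notin_hull uv(5,6) by auto
    have "0 = a \<bullet> (u *\<^sub>R a + v *\<^sub>R b)" using uv(1) by simp
    also have "\<dots> = u * (a \<bullet> a) + v * (a \<bullet> b)" by (simp add: inner_add_right)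
    finally have "u * (a \<bullet> a) = 0" using uv(2,3) ab by (smt (verit) inner_ge_zero mult_nonneg_nonneg)
    moreover have "0 = b \<bullet> (u *\<^sub>R a + v *\<^sub>R b)" using uv(1) by simp
    then have "0 = u * (a \<bullet> b) + v * (b \<bullet> b)" by (simp add: inner_add_right inner_commute)
    then have "v * (b \<bullet> b) = 0" using uv(2,3) ab by (smt (verit) inner_ge_zero mult_nonneg_nonneg)
    ultimately show False using nz uv(4) by simp
  qed
  moreover have "compact ?C"
    using sphere_continuous_on[OF sf] sphere_continuous_on[OF s\<nu>]
    by (intro compact_convex_hull compact_Un compact_continuous_image compact_sphere)
  ultimately obtain m b where mb: "0 < b" "\<And>x. x \<in> ?C \<Longrightarrow> m \<bullet> x > b"
    using separating_hyperplane_closed_0[of ?C] compact_imp_closed by (metis convex_convex_hull)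
  have "0 < x \<bullet> m" if "x \<in> f ` usphere \<union> \<nu> ` usphere" for x
    using mb(2)[OF hull_inc[OF that]] mb(1) by (simp add: inner_commute)
  then show ?thesis by (intro that[of m]) auto
qed

end

section \<open>Curvature radii spread by less than pi / 2\<close>

locale pinched_front = immersed_front f \<nu> for f \<nu> :: "'a::euclidean_space \<Rightarrow> 'b::euclidean_space" +
  fixes a b :: real
  assumes ab: "0 < a" "a \<le> b" "b < pi" "b < a + pi / 2" and dim3: "DIM('a) \<ge> 3"
    and lower: "\<And>p u. p \<in> usphere \<Longrightarrow> u \<in> tangent p \<Longrightarrow> cot b * (Dh f p u \<bullet> Dh f p u) \<le> - (Dh f p u \<bullet> Dh \<nu> p u)"
    and upper: "\<And>p u. p \<in> usphere \<Longrightarrow> u \<in> tangent p \<Longrightarrow> - (Dh f p u \<bullet> Dh \<nu> p u) \<le> cot a * (Dh f p u \<bullet> Dh f p u)"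
begin

lemma positive_combinations:
  obtains m where "\<And>p k. p \<in> usphere \<Longrightarrow> cot b \<le> k \<Longrightarrow> k \<le> cot a \<Longrightarrow> 0 < (k *\<^sub>R f p + \<nu> p) \<bullet> m"
proof -
  \<comment> \<open>The interval of radii is widened at both ends, so that \<open>l < m\<close>
    below even if \<open>a = b\<close>. A third of the smallest slack keeps it inside
    \<open>(0, pi)\<close> and shorter than \<open>pi / 2\<close>.\<close>
  define e where "e = Min {a, pi - b, a + pi / 2 - b} / 3"
  have e: "0 < e" "3 * e \<le> a" "3 * e \<le> pi - b" "3 * e \<le> a + pi / 2 - b" using ab by (simp_all add: e_def)
  define a' where "a' = a - e"
  define b' where "b' = b + e"
  have ab': "0 < a'" "a' < a" "b < b'" "b' < pi" "b' < a' + pi / 2" using e ab by (simp_all add: a'_def b'_def)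
  have cab: "cot a \<le> cot a'" "cot b' \<le> cot b" "cot b' < cot a'"
    using cot_less[of a' a] cot_less[of b b'] cot_less[of a' b'] ab ab' by simp_all
  \<comment> \<open>The midpoint of the admissible shifts: \<open>s\<close> lies in
    \<open>(0, pi / 2)\<close>, and after the shift by \<open>s\<close> all radii do as
    well.\<close>
  define s where "s = (max 0 (b' - pi / 2) + min a' (pi / 2)) / 2"
  have s: "0 < s" "s < pi / 2" "s < a'" "b' < s + pi / 2"
    using ab ab' by (auto simp: s_def max_def min_def field_simps)
  have sc: "0 < sin s" "0 < cos s" using s by (auto intro!: sin_gt_zero cos_gt_zero_pi)
  have ca: "0 < cos s - cot a' * sin s" "0 < cot a' * cos s + sin s"
    by (rule cot_shift; use s ab ab' in simp)+
  have cb: "0 < cos s - cot b' * sin s" "0 < cot b' * cos s + sin s"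
    by (rule cot_shift; use s ab ab' in simp)+
  define g where "g = (\<lambda>p. cos s *\<^sub>R f p + sin s *\<^sub>R \<nu> p)"
  define \<mu> where "\<mu> = (\<lambda>p. (- sin s) *\<^sub>R f p + cos s *\<^sub>R \<nu> p)"
  have Dg: "Dh g p u = cos s *\<^sub>R Dh f p u + sin s *\<^sub>R Dh \<nu> p u" if "p \<in> usphere" for p u
    unfolding g_def by (rule Dh_lincomb[OF sf s\<nu> sphere_nonzero[OF that]])
  have D\<mu>: "Dh \<mu> p u = (- sin s) *\<^sub>R Dh f p u + cos s *\<^sub>R Dh \<nu> p u" if "p \<in> usphere" for p u
    unfolding \<mu>_def by (rule Dh_lincomb[OF sf s\<nu> sphere_nonzero[OF that]])
  interpret c: convex_front g \<mu>
  proof (intro convex_front.intro convex_front_axioms.intro)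
    show "front g \<mu>" unfolding g_def \<mu>_def by (rule shifted_front) (rule front_axioms)
    show "DIM('b) = DIM('a) + 1" by (rule dims)
    show "DIM('a) \<ge> 3" by (rule dim3)
    fix p u :: 'a assume p: "p \<in> usphere" and u: "u \<in> tangent p" "u \<noteq> 0"
    define l where "l = cot b'"
    define m where "m = cot a'"
    define P where "P = Dh f p u \<bullet> Dh f p u"
    define x where "x = - (Dh f p u \<bullet> Dh \<nu> p u)"
    define N where "N = Dh \<nu> p u \<bullet> Dh \<nu> p u"
    have lo: "l * (Dh f p v \<bullet> Dh f p v) \<le> - (Dh f p v \<bullet> Dh \<nu> p v)" and up: "- (Dh f p v \<bullet> Dh \<nu> p v) \<le> m * (Dh f p v \<bullet> Dh f p v)"
      if v: "v \<in> tangent p" for v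
      using lower[OF p v] upper[OF p v] mult_right_mono[OF cab(1), of "Dh f p v \<bullet> Dh f p v"] mult_right_mono[OF cab(2), of "Dh f p v \<bullet> Dh f p v"]
      unfolding l_def m_def by (simp_all del: minus_le_iff)
    have lm: "l < m" unfolding l_def m_def by (rule cab)
    have N: "N \<le> (l + m) * x - l * m * P"
      using shape_bound[OF p u(1) lm lo up] unfolding N_def x_def P_def by (simp add: algebra_simps)
    have P: "P > 0" using inj[OF p u(1)] u(2) by (auto simp: P_def)
    have x: "l * P \<le> x" "x \<le> m * P" using lo[OF u(1)] up[OF u(1)] unfolding x_def P_def .
    \<comment> \<open>\<open>F k\<close> is the value of the new second fundamental form, relative
      to \<open>P\<close>, in a principal direction of curvature \<open>k\<close>. Bounding
      \<open>N\<close> by \<open>shape_bound\<close> leaves \<open>E\<close> as a lower bound for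
      the form; it is affine in \<open>x\<close>, with the values \<open>F l * P\<close> and
      \<open>F m * P\<close> at the two ends of the range of \<open>x\<close>.\<close>
    define F where "F = (\<lambda>k. (k * cos s + sin s) * (cos s - k * sin s))"
    have F: "F l > 0" "F m > 0" unfolding F_def l_def m_def using ca cb by simp_all
    define E where "E = cos s * sin s * (1 + l * m) * P + (cos s * cos s - sin s * sin s - sin s * cos s * (l + m)) * x"
    have "(m - l) * E = (m * P - x) * F l + (x - l * P) * F m"
      unfolding E_def F_def by algebra
    also have "\<dots> > 0"
    proof (cases "x = l * P")
      case True
      then have "m * P - x > 0" using lm P by simp
      then show ?thesis using True F by simp
    next
      case False
      then show ?thesis using x F by (intro add_nonneg_pos) simp_all
    qed
    finally have E: "E > 0" using lm by (simp add: zero_less_mult_iff)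
    have "Dh g p u \<bullet> Dh \<mu> p u = - (cos s * sin s) * P - (cos s * cos s - sin s * sin s) * x + sin s * cos s * N"
      unfolding Dg[OF p] D\<mu>[OF p] P_def x_def N_def
      by (simp add: inner_add_left inner_add_right inner_diff_left inner_diff_right inner_commute algebra_simps)
    also have "\<dots> \<le> - (cos s * sin s) * P - (cos s * cos s - sin s * sin s) * x + sin s * cos s * ((l + m) * x - l * m * P)"
      using N sc by (intro add_left_mono mult_left_mono) simp_all
    also have "\<dots> = - E" unfolding E_def by algebra
    finally show "Dh g p u \<bullet> Dh \<mu> p u < 0" using E by simp
  qed
  obtain m where m: "\<And>p. p \<in> usphere \<Longrightarrow> 0 < g p \<bullet> m" "\<And>p. p \<in> usphere \<Longrightarrow> 0 < \<mu> p \<bullet> m"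
    by (rule c.common_half_space) (rule that, assumption+)
  show ?thesis
  proof (rule that[of m])
    fix p :: 'a and k assume p: "p \<in> usphere" and k: "cot b \<le> k" "k \<le> cot a"
    have s1: "cos s * cos s + sin s * sin s = 1" using sin_cos_squared_add[of s] by (simp add: power2_eq_square)
    have "cot b' * cos s \<le> k * cos s" "k * sin s \<le> cot a' * sin s"
      using cab k sc by (auto intro!: mult_right_mono)
    then have "k * cos s + sin s > 0" "cos s - k * sin s > 0" using cb(2) ca(1) by linarith+
    \<comment> \<open>Undoing the rotation by \<open>s\<close> writes the vector as a combination of
      \<open>g p\<close> and \<open>\<mu> p\<close>, whose coefficients are positive because the
      shifted radii lie in \<open>(0, pi / 2)\<close>.\<close>
    moreover have "(k *\<^sub>R f p + \<nu> p) \<bullet> m = (k * cos s + sin s) * (g p \<bullet> m) + (cos s - k * sin s) * (\<mu> p \<bullet> m)"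
    proof -
      define x y where "x = f p \<bullet> m" and "y = \<nu> p \<bullet> m"
      have "(k * cos s + sin s) * (cos s * x + sin s * y) + (cos s - k * sin s) * (- sin s * x + cos s * y) =
        (k * (cos s * cos s + sin s * sin s)) * x + (cos s * cos s + sin s * sin s) * y"
        by algebra
      then show ?thesis unfolding s1 g_def \<mu>_def by (simp add: inner_add_left inner_diff_left x_def y_def)
    qed
    ultimately show "0 < (k *\<^sub>R f p + \<nu> p) \<bullet> m" using m[OF p] by (simp add: add_pos_pos)
  qed
qed

end

text \<open>Normal curvatures in all directions are taken, since principal directions need not vary
  continuously; so the generating set is compact and continuous in \<open>f\<close>. A generator
  with normal curvature \<open>cot \<rho>\<close> is a multiple \<open>1 / sin \<rho>\<close> of the
  corresponding combination of \<open>f\<close> and \<open>\<nu>\<close> at angle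
  \<open>\<rho>\<close>.\<close>

definition normal_hull :: "('a::euclidean_space \<Rightarrow> 'b::euclidean_space) \<Rightarrow> ('a \<Rightarrow> 'b) \<Rightarrow> 'b set" where
  "normal_hull f \<nu> = convex hull ((\<lambda>z. ncurv f \<nu> z *\<^sub>R f (fst z) + \<nu> (fst z)) ` unit_tangents)"

definition center :: "('a::euclidean_space \<Rightarrow> 'b::euclidean_space) \<Rightarrow> ('a \<Rightarrow> 'b) \<Rightarrow> 'b" where
  "center f \<nu> = closest_point (normal_hull f \<nu>) 0 /\<^sub>R norm (closest_point (normal_hull f \<nu>) 0)"

lemma (in immersed_front) normal_hull:
  assumes "DIM('a) \<ge> 2"
  shows "compact (normal_hull f \<nu>)" "convex (normal_hull f \<nu>)" "normal_hull f \<nu> \<noteq> {}"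
proof -
  have *: "continuous_on unit_tangents (\<lambda>z. g (fst z))" if "smooth_map_on usphere g" for g :: "'a \<Rightarrow> 'b"
    by (rule continuous_on_compose2[OF sphere_continuous_on[OF that] continuous_on_fst[OF continuous_on_id]]) (auto simp: unit_tangents_def)
  show "compact (normal_hull f \<nu>)"
    unfolding normal_hull_def
    by (intro compact_convex_hull compact_continuous_image compact_unit_tangents continuous_intros ncurv_continuous_on *[OF sf] *[OF s\<nu>])
  show "convex (normal_hull f \<nu>)" "normal_hull f \<nu> \<noteq> {}"
    using unit_tangents_nonempty[OF assms] by (auto simp: normal_hull_def)
qed

context pinched_front
begin

lemma dim2: "DIM('a) \<ge> 2"
  using dim3 by simp

lemma ncurv_range:
  assumes "z \<in> unit_tangents"
  shows "cot b \<le> ncurv f \<nu> z" "ncurv f \<nu> z \<le> cot a"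
proof -
  obtain p u where z: "z = (p, u)" by (cases z)
  have p: "p \<in> usphere" and u: "u \<in> tangent p" "u \<noteq> 0" using assms by (auto simp: z unit_tangents_def)
  have P: "Dh f p u \<bullet> Dh f p u > 0" using inj[OF p u(1)] u(2) by auto
  show "cot b \<le> ncurv f \<nu> z" "ncurv f \<nu> z \<le> cot a"
    using lower[OF p u(1)] upper[OF p u(1)] P ncurv_mult[OF p u(1)] unfolding z
    by (metis mult_le_cancel_right_pos)+
qed

lemma closest_nonzero: "closest_point (normal_hull f \<nu>) 0 \<noteq> 0"
proof
  assume "closest_point (normal_hull f \<nu>) 0 = 0"
  then have "0 \<in> normal_hull f \<nu>"
    using closest_point_in_set[OF compact_imp_closed] normal_hull[OF dim2] by metis
  obtain m where m: "\<And>p k. p \<in> usphere \<Longrightarrow> cot b \<le> k \<Longrightarrow> k \<le> cot a \<Longrightarrow> 0 < (k *\<^sub>R f p + \<nu> p) \<bullet> m"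
    by (rule positive_combinations) (rule that, assumption+)
  have "normal_hull f \<nu> \<subseteq> {y. m \<bullet> y > 0}"
    unfolding normal_hull_def
    by (rule hull_minimal) (use m ncurv_range convex_halfspace_gt[of 0 m] in \<open>auto simp: unit_tangents_def inner_commute\<close>)
  then show False using \<open>0 \<in> normal_hull f \<nu>\<close> by auto
qed

lemma norm_center: "norm (center f \<nu>) = 1"
  using closest_nonzero by (simp add: center_def)

text \<open>The nearest point \<open>y\<close> of the hull satisfies
  \<open>y \<bullet> y \<le> w \<bullet> y\<close> for every \<open>w\<close> in the hull.\<close>

lemma center_positive:
  assumes p: "p \<in> usphere" and u: "u \<in> tangent p" "u \<noteq> 0"
  shows "0 < (ncurv f \<nu> (p, u) *\<^sub>R f p + \<nu> p) \<bullet> center f \<nu>"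
proof -
  define y where "y = closest_point (normal_hull f \<nu>) 0"
  have y: "y \<noteq> 0" using closest_nonzero by (simp add: y_def)
  define w where "w = ncurv f \<nu> (p, u) *\<^sub>R f p + \<nu> p"
  have "w \<in> normal_hull f \<nu>"
    unfolding normal_hull_def
  proof (rule hull_inc, rule image_eqI)
    show "(p, u /\<^sub>R norm u) \<in> unit_tangents" by (rule ncurv_normalize(1)[OF p u])
  qed (simp add: w_def ncurv_normalize(2)[OF p u])
  then have "(0 - y) \<bullet> (w - y) \<le> 0"
    unfolding y_def by (intro closest_point_dot compact_imp_closed normal_hull[OF dim2])
  then have "y \<bullet> y \<le> w \<bullet> y" by (simp add: inner_diff_right inner_commute)
  moreover have "0 < y \<bullet> y" using y by simp
  ultimately have "0 < w \<bullet> y" by linarith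
  then show ?thesis using y by (simp add: center_def w_def flip: y_def)
qed

end

text \<open>The variational inequality for the nearest point \<open>y\<close> of \<open>S\<close> is
  tested with a point of \<open>S\<close> close to \<open>z\<close>; together with
  \<open>norm z \<le> norm y + e\<close> this bounds the distance.\<close>

lemma closest_point_stable:
  fixes S T :: "'a::euclidean_space set"
  assumes S: "compact S" "convex S" "S \<noteq> {}" and T: "compact T" "convex T" "T \<noteq> {}"
    and ST: "\<And>x. x \<in> S \<Longrightarrow> \<exists>y\<in>T. dist x y \<le> e" and TS: "\<And>y. y \<in> T \<Longrightarrow> \<exists>x\<in>S. dist x y \<le> e"
  shows "(dist (closest_point S 0) (closest_point T 0))\<^sup>2 \<le> 4 * e * norm (closest_point S 0) + e\<^sup>2"
proof -
  define y where "y = closest_point S 0"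
  define z where "z = closest_point T 0"
  have yS: "y \<in> S" and zT: "z \<in> T" unfolding y_def z_def using S T by (auto intro: closest_point_in_set compact_imp_closed)
  obtain y' where y': "y' \<in> T" "dist y y' \<le> e" using ST[OF yS] by blast
  obtain z' where z': "z' \<in> S" "dist z' z \<le> e" using TS[OF zT] by blast
  have e: "0 \<le> e" using y'(2) zero_le_dist[of y y'] by linarith
  have "norm z \<le> norm y'" using closest_point_le[OF compact_imp_closed[OF T(1)] y'(1), of 0] by (simp add: z_def)
  also have "\<dots> \<le> norm y + e" using y'(2) norm_triangle_sub[of y' y] by (simp add: dist_norm norm_minus_commute)
  finally have zy: "norm z \<le> norm y + e" .
  have "(0 - y) \<bullet> (z' - y) \<le> 0" unfolding y_def using S z'(1) by (intro closest_point_dot compact_imp_closed)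
  then have "y \<bullet> y \<le> y \<bullet> z'" by (simp add: inner_diff_right)
  also have "\<dots> = y \<bullet> z + y \<bullet> (z' - z)" by (simp add: inner_diff_right)
  also have "y \<bullet> (z' - z) \<le> norm y * e"
    using norm_cauchy_schwarz[of y "z' - z"] z'(2) mult_left_mono[of "norm (z' - z)" e "norm y"] by (simp add: dist_norm)
  finally have yz: "y \<bullet> y \<le> y \<bullet> z + norm y * e" by simp
  have "(dist y z)\<^sup>2 = y \<bullet> y - 2 * (y \<bullet> z) + z \<bullet> z"
    by (simp add: dist_norm power2_norm_eq_inner inner_diff_left inner_diff_right inner_commute)
  also have "\<dots> \<le> z \<bullet> z - y \<bullet> y + 2 * (norm y * e)" using yz by simp
  also have "z \<bullet> z \<le> (norm y + e)\<^sup>2" using power_mono[OF zy, of 2] by (simp add: power2_norm_eq_inner)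
  also have "(norm y + e)\<^sup>2 - y \<bullet> y + 2 * (norm y * e) = 4 * e * norm y + e\<^sup>2"
    by (simp add: power2_sum flip: power2_norm_eq_inner)
  finally show ?thesis by (simp add: y_def z_def)
qed

text \<open>The set of points within distance \<open>e\<close> of a convex set is convex, so it
  contains the hull as soon as it contains the generators.\<close>

lemma hull_approx:
  fixes F G :: "'z \<Rightarrow> 'b::euclidean_space"
  assumes "\<And>z. z \<in> K \<Longrightarrow> dist (F z) (G z) \<le> e" "x \<in> convex hull (F ` K)"
  shows "\<exists>y\<in>convex hull (G ` K). dist x y \<le> e"
proof -
  let ?C = "\<Union>a\<in>convex hull (G ` K). \<Union>b\<in>cball 0 e. {a + b}"
  have "convex ?C" by (intro convex_sums convex_convex_hull convex_cball)
  moreover have "F ` K \<subseteq> ?C"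
  proof
    fix x assume "x \<in> F ` K"
    then obtain z where z: "z \<in> K" "x = F z" by blast
    have "x = G z + (F z - G z)" "F z - G z \<in> cball 0 e" using assms(1)[OF z(1)] z by (auto simp: dist_norm norm_minus_commute)
    then show "x \<in> ?C" using hull_inc[of "G z" "G ` K" convex] z(1) by blast
  qed
  ultimately have "convex hull (F ` K) \<subseteq> ?C" by (simp add: hull_minimal)
  then obtain a b where "x = a + b" "a \<in> convex hull (G ` K)" "b \<in> cball 0 e" using assms(2) by blast
  then show ?thesis by (intro bexI[of _ a]) (auto simp: dist_norm)
qed

text \<open>Compactness of \<open>K\<close> turns joint continuity of \<open>W\<close> into uniform
  closeness of \<open>W t\<close> and \<open>W t0\<close>. The hulls are then close in the Hausdorff
  sense, and \<open>closest_point_stable\<close> applies.\<close>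

lemma continuous_map_closest_point:
  fixes W :: "'t \<Rightarrow> 'z::topological_space \<Rightarrow> 'b::euclidean_space"
  assumes W: "continuous_map (prod_topology T (top_of_set K)) euclidean (\<lambda>x. W (fst x) (snd x))"
    and K: "compact K" "K \<noteq> {}"
  shows "continuous_map T euclidean (\<lambda>t. closest_point (convex hull (W t ` K)) 0)"
  unfolding continuous_map_topcontinuous_iff
proof (intro ballI allI impI)
  fix t0 and d :: real assume t0: "t0 \<in> topspace T" and d: "0 < d"
  let ?H = "\<lambda>t. convex hull (W t ` K)"
  have cont: "continuous_on K (W t)" if "t \<in> topspace T" for t
  proof -
    have "continuous_map (top_of_set K) (prod_topology T (top_of_set K)) (\<lambda>z. (t, z))"
      using that by (intro continuous_map_pairedI) auto
    from continuous_map_compose[OF this W] show ?thesis by (simp add: o_def)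
  qed
  have H: "compact (?H t)" "convex (?H t)" "?H t \<noteq> {}" if "t \<in> topspace T" for t
    using cont[OF that] K by (auto intro!: compact_convex_hull compact_continuous_image convex_convex_hull)
  define y where "y = closest_point (?H t0) 0"
  \<comment> \<open>As \<open>e \<le> 1\<close>, the bound \<open>4 * e * norm y + e\<^sup>2\<close>
    is at most \<open>e * (4 * norm y + 1)\<close>, which is below \<open>d\<^sup>2\<close>.\<close>
  define e where "e = min 1 (d\<^sup>2 / (4 * norm y + 2))"
  have q: "4 * norm y + 2 > 0" using norm_ge_zero[of y] by linarith
  have e: "0 < e" "e \<le> 1" using d q by (simp_all add: e_def)
  have "e \<le> d\<^sup>2 / (4 * norm y + 2)" by (simp add: e_def)
  then have ed: "e * (4 * norm y + 2) \<le> d\<^sup>2" using q by (simp add: pos_le_divide_eq)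
  define O' where "O' = {x \<in> topspace (prod_topology T (top_of_set K)). dist (W (fst x) (snd x)) (W t0 (snd x)) \<in> {..<e}}"
  have "continuous_map (prod_topology T (top_of_set K)) euclidean (\<lambda>x. W t0 (snd x))"
    by (rule continuous_map_compose_on[OF _ cont[OF t0]])
      (auto intro!: continuous_map_into_fulltopology[OF continuous_map_snd])
  then have "continuous_map (prod_topology T (top_of_set K)) euclidean (\<lambda>x. dist (W (fst x) (snd x)) (W t0 (snd x)))"
    by (rule continuous_map_compose_on2[OF W, where S=UNIV]) (auto intro!: continuous_intros)
  then have "openin (prod_topology T (top_of_set K)) O'"
    unfolding O'_def by (rule openin_continuous_map_preimage) auto
  moreover have "compactin (top_of_set K) K" using K(1) by (simp add: compactin_subtopology)
  moreover have "{t0} \<times> K \<subseteq> O'" using t0 e by (auto simp: O'_def)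
  ultimately obtain U V where UV: "openin T U" "t0 \<in> U" "K \<subseteq> V" "U \<times> V \<subseteq> O'"
    using tube_lemma_right[of T "top_of_set K" O' K t0] t0 by blast
  show "\<exists>U. openin T U \<and> t0 \<in> U \<and> (\<forall>t\<in>U. dist (closest_point (?H t) 0) (closest_point (?H t0) 0) < d)"
  proof (intro exI conjI ballI)
    fix t assume t: "t \<in> U"
    have tT: "t \<in> topspace T" using t UV(1) openin_subset by blast
    have le: "dist (W t z) (W t0 z) \<le> e" "dist (W t0 z) (W t z) \<le> e" if "z \<in> K" for z
    proof -
      have "(t, z) \<in> O'" using UV(3,4) t that by blast
      then show "dist (W t z) (W t0 z) \<le> e" "dist (W t0 z) (W t z) \<le> e" by (simp_all add: O'_def dist_commute)
    qed
    have "(dist (closest_point (?H t0) 0) (closest_point (?H t) 0))\<^sup>2 \<le> 4 * e * norm y + e\<^sup>2"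
      unfolding y_def
    proof (rule closest_point_stable[OF H[OF t0] H[OF tT]])
      show "\<exists>y\<in>?H t. dist x y \<le> e" if "x \<in> ?H t0" for x by (rule hull_approx[OF le(2) that])
      show "\<exists>y\<in>?H t0. dist y x \<le> e" if "x \<in> ?H t" for x
        using hull_approx[OF le(1) that] by (simp add: dist_commute)
    qed
    also have "\<dots> \<le> 4 * e * norm y + e" using e by (simp add: power2_eq_square mult_le_one)
    also have "\<dots> < e * (4 * norm y + 2)" using e by (simp add: algebra_simps)
    also have "\<dots> \<le> d\<^sup>2" by (rule ed)
    finally show "dist (closest_point (?H t) 0) (closest_point (?H t0) 0) < d"
      using d by (metis dist_commute less_imp_le power2_less_imp_less)
  qed (use UV in auto)
qed

section \<open>The space of immersions and the continuity of the centre\<close>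

definition curvature_immersions :: "real set \<Rightarrow> ('n::finite euc1 \<Rightarrow> 'n euc2) set" where
  "curvature_immersions I = {f. immersion f \<and> (\<forall>p\<in>usphere. \<forall>\<kappa>. principal_curvature f p \<kappa> \<longrightarrow> \<kappa> \<in> I)}"

lemma topspace_immersion_space: "topspace (immersion_space I) = curvature_immersions I"
  by (auto simp: immersion_space_def topspace_subtopology topspace_smooth_topology curvature_immersions_def immersion_def)

lemma principal_curvature_iff:
  assumes "immersion f" "p \<in> usphere"
  shows "principal_curvature f p \<kappa> \<longleftrightarrow> (\<exists>u\<in>tangent p. u \<noteq> 0 \<and> Dh (gauss_map f) p u = - \<kappa> *\<^sub>R Dh f p u)"
  unfolding principal_curvature_def
  using dS_eq_Dh[OF immersion_smooth[OF assms(1)] assms(2)] dS_eq_Dh[OF gauss_map_smooth[OF assms(1)] assms(2)]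
  by (intro bex_cong) auto

locale admissible =
  fixes J :: "real set" and r :: real
  assumes J: "is_interval J" "J \<subseteq> {0<..<pi}" "J \<inter> (\<lambda>x. x + pi / 2) ` J = {}" and r: "r \<in> J"
begin

lemma between: "a \<in> J \<Longrightarrow> b \<in> J \<Longrightarrow> a \<le> x \<Longrightarrow> x \<le> b \<Longrightarrow> x \<in> J"
  using J(1) unfolding is_interval_1 by blast

text \<open>Otherwise \<open>a + pi / 2\<close> would lie between \<open>a\<close> and
  \<open>b\<close>, hence in \<open>J\<close>, while it also lies in the translate of
  \<open>J\<close>.\<close>

lemma short: "a \<in> J \<Longrightarrow> b \<in> J \<Longrightarrow> b < a + pi / 2"
proof (rule ccontr)
  assume a: "a \<in> J" and b: "b \<in> J" and "\<not> b < a + pi / 2"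
  then have "a + pi / 2 \<in> J" by (intro between[OF a b]) auto
  then show False using J(3) a by blast
qed

lemma bounds: "a \<in> J \<Longrightarrow> 0 < a \<and> a < pi"
  using J(2) by auto

lemma cot_antimono: "a \<in> J \<Longrightarrow> b \<in> J \<Longrightarrow> a \<le> b \<Longrightarrow> cot b \<le> cot a"
  using cot_less[of a b] bounds by (cases "a = b") fastforce+

lemma pinched:
  fixes f :: "'n::finite euc1 \<Rightarrow> 'n euc2"
  assumes f: "f \<in> curvature_immersions (cot ` J)" and n: "CARD('n) \<ge> 2"
  obtains a b where "a \<in> J" "b \<in> J" "a \<le> r" "r \<le> b" "pinched_front f (gauss_map f) a b"
proof -
  have imm: "immersion f" and pc: "\<And>p \<kappa>. p \<in> usphere \<Longrightarrow> principal_curvature f p \<kappa> \<Longrightarrow> \<kappa> \<in> cot ` J"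
    using f by (auto simp: curvature_immersions_def)
  interpret immersed_front f "gauss_map f" by (rule immersed_front_gauss_map[OF imm])
  have d3: "DIM('n euc1) \<ge> 3" using n by simp
  obtain k1 p1 u1 k2 p2 u2 where e: "p1 \<in> usphere" "u1 \<in> tangent p1" "u1 \<noteq> 0" "Dh (gauss_map f) p1 u1 = - k1 *\<^sub>R Dh f p1 u1"
    "p2 \<in> usphere" "u2 \<in> tangent p2" "u2 \<noteq> 0" "Dh (gauss_map f) p2 u2 = - k2 *\<^sub>R Dh f p2 u2"
    "\<And>p u. p \<in> usphere \<Longrightarrow> u \<in> tangent p \<Longrightarrow> k1 * (Dh f p u \<bullet> Dh f p u) \<le> - (Dh f p u \<bullet> Dh (gauss_map f) p u)"
    "\<And>p u. p \<in> usphere \<Longrightarrow> u \<in> tangent p \<Longrightarrow> - (Dh f p u \<bullet> Dh (gauss_map f) p u) \<le> k2 * (Dh f p u \<bullet> Dh f p u)"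
    by (rule curvature_range) (use d3 in simp, rule that, assumption+)
  have "principal_curvature f p1 k1" "principal_curvature f p2 k2"
    unfolding principal_curvature_iff[OF imm e(1)] principal_curvature_iff[OF imm e(5)] using e by blast+
  then obtain b0 a0 where ab0: "b0 \<in> J" "k1 = cot b0" "a0 \<in> J" "k2 = cot a0" using pc e(1,5) by blast
  \<comment> \<open>The interval is enlarged to contain \<open>r\<close>, since the deformation
    moves all radii towards \<open>r\<close>.\<close>
  define a where "a = min a0 r"
  define b where "b = max b0 r"
  have ab: "a \<in> J" "b \<in> J" "a \<le> r" "r \<le> b" "a \<le> a0" "b0 \<le> b" using ab0 r by (auto simp: a_def b_def min_def max_def)
  have c: "cot b \<le> k1" "k2 \<le> cot a" unfolding ab0 using ab ab0 by (auto intro: cot_antimono)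
  have "pinched_front f (gauss_map f) a b"
  proof (intro pinched_front.intro pinched_front_axioms.intro)
    show "immersed_front f (gauss_map f)" by (rule immersed_front_gauss_map[OF imm])
    show "0 < a" "b < pi" using bounds ab by auto
    show "b < a + pi / 2" using short ab by blast
    show "a \<le> b" using ab by simp
    show "3 \<le> DIM('n euc1)" by (rule d3)
    fix p u :: "'n euc1" assume pu: "p \<in> usphere" "u \<in> tangent p"
    show "cot b * (Dh f p u \<bullet> Dh f p u) \<le> - (Dh f p u \<bullet> Dh (gauss_map f) p u)"
      using e(9)[OF pu] mult_right_mono[OF c(1) inner_ge_zero[of "Dh f p u"]] by linarith
    show "- (Dh f p u \<bullet> Dh (gauss_map f) p u) \<le> cot a * (Dh f p u \<bullet> Dh f p u)"
      using e(10)[OF pu] mult_right_mono[OF c(2) inner_ge_zero[of "Dh f p u"]] by linarith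
  qed
  then show ?thesis using that ab by blast
qed

end

lemma csmooth_immersion_space:
  "csmooth (immersion_space I) (-{0}) (\<lambda>f. hext f)" "csmooth (immersion_space I) (-{0}) (\<lambda>f. hext (gauss_map f))"
proof -
  have "continuous_map (immersion_space I) smooth_topology (\<lambda>f. f)"
    unfolding immersion_space_def by (rule continuous_map_from_subtopology) simp
  then show *: "csmooth (immersion_space I) (-{0}) (\<lambda>f. hext f)" unfolding continuous_map_smooth_topology by (rule conjunct2)
  show "csmooth (immersion_space I) (-{0}) (\<lambda>f. hext (gauss_map f))"
    by (rule csmooth_hext_gauss_map[OF *]) (simp add: topspace_immersion_space curvature_immersions_def)
qed

lemma continuous_map_center:
  assumes adm: "admissible J r" and n: "CARD('n::finite) \<ge> 2"
  shows "continuous_map (immersion_space (cot ` J) :: ('n euc1 \<Rightarrow> 'n euc2) topology) euclidean (\<lambda>f. center f (gauss_map f))"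
proof -
  interpret admissible J r by (rule adm)
  define Y :: "('n euc1 \<Rightarrow> 'n euc2) topology" where "Y = immersion_space (cot ` J)"
  define P where "P = prod_topology Y (top_of_set (unit_tangents :: ('n euc1 \<times> 'n euc1) set))"
  have Y: "f \<in> topspace Y \<longleftrightarrow> f \<in> curvature_immersions (cot ` J)" for f by (simp add: Y_def topspace_immersion_space)
  have cs: "csmooth Y (-{0}) (\<lambda>f. hext f)" "csmooth Y (-{0}) (\<lambda>f. hext (gauss_map f))"
    unfolding Y_def by (rule csmooth_immersion_space)+
  have f: "continuous_map P Y fst" unfolding P_def by (rule continuous_map_fst)
  have s: "continuous_map P euclidean snd"
    unfolding P_def by (rule continuous_map_into_fulltopology[OF continuous_map_snd])
  have p: "continuous_map P euclidean (\<lambda>z. fst (snd z))" and u: "continuous_map P euclidean (\<lambda>z. snd (snd z))"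
    by (rule continuous_map_compose_on[OF s, where S=UNIV]; simp add: continuous_on_fst continuous_on_snd)+
  have U: "fst (snd z) \<in> usphere \<and> snd (snd z) \<in> tangent (fst (snd z)) \<and> snd (snd z) \<noteq> 0 \<and> snd z \<in> unit_tangents \<and> fst z \<in> topspace Y" if "z \<in> topspace P" for z
    using that by (auto simp: P_def unit_tangents_def)
  have U0: "fst (snd z) \<in> -{0}" if "z \<in> topspace P" for z using U[OF that] by auto
  have vf: "continuous_map P euclidean (\<lambda>z. fst z (fst (snd z)))"
    by (rule continuous_map_eq[OF csmooth_cont_compose[OF cs(1) f p U0]]) (assumption, rule hext_sphere[OF conjunct1[OF U]])
  have v\<nu>: "continuous_map P euclidean (\<lambda>z. gauss_map (fst z) (fst (snd z)))"
    by (rule continuous_map_eq[OF csmooth_cont_compose[OF cs(2) f p U0]]) (assumption, rule hext_sphere[OF conjunct1[OF U]])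
  have df: "continuous_map P euclidean (\<lambda>z. Dh (fst z) (fst (snd z)) (snd (snd z)))"
    unfolding Dh_def by (rule csmooth_frechet_derivative_compose[OF cs(1) f p U0 u])
  have d\<nu>: "continuous_map P euclidean (\<lambda>z. Dh (gauss_map (fst z)) (fst (snd z)) (snd (snd z)))"
    unfolding Dh_def by (rule csmooth_frechet_derivative_compose[OF cs(2) f p U0 u])
  have nz: "Dh (fst z) (fst (snd z)) (snd (snd z)) \<bullet> Dh (fst z) (fst (snd z)) (snd (snd z)) \<noteq> 0" if "z \<in> topspace P" for z
    using U[OF that] unfolding Y curvature_immersions_def immersion_iff by auto
  have k: "continuous_map P euclidean (\<lambda>z. ncurv (fst z) (gauss_map (fst z)) (snd z))"
    unfolding ncurv_def
    by (intro continuous_map_real_divide continuous_map_minus continuous_map_bilinear[OF bounded_bilinear_inner] df d\<nu> nz)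
  have W: "continuous_map P euclidean (\<lambda>z. ncurv (fst z) (gauss_map (fst z)) (snd z) *\<^sub>R fst z (fst (snd z)) + gauss_map (fst z) (fst (snd z)))"
    by (intro continuous_map_add continuous_map_bilinear[OF bounded_bilinear_scaleR] k vf v\<nu>)
  have c: "continuous_map Y euclidean (\<lambda>f. closest_point (normal_hull f (gauss_map f)) 0)"
    unfolding normal_hull_def
    by (rule continuous_map_closest_point[of Y unit_tangents, OF W[unfolded P_def] compact_unit_tangents unit_tangents_nonempty])
      (use n in simp)
  show ?thesis
    unfolding center_def Y_def[symmetric]
  proof (rule continuous_map_compose_on[OF c, where S="-{0}"])
    show "continuous_on (- {0}) (\<lambda>x :: 'n euc2. x /\<^sub>R norm x)" by (intro continuous_intros) auto
    fix f assume "f \<in> topspace Y"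
    then obtain a b where "pinched_front f (gauss_map f) a b" unfolding Y using pinched[OF _ n] by metis
    then show "closest_point (normal_hull f (gauss_map f)) 0 \<in> - {0}" using pinched_front.closest_nonzero by auto
  qed
qed

section \<open>The deformation\<close>

text \<open>For \<open>k\<^sup>2 + t\<^sup>2 = 1\<close>, the map \<open>pushA k t c\<close> is the conformal transformation of the unit sphere that
  fixes \<open>c\<close> and \<open>- c\<close> and is a dilation in the stereographic projection from \<open>- c\<close>; its differential at \<open>A\<close> is the
  multiple \<open>k / (1 + t (A \<bullet> c))\<close> of the isometry \<open>pushV k t c A\<close>. For \<open>t = 1\<close> it collapses the sphere to \<open>c\<close>, but
  \<open>pushV\<close> remains an isometry.\<close>

definition pushA :: "real \<Rightarrow> real \<Rightarrow> 'a::real_inner \<Rightarrow> 'a \<Rightarrow> 'a" where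
  "pushA k t c A = inverse (1 + t * (A \<bullet> c)) *\<^sub>R (k *\<^sub>R (A - (A \<bullet> c) *\<^sub>R c) + (A \<bullet> c + t) *\<^sub>R c)"

definition pushV :: "real \<Rightarrow> real \<Rightarrow> 'a::real_inner \<Rightarrow> 'a \<Rightarrow> 'a \<Rightarrow> 'a" where
  "pushV k t c A v = v - (v \<bullet> c) *\<^sub>R c +
     ((v \<bullet> c) * inverse (1 + t * (A \<bullet> c))) *\<^sub>R (k *\<^sub>R c - t *\<^sub>R (A - (A \<bullet> c) *\<^sub>R c))"

lemma linear_pushV: "linear (pushV k t c A)"
  by (rule linearI) (simp_all add: pushV_def algebra_simps)

context
  fixes k t :: real and c A :: "'a::real_inner"
  assumes kt: "k\<^sup>2 + t\<^sup>2 = 1" and c: "c \<bullet> c = 1" and A: "A \<bullet> A = 1" and D: "1 + t * (A \<bullet> c) \<noteq> 0"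
begin

private lemma D': "inverse (1 + t * (A \<bullet> c)) * (1 + t * (A \<bullet> c)) = 1"
  using D by simp

text \<open>With \<open>i\<close> standing for the inverse of \<open>1 + t * \<alpha>\<close>, the
  claim becomes a polynomial identity modulo \<open>i * (1 + t * \<alpha>) = 1\<close> and
  \<open>k\<^sup>2 + t\<^sup>2 = 1\<close>. The next two facts are obtained by the same
  reduction.\<close>

lemma pushV_inner:
  assumes "v \<bullet> A = 0" "w \<bullet> A = 0"
  shows "pushV k t c A v \<bullet> pushV k t c A w = v \<bullet> w"
proof -
  define i \<alpha> x y where "i = inverse (1 + t * (A \<bullet> c))" and "\<alpha> = A \<bullet> c" and "x = v \<bullet> c" and "y = w \<bullet> c"
  have "pushV k t c A v \<bullet> pushV k t c A w = v \<bullet> w - x * y + (x * i) * (t * (\<alpha> * y)) + (y * i) * (t * (\<alpha> * x))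
      + x * y * i * i * (k * k + t * t * (1 - \<alpha> * \<alpha>))"
    unfolding pushV_def i_def[symmetric]
    using assms A c by (simp add: inner_add_left inner_add_right inner_diff_left inner_diff_right inner_commute
      x_def y_def \<alpha>_def algebra_simps)
  also have "\<dots> = v \<bullet> w"
    using D'[folded i_def \<alpha>_def] kt by algebra
  finally show ?thesis .
qed

lemma pushV_pushA:
  assumes "v \<bullet> A = 0"
  shows "pushV k t c A v \<bullet> pushA k t c A = 0"
proof -
  define i \<alpha> x where "i = inverse (1 + t * (A \<bullet> c))" and "\<alpha> = A \<bullet> c" and "x = v \<bullet> c"
  have "pushV k t c A v \<bullet> pushA k t c A = i * (- (k * \<alpha> * x) + x * i * (k * (\<alpha> + t) - t * k * (1 - \<alpha> * \<alpha>)))"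
    unfolding pushV_def pushA_def i_def[symmetric]
    using assms A c by (simp add: inner_add_left inner_add_right inner_diff_left inner_diff_right inner_commute
      x_def \<alpha>_def algebra_simps)
  also have "\<dots> = 0"
    using D'[folded i_def \<alpha>_def] by algebra
  finally show ?thesis .
qed

lemma pushA_unit: "pushA k t c A \<bullet> pushA k t c A = 1"
proof -
  define i \<alpha> where "i = inverse (1 + t * (A \<bullet> c))" and "\<alpha> = A \<bullet> c"
  have "pushA k t c A \<bullet> pushA k t c A = i * i * (k * k * (1 - \<alpha> * \<alpha>) + (\<alpha> + t) * (\<alpha> + t))"
    unfolding pushA_def i_def[symmetric]
    using A c by (simp add: inner_add_left inner_add_right inner_diff_left inner_diff_right inner_commute \<alpha>_def algebra_simps)
  also have "\<dots> = 1"
    using D'[folded i_def \<alpha>_def] kt by algebra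
  finally show ?thesis .
qed

end

lemma pushA_has_derivative:
  fixes A :: "'b::real_normed_vector \<Rightarrow> 'a::euclidean_space"
  assumes kt: "k\<^sup>2 + t\<^sup>2 = 1" and D: "1 + t * (A p \<bullet> c) \<noteq> 0" and A: "(A has_derivative A') (at p)"
  shows "((\<lambda>x. pushA k t c (A x)) has_derivative (\<lambda>u. (k * inverse (1 + t * (A p \<bullet> c))) *\<^sub>R pushV k t c (A p) (A' u))) (at p)"
proof -
  define i where "i = inverse (1 + t * (A p \<bullet> c))"
  have d1: "((\<lambda>x. inverse (1 + t * (A x \<bullet> c))) has_derivative (\<lambda>u. - (i * (t * (A' u \<bullet> c)) * i))) (at p)"
    unfolding i_def by (rule derivative_eq_intros refl D A | simp add: D)+
  have "((\<lambda>x. pushA k t c (A x)) has_derivative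
      (\<lambda>u. i *\<^sub>R (k *\<^sub>R (A' u - (A' u \<bullet> c) *\<^sub>R c) + (A' u \<bullet> c) *\<^sub>R c) + (- (i * (t * (A' u \<bullet> c)) * i)) *\<^sub>R
        (k *\<^sub>R (A p - (A p \<bullet> c) *\<^sub>R c) + (A p \<bullet> c + t) *\<^sub>R c))) (at p)"
    unfolding pushA_def
    by (rule derivative_eq_intros d1 refl A | simp add: i_def)+
  moreover have "i *\<^sub>R (k *\<^sub>R (v - (v \<bullet> c) *\<^sub>R c) + (v \<bullet> c) *\<^sub>R c) + (- (i * (t * (v \<bullet> c)) * i)) *\<^sub>R
        (k *\<^sub>R (A p - (A p \<bullet> c) *\<^sub>R c) + (A p \<bullet> c + t) *\<^sub>R c) = (k * i) *\<^sub>R pushV k t c (A p) v" for v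
  proof (subst vector_eq_ldot[symmetric], rule allI)
    fix z
    define vz Az cz \<alpha> vc where "vz = z \<bullet> v" and "Az = z \<bullet> A p" and "cz = z \<bullet> c" and "\<alpha> = A p \<bullet> c" and "vc = v \<bullet> c"
    have "i * (1 + t * \<alpha>) = 1" using D by (simp add: i_def \<alpha>_def)
    then have "i * (k * (vz - vc * cz) + vc * cz) + (- (i * (t * vc) * i)) * (k * (Az - \<alpha> * cz) + (\<alpha> + t) * cz) =
      (k * i) * (vz - vc * cz + (vc * i) * (k * cz - t * (Az - \<alpha> * cz)))"
      using kt by algebra
    then show "z \<bullet> (i *\<^sub>R (k *\<^sub>R (v - (v \<bullet> c) *\<^sub>R c) + (v \<bullet> c) *\<^sub>R c) + (- (i * (t * (v \<bullet> c)) * i)) *\<^sub>R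
        (k *\<^sub>R (A p - (A p \<bullet> c) *\<^sub>R c) + (A p \<bullet> c + t) *\<^sub>R c)) = z \<bullet> ((k * i) *\<^sub>R pushV k t c (A p) v)"
      unfolding pushV_def i_def[symmetric] vz_def Az_def cz_def \<alpha>_def vc_def
      by (simp only: inner_add_right inner_diff_right inner_scaleR_right)
  qed
  ultimately show ?thesis by (simp add: i_def)
qed

text \<open>Moving the base point in the direction \<open>A' u\<close> contributes a multiple of
  \<open>pushV\<close> applied to \<open>A' u\<close>: a conformal map changes the shape operator by
  a scaling and by a multiple of the identity. The coefficient carries no factor \<open>k\<close>,
  so the formula survives the collapse at \<open>k = 0\<close>.\<close>

lemma pushV_has_derivative:
  fixes A B :: "'b::real_normed_vector \<Rightarrow> 'a::euclidean_space"
  assumes D: "1 + t * (A p \<bullet> c) \<noteq> 0" and A: "(A has_derivative A') (at p)" and B: "(B has_derivative B') (at p)"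
  shows "((\<lambda>x. pushV k t c (A x) (B x)) has_derivative (\<lambda>u. pushV k t c (A p) (B' u)
    - ((B p \<bullet> c) * t * inverse (1 + t * (A p \<bullet> c))) *\<^sub>R pushV k t c (A p) (A' u))) (at p)"
proof -
  define i where "i = inverse (1 + t * (A p \<bullet> c))"
  have d1: "((\<lambda>x. inverse (1 + t * (A x \<bullet> c))) has_derivative (\<lambda>u. - (i * (t * (A' u \<bullet> c)) * i))) (at p)"
    unfolding i_def by (rule derivative_eq_intros refl D A | simp add: D)+
  have "((\<lambda>x. pushV k t c (A x) (B x)) has_derivative
      (\<lambda>u. B' u - (B' u \<bullet> c) *\<^sub>R c + (((B p \<bullet> c) * i) *\<^sub>R (- (t *\<^sub>R (A' u - (A' u \<bullet> c) *\<^sub>R c))) +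
        ((B p \<bullet> c) * - (i * (t * (A' u \<bullet> c)) * i) + (B' u \<bullet> c) * i) *\<^sub>R (k *\<^sub>R c - t *\<^sub>R (A p - (A p \<bullet> c) *\<^sub>R c))))) (at p)"
    unfolding pushV_def
    by (rule derivative_eq_intros d1 refl A B | simp add: i_def)+
  moreover have "w - (w \<bullet> c) *\<^sub>R c + (((B p \<bullet> c) * i) *\<^sub>R (- (t *\<^sub>R (v - (v \<bullet> c) *\<^sub>R c))) +
        ((B p \<bullet> c) * - (i * (t * (v \<bullet> c)) * i) + (w \<bullet> c) * i) *\<^sub>R (k *\<^sub>R c - t *\<^sub>R (A p - (A p \<bullet> c) *\<^sub>R c))) =
      pushV k t c (A p) w - ((B p \<bullet> c) * t * i) *\<^sub>R pushV k t c (A p) v" for v w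
    unfolding pushV_def i_def[symmetric] by (simp add: algebra_simps)
  ultimately show ?thesis by (simp add: i_def)
qed

lemma csmooth_push:
  fixes A B :: "'t \<Rightarrow> 'a::euclidean_space \<Rightarrow> 'b::euclidean_space"
  assumes A: "csmooth T U A" and U: "open U" and c: "continuous_map T euclidean c"
    and k: "continuous_map T euclidean k" and t: "continuous_map T euclidean t"
    and D: "\<And>s x. s \<in> topspace T \<Longrightarrow> x \<in> U \<Longrightarrow> 1 + t s * (A s x \<bullet> c s) \<noteq> 0"
  shows "csmooth T U (\<lambda>s x. pushA (k s) (t s) (c s) (A s x))"
    and "csmooth T U B \<Longrightarrow> csmooth T U (\<lambda>s x. pushV (k s) (t s) (c s) (A s x) (B s x))"
  unfolding pushA_def pushV_def
  by (intro csmooth_scaleR csmooth_add csmooth_diff csmooth_mult csmooth_inner csmooth_inverse csmooth_const A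
      csmooth_time[OF c U] csmooth_time[OF k U] csmooth_time[OF t U] U D, assumption+)+

text \<open>\<open>D\<close> says that the conformal map is defined along \<open>A\<close>; for
  \<open>t = 1\<close> it keeps \<open>A p\<close> away from \<open>- c\<close>.\<close>

locale push_front = front A B for A B :: "'a::euclidean_space \<Rightarrow> 'b::euclidean_space" +
  fixes k t :: real and c :: 'b
  assumes kt: "k\<^sup>2 + t\<^sup>2 = 1" and c: "c \<bullet> c = 1" and D: "\<And>p. p \<in> usphere \<Longrightarrow> 1 + t * (A p \<bullet> c) > 0"
begin

lemma smooth_push:
  "smooth_map_on usphere (\<lambda>p. pushA k t c (A p))" "smooth_map_on usphere (\<lambda>p. pushV k t c (A p) (B p))"
proof -
  have D': "1 + t * (hext A x \<bullet> c) \<noteq> 0" if "x \<in> -{0}" for x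
    using D[OF normalize_sphere, of x] that by (simp add: hext_def)
  have cs: "csmooth (discrete_topology {()}) (-{0}) (\<lambda>_. hext A)" "csmooth (discrete_topology {()}) (-{0}) (\<lambda>_. hext B)"
    using sf s\<nu> by (simp_all add: smooth_map_on_sphere_iff csmooth_if_smooth_on_open)
  have e: "hext (\<lambda>p. pushA k t c (A p)) = (\<lambda>x. pushA k t c (hext A x))" "hext (\<lambda>p. pushV k t c (A p) (B p)) = (\<lambda>x. pushV k t c (hext A x) (hext B x))"
    by (simp_all add: hext_def fun_eq_iff)
  show "smooth_map_on usphere (\<lambda>p. pushA k t c (A p))"
    unfolding smooth_map_on_sphere_iff e
    by (rule smooth_on_openI[OF csmooth_push(1)[OF cs(1) open_punctured, of "\<lambda>_. c" "\<lambda>_. k" "\<lambda>_. t"] open_punctured]) (use D' in auto)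
  show "smooth_map_on usphere (\<lambda>p. pushV k t c (A p) (B p))"
    unfolding smooth_map_on_sphere_iff e
    by (rule smooth_on_openI[OF csmooth_push(2)[OF cs(1) open_punctured _ _ _ _ cs(2), of "\<lambda>_. c" "\<lambda>_. k" "\<lambda>_. t"] open_punctured]) (use D' in auto)
qed

lemma Dh_pushA:
  assumes p: "p \<in> usphere"
  shows "Dh (\<lambda>p. pushA k t c (A p)) p u = (k * inverse (1 + t * (A p \<bullet> c))) *\<^sub>R pushV k t c (A p) (Dh A p u)"
proof -
  have p0: "p \<noteq> 0" using p by auto
  have e: "hext (\<lambda>p. pushA k t c (A p)) = (\<lambda>x. pushA k t c (hext A x))" by (simp add: hext_def fun_eq_iff)
  have D': "1 + t * (hext A p \<bullet> c) \<noteq> 0" using D[OF p] by (simp add: hext_sphere[OF p])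
  from fun_cong[OF frechet_derivative_at[OF pushA_has_derivative[OF kt D' hext_has_derivative[OF sf p0]]], of u]
  show ?thesis unfolding Dh_def[of "\<lambda>p. pushA k t c (A p)"] e by (simp add: hext_sphere[OF p])
qed

lemma Dh_pushV:
  assumes p: "p \<in> usphere"
  shows "Dh (\<lambda>p. pushV k t c (A p) (B p)) p u = pushV k t c (A p) (Dh B p u)
    - ((B p \<bullet> c) * t * inverse (1 + t * (A p \<bullet> c))) *\<^sub>R pushV k t c (A p) (Dh A p u)"
proof -
  have p0: "p \<noteq> 0" using p by auto
  have e: "hext (\<lambda>p. pushV k t c (A p) (B p)) = (\<lambda>x. pushV k t c (hext A x) (hext B x))" by (simp add: hext_def fun_eq_iff)
  have D': "1 + t * (hext A p \<bullet> c) \<noteq> 0" using D[OF p] by (simp add: hext_sphere[OF p])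
  from fun_cong[OF frechet_derivative_at[OF pushV_has_derivative[OF D' hext_has_derivative[OF sf p0] hext_has_derivative[OF s\<nu> p0], where k=k]], of u]
  show ?thesis unfolding Dh_def[of "\<lambda>p. pushV k t c (A p) (B p)"] e by (simp add: hext_sphere[OF p])
qed

sublocale pushed: front "\<lambda>p. pushA k t c (A p)" "\<lambda>p. pushV k t c (A p) (B p)"
proof
  show "smooth_map_on usphere (\<lambda>p. pushA k t c (A p))" "smooth_map_on usphere (\<lambda>p. pushV k t c (A p) (B p))" by (rule smooth_push)+
  fix p u :: 'a assume p: "p \<in> usphere"
  have D': "1 + t * (A p \<bullet> c) \<noteq> 0" using D[OF p] by simp
  have BA: "B p \<bullet> A p = 0" using f\<nu>[OF p] by (simp add: inner_commute)
  show "pushA k t c (A p) \<bullet> pushA k t c (A p) = 1" by (rule pushA_unit[OF kt c nf[OF p] D'])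
  show "pushV k t c (A p) (B p) \<bullet> pushV k t c (A p) (B p) = 1"
    using pushV_inner[OF kt c nf[OF p] D' BA BA] n\<nu>[OF p] by simp
  show "pushA k t c (A p) \<bullet> pushV k t c (A p) (B p) = 0"
    using pushV_pushA[OF kt c nf[OF p] D' BA] by (simp add: inner_commute)
  show "Dh (\<lambda>p. pushA k t c (A p)) p u \<bullet> pushV k t c (A p) (B p) = 0"
    unfolding Dh_pushA[OF p] using pushV_inner[OF kt c nf[OF p] D' Df_f[OF p] BA] contact'[OF p] by simp
qed

text \<open>A linear relation between the pushed derivatives is a relation between images under the
  isometry \<open>pushV\<close>, so it holds before the push. The denominators are cleared, and
  \<open>k = 0\<close> is allowed.\<close>

lemma pushed_kernel:
  assumes p: "p \<in> usphere"
    and eq: "x *\<^sub>R Dh (\<lambda>p. pushA k t c (A p)) p u + y *\<^sub>R Dh (\<lambda>p. pushV k t c (A p) (B p)) p u = 0"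
  shows "(x * k - y * t * (B p \<bullet> c)) *\<^sub>R Dh A p u + (y * (1 + t * (A p \<bullet> c))) *\<^sub>R Dh B p u = 0"
proof -
  define i where "i = inverse (1 + t * (A p \<bullet> c))"
  have D': "1 + t * (A p \<bullet> c) \<noteq> 0" using D[OF p] by simp
  define v where "v = ((x * k - y * t * (B p \<bullet> c)) * i) *\<^sub>R Dh A p u + y *\<^sub>R Dh B p u"
  have "v \<bullet> A p = 0" by (simp add: v_def inner_add_left Df_f[OF p] D\<nu>_f[OF p])
  moreover have "pushV k t c (A p) v = 0"
    using eq unfolding Dh_pushA[OF p] Dh_pushV[OF p] i_def[symmetric]
    by (simp add: v_def linear_add[OF linear_pushV] linear_diff[OF linear_pushV] linear_cmul[OF linear_pushV] algebra_simps)
  ultimately have "v \<bullet> v = 0"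
    using pushV_inner[OF kt c nf[OF p] D', of v v] by simp
  then have "(1 + t * (A p \<bullet> c)) *\<^sub>R v = 0" by simp
  moreover have "(1 + t * (A p \<bullet> c)) * ((x * k - y * t * (B p \<bullet> c)) * i) = x * k - y * t * (B p \<bullet> c)"
    using D' by (simp add: i_def)
  moreover have "(1 + t * (A p \<bullet> c)) * y = y * (1 + t * (A p \<bullet> c))" by (rule mult.commute)
  ultimately show ?thesis unfolding v_def scaleR_add_right scaleR_scaleR by (simp only:)
qed

end

section \<open>How the deformation changes the curvature radii\<close>

lemma cot_attained:
  assumes "0 < a" "a \<le> b" "b < pi" "cot b \<le> x" "x \<le> cot a"
  obtains \<rho> where "a \<le> \<rho>" "\<rho> \<le> b" "cot \<rho> = x"
proof -
  have "continuous_on {a..b} cot"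
  proof (intro continuous_at_imp_continuous_on ballI isCont_cot)
    show "sin y \<noteq> 0" if "y \<in> {a..b}" for y using that sin_gt_zero[of y] assms by auto
  qed
  then show ?thesis using IVT2'[of cot b x a] assms that by blast
qed

text \<open>\<open>\<rho>' - r\<close> is the angle with tangent
  \<open>k * sin (\<rho> - r) / E\<close>. As \<open>k \<le> 1\<close> and \<open>E\<close> is at
  least the positive number \<open>cos (\<rho> - r)\<close>, it lies between 0 and
  \<open>\<rho> - r\<close>, so the new radius lies between \<open>r\<close> and the old
  one.\<close>

lemma intermediate_angle:
  assumes a: "a \<le> r" "r \<le> b" "b < a + pi / 2" "a \<le> \<rho>" "\<rho> \<le> b" and k: "0 \<le> k" "k \<le> 1" and E: "cos (\<rho> - r) \<le> E"
  obtains \<rho>' where "a \<le> \<rho>'" "\<rho>' \<le> b" "0 < cos (\<rho>' - r)" "k * sin (\<rho> - r) * cos (\<rho>' - r) = E * sin (\<rho>' - r)"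
proof -
  define \<tau> where "\<tau> = \<rho> - r"
  have \<tau>: "- (pi / 2) < \<tau>" "\<tau> < pi / 2" using a by (simp_all add: \<tau>_def)
  have c: "0 < cos \<tau>" using \<tau> by (simp add: cos_gt_zero_pi)
  have E0: "0 < E" using c E by (simp add: \<tau>_def)
  define \<theta> where "\<theta> = arctan (k * sin \<tau> / E)"
  have c\<theta>: "0 < cos \<theta>" unfolding \<theta>_def by (simp add: cos_arctan add_pos_nonneg)
  have "tan \<theta> = k * sin \<tau> / E" by (simp add: \<theta>_def tan_arctan)
  then have eq: "k * sin \<tau> * cos \<theta> = E * sin \<theta>" using c\<theta> E0 by (simp add: tan_def field_simps)
  have tt: "arctan (tan \<tau>) = \<tau>" using \<tau> by (simp add: arctan_tan)
  have "min 0 \<tau> \<le> \<theta> \<and> \<theta> \<le> max 0 \<tau>"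
  proof (cases "0 \<le> \<tau>")
    case True
    then have s: "0 \<le> sin \<tau>" using \<tau> by (intro sin_ge_zero) auto
    have "k * sin \<tau> / E \<le> sin \<tau> / cos \<tau>"
      using s k E c by (intro frac_le) (auto simp: \<tau>_def mult_left_le_one_le)
    then have "\<theta> \<le> arctan (tan \<tau>)" unfolding \<theta>_def tan_def by (simp add: arctan_le_iff)
    moreover have "0 \<le> \<theta>" using s k E0 by (simp add: \<theta>_def)
    ultimately show ?thesis using True tt by simp
  next
    case False
    then have s: "0 \<le> - sin \<tau>" using \<tau> sin_ge_zero[of "- \<tau>"] by auto
    have "k * (- sin \<tau>) / E \<le> (- sin \<tau>) / cos \<tau>"
      using s k E c by (intro frac_le mult_left_le_one_le) (auto simp: \<tau>_def)
    then have "sin \<tau> / cos \<tau> \<le> k * sin \<tau> / E" by simp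
    then have "arctan (tan \<tau>) \<le> \<theta>" unfolding \<theta>_def tan_def by (simp add: arctan_le_iff)
    moreover have "k * sin \<tau> \<le> 0" using s k by (simp add: mult_nonneg_nonpos)
    then have "k * sin \<tau> / E \<le> 0" using E0 by (simp add: divide_le_0_iff)
    then have "\<theta> \<le> 0" by (simp add: \<theta>_def)
    ultimately show ?thesis using False tt by simp
  qed
  then have "a \<le> r + \<theta>" "r + \<theta> \<le> b" using a by (auto simp: \<tau>_def)
  then show ?thesis using that[of "r + \<theta>"] c\<theta> eq by (simp add: \<tau>_def)
qed

locale deformation = pinched_front f \<nu> a b for f \<nu> :: "'a::euclidean_space \<Rightarrow> 'b::euclidean_space" and a b :: real +
  fixes r k t :: real and c :: 'b
  assumes r: "a \<le> r" "r \<le> b" and kt: "k\<^sup>2 + t\<^sup>2 = 1" and k: "0 \<le> k" and t: "0 \<le> t"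
    and c: "norm c = 1"
    and c_positive: "\<And>p u. p \<in> usphere \<Longrightarrow> u \<in> tangent p \<Longrightarrow> u \<noteq> 0 \<Longrightarrow> 0 < (ncurv f \<nu> (p, u) *\<^sub>R f p + \<nu> p) \<bullet> c"
begin

definition A where "A = (\<lambda>p. cos r *\<^sub>R f p + sin r *\<^sub>R \<nu> p)"
definition B where "B = (\<lambda>p. (- sin r) *\<^sub>R f p + cos r *\<^sub>R \<nu> p)"
definition f' where "f' = (\<lambda>p. cos (- r) *\<^sub>R pushA k t c (A p) + sin (- r) *\<^sub>R pushV k t c (A p) (B p))"
definition \<nu>' where "\<nu>' = (\<lambda>p. (- sin (- r)) *\<^sub>R pushA k t c (A p) + cos (- r) *\<^sub>R pushV k t c (A p) (B p))"

lemma front_AB: "front A B"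
  unfolding A_def B_def by (rule shifted_front) (rule front_axioms)

lemma k1: "k \<le> 1" and t1: "t \<le> 1"
proof -
  have "k\<^sup>2 \<le> 1\<^sup>2" "t\<^sup>2 \<le> 1\<^sup>2" using kt zero_le_power2[of k] zero_le_power2[of t] unfolding power_one by linarith+
  then show "k \<le> 1" "t \<le> 1" by (auto intro: power2_le_imp_le)
qed

text \<open>Multiplied by \<open>sin \<rho>\<close>, the positivity of the centre concerns the
  vector \<open>cos \<rho> *\<^sub>R f p + sin \<rho> *\<^sub>R \<nu> p\<close>, which in the
  rotated frame is \<open>cos (\<rho> - r) *\<^sub>R A p + sin (\<rho> - r) *\<^sub>R B
  p\<close>.\<close>

lemma angle:
  assumes p: "p \<in> usphere" and u: "u \<in> tangent p" "u \<noteq> 0"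
  obtains \<rho> where "a \<le> \<rho>" "\<rho> \<le> b" "cot \<rho> = ncurv f \<nu> (p, u)" "0 < sin \<rho>"
    "0 < cos (\<rho> - r) * (A p \<bullet> c) + sin (\<rho> - r) * (B p \<bullet> c)" "0 < cos (\<rho> - r)"
proof -
  have z: "cot b \<le> ncurv f \<nu> (p, u)" "ncurv f \<nu> (p, u) \<le> cot a"
    using ncurv_range[OF ncurv_normalize(1)[OF p u]] by (simp_all only: ncurv_normalize(2)[OF p u])
  obtain \<rho> where \<rho>: "a \<le> \<rho>" "\<rho> \<le> b" "cot \<rho> = ncurv f \<nu> (p, u)" by (rule cot_attained[OF ab(1,2,3) z])
  have s: "0 < sin \<rho>" using \<rho> ab by (intro sin_gt_zero) auto
  have "sin \<rho> * (cot \<rho> * (f p \<bullet> c) + \<nu> p \<bullet> c) > 0"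
    using c_positive[OF p u] s \<rho>(3) by (simp add: inner_add_left)
  then have "0 < cos \<rho> * (f p \<bullet> c) + sin \<rho> * (\<nu> p \<bullet> c)" using s by (simp add: cot_def distrib_left)
  also have "\<dots> = cos (\<rho> - r) * (A p \<bullet> c) + sin (\<rho> - r) * (B p \<bullet> c)"
  proof -
    have 1: "sin r * sin r + cos r * cos r = 1" using sin_cos_squared_add[of r] by (simp add: power2_eq_square)
    define x y where "x = f p \<bullet> c" and "y = \<nu> p \<bullet> c"
    have "(cos \<rho> * cos r + sin \<rho> * sin r) * (cos r * x + sin r * y) + (sin \<rho> * cos r - cos \<rho> * sin r) * (- sin r * x + cos r * y)
      = (sin r * sin r + cos r * cos r) * (cos \<rho> * x + sin \<rho> * y)" by algebra
    then show ?thesis unfolding A_def B_def cos_diff sin_diff 1 x_def y_def by (simp add: inner_add_left inner_diff_left)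
  qed
  finally have q: "0 < cos (\<rho> - r) * (A p \<bullet> c) + sin (\<rho> - r) * (B p \<bullet> c)" .
  have "0 < cos (\<rho> - r)" using \<rho> r ab by (intro cos_gt_zero_pi) auto
  then show ?thesis using that \<rho> s q by blast
qed

text \<open>If \<open>A p = - c\<close>, then \<open>B p \<bullet> c = 0\<close>, and the vector
  from \<open>angle\<close> would have negative inner product with \<open>c\<close>.\<close>

lemma A_c:
  assumes p: "p \<in> usphere"
  shows "- 1 < A p \<bullet> c"
proof -
  interpret AB: front A B by (rule front_AB)
  obtain u where u: "u \<in> tangent p" "u \<noteq> 0" by (rule tangent_nonzero_exists[OF sphere_nonzero[OF p] dim3])
  obtain \<rho> where \<rho>: "0 < cos (\<rho> - r) * (A p \<bullet> c) + sin (\<rho> - r) * (B p \<bullet> c)" "0 < cos (\<rho> - r)"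
    by (rule angle[OF p u])
  have nA: "norm (A p) = 1" using AB.nf[OF p] by (simp add: norm_eq_1)
  have "\<bar>A p \<bullet> c\<bar> \<le> 1" using Cauchy_Schwarz_ineq2[of "A p" c] nA c by simp
  moreover have "A p \<bullet> c \<noteq> - 1"
  proof
    assume e: "A p \<bullet> c = - 1"
    have "(norm (A p + c))\<^sup>2 = 0" using e AB.nf[OF p] c
      by (simp add: power2_norm_eq_inner inner_add_left inner_add_right inner_commute norm_eq_1)
    then have "c = - A p" by (simp add: add_eq_0_iff)
    then have "B p \<bullet> c = 0" using AB.f\<nu>[OF p] by (simp add: inner_commute)
    then show False using \<rho> e by simp
  qed
  ultimately show ?thesis by simp
qed

sublocale push: push_front A B k t c
proof (intro push_front.intro push_front_axioms.intro)
  show "front A B" by (rule front_AB)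
  show "c \<bullet> c = 1" using c by (simp add: norm_eq_1)
  fix p :: 'a assume p: "p \<in> usphere"
  show "0 < 1 + t * (A p \<bullet> c)"
  proof (cases "0 \<le> A p \<bullet> c")
    case True then show ?thesis using t by (simp add: add_pos_nonneg)
  next
    case False
    then have "t * (- (A p \<bullet> c)) \<le> 1 * (- (A p \<bullet> c))" using t1 by (intro mult_right_mono) auto
    then show ?thesis using A_c[OF p] by simp
  qed
qed (rule kt)

sublocale new: front f' \<nu>'
  unfolding f'_def \<nu>'_def by (rule shifted_front) (rule push.pushed.front_axioms)

text \<open>A linear relation between \<open>Dh f' p u\<close> and \<open>Dh \<nu>' p u\<close> is
  traced back: by the rotation through \<open>r\<close> to the pushed pair, by
  \<open>pushed_kernel\<close> to \<open>A\<close> and \<open>B\<close>, and from there to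
  \<open>f\<close> and \<open>\<nu>\<close>, where the inner product with \<open>Dh f p u\<close>
  brings in the normal curvature \<open>cot \<rho>\<close>. The coefficients \<open>(1, 0)\<close>
  show that \<open>f'\<close> is immersed, and \<open>(\<kappa>, 1)\<close> locate its principal
  curvatures.\<close>

lemma kernel:
  assumes p: "p \<in> usphere" and u: "u \<in> tangent p" "u \<noteq> 0"
    and eq: "x *\<^sub>R Dh f' p u + y *\<^sub>R Dh \<nu>' p u = 0"
  obtains \<rho>' where "a \<le> \<rho>'" "\<rho>' \<le> b" "x * sin \<rho>' = y * cos \<rho>'"
proof -
  define P where "P = Dh f p u \<bullet> Dh f p u"
  define N where "N = Dh \<nu> p u \<bullet> Dh f p u"
  define x1 where "x1 = x * cos r + y * sin r"
  define y1 where "y1 = y * cos r - x * sin r"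
  have p0: "p \<noteq> 0" using p by auto
  have D': "Dh f' p u = cos (- r) *\<^sub>R Dh (\<lambda>p. pushA k t c (A p)) p u + sin (- r) *\<^sub>R Dh (\<lambda>p. pushV k t c (A p) (B p)) p u"
    "Dh \<nu>' p u = (- sin (- r)) *\<^sub>R Dh (\<lambda>p. pushA k t c (A p)) p u + cos (- r) *\<^sub>R Dh (\<lambda>p. pushV k t c (A p) (B p)) p u"
    unfolding f'_def \<nu>'_def by (rule Dh_lincomb[OF push.smooth_push p0])+
  have "x1 *\<^sub>R Dh (\<lambda>p. pushA k t c (A p)) p u + y1 *\<^sub>R Dh (\<lambda>p. pushV k t c (A p) (B p)) p u = 0"
    using eq unfolding D' x1_def y1_def by (simp add: algebra_simps)
  note K = push.pushed_kernel[OF p this]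
  define X where "X = x1 * k - y1 * t * (B p \<bullet> c)"
  define Z where "Z = y1 * (1 + t * (A p \<bullet> c))"
  have DA: "Dh A p u = cos r *\<^sub>R Dh f p u + sin r *\<^sub>R Dh \<nu> p u" "Dh B p u = (- sin r) *\<^sub>R Dh f p u + cos r *\<^sub>R Dh \<nu> p u"
    unfolding A_def B_def by (rule Dh_lincomb[OF sf s\<nu> p0])+
  have "(X *\<^sub>R Dh A p u + Z *\<^sub>R Dh B p u) \<bullet> Dh f p u = 0" using K by (simp add: X_def Z_def)
  then have PN: "(X * cos r - Z * sin r) * P + (X * sin r + Z * cos r) * N = 0"
    unfolding DA P_def N_def by (simp add: inner_add_left inner_diff_left algebra_simps)
  obtain \<rho> where \<rho>: "a \<le> \<rho>" "\<rho> \<le> b" "cot \<rho> = ncurv f \<nu> (p, u)" "0 < sin \<rho>"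
    "0 < cos (\<rho> - r) * (A p \<bullet> c) + sin (\<rho> - r) * (B p \<bullet> c)" "0 < cos (\<rho> - r)"
    by (rule angle[OF p u])
  have P: "P > 0" using inj[OF p u(1)] u(2) by (auto simp: P_def)
  have "N = - (cot \<rho> * P)" using ncurv_mult[OF p u(1)] by (simp add: \<rho>(3) P_def N_def inner_commute)
  then have "sin \<rho> * N = - (cos \<rho> * P)" using \<rho>(4) by (simp add: cot_def)
  then have "(X * sin (\<rho> - r) - Z * cos (\<rho> - r)) * P = 0"
    using PN unfolding sin_diff cos_diff by algebra
  then have XZ: "X * sin (\<rho> - r) = Z * cos (\<rho> - r)" using P by simp
  \<comment> \<open>This is \<open>cos (\<rho> - r)\<close> plus \<open>t\<close> times a quantity
    that is positive by the choice of \<open>c\<close>, hence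
    \<open>cos (\<rho> - r) \<le> E\<close>.\<close>
  define E where "E = cos (\<rho> - r) + t * (cos (\<rho> - r) * (A p \<bullet> c) + sin (\<rho> - r) * (B p \<bullet> c))"
  have xy: "x1 * (k * sin (\<rho> - r)) = y1 * E" using XZ unfolding X_def Z_def E_def by algebra
  have "cos (\<rho> - r) \<le> E" using \<rho>(5) t by (simp add: E_def)
  then obtain \<rho>' where \<rho>': "a \<le> \<rho>'" "\<rho>' \<le> b" "0 < cos (\<rho>' - r)" "k * sin (\<rho> - r) * cos (\<rho>' - r) = E * sin (\<rho>' - r)"
    using intermediate_angle[OF r ab(4) \<rho>(1,2) k k1] by blast
  have E: "E > 0" using \<open>cos (\<rho> - r) \<le> E\<close> \<rho>(6) by linarith
  have "E * (x1 * sin (\<rho>' - r) - y1 * cos (\<rho>' - r)) = 0" using xy \<rho>'(4) by algebra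
  then have "x1 * sin (\<rho>' - r) = y1 * cos (\<rho>' - r)" using E by simp
  then have "(sin r * sin r + cos r * cos r) * (x * sin \<rho>' - y * cos \<rho>') = 0"
    unfolding x1_def y1_def sin_diff cos_diff by algebra
  moreover have "sin r * sin r + cos r * cos r = 1" using sin_cos_squared_add[of r] by (simp add: power2_eq_square)
  ultimately show ?thesis using that[OF \<rho>'(1,2)] by simp
qed

lemma new_immersed:
  assumes p: "p \<in> usphere" and u: "u \<in> tangent p" and 0: "Dh f' p u = 0"
  shows "u = 0"
proof (rule ccontr)
  assume "u \<noteq> 0"
  then obtain \<rho>' where "a \<le> \<rho>'" "\<rho>' \<le> b" "1 * sin \<rho>' = 0 * cos \<rho>'"
    using kernel[OF p u, of 1 0] 0 by auto
  then show False using sin_gt_zero[of \<rho>'] ab by simp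
qed

lemma new_curvature:
  assumes p: "p \<in> usphere" and u: "u \<in> tangent p" "u \<noteq> 0" and e: "Dh \<nu>' p u = - \<kappa> *\<^sub>R Dh f' p u"
  obtains \<rho>' where "a \<le> \<rho>'" "\<rho>' \<le> b" "\<kappa> = cot \<rho>'"
proof -
  obtain \<rho>' where \<rho>': "a \<le> \<rho>'" "\<rho>' \<le> b" "\<kappa> * sin \<rho>' = 1 * cos \<rho>'"
    by (rule kernel[OF p u, of \<kappa> 1]) (simp add: e, rule that)
  moreover have "sin \<rho>' > 0" using \<rho>' ab by (intro sin_gt_zero) auto
  ultimately show ?thesis using that[of \<rho>'] by (simp add: cot_def field_simps)
qed

end

section \<open>The deformation as a homotopy of the space of immersions\<close>

definition shiftA :: "real \<Rightarrow> ('n::finite euc1 \<Rightarrow> 'n euc2) \<Rightarrow> 'n euc1 \<Rightarrow> 'n euc2" where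
  "shiftA r f p = cos r *\<^sub>R f p + sin r *\<^sub>R gauss_map f p"

definition shiftB :: "real \<Rightarrow> ('n::finite euc1 \<Rightarrow> 'n euc2) \<Rightarrow> 'n euc1 \<Rightarrow> 'n euc2" where
  "shiftB r f p = (- sin r) *\<^sub>R f p + cos r *\<^sub>R gauss_map f p"

text \<open>\<open>z\<close> is a pair \<open>(\<phi>, f)\<close>. The parameters
  \<open>k = cos \<phi>\<close> and \<open>t = sin \<phi>\<close> run from \<open>(1, 0)\<close>,
  the identity, to \<open>(0, 1)\<close>, the collapse, at \<open>\<phi> = pi / 2\<close>. The
  rotation by \<open>- r\<close> undoes the parallel shift.\<close>

definition deformed :: "real \<Rightarrow> real \<times> ('n::finite euc1 \<Rightarrow> 'n euc2) \<Rightarrow> 'n euc1 \<Rightarrow> 'n euc2" where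
  "deformed r z p = cos (- r) *\<^sub>R pushA (cos (fst z)) (sin (fst z)) (center (snd z) (gauss_map (snd z))) (shiftA r (snd z) p)
     + sin (- r) *\<^sub>R pushV (cos (fst z)) (sin (fst z)) (center (snd z) (gauss_map (snd z))) (shiftA r (snd z) p) (shiftB r (snd z) p)"

definition deformed_normal :: "real \<Rightarrow> real \<times> ('n::finite euc1 \<Rightarrow> 'n euc2) \<Rightarrow> 'n euc1 \<Rightarrow> 'n euc2" where
  "deformed_normal r z p = (- sin (- r)) *\<^sub>R pushA (cos (fst z)) (sin (fst z)) (center (snd z) (gauss_map (snd z))) (shiftA r (snd z) p)
     + cos (- r) *\<^sub>R pushV (cos (fst z)) (sin (fst z)) (center (snd z) (gauss_map (snd z))) (shiftA r (snd z) p) (shiftB r (snd z) p)"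

definition deform_map :: "real \<Rightarrow> real \<times> ('n::finite euc1 \<Rightarrow> 'n euc2) \<Rightarrow> 'n euc1 \<Rightarrow> 'n euc2" where
  "deform_map r z = restrict (deformed r z) usphere"

lemma hext_restrict: "x \<noteq> 0 \<Longrightarrow> hext (restrict F usphere) x = hext F x"
  by (rule hext_cong) auto

lemma rotate_back:
  fixes x y :: "'a::real_vector"
  shows "cos r *\<^sub>R (cos r *\<^sub>R x + sin r *\<^sub>R y) - sin r *\<^sub>R (cos r *\<^sub>R y - sin r *\<^sub>R x) = x"
    and "sin r *\<^sub>R (cos r *\<^sub>R x + sin r *\<^sub>R y) + cos r *\<^sub>R (cos r *\<^sub>R y - sin r *\<^sub>R x) = y"
    and "cos r *\<^sub>R (cos r *\<^sub>R x - sin r *\<^sub>R y) + sin r *\<^sub>R (sin r *\<^sub>R x + cos r *\<^sub>R y) = x"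
proof -
  have "(cos r * cos r) *\<^sub>R z + (sin r * sin r) *\<^sub>R z = z" for z :: 'a
    using sin_cos_squared_add[of r] by (simp add: power2_eq_square add.commute flip: scaleR_add_left)
  note e = this this[unfolded add.commute[of "(cos r * cos r) *\<^sub>R _"]]
  show "cos r *\<^sub>R (cos r *\<^sub>R x + sin r *\<^sub>R y) - sin r *\<^sub>R (cos r *\<^sub>R y - sin r *\<^sub>R x) = x"
    "sin r *\<^sub>R (cos r *\<^sub>R x + sin r *\<^sub>R y) + cos r *\<^sub>R (cos r *\<^sub>R y - sin r *\<^sub>R x) = y"
    "cos r *\<^sub>R (cos r *\<^sub>R x - sin r *\<^sub>R y) + sin r *\<^sub>R (sin r *\<^sub>R x + cos r *\<^sub>R y) = x"
    using e[of x] e[of y] by (simp_all add: algebra_simps)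
qed

locale admissible_dim = admissible J r for J r +
  fixes Y :: "('n::finite euc1 \<Rightarrow> 'n euc2) set" and \<Phi> :: "(real \<times> ('n euc1 \<Rightarrow> 'n euc2)) topology"
  assumes n: "CARD('n) \<ge> 2"
  defines "Y \<equiv> curvature_immersions (cot ` J)"
  defines "\<Phi> \<equiv> prod_topology (top_of_set {0..pi/2}) (immersion_space (cot ` J))"
begin

lemma Y_immersion: "f \<in> Y \<Longrightarrow> immersion f"
  by (simp add: Y_def curvature_immersions_def)

lemma deformation:
  assumes f: "f \<in> Y" and \<phi>: "0 \<le> \<phi>" "\<phi> \<le> pi / 2"
  obtains a b where "a \<in> J" "b \<in> J" "deformation f (gauss_map f) a b r (cos \<phi>) (sin \<phi>) (center f (gauss_map f))"
    "deformed r (\<phi>, f) = deformation.f' f (gauss_map f) r (cos \<phi>) (sin \<phi>) (center f (gauss_map f))"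
    "deformed_normal r (\<phi>, f) = deformation.\<nu>' f (gauss_map f) r (cos \<phi>) (sin \<phi>) (center f (gauss_map f))"
    "shiftA r f = deformation.A f (gauss_map f) r"
proof -
  obtain a b where abJ: "a \<in> J" "b \<in> J" "a \<le> r" "r \<le> b" "pinched_front f (gauss_map f) a b"
    using pinched[OF _ n] f unfolding Y_def by blast
  interpret pinched_front f "gauss_map f" a b by (rule abJ)
  have d: "deformation f (gauss_map f) a b r (cos \<phi>) (sin \<phi>) (center f (gauss_map f))"
    by (intro deformation.intro deformation_axioms.intro abJ norm_center center_positive cos_ge_zero sin_ge_zero)
      (use \<phi> abJ in auto)
  note D = deformation.f'_def[OF d] deformation.\<nu>'_def[OF d] deformation.A_def[OF d] deformation.B_def[OF d]
  show ?thesis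
    by (rule that[OF abJ(1,2) d]) (simp_all only: D deformed_def[abs_def] deformed_normal_def[abs_def] shiftA_def[abs_def] shiftB_def[abs_def] fst_conv snd_conv)
qed

lemma deformed_front:
  assumes f: "f \<in> Y" and \<phi>: "0 \<le> \<phi>" "\<phi> \<le> pi / 2"
  shows "front (deformed r (\<phi>, f)) (deformed_normal r (\<phi>, f))"
    and "p \<in> usphere \<Longrightarrow> u \<in> tangent p \<Longrightarrow> Dh (deformed r (\<phi>, f)) p u = 0 \<Longrightarrow> u = 0"
    and "p \<in> usphere \<Longrightarrow> 0 < 1 + sin \<phi> * (shiftA r f p \<bullet> center f (gauss_map f))"
    and "p \<in> usphere \<Longrightarrow> u \<in> tangent p \<Longrightarrow> u \<noteq> 0 \<Longrightarrow> Dh (deformed_normal r (\<phi>, f)) p u = - \<kappa> *\<^sub>R Dh (deformed r (\<phi>, f)) p u \<Longrightarrow> \<kappa> \<in> cot ` J"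
proof -
  obtain a b where abJ: "a \<in> J" "b \<in> J" "deformation f (gauss_map f) a b r (cos \<phi>) (sin \<phi>) (center f (gauss_map f))"
    and e: "deformed r (\<phi>, f) = deformation.f' f (gauss_map f) r (cos \<phi>) (sin \<phi>) (center f (gauss_map f))"
    "deformed_normal r (\<phi>, f) = deformation.\<nu>' f (gauss_map f) r (cos \<phi>) (sin \<phi>) (center f (gauss_map f))"
    "shiftA r f = deformation.A f (gauss_map f) r"
    by (rule deformation[OF f \<phi>])
  interpret deformation f "gauss_map f" a b r "cos \<phi>" "sin \<phi>" "center f (gauss_map f)" by (rule abJ)
  show "front (deformed r (\<phi>, f)) (deformed_normal r (\<phi>, f))" unfolding e by (rule new.front_axioms)
  show "p \<in> usphere \<Longrightarrow> u \<in> tangent p \<Longrightarrow> Dh (deformed r (\<phi>, f)) p u = 0 \<Longrightarrow> u = 0" unfolding e by (rule new_immersed)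
  show "p \<in> usphere \<Longrightarrow> 0 < 1 + sin \<phi> * (shiftA r f p \<bullet> center f (gauss_map f))" unfolding e by (rule push.D)
  assume p: "p \<in> usphere" and u: "u \<in> tangent p" "u \<noteq> 0" and \<kappa>: "Dh (deformed_normal r (\<phi>, f)) p u = - \<kappa> *\<^sub>R Dh (deformed r (\<phi>, f)) p u"
  obtain \<rho> where "a \<le> \<rho>" "\<rho> \<le> b" "\<kappa> = cot \<rho>" by (rule new_curvature[OF p u \<kappa>[unfolded e]])
  then show "\<kappa> \<in> cot ` J" using between[OF abJ(1,2)] by blast
qed

lemma deform_map_immersion:
  assumes f: "f \<in> Y" and \<phi>: "0 \<le> \<phi>" "\<phi> \<le> pi / 2"
  shows "immersion (deform_map r (\<phi>, f))"
proof -
  interpret front "deformed r (\<phi>, f)" "deformed_normal r (\<phi>, f)" by (rule deformed_front[OF f \<phi>])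
  have "smooth_on_open (-{0}) (hext (deform_map r (\<phi>, f)))"
  proof (rule smooth_on_openI[OF csmooth_cong[OF csmooth_if_smooth_on_open]])
    show "smooth_on_open (-{0}) (hext (deformed r (\<phi>, f)))" using sf by (simp add: smooth_map_on_sphere_iff)
  qed (auto simp: deform_map_def hext_restrict open_punctured)
  moreover have "deform_map r (\<phi>, f) \<in> usphere \<rightarrow>\<^sub>E usphere"
    using nf by (auto simp: deform_map_def norm_eq_1)
  ultimately have "deform_map r (\<phi>, f) \<in> smooth_maps" by (simp add: smooth_maps_iff)
  moreover have "Dh (deform_map r (\<phi>, f)) p = Dh (deformed r (\<phi>, f)) p" if "p \<in> usphere" for p
    by (rule Dh_cong) (use that in \<open>auto simp: deform_map_def\<close>)
  ultimately show ?thesis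
    unfolding immersion_iff using deformed_front(2)[OF f \<phi>] by auto
qed

lemma csmooth_deformed:
  "csmooth \<Phi> (-{0}) (\<lambda>z. hext (deformed r z))" "csmooth \<Phi> (-{0}) (\<lambda>z. hext (deformed_normal r z))"
proof -
  let ?c = "\<lambda>z. center (snd z) (gauss_map (snd z)) :: 'n euc2"
  have s: "continuous_map \<Phi> (immersion_space (cot ` J)) snd" unfolding \<Phi>_def by (rule continuous_map_snd)
  have f: "continuous_map \<Phi> euclidean fst" unfolding \<Phi>_def by (rule continuous_map_into_fulltopology[OF continuous_map_fst])
  have c: "continuous_map \<Phi> euclidean ?c"
    using continuous_map_compose[OF s continuous_map_center[OF admissible_axioms n]] by (simp add: o_def)
  have k: "continuous_map \<Phi> euclidean (\<lambda>z. cos (fst z))" and t: "continuous_map \<Phi> euclidean (\<lambda>z. sin (fst z))"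
    by (rule continuous_map_compose_on[OF f, where S=UNIV]; simp add: continuous_on_cos continuous_on_sin)+
  have A: "csmooth \<Phi> (-{0}) (\<lambda>z. hext (shiftA r (snd z)))" and B: "csmooth \<Phi> (-{0}) (\<lambda>z. hext (shiftB r (snd z)))"
    unfolding hext_def shiftA_def shiftB_def
    by (intro csmooth_add csmooth_scaleR csmooth_const csmooth_param[OF csmooth_immersion_space(1)[unfolded hext_def] s]
      csmooth_param[OF csmooth_immersion_space(2)[unfolded hext_def] s] open_punctured)+
  have D: "1 + sin (fst z) * (hext (shiftA r (snd z)) x \<bullet> ?c z) \<noteq> 0" if z: "z \<in> topspace \<Phi>" and x: "x \<in> - {0}" for z x
  proof -
    have "snd z \<in> Y" "0 \<le> fst z" "fst z \<le> pi / 2" using z by (auto simp: \<Phi>_def Y_def topspace_immersion_space)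
    from deformed_front(3)[OF this normalize_sphere, of x] x show ?thesis by (simp add: hext_def)
  qed
  note P = csmooth_push(1)[OF A open_punctured c k t D] csmooth_push(2)[OF A open_punctured c k t D B]
  have "csmooth \<Phi> (-{0}) (\<lambda>z x. x1 *\<^sub>R pushA (cos (fst z)) (sin (fst z)) (?c z) (hext (shiftA r (snd z)) x)
     + x2 *\<^sub>R pushV (cos (fst z)) (sin (fst z)) (?c z) (hext (shiftA r (snd z)) x) (hext (shiftB r (snd z)) x))" for x1 x2
    by (rule csmooth_add[OF csmooth_scaleR[OF csmooth_const P(1)] csmooth_scaleR[OF csmooth_const P(2)]])
      (simp_all add: open_punctured)
  then show "csmooth \<Phi> (-{0}) (\<lambda>z. hext (deformed r z))" "csmooth \<Phi> (-{0}) (\<lambda>z. hext (deformed_normal r z))"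
    unfolding hext_def deformed_def deformed_normal_def by this+
qed

lemma deformed_0:
  assumes f: "f \<in> Y"
  shows "deform_map r (0, f) = f" "p \<in> usphere \<Longrightarrow> deformed_normal r (0, f) p = gauss_map f p"
proof -
  have A: "pushA 1 0 c x = x" and V: "pushV 1 0 c x y = y" for c x y :: "'n euc2" by (simp_all add: pushA_def pushV_def)
  have "deformed r (0, f) p = f p" "deformed_normal r (0, f) p = gauss_map f p" for p
    using rotate_back(1,2)[of r "f p" "gauss_map f p"] by (simp_all add: deformed_def deformed_normal_def A V shiftA_def shiftB_def)
  moreover have "f \<in> extensional usphere" using Y_immersion[OF f] by (auto simp: immersion_def smooth_maps_def PiE_iff)
  ultimately show "deform_map r (0, f) = f" "p \<in> usphere \<Longrightarrow> deformed_normal r (0, f) p = gauss_map f p"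
    by (auto simp: deform_map_def fun_eq_iff extensional_def)
qed

text \<open>\<open>deformed_normal\<close> is a unit normal of the immersion at every time, so its
  orientation sign never vanishes. At time 0 it is the Gauss map itself, and by continuity the sign
  stays positive.\<close>

lemma gauss_map_deform_map:
  assumes f: "f \<in> Y" and \<phi>: "0 \<le> \<phi>" "\<phi> \<le> pi / 2" and p: "p \<in> usphere"
  shows "gauss_map (deform_map r (\<phi>, f)) p = deformed_normal r (\<phi>, f) p"
proof -
  define T where "T = top_of_set {0..pi/2}"
  have fr: "front (deformed r (x, f)) (deformed_normal r (x, f))" and im: "immersion (deform_map r (x, f))" if "x \<in> {0..pi/2}" for x
    using deformed_front(1)[OF f] deform_map_immersion[OF f] that by auto
  have normal: "deformed_normal r (x, f) p \<bullet> deform_map r (x, f) p = 0" "deformed_normal r (x, f) p \<bullet> deformed_normal r (x, f) p = 1"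
      "deformed_normal r (x, f) p \<bullet> Dh (deform_map r (x, f)) p u = 0" if "x \<in> {0..pi/2}" for x u
  proof -
    interpret front "deformed r (x, f)" "deformed_normal r (x, f)" by (rule fr[OF that])
    have "Dh (deform_map r (x, f)) p = Dh (deformed r (x, f)) p"
      by (rule Dh_cong) (use p in \<open>auto simp: deform_map_def\<close>)
    then show "deformed_normal r (x, f) p \<bullet> deform_map r (x, f) p = 0" "deformed_normal r (x, f) p \<bullet> deformed_normal r (x, f) p = 1"
      "deformed_normal r (x, f) p \<bullet> Dh (deform_map r (x, f)) p u = 0"
      using f\<nu>[OF p] n\<nu>[OF p] contact'[OF p] p by (simp_all add: inner_commute deform_map_def)
  qed
  have nz: "orient (deform_map r (x, f)) p (deformed_normal r (x, f) p) \<noteq> 0" if "x \<in> {0..pi/2}" for x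
  proof (rule orient_nonzero[OF im[OF that] p])
    show "deformed_normal r (x, f) p \<noteq> 0" using normal(2)[OF that] by auto
  qed (use normal[OF that] in auto)
  have "f \<in> topspace (immersion_space (cot ` J))" using f by (simp add: topspace_immersion_space Y_def)
  then have "continuous_map T \<Phi> (\<lambda>x. (x, f))" unfolding T_def \<Phi>_def by (intro continuous_map_pairedI) auto
  note cs = csmooth_param[OF csmooth_deformed(1) this] csmooth_param[OF csmooth_deformed(2) this]
  have "csmooth T (-{0}) (\<lambda>x. hext (deform_map r (x, f)))"
    by (rule csmooth_cong[OF cs(1) open_punctured]) (simp add: deform_map_def hext_restrict)
  then have cn: "csmooth T (-{0}) (\<lambda>x. hext (cross_normal (deform_map r (x, f))))"
    by (rule csmooth_cross_normal) (simp add: T_def im)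
  have p0: "\<And>x. x \<in> topspace T \<Longrightarrow> p \<in> -{0}" using p by auto
  have "continuous_map T euclidean (\<lambda>x. hext (cross_normal (deform_map r (x, f))) p \<bullet> hext (deformed_normal r (x, f)) p)"
    by (intro continuous_map_bilinear[OF bounded_bilinear_inner] csmooth_cont_compose[OF cn continuous_map_id[unfolded id_def] _ p0]
       csmooth_cont_compose[OF cs(2) continuous_map_id[unfolded id_def] _ p0]) auto
  then have "continuous_on {0..pi/2} (\<lambda>x. hext (cross_normal (deform_map r (x, f))) p \<bullet> hext (deformed_normal r (x, f)) p)"
    by (simp add: T_def continuous_map_iff_continuous)
  then have co: "continuous_on {0..pi/2} (\<lambda>x. orient (deform_map r (x, f)) p (deformed_normal r (x, f) p))"
    by (rule continuous_on_eq) (simp add: hext_sphere[OF p] orient_inner[OF im p])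
  have pos0: "orient (deform_map r (0, f)) p (deformed_normal r (0, f) p) > 0"
    using gauss_map_props(4)[OF Y_immersion[OF f] p] by (simp add: deformed_0(1)[OF f] deformed_0(2)[OF f p])
  have "orient (deform_map r (\<phi>, f)) p (deformed_normal r (\<phi>, f) p) > 0"
  proof (rule ccontr)
    assume "\<not> ?thesis"
    then obtain x where "0 \<le> x" "x \<le> \<phi>" "orient (deform_map r (x, f)) p (deformed_normal r (x, f) p) = 0"
      using IVT2'[of "\<lambda>x. orient (deform_map r (x, f)) p (deformed_normal r (x, f) p)" \<phi> 0 0] pos0 \<phi>(1)
        continuous_on_subset[OF co, of "{0..\<phi>}"] \<phi>(2) by force
    then show False using nz[of x] \<phi>(2) by auto
  qed
  then show ?thesis
    using normal[of \<phi>] \<phi> by (intro gauss_map_unique[OF deform_map_immersion[OF f \<phi>] p]) auto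
qed

lemma deform_map_in:
  assumes f: "f \<in> Y" and \<phi>: "0 \<le> \<phi>" "\<phi> \<le> pi / 2"
  shows "deform_map r (\<phi>, f) \<in> Y"
  unfolding Y_def curvature_immersions_def
proof (intro CollectI conjI ballI allI impI)
  show im: "immersion (deform_map r (\<phi>, f))" by (rule deform_map_immersion[OF f \<phi>])
  fix p \<kappa> assume p: "p \<in> usphere" and "principal_curvature (deform_map r (\<phi>, f)) p \<kappa>"
  then obtain u where u: "u \<in> tangent p" "u \<noteq> 0" "Dh (gauss_map (deform_map r (\<phi>, f))) p u = - \<kappa> *\<^sub>R Dh (deform_map r (\<phi>, f)) p u"
    unfolding principal_curvature_iff[OF im p] by blast
  have "Dh (deform_map r (\<phi>, f)) p = Dh (deformed r (\<phi>, f)) p"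
    by (rule Dh_cong) (use p in \<open>auto simp: deform_map_def\<close>)
  moreover have "Dh (gauss_map (deform_map r (\<phi>, f))) p = Dh (deformed_normal r (\<phi>, f)) p"
    by (rule Dh_cong) (use p gauss_map_deform_map[OF f \<phi>] in auto)
  ultimately show "\<kappa> \<in> cot ` J" using deformed_front(4)[OF f \<phi> p u(1,2)] u(3) by simp
qed

lemma continuous_map_deform_map:
  "continuous_map \<Phi> (immersion_space (cot ` J)) (deform_map r)"
proof -
  have \<Phi>: "\<exists>\<phi> f. z = (\<phi>, f) \<and> 0 \<le> \<phi> \<and> \<phi> \<le> pi / 2 \<and> f \<in> Y" if "z \<in> topspace \<Phi>" for z
    using that by (cases z) (auto simp: \<Phi>_def Y_def topspace_immersion_space)
  have inY: "deform_map r z \<in> Y" if z: "z \<in> topspace \<Phi>" for z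
    using \<Phi>[OF z] deform_map_in by auto
  have "continuous_map \<Phi> smooth_topology (deform_map r)"
    unfolding continuous_map_smooth_topology
  proof
    show "\<forall>z\<in>topspace \<Phi>. deform_map r z \<in> smooth_maps"
      using inY Y_immersion unfolding immersion_def by blast
    show "csmooth \<Phi> (-{0}) (\<lambda>z. hext (deform_map r z))"
      by (rule csmooth_cong[OF csmooth_deformed(1) open_punctured]) (simp add: deform_map_def hext_restrict)
  qed
  then show ?thesis
    unfolding immersion_space_def continuous_map_in_subtopology
    using inY by (auto simp: Y_def curvature_immersions_def)
qed

text \<open>The parallel hypersurface at distance \<open>r\<close> is a single point
  \<open>c\<close>: these are the immersions into the round sphere of radius \<open>r\<close> about
  \<open>c\<close>, with normal towards \<open>c\<close>.\<close>

definition round_maps :: "('n euc1 \<Rightarrow> 'n euc2) set" where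
  "round_maps = {f \<in> Y. \<exists>c. \<forall>p\<in>usphere. shiftA r f p = c}"

lemma deform_map_end:
  assumes f: "f \<in> Y"
  shows "deform_map r (pi / 2, f) \<in> round_maps"
proof -
  define c where "c = center f (gauss_map f)"
  have "shiftA r (deform_map r (pi / 2, f)) p = c" if p: "p \<in> usphere" for p
  proof -
    have D: "1 + shiftA r f p \<bullet> c \<noteq> 0" using deformed_front(3)[OF f _ _ p, of "pi / 2"] by (simp add: c_def)
    have "shiftA r (deform_map r (pi / 2, f)) p = cos r *\<^sub>R deformed r (pi / 2, f) p + sin r *\<^sub>R deformed_normal r (pi / 2, f) p"
      using p gauss_map_deform_map[OF f _ _ p, of "pi / 2"] by (simp add: shiftA_def) (simp add: deform_map_def)
    also have "\<dots> = pushA 0 1 c (shiftA r f p)"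
      using rotate_back(3)[of r "pushA 0 1 c (shiftA r f p)" "pushV 0 1 c (shiftA r f p) (shiftB r f p)"]
      by (simp add: deformed_def deformed_normal_def c_def)
    also have "\<dots> = c" using D by (simp add: pushA_def add.commute)
    finally show ?thesis .
  qed
  then show ?thesis using deform_map_in[OF f] by (auto simp: round_maps_def)
qed

text \<open>All normal curvatures equal \<open>cot r\<close>, so the hull that defines the centre is
  the single point \<open>inverse (sin r) *\<^sub>R c\<close>.\<close>

lemma round_center:
  assumes f: "f \<in> Y" and c: "\<And>p. p \<in> usphere \<Longrightarrow> shiftA r f p = c"
  shows "center f (gauss_map f) = c"
proof -
  interpret immersed_front f "gauss_map f" by (rule immersed_front_gauss_map[OF Y_immersion[OF f]])
  have sr: "sin r > 0" using bounds[OF r] by (intro sin_gt_zero) auto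
  obtain p0 :: "'n euc1" where p0: "p0 \<in> usphere" using sphere_eq_empty[of "0 :: 'n euc1" 1] by fastforce
  interpret sh: front "\<lambda>p. cos r *\<^sub>R f p + sin r *\<^sub>R gauss_map f p" "\<lambda>p. (- sin r) *\<^sub>R f p + cos r *\<^sub>R gauss_map f p"
    by (rule shifted_front) (rule front_axioms)
  have nc: "norm c = 1" using c[OF p0] sh.nf[OF p0] by (simp add: norm_eq_1 shiftA_def)
  have k: "ncurv f (gauss_map f) (p, u) *\<^sub>R f p + gauss_map f p = inverse (sin r) *\<^sub>R c" if pu: "(p, u) \<in> unit_tangents" for p u
  proof -
    have p: "p \<in> usphere" and u: "u \<in> tangent p" "u \<noteq> 0" using pu by (auto simp: unit_tangents_def)
    have "Dh (shiftA r f) p u = Dh (\<lambda>_. c) p u" by (rule fun_cong[OF Dh_cong]) (use c p in auto)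
    moreover have "Dh (\<lambda>_. c) p u = 0" by (simp add: Dh_def hext_def[abs_def])
    ultimately have "cos r *\<^sub>R Dh f p u + sin r *\<^sub>R Dh (gauss_map f) p u = 0"
      using Dh_lincomb[OF sf s\<nu> sphere_nonzero[OF p], of "cos r" "sin r" u] by (simp add: shiftA_def[abs_def])
    from arg_cong[OF this, of "(*\<^sub>R) (inverse (sin r))"] have "Dh (gauss_map f) p u = - cot r *\<^sub>R Dh f p u"
      using sr by (simp add: scaleR_add_right cot_def divide_inverse mult.commute eq_neg_iff_add_eq_0 add.commute)
    then have "ncurv f (gauss_map f) (p, u) = cot r" by (rule ncurv_eigen[OF p u])
    then show ?thesis using sr unfolding c[OF p, symmetric] shiftA_def by (simp add: scaleR_add_right cot_def divide_inverse mult.commute)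
  qed
  have "(\<lambda>z. ncurv f (gauss_map f) z *\<^sub>R f (fst z) + gauss_map f (fst z)) ` unit_tangents = {inverse (sin r) *\<^sub>R c}"
  proof -
    have "unit_tangents \<noteq> ({} :: ('n euc1 \<times> 'n euc1) set)" using n by (intro unit_tangents_nonempty) simp
    moreover have "ncurv f (gauss_map f) z *\<^sub>R f (fst z) + gauss_map f (fst z) = inverse (sin r) *\<^sub>R c" if "z \<in> unit_tangents" for z
      using k[of "fst z" "snd z"] that by simp
    ultimately show ?thesis by (simp add: image_constant_conv cong: image_cong)
  qed
  then have h: "normal_hull f (gauss_map f) = {inverse (sin r) *\<^sub>R c}" by (simp add: normal_hull_def)
  have "closest_point {x} 0 = x" for x :: "'n euc2" using closest_point_in_set[of "{x}" 0] by simp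
  then show ?thesis unfolding center_def h using sr nc by simp
qed

text \<open>\<open>pushA\<close> fixes \<open>c\<close>, which is the whole parallel hypersurface,
  and \<open>pushV\<close> at \<open>c\<close> fixes all vectors orthogonal to \<open>c\<close>, in
  particular the normals.\<close>

lemma deform_map_round:
  assumes f: "f \<in> round_maps" and that: "0 \<le> \<phi>" "\<phi> \<le> pi / 2"
  shows "deform_map r (\<phi>, f) = f"
proof
  fix p
  obtain c where fY: "f \<in> Y" and c: "\<And>p. p \<in> usphere \<Longrightarrow> shiftA r f p = c" using f by (auto simp: round_maps_def)
  have fe: "f \<in> extensional usphere" using Y_immersion[OF fY] by (auto simp: immersion_def smooth_maps_def PiE_iff)
  interpret immersed_front f "gauss_map f" by (rule immersed_front_gauss_map[OF Y_immersion[OF fY]])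
  interpret sh: front "\<lambda>p. cos r *\<^sub>R f p + sin r *\<^sub>R gauss_map f p" "\<lambda>p. (- sin r) *\<^sub>R f p + cos r *\<^sub>R gauss_map f p"
    by (rule shifted_front) (rule front_axioms)
  show "deform_map r (\<phi>, f) p = f p"
  proof (cases "p \<in> usphere")
    case p: True
    have s0: "sin \<phi> \<ge> 0" using that by (intro sin_ge_zero) auto
    have cc: "c \<bullet> c = 1" and Bc: "shiftB r f p \<bullet> c = 0"
      using sh.nf[OF p] sh.f\<nu>[OF p] unfolding c[OF p, symmetric] by (simp_all add: shiftA_def shiftB_def inner_commute)
    have "pushA (cos \<phi>) (sin \<phi>) c c = (inverse (1 + sin \<phi>) * (1 + sin \<phi>)) *\<^sub>R c" by (simp add: pushA_def cc)
    then have "pushA (cos \<phi>) (sin \<phi>) c c = c" using s0 by simp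
    moreover have "pushV (cos \<phi>) (sin \<phi>) c c (shiftB r f p) = shiftB r f p" by (simp add: pushV_def Bc)
    ultimately have "deformed r (\<phi>, f) p = cos r *\<^sub>R shiftA r f p - sin r *\<^sub>R shiftB r f p"
      using round_center[OF fY, of c] c by (simp add: deformed_def c[OF p])
    also have "\<dots> = f p" using rotate_back(1)[of r "f p" "gauss_map f p"] by (simp add: shiftA_def shiftB_def)
    finally show ?thesis using p by (simp add: deform_map_def)
  qed (use fe in \<open>auto simp: deform_map_def extensional_def\<close>)
qed

end

section \<open>Retractions that are weak homotopy equivalences\<close>

lemma cube_coordinate: "continuous_map (cube k) euclidean (\<lambda>t. t i)"
  unfolding cube_def using continuous_map_product_projection[of i UNIV "\<lambda>_. euclideanreal"] by (intro continuous_map_from_subtopology) simp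

lemma topspace_cube: "topspace (cube k) = {t. (\<forall>i<k. t i \<in> {0..1}) \<and> (\<forall>i\<ge>k. t i = 0)}"
  by (simp add: cube_def)

lemma continuous_map_into_cube:
  assumes "\<And>i. continuous_map Z euclidean (\<lambda>z. h z i)" "\<And>z. z \<in> topspace Z \<Longrightarrow> h z \<in> topspace (cube k)"
  shows "continuous_map Z (cube k) h"
  using assms by (auto simp: cube_def continuous_map_in_subtopology continuous_map_componentwise_UNIV)

lemma concat_cube_comp: "F \<circ> concat_cube g h = concat_cube (F \<circ> g) (F \<circ> h)"
  by (auto simp: concat_cube_def fun_eq_iff)

lemma based_at_concat_cube:
  assumes k: "k \<ge> 1" and g: "based_at k x0 g" and h: "based_at k x0 h"
  shows "based_at k x0 (concat_cube g h)"
  unfolding based_at_def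
proof (intro ballI impI)
  fix t assume t: "t \<in> topspace (cube k)" and ex: "\<exists>i<k. t i = 0 \<or> t i = 1"
  then obtain i where i: "i < k" "t i = 0 \<or> t i = 1" by blast
  have t0: "t 0 \<in> {0..1}" using t k by (auto simp: topspace_cube)
  show "concat_cube g h t = x0"
  proof (cases "t 0 \<le> 1 / 2")
    case True
    have "t(0 := 2 * t 0) \<in> topspace (cube k)" using t t0 True k by (auto simp: topspace_cube)
    moreover have "(t(0 := 2 * t 0)) i = 0 \<or> (t(0 := 2 * t 0)) i = 1" using i True by auto
    ultimately show ?thesis using g i(1) True unfolding based_at_def concat_cube_def by auto
  next
    case False
    have "t(0 := 2 * t 0 - 1) \<in> topspace (cube k)" using t t0 False k by (auto simp: topspace_cube)
    moreover have "(t(0 := 2 * t 0 - 1)) i = 0 \<or> (t(0 := 2 * t 0 - 1)) i = 1" using i False by auto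
    ultimately show ?thesis using h i(1) False unfolding based_at_def concat_cube_def by auto
  qed
qed

lemma concat_cube_homotopic:
  assumes k: "k \<ge> 1" and g: "homotopic_with (based_at k x0) (cube k) X g g'" and h: "homotopic_with (based_at k x0) (cube k) X h h'"
  shows "homotopic_with (based_at k x0) (cube k) X (concat_cube g h) (concat_cube g' h')"
proof -
  let ?I = "top_of_set {0..1::real}"
  obtain G where G: "continuous_map (prod_topology ?I (cube k)) X G" "\<And>x. G (0, x) = g x" "\<And>x. G (1, x) = g' x"
    "\<And>s. s \<in> {0..1} \<Longrightarrow> based_at k x0 (\<lambda>x. G (s, x))"
    using g unfolding homotopic_with_def by blast
  obtain H where H: "continuous_map (prod_topology ?I (cube k)) X H" "\<And>x. H (0, x) = h x" "\<And>x. H (1, x) = h' x"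
    "\<And>s. s \<in> {0..1} \<Longrightarrow> based_at k x0 (\<lambda>x. H (s, x))"
    using h unfolding homotopic_with_def by blast
  define P where "P = prod_topology ?I (cube k)"
  have tP: "z \<in> topspace P \<longleftrightarrow> fst z \<in> {0..1} \<and> snd z \<in> topspace (cube k)" for z
    by (cases z) (simp add: P_def)
  have co: "continuous_map P euclidean (\<lambda>z. snd z i)" for i
    using continuous_map_compose[OF continuous_map_snd cube_coordinate] by (simp add: P_def o_def)
  have reparam: "continuous_map (subtopology P S) P (\<lambda>z. (fst z, (snd z)(0 := a * snd z 0 + b)))"
    if S: "\<And>z. z \<in> topspace P \<Longrightarrow> z \<in> S \<Longrightarrow> 0 \<le> a * snd z 0 + b \<and> a * snd z 0 + b \<le> 1" for S and a b :: real
    unfolding P_def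
  proof (intro continuous_map_pairedI, unfold P_def[symmetric])
    show "continuous_map (subtopology P S) ?I fst"
      by (rule continuous_map_from_subtopology) (simp add: P_def continuous_map_fst)
    show "continuous_map (subtopology P S) (cube k) (\<lambda>z. (snd z)(0 := a * snd z 0 + b))"
    proof (rule continuous_map_into_cube)
      fix i
      have "continuous_map P euclidean (\<lambda>z. ((snd z)(0 := a * snd z 0 + b)) i)"
      proof (cases "i = 0")
        case True
        have "continuous_map P euclidean (\<lambda>z. a * snd z 0 + b)" by (intro continuous_intros co)
        then show ?thesis using True by simp
      qed (simp add: co)
      then show "continuous_map (subtopology P S) euclidean (\<lambda>z. ((snd z)(0 := a * snd z 0 + b)) i)"
        by (rule continuous_map_from_subtopology)
    qed (use S tP k in \<open>auto simp: topspace_cube\<close>)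
  qed
  define K where "K = (\<lambda>z. if snd z 0 \<le> 1 / 2 then G (fst z, (snd z)(0 := 2 * snd z 0)) else H (fst z, (snd z)(0 := 2 * snd z 0 - 1)))"
  have K: "continuous_map P X K" unfolding K_def
  proof (rule continuous_map_cases_le)
    show "continuous_map P euclideanreal (\<lambda>z. snd z 0)" by (rule co)
    show "continuous_map (subtopology P {z \<in> topspace P. snd z 0 \<le> 1 / 2}) X (\<lambda>z. G (fst z, (snd z)(0 := 2 * snd z 0)))"
      using continuous_map_compose[OF reparam[of _ 2 0] G(1)[folded P_def], of "{z \<in> topspace P. snd z 0 \<le> 1 / 2}"] k
      by (auto simp: o_def tP topspace_cube)
    show "continuous_map (subtopology P {z \<in> topspace P. 1 / 2 \<le> snd z 0}) X (\<lambda>z. H (fst z, (snd z)(0 := 2 * snd z 0 - 1)))"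
      using continuous_map_compose[OF reparam[of _ 2 "-1"] H(1)[folded P_def], of "{z \<in> topspace P. 1 / 2 \<le> snd z 0}"] k
      by (auto simp: o_def tP topspace_cube)
    fix z assume z: "z \<in> topspace P" and e: "snd z 0 = 1 / 2"
    have m: "(snd z)(0 := 2 * snd z 0) \<in> topspace (cube k)" "(snd z)(0 := 2 * snd z 0 - 1) \<in> topspace (cube k)"
      using z e k by (auto simp: tP topspace_cube)
    have s: "fst z \<in> {0..1}" using z tP by blast
    have "G (fst z, (snd z)(0 := 2 * snd z 0)) = x0"
      by (rule G(4)[OF s, unfolded based_at_def, rule_format, OF m(1)]) (rule exI[of _ 0], use k e in simp)
    moreover have "H (fst z, (snd z)(0 := 2 * snd z 0 - 1)) = x0"
      by (rule H(4)[OF s, unfolded based_at_def, rule_format, OF m(2)]) (rule exI[of _ 0], use k e in simp)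
    ultimately show "G (fst z, (snd z)(0 := 2 * snd z 0)) = H (fst z, (snd z)(0 := 2 * snd z 0 - 1))" by simp
  qed simp
  have Ks: "(\<lambda>t. K (s, t)) = concat_cube (\<lambda>t. G (s, t)) (\<lambda>t. H (s, t))" for s
    by (auto simp: K_def concat_cube_def fun_eq_iff)
  show ?thesis
    unfolding homotopic_with_def
  proof (intro exI[of _ K] conjI allI ballI)
    show "continuous_map (prod_topology ?I (cube k)) X K" using K by (simp only: P_def)
    show "K (0, t) = concat_cube g h t" "K (1, t) = concat_cube g' h' t" for t
      using fun_cong[OF Ks[of 0], of t] fun_cong[OF Ks[of 1], of t] by (simp_all add: G(2,3) H(2,3))
    show "based_at k x0 (\<lambda>t. K (s, t))" if "s \<in> {0..1}" for s
      unfolding Ks by (rule based_at_concat_cube[OF k G(4)[OF that] H(4)[OF that]])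
  qed
qed

lemma hclass_eq:
  assumes "homotopic_with (based_at k x0) (cube k) X g h"
  shows "hclass k X x0 g = hclass k X x0 h"
  unfolding hclass_def using assms homotopic_with_trans homotopic_with_symD by blast

lemma hclass_self: "continuous_map (cube k) X g \<Longrightarrow> based_at k x0 g \<Longrightarrow> g \<in> hclass k X x0 g"
  by (simp add: hclass_def)

lemma homotopy_group_mult:
  assumes k: "k \<ge> 1" and g: "continuous_map (cube k) X g" "based_at k x0 g" and h: "continuous_map (cube k) X h" "based_at k x0 h"
  shows "hclass k X x0 g \<otimes>\<^bsub>homotopy_group k X x0\<^esub> hclass k X x0 h = hclass k X x0 (concat_cube g h)"
    and "continuous_map (cube k) X (concat_cube g h)" "based_at k x0 (concat_cube g h)"
proof -
  \<comment> \<open>A homotopy of the concatenation with itself carries its continuity and its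
    boundary condition.\<close>
  have "homotopic_with (based_at k x0) (cube k) X (concat_cube g h) (concat_cube g h)"
    using g h by (intro concat_cube_homotopic k) simp_all
  then show "continuous_map (cube k) X (concat_cube g h)" "based_at k x0 (concat_cube g h)" by simp_all
  have "hclass k X x0 (concat_cube g' h') = hclass k X x0 (concat_cube g h)" if "g' \<in> hclass k X x0 g" "h' \<in> hclass k X x0 h" for g' h'
    using that unfolding hclass_def[of _ _ _ g] hclass_def[of _ _ _ h] mem_Collect_eq
    by (intro hclass_eq[symmetric] concat_cube_homotopic k)
  then show "hclass k X x0 g \<otimes>\<^bsub>homotopy_group k X x0\<^esub> hclass k X x0 h = hclass k X x0 (concat_cube g h)"
    unfolding homotopy_group_def monoid.simps using hclass_self[OF g] hclass_self[OF h] by blast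
qed

lemma homotopy_induced_hclass:
  assumes \<Psi>: "continuous_map X Y \<Psi>" and g: "continuous_map (cube k) X g" "based_at k x0 g"
  shows "homotopy_induced k Y \<Psi> x0 (hclass k X x0 g) = hclass k Y (\<Psi> x0) (\<Psi> \<circ> g)"
proof -
  have "hclass k Y (\<Psi> x0) (\<Psi> \<circ> h) = hclass k Y (\<Psi> x0) (\<Psi> \<circ> g)" if "h \<in> hclass k X x0 g" for h
  proof (rule hclass_eq[symmetric])
    show "homotopic_with (based_at k (\<Psi> x0)) (cube k) Y (\<Psi> \<circ> g) (\<Psi> \<circ> h)"
      by (rule homotopic_with_compose_continuous_map_left[OF _ \<Psi>])
        (use that in \<open>simp add: hclass_def\<close>, simp add: based_at_def)
  qed
  then show ?thesis unfolding homotopy_induced_def using hclass_self[OF g] by blast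
qed

text \<open>\<open>H\<close> fixes all points \<open>\<Psi> x\<close>, so maps pushed along it stay
  based and no change of base point enters. \<open>G\<close> induces a left inverse on homotopy
  groups, and pushing a based map along \<open>H\<close> into the image of \<open>\<Psi>\<close>
  gives surjectivity.\<close>

theorem weak_homotopy_equivalence_retract:
  assumes \<Psi>: "continuous_map X Y \<Psi>" and G: "continuous_map Y X G"
    and G\<Psi>: "\<And>x. x \<in> topspace X \<Longrightarrow> G (\<Psi> x) = x"
    and H: "continuous_map (prod_topology (top_of_set {0..1::real}) Y) Y H"
    and H0: "\<And>y. y \<in> topspace Y \<Longrightarrow> H (0, y) = y" and H1: "\<And>y. y \<in> topspace Y \<Longrightarrow> H (1, y) = \<Psi> (G y)"
    and H\<Psi>: "\<And>s x. s \<in> {0..1} \<Longrightarrow> x \<in> topspace X \<Longrightarrow> H (s, \<Psi> x) = \<Psi> x"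
  shows "weak_homotopy_equivalence X Y \<Psi>"
  unfolding weak_homotopy_equivalence_def
proof (intro conjI allI impI ballI)
  show "continuous_map X Y \<Psi>" by (rule \<Psi>)
  have \<Psi>t: "\<Psi> x \<in> topspace Y" if "x \<in> topspace X" for x using \<Psi> that by (auto simp: continuous_map_def)
  have Gt: "G y \<in> topspace X" if "y \<in> topspace Y" for y using G that by (auto simp: continuous_map_def)
  have pc_map: "path_component_of Z' (F a) (F b)" if F: "continuous_map Z Z' F" and ab: "path_component_of Z a b"
    for Z :: "'z topology" and Z' :: "'w topology" and F a b
  proof -
    obtain g where "pathin Z g" "g 0 = a" "g 1 = b" using ab by (auto simp: path_component_of_def)
    then have "pathin Z' (F \<circ> g)" using continuous_map_compose[OF _ F] unfolding pathin_def by blast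
    then show ?thesis unfolding path_component_of_def by (intro exI[of _ "F \<circ> g"]) (simp add: \<open>g 0 = a\<close> \<open>g 1 = b\<close>)
  qed
  have pc_eq: "path_component_of_set Z a = path_component_of_set Z b \<longleftrightarrow> path_component_of Z a b" if "a \<in> topspace Z" "b \<in> topspace Z"
    for Z :: "'z topology" and a b
    using that path_component_of_refl path_component_of_sym path_component_of_trans by (metis (no_types, opaque_lifting) Collect_cong mem_Collect_eq)
  define F where "F = (\<lambda>C. \<Union>x\<in>C. path_component_of_set Y (\<Psi> x))"
  have F: "F (path_component_of_set X x) = path_component_of_set Y (\<Psi> x)" if x: "x \<in> topspace X" for x
  proof -
    have "path_component_of_set Y (\<Psi> x') = path_component_of_set Y (\<Psi> x)" if "path_component_of X x x'" for x'
      using pc_map[OF \<Psi> that] path_component_of_trans path_component_of_sym by (metis (no_types, opaque_lifting) Collect_cong)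
    moreover have "path_component_of X x x" using x by (simp add: path_component_of_refl)
    ultimately show ?thesis unfolding F_def by blast
  qed
  show "bij_betw F (path_components_of X) (path_components_of Y)"
    unfolding bij_betw_def path_components_of_def
  proof
    show "inj_on F (path_component_of_set X ` topspace X)"
    proof (rule inj_onI, clarify)
      fix x x' assume x: "x \<in> topspace X" and x': "x' \<in> topspace X" and "F (path_component_of_set X x) = F (path_component_of_set X x')"
      then have "path_component_of Y (\<Psi> x) (\<Psi> x')" using F pc_eq[OF \<Psi>t[OF x] \<Psi>t[OF x']] by metis
      then have "path_component_of X x x'" using pc_map[OF G] G\<Psi> x x' by metis
      then show "path_component_of_set X x = path_component_of_set X x'" using pc_eq[OF x x'] by blast
    qed
    have "F ` path_component_of_set X ` topspace X = (\<lambda>x. path_component_of_set Y (\<Psi> x)) ` topspace X"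
      using F by (auto simp: image_image)
    also have "\<dots> = path_component_of_set Y ` topspace Y"
    proof
      show "(\<lambda>x. path_component_of_set Y (\<Psi> x)) ` topspace X \<subseteq> path_component_of_set Y ` topspace Y" using \<Psi>t by auto
      show "path_component_of_set Y ` topspace Y \<subseteq> (\<lambda>x. path_component_of_set Y (\<Psi> x)) ` topspace X"
      proof (rule image_subsetI, rule image_eqI)
        fix y assume y: "y \<in> topspace Y"
        show "G y \<in> topspace X" by (rule Gt[OF y])
        have "continuous_map (top_of_set {0..1::real}) (prod_topology (top_of_set {0..1::real}) Y) (\<lambda>s. (s, y))"
          using y by (intro continuous_map_pairedI) auto
        from continuous_map_compose[OF this H] have "pathin Y (\<lambda>s. H (s, y))" by (simp add: pathin_def o_def)
        then have "path_component_of Y y (\<Psi> (G y))"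
          unfolding path_component_of_def using H0[OF y] H1[OF y] by blast
        then show "path_component_of_set Y y = path_component_of_set Y (\<Psi> (G y))"
          using pc_eq[OF y \<Psi>t[OF Gt[OF y]]] by blast
      qed
    qed
    finally show "F ` path_component_of_set X ` topspace X = path_component_of_set Y ` topspace Y" .
  qed
  fix k :: nat and x0 assume k: "1 \<le> k" and x0: "x0 \<in> topspace X"
  let ?X = "homotopy_group k X x0" and ?Y = "homotopy_group k Y (\<Psi> x0)" and ?h = "homotopy_induced k Y \<Psi> x0"
  note ind = homotopy_induced_hclass[OF \<Psi>]
  have comp: "continuous_map (cube k) Y (\<Psi> \<circ> g)" "based_at k (\<Psi> x0) (\<Psi> \<circ> g)" if "continuous_map (cube k) X g" "based_at k x0 g" for g
    using continuous_map_compose[OF that(1) \<Psi>] that(2) by (auto simp: based_at_def)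
  have carX: "carrier ?X = {hclass k X x0 g | g. continuous_map (cube k) X g \<and> based_at k x0 g}"
    and carY: "carrier ?Y = {hclass k Y (\<Psi> x0) g | g. continuous_map (cube k) Y g \<and> based_at k (\<Psi> x0) g}"
    by (simp_all add: homotopy_group_def)
  have "?h \<in> hom ?X ?Y"
    unfolding hom_def
  proof (intro CollectI conjI ballI)
    show "?h \<in> carrier ?X \<rightarrow> carrier ?Y"
      unfolding carX carY using ind comp by blast
    fix A B assume "A \<in> carrier ?X" "B \<in> carrier ?X"
    then obtain g h where g: "A = hclass k X x0 g" "continuous_map (cube k) X g" "based_at k x0 g"
      and h: "B = hclass k X x0 h" "continuous_map (cube k) X h" "based_at k x0 h" unfolding carX by blast
    show "?h (A \<otimes>\<^bsub>?X\<^esub> B) = ?h A \<otimes>\<^bsub>?Y\<^esub> ?h B"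
      unfolding g(1) h(1) homotopy_group_mult(1)[OF k g(2,3) h(2,3)] ind[OF g(2,3)] ind[OF h(2,3)]
        homotopy_group_mult(1)[OF k comp[OF g(2,3)] comp[OF h(2,3)]] ind[OF homotopy_group_mult(2,3)[OF k g(2,3) h(2,3)]]
        concat_cube_comp ..
  qed
  moreover have "bij_betw ?h (carrier ?X) (carrier ?Y)"
    unfolding bij_betw_def
  proof
    show "inj_on ?h (carrier ?X)"
    proof (rule inj_on_inverseI)
      fix A assume "A \<in> carrier ?X"
      then obtain g where g: "A = hclass k X x0 g" "continuous_map (cube k) X g" "based_at k x0 g" unfolding carX by blast
      have "homotopic_with (based_at k x0) (cube k) X (G \<circ> (\<Psi> \<circ> g)) g"
      proof (rule homotopic_with_equal)
        show "based_at k x0 (G \<circ> (\<Psi> \<circ> g))" using g(3) by (auto simp: based_at_def G\<Psi>[OF x0])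
        show "continuous_map (cube k) X (G \<circ> (\<Psi> \<circ> g))" by (rule continuous_map_compose[OF comp(1)[OF g(2,3)] G])
        show "(G \<circ> (\<Psi> \<circ> g)) t = g t" if "t \<in> topspace (cube k)" for t
          using G\<Psi> g(2) that by (auto simp: continuous_map_def)
      qed (rule g(3))
      then show "homotopy_induced k X G (\<Psi> x0) (?h A) = A"
        unfolding g(1) ind[OF g(2,3)] homotopy_induced_hclass[OF G comp[OF g(2,3)]] G\<Psi>[OF x0] by (rule hclass_eq)
    qed
    show "?h ` carrier ?X = carrier ?Y"
    proof
      show "?h ` carrier ?X \<subseteq> carrier ?Y" using \<open>?h \<in> hom ?X ?Y\<close> by (auto simp: hom_def)
      show "carrier ?Y \<subseteq> ?h ` carrier ?X"
      proof
        fix B assume "B \<in> carrier ?Y"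
        then obtain g where g: "B = hclass k Y (\<Psi> x0) g" "continuous_map (cube k) Y g" "based_at k (\<Psi> x0) g" unfolding carY by blast
        have Gg: "continuous_map (cube k) X (G \<circ> g)" "based_at k x0 (G \<circ> g)"
          using continuous_map_compose[OF g(2) G] g(3) by (auto simp: based_at_def G\<Psi>[OF x0])
        have gt: "g t \<in> topspace Y" if "t \<in> topspace (cube k)" for t using g(2) that by (auto simp: continuous_map_def)
        let ?p = "based_at k (\<Psi> x0)"
        have hom: "homotopic_with ?p (cube k) Y (\<lambda>t. H (0, g t)) (\<lambda>t. H (1, g t))"
          unfolding homotopic_with_def
        proof (intro exI[of _ "\<lambda>z. H (fst z, g (snd z))"] conjI allI ballI)
          have "continuous_map (prod_topology (top_of_set {0..1}) (cube k)) (prod_topology (top_of_set {0..1::real}) Y) (\<lambda>z. (fst z, g (snd z)))"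
            using continuous_map_compose[OF continuous_map_snd g(2)]
            by (intro continuous_map_pairedI continuous_map_fst) (simp add: o_def)
          from continuous_map_compose[OF this H]
          show "continuous_map (prod_topology (top_of_set {0..1}) (cube k)) Y (\<lambda>z. H (fst z, g (snd z)))" by (simp add: o_def)
          show "?p (\<lambda>x. H (fst (s, x), g (snd (s, x))))" if "s \<in> {0..1}" for s
            using g(3) H\<Psi>[OF that x0] by (auto simp: based_at_def)
        qed simp_all
        have e': "homotopic_with ?p (cube k) Y g (\<lambda>t. H (0, g t))"
          and e'': "homotopic_with ?p (cube k) Y (\<Psi> \<circ> (G \<circ> g)) (\<lambda>t. H (1, g t))"
          using homotopic_with_imp_property[OF hom] g comp[OF Gg] gt H0 H1 by (auto intro!: homotopic_with_equal)
        have "?h (hclass k X x0 (G \<circ> g)) = B"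
          unfolding ind[OF Gg] g(1)
          by (rule hclass_eq) (rule homotopic_with_trans[OF e'' homotopic_with_symD[OF homotopic_with_trans[OF e' hom]]])
        moreover have "hclass k X x0 (G \<circ> g) \<in> carrier ?X" unfolding carX using Gg by blast
        ultimately show "B \<in> ?h ` carrier ?X" by blast
      qed
    qed
  qed
  ultimately show "?h \<in> iso ?X ?Y" by (simp add: iso_def)
qed

section \<open>Diffeomorphisms of the sphere\<close>

text \<open>The derivative of \<open>H\<close> in the direction \<open>v\<close> is
  \<open>\<phi> v\<close> composed with \<open>H\<close>, where \<open>\<phi>\<close> solves the
  linear system by Cramer's rule and is smooth. So each order of regularity of \<open>H\<close>
  yields the next one, starting from continuity.\<close>

lemma smooth_on_open_inverse:
  fixes G H :: "real^'m \<Rightarrow> real^'m"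
  assumes G: "smooth_on_open U G" and V: "open V" and H: "continuous_on V H" and HU: "\<And>y. y \<in> V \<Longrightarrow> H y \<in> U"
    and GH: "\<And>y. y \<in> V \<Longrightarrow> G (H y) = y"
    and inj: "\<And>x u. x \<in> U \<Longrightarrow> frechet_derivative G (at x) u = 0 \<Longrightarrow> u = 0"
  shows "smooth_on_open V H"
proof -
  let ?T = "discrete_topology {()}"
  have U: "open U" and Gc: "csmooth ?T U (\<lambda>_. G)" using G by (auto simp: smooth_on_open_iff)
  have dG: "(G has_derivative frechet_derivative G (at x)) (at x)" if "x \<in> U" for x
    using csmooth_has_derivative[OF Gc _ that, of "()"] by simp
  define A where "A = (\<lambda>x. matrix (frechet_derivative G (at x)))"
  have A: "A x *v u = frechet_derivative G (at x) u" if "x \<in> U" for x u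
    unfolding A_def by (rule fun_cong[OF matrix_vector_mul(2)[OF has_derivative_linear[OF dG[OF that]]]])
  have dA: "det (A x) \<noteq> 0" if "x \<in> U" for x
  proof -
    have "\<exists>B. B ** A x = mat 1" unfolding matrix_left_invertible_ker using inj[OF that] A[OF that] by simp
    then show ?thesis by (simp flip: invertible_det_nz invertible_left_inverse)
  qed
  define \<phi> where "\<phi> = (\<lambda>v x. (\<chi> k. det (\<chi> i j. if j = k then v $ i else A x $ i $ j) / det (A x)) :: real^'m)"
  have \<phi>: "csmooth ?T U (\<lambda>_. \<phi> v)" for v
  proof -
    have a: "csmooth ?T U (\<lambda>_ x. A x $ i $ j)" for i j
      unfolding A_def matrix_def using csmooth_nth[OF csmooth_deriv[OF Gc] U] by simp
    have "csmooth ?T U (\<lambda>_ x. (if j = k then v $ i else A x $ i $ j))" for i j k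
      by (cases "j = k") (simp_all add: a csmooth_const U)
    then have "csmooth ?T U (\<lambda>_ x. det (\<chi> i j. if j = k then v $ i else A x $ i $ j))" for k
      by (intro csmooth_det U) simp
    moreover have "csmooth ?T U (\<lambda>_ x. inverse (det (A x)))"
      by (intro csmooth_inverse csmooth_det a U) (simp add: dA)
    ultimately have "csmooth ?T U (\<lambda>_ x. det (\<chi> i j. if j = k then v $ i else A x $ i $ j) * inverse (det (A x)))" for k
      by (intro csmooth_mult U)
    then show ?thesis unfolding \<phi>_def divide_inverse by (intro csmooth_vec U) simp
  qed
  have dH: "(H has_derivative (\<lambda>v. \<phi> v (H y))) (at y)" if y: "y \<in> V" for y
  proof -
    obtain B where B: "B ** A (H y) = mat 1" "A (H y) ** B = mat 1"
      using dA[OF HU[OF y]] invertible_det_nz[of "A (H y)"] unfolding invertible_def by blast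
    have "\<phi> v (H y) = B *v v" for v
    proof -
      have "A (H y) *v (B *v v) = v" by (simp add: matrix_vector_mul_assoc B)
      then show ?thesis unfolding \<phi>_def using cramer[OF dA[OF HU[OF y]], of "B *v v" v] by simp
    qed
    moreover have "(H has_derivative ((*v) B)) (at y)"
    proof (rule has_derivative_inverse_basic[OF dG[OF HU[OF y]] _ _ _ V y GH])
      show "(*v) B \<circ> frechet_derivative G (at (H y)) = id"
        by (simp add: fun_eq_iff matrix_vector_mul_assoc B flip: A[OF HU[OF y]])
      show "continuous (at y) H" using H V y by (simp add: continuous_on_eq_continuous_at)
    qed auto
    ultimately show ?thesis by simp
  qed
  have "csm k ?T V (\<lambda>_. H)" for k
  proof (induction k)
    case 0
    have "continuous_map (top_of_set V) euclidean H" using H by simp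
    from continuous_map_compose[OF continuous_map_snd this] show ?case by (simp add: o_def)
  next
    case (Suc k)
    have "csm k ?T V (\<lambda>_ y. frechet_derivative H (at y) v)" for v
    proof (rule csm_cong[OF V])
      show "csm k ?T V (\<lambda>_ y. \<phi> v (H y))"
        by (rule csm_compose[OF V U _ Suc csmooth_csm[OF \<phi>]]) (rule HU)
      show "\<phi> v (H y) = frechet_derivative H (at y) v" if "y \<in> V" for y
        by (rule fun_cong[OF frechet_derivative_at[OF dH[OF that]]])
    qed
    moreover have "H differentiable (at y)" if "y \<in> V" for y using dH[OF that] by (auto simp: differentiable_def)
    moreover have "continuous_map (prod_topology ?T (top_of_set V)) euclidean (\<lambda>z. H (snd z))" using csm_cont[OF Suc] .
    ultimately show ?case by simp
  qed
  then show ?thesis by (simp add: smooth_on_open_iff V csmooth_def)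
qed

section \<open>Immersions of the sphere into itself are diffeomorphisms\<close>

lemma smooth_map_on_affine:
  fixes g :: "'a::euclidean_space \<Rightarrow> 'b::euclidean_space" and L :: "'b \<Rightarrow> 'c::euclidean_space"
  assumes g: "smooth_map_on usphere g" and L: "bounded_linear L"
  shows "smooth_map_on usphere (\<lambda>x. L (g x) + c)" "x \<noteq> 0 \<Longrightarrow> Dh (\<lambda>x. L (g x) + c) x u = L (Dh g x u)"
proof -
  have e: "hext (\<lambda>x. L (g x) + c) = (\<lambda>x. L (hext g x) + c)" by (simp add: hext_def fun_eq_iff)
  show "smooth_map_on usphere (\<lambda>x. L (g x) + c)"
    using g unfolding smooth_map_on_sphere_iff smooth_on_open_iff e
    by (auto intro!: csmooth_add csmooth_linear[OF _ L] csmooth_const)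
  assume x: "x \<noteq> 0"
  have "((\<lambda>x. L (hext g x) + c) has_derivative (\<lambda>u. L (Dh g x u) + 0)) (at x)"
    by (intro has_derivative_add has_derivative_const bounded_linear.has_derivative[OF L] hext_has_derivative g x)
  from fun_cong[OF frechet_derivative_at[OF this], of u]
  show "Dh (\<lambda>x. L (g x) + c) x u = L (Dh g x u)" unfolding Dh_def[of "\<lambda>x. L (g x) + c"] e by simp
qed

lemma linear_incl: "linear incl"
  by (rule linearI) (simp_all add: incl_def vec_eq_iff split: option.split)

lemma bounded_linear_incl: "bounded_linear incl"
  using linear_incl linear_conv_bounded_linear by blast

lemma incl_nth [simp]: "incl x $ None = 0" "incl x $ Some j = x $ j"
  by (simp_all add: incl_def)

lemma e_last_nth [simp]: "e_last $ None = 1" "e_last $ Some j = 0"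
  by (simp_all add: e_last_def axis_def)

lemma inner_option: "x \<bullet> y = x $ None * y $ None + (\<Sum>k\<in>UNIV. x $ Some k * y $ Some k)" for x y :: "real^('k::finite option)"
  by (simp add: inner_vec_def sum_UNIV_option)

lemma incl_inner [simp]: "incl x \<bullet> incl y = x \<bullet> y"
  unfolding inner_option[of "incl x"] by (simp add: inner_vec_def)

lemma incl_e_last [simp]: "incl x \<bullet> e_last = 0" "e_last \<bullet> incl x = 0" "e_last \<bullet> e_last = 1"
  by (simp_all add: inner_option)

lemma sphere_deriv_orthogonal:
  fixes g :: "'a::euclidean_space \<Rightarrow> 'b::euclidean_space"
  assumes g: "smooth_map_on usphere g" and n: "\<And>p. p \<in> usphere \<Longrightarrow> norm (g p) = 1" and p: "p \<in> usphere"
  shows "Dh g p u \<bullet> g p = 0"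
proof -
  have "g x \<bullet> g x = 1" if "x \<in> usphere" for x using n[OF that] by (simp add: norm_eq_1)
  from const_inner_derivative[OF g g this p, of u] show ?thesis by (simp add: inner_commute)
qed

text \<open>The graph-like pair \<open>(e + g) / sqrt 2, (e - g) / sqrt 2\<close> turns the immersion \<open>g\<close> of the sphere into itself
  into a strictly convex hypersurface.\<close>

lemma sphere_self_immersion_inj:
  fixes g :: "'n::finite euc1 \<Rightarrow> 'n euc1"
  assumes n: "CARD('n) \<ge> 2" and g: "smooth_map_on usphere g" and ng: "\<And>p. p \<in> usphere \<Longrightarrow> norm (g p) = 1"
    and inj: "\<And>p u. p \<in> usphere \<Longrightarrow> u \<in> tangent p \<Longrightarrow> Dh g p u = 0 \<Longrightarrow> u = 0"
  shows "inj_on g usphere"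
proof -
  define s :: real where "s = 1 / sqrt 2"
  have ss: "s * s = 1 / 2" by (simp add: s_def)
  have gg: "g p \<bullet> g p = 1" if "p \<in> usphere" for p using ng[OF that] by (simp add: norm_eq_1)
  define F where "F = (\<lambda>p. s *\<^sub>R incl (g p) + s *\<^sub>R e_last)"
  define N where "N = (\<lambda>p. (- s) *\<^sub>R incl (g p) + s *\<^sub>R e_last)"
  have L: "bounded_linear (\<lambda>x. s *\<^sub>R incl x)" "bounded_linear (\<lambda>x. (- s) *\<^sub>R incl x)"
    by (intro bounded_linear_compose[OF bounded_linear_scaleR_right bounded_linear_incl])+
  have DF: "Dh F p u = s *\<^sub>R incl (Dh g p u)" and DN: "Dh N p u = (- s) *\<^sub>R incl (Dh g p u)" if "p \<in> usphere" for p u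
    unfolding F_def N_def
    by (rule smooth_map_on_affine(2)[OF g L(1) sphere_nonzero[OF that]], rule smooth_map_on_affine(2)[OF g L(2) sphere_nonzero[OF that]])
  interpret convex_front F N
  proof
    show "smooth_map_on usphere F" "smooth_map_on usphere N" unfolding F_def N_def
      by (rule smooth_map_on_affine(1)[OF g L(1)], rule smooth_map_on_affine(1)[OF g L(2)])
    show "DIM('n euc1) \<ge> 3" using n by simp
    show "DIM('n euc2) = DIM('n euc1) + 1" by simp
    fix p u :: "'n euc1" assume p: "p \<in> usphere"
    show "F p \<bullet> F p = 1" "N p \<bullet> N p = 1" "F p \<bullet> N p = 0"
      using gg[OF p] ss by (simp_all add: F_def N_def inner_add_left inner_add_right inner_diff_left inner_diff_right)
    show "Dh F p u \<bullet> N p = 0"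
      using sphere_deriv_orthogonal[OF g ng p] by (simp add: DF[OF p] N_def inner_add_right inner_diff_right)
    assume u: "u \<in> tangent p" "u \<noteq> 0"
    have "0 < (s * s) * (Dh g p u \<bullet> Dh g p u)" using inj[OF p u(1)] u(2) by (auto simp: ss)
    then show "Dh F p u \<bullet> Dh N p u < 0" by (simp add: DF[OF p] DN[OF p])
  qed
  show ?thesis
  proof (rule inj_onI, rule ccontr)
    fix x p assume x: "x \<in> usphere" and p: "p \<in> usphere" and e: "g x = g p" and ne: "x \<noteq> p"
    \<comment> \<open>\<open>F x \<bullet> N p\<close> is half of
      \<open>1 - g x \<bullet> g p\<close>, so global convexity of the pair is injectivity of
      \<open>g\<close>.\<close>
    have "F x \<bullet> N p = 0"
      using gg[OF p] by (simp add: F_def N_def e inner_add_left inner_add_right inner_diff_right)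
    then show False using globally_convex[OF p x ne] by simp
  qed
qed

text \<open>The extension \<open>G\<close> of \<open>g\<close> that is homogeneous of degree one
  acts between open sets of the same Euclidean space. Injectivity and invariance of domain make its
  image open, connectedness and compactness of the sphere make \<open>g\<close> onto, and
  \<open>smooth_on_open_inverse\<close> makes the inverse smooth.\<close>

lemma sphere_self_immersion_diffeo:
  fixes g :: "'n::finite euc1 \<Rightarrow> 'n euc1"
  assumes n: "CARD('n) \<ge> 2" and g: "smooth_map_on usphere g" and ng: "\<And>p. p \<in> usphere \<Longrightarrow> norm (g p) = 1"
    and inj: "\<And>p u. p \<in> usphere \<Longrightarrow> u \<in> tangent p \<Longrightarrow> Dh g p u = 0 \<Longrightarrow> u = 0"
  shows "\<exists>h. diffeomorphism usphere usphere g h"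
proof -
  have ginj: "inj_on g usphere" by (rule sphere_self_immersion_inj[OF assms])
  define G where "G = (\<lambda>x. norm x *\<^sub>R hext g x)"
  have nh: "norm (hext g x) = 1" if "x \<noteq> 0" for x using ng[OF normalize_sphere[OF that]] by (simp add: hext_def)
  have nG: "norm (G x) = norm x" if "x \<noteq> 0" for x using nh[OF that] by (simp add: G_def)
  have G0: "G x \<noteq> 0" if "x \<noteq> 0" for x using nG[OF that] that by auto
  have so: "smooth_on_open (-{0}) (hext g)" using g by (simp add: smooth_map_on_sphere_iff)
  have Gs: "smooth_on_open (-{0}) G"
    unfolding G_def
    by (rule smooth_on_openI[OF _ open_punctured])
      (intro csmooth_scaleR csmooth_norm csmooth_ident csmooth_if_smooth_on_open so open_punctured, simp)
  have Gcont: "continuous_on (-{0}) G"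
    unfolding G_def using hext_continuous_on[OF g] by (intro continuous_intros)
  have Ginj: "inj_on G (-{0})"
  proof (rule inj_onI)
    fix x y assume x: "x \<in> -{0}" and y: "y \<in> -{0}" and e: "G x = G y"
    have nn: "norm x = norm y" using nG[of x] nG[of y] e x y by simp
    then have "hext g x = hext g y" using e x y by (simp add: G_def)
    then have "x /\<^sub>R norm x = y /\<^sub>R norm y"
      using inj_onD[OF ginj, of "x /\<^sub>R norm x" "y /\<^sub>R norm y"] normalize_sphere x y by (simp add: hext_def)
    then show "x = y" using nn x y by simp
  qed
  have oG: "open (G ` (-{0}))" by (rule invariance_of_domain[OF Gcont open_punctured Ginj])
  have GS: "g ` usphere = usphere \<inter> G ` (-{0})"
  proof
    show "g ` usphere \<subseteq> usphere \<inter> G ` (-{0})"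
    proof (rule image_subsetI)
      fix x :: "'n euc1" assume x: "x \<in> usphere"
      have "g x = G x" using x by (simp add: G_def hext_sphere)
      moreover have "x \<in> -{0}" using x by auto
      ultimately show "g x \<in> usphere \<inter> G ` (-{0})" using ng[OF x] by auto
    qed
    show "usphere \<inter> G ` (-{0}) \<subseteq> g ` usphere"
    proof
      fix y assume "y \<in> usphere \<inter> G ` (-{0})"
      then obtain x where y: "y \<in> usphere" and x0: "x \<noteq> 0" and e: "y = G x" by blast
      have x: "x \<in> usphere" using nG[OF x0] y e by simp
      then show "y \<in> g ` usphere" by (intro image_eqI[of _ _ x]) (simp_all add: e G_def hext_sphere)
    qed
  qed
  have gS: "g ` usphere = usphere"
  proof -
    have "connected (usphere :: 'n euc1 set)" using n by (intro connected_sphere) simp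
    moreover have "openin (top_of_set usphere) (g ` usphere)" unfolding GS using oG by (simp add: openin_open_Int)
    moreover have "closedin (top_of_set usphere) (g ` usphere)"
      using compact_continuous_image[OF sphere_continuous_on[OF g] compact_sphere] ng
      by (intro closed_subset compact_imp_closed) auto
    moreover have "usphere \<noteq> ({} :: 'n euc1 set)" using sphere_eq_empty[of "0 :: 'n euc1" 1] by simp
    ultimately show ?thesis unfolding connected_clopen by blast
  qed
  define h where "h = inv_into usphere g"
  have hg: "h (g x) = x" if "x \<in> usphere" for x unfolding h_def by (rule inv_into_f_f[OF ginj that])
  have gh: "g (h y) = y" and hS: "h y \<in> usphere" if "y \<in> usphere" for y
  proof -
    have y: "y \<in> g ` usphere" using that gS by simp
    show "g (h y) = y" "h y \<in> usphere" unfolding h_def using f_inv_into_f[OF y] inv_into_into[OF y] by simp_all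
  qed
  define H where "H = (\<lambda>y. norm y *\<^sub>R hext h y)"
  have nhh: "norm (hext h y) = 1" if "y \<noteq> 0" for y using hS[OF normalize_sphere[OF that]] by (simp add: hext_def)
  have H0: "H y \<in> -{0}" if "y \<in> -{0}" for y using nhh[of y] that by (auto simp: H_def)
  have GH: "G (H y) = y" if y: "y \<in> -{0}" for y
  proof -
    have "hext g (H y) = hext g (hext h y)"
      using y nhh[of y] by (simp add: hext_def[of g] H_def)
    also have "\<dots> = g (hext h y)" using y nhh[of y] by (intro hext_sphere) simp
    also have "\<dots> = y /\<^sub>R norm y" using gh[OF normalize_sphere[of y]] y by (simp add: hext_def)
    finally show ?thesis using y nhh[of y] by (simp add: G_def) (simp add: H_def)
  qed
  have Himg: "G ` (-{0}) = -{0}" using GH H0 G0 by (auto simp: image_iff) (metis ComplI singletonD)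
  have HG: "H (G x) = x" if "x \<in> -{0}" for x
    using inj_onD[OF Ginj GH[of "G x"]] H0[of "G x"] G0[of x] that by auto
  have Hcont: "continuous_on (-{0}) H"
    using continuous_on_inverse_open[OF open_punctured Gcont order_refl HG] unfolding Himg by simp
  have Hs: "smooth_on_open (-{0}) H"
  proof (rule smooth_on_open_inverse[OF Gs open_punctured Hcont H0 GH])
    fix x u :: "'n euc1" assume x: "x \<in> -{0}" and z: "frechet_derivative G (at x) u = 0"
    then have x0: "x \<noteq> 0" by simp
    have "(G has_derivative (\<lambda>u. norm x *\<^sub>R Dh g x u + (u \<bullet> sgn x) *\<^sub>R hext g x)) (at x)"
      unfolding G_def by (intro has_derivative_scaleR has_derivative_norm hext_has_derivative g x0)
    from fun_cong[OF frechet_derivative_at[OF this], of u] z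
    have eq: "norm x *\<^sub>R Dh g x u + (u \<bullet> sgn x) *\<^sub>R hext g x = 0" by simp
    define p where "p = x /\<^sub>R norm x"
    have p: "p \<in> usphere" unfolding p_def by (rule normalize_sphere[OF x0])
    have Dp: "Dh g x u = inverse (norm x) *\<^sub>R Dh g p u"
      using Dh_scaleR[OF g x0, of "inverse (norm x)" u] x0 by (simp add: p_def)
    have hp: "hext g x = g p" by (simp add: hext_def p_def)
    have eq': "Dh g p u + (u \<bullet> p) *\<^sub>R g p = 0" using eq x0 unfolding Dp hp by (simp add: p_def sgn_div_norm)
    from arg_cong[OF this, of "\<lambda>z. z \<bullet> g p"] have up: "u \<bullet> p = 0"
      using sphere_deriv_orthogonal[OF g ng p, of u] ng[OF p] by (simp add: inner_add_left norm_eq_1)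
    then show "u = 0" using eq' inj[OF p, of u] by (simp add: tangent_def)
  qed
  have "smooth_on_open (-{0}) (hext h)"
  proof (rule smooth_on_openI[OF csmooth_cong open_punctured])
    show "csmooth (discrete_topology {()}) (-{0}) (\<lambda>_ y. inverse (norm y) *\<^sub>R H y)"
      by (intro csmooth_scaleR csmooth_inverse csmooth_norm csmooth_ident csmooth_if_smooth_on_open Hs open_punctured) auto
  qed (auto simp: H_def open_punctured)
  then have "smooth_map_on usphere h" by (simp add: smooth_map_on_sphere_iff)
  moreover have "h ` usphere = usphere"
  proof
    show "h ` usphere \<subseteq> usphere" using hS by blast
    show "usphere \<subseteq> h ` usphere" using hg gS by (metis image_eqI subsetI)
  qed
  ultimately show ?thesis unfolding diffeomorphism_def using g gS hg gh by blast
qed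

section \<open>Round immersions\<close>

lemma smooth_map_on_cong:
  fixes f g :: "'a::euclidean_space \<Rightarrow> 'b::euclidean_space"
  assumes "smooth_map_on S f" "\<And>x. x \<in> S \<Longrightarrow> f x = g x"
  shows "smooth_map_on S g"
  unfolding smooth_map_on_def
proof
  fix p assume "p \<in> S"
  then obtain U F where "p \<in> U" "smooth_on_open U F" "\<forall>x\<in>S \<inter> U. F x = f x"
    using assms(1) unfolding smooth_map_on_def by meson
  then show "\<exists>U F. p \<in> U \<and> smooth_on_open U F \<and> (\<forall>x\<in>S \<inter> U. F x = g x)"
    using assms(2) by (intro exI[of _ U] exI[of _ F]) simp
qed

lemma Dh_identity:
  fixes p :: "'a::euclidean_space"
  assumes p: "p \<in> usphere" and u: "u \<in> tangent p"
  shows "Dh (\<lambda>x. x) p u = u"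
proof -
  have p0: "p \<noteq> 0" using p by auto
  have "smooth_on_open (-{0}) (hext (\<lambda>x::'a. x))"
    unfolding hext_def by (rule smooth_on_openI[OF csmooth_normalize open_punctured])
  then have s: "smooth_map_on usphere (\<lambda>x::'a. x)" by (simp add: smooth_map_on_sphere_iff)
  have "((\<lambda>x. norm x *\<^sub>R hext (\<lambda>x. x) x) has_derivative (\<lambda>u. norm p *\<^sub>R Dh (\<lambda>x. x) p u + (u \<bullet> sgn p) *\<^sub>R hext (\<lambda>x. x) p)) (at p)"
    by (intro has_derivative_scaleR has_derivative_norm hext_has_derivative s p0)
  moreover have "((\<lambda>x. norm x *\<^sub>R hext (\<lambda>x. x) x) has_derivative (\<lambda>u. u)) (at p)"
    by (rule has_derivative_transform_within_open[OF has_derivative_ident open_punctured]) (use p0 in \<open>auto simp: hext_def\<close>)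
  ultimately have "(\<lambda>u. norm p *\<^sub>R Dh (\<lambda>x. x) p u + (u \<bullet> sgn p) *\<^sub>R hext (\<lambda>x. x) p) = (\<lambda>u. u)" by (rule has_derivative_unique)
  from fun_cong[OF this, of u] show ?thesis using p u by (simp add: tangent_def sgn_div_norm)
qed

lemma Diff_plus_props:
  fixes g :: "'n::finite euc1 \<Rightarrow> 'n euc1"
  assumes g: "g \<in> Diff_plus"
  shows "g \<in> smooth_maps" "smooth_map_on usphere g" "p \<in> usphere \<Longrightarrow> norm (g p) = 1"
    "p \<in> usphere \<Longrightarrow> u \<in> tangent p \<Longrightarrow> Dh g p u = 0 \<Longrightarrow> u = 0"
proof -
  obtain h where h: "diffeomorphism usphere usphere g h" and e: "g \<in> usphere \<rightarrow>\<^sub>E usphere"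
    using g by (auto simp: Diff_plus_def)
  show sg: "smooth_map_on usphere g" using h by (simp add: diffeomorphism_def)
  then show sm: "g \<in> smooth_maps" using e by (simp add: smooth_maps_def)
  show n: "norm (g p) = 1" if "p \<in> usphere" for p by (rule smooth_maps_norm[OF sm that])
  have sh: "smooth_map_on usphere h" and hg: "\<And>x. x \<in> usphere \<Longrightarrow> h (g x) = x" using h by (auto simp: diffeomorphism_def)
  assume p: "p \<in> usphere" and u: "u \<in> tangent p" and z: "Dh g p u = 0"
  have p0: "p \<noteq> 0" and gp0: "hext g p \<noteq> 0" using p n[OF p] by (auto simp: hext_sphere)
  have "((\<lambda>x. hext h (hext g x)) has_derivative (\<lambda>u. Dh h (hext g p) (Dh g p u))) (at p)"
    using has_derivative_compose[OF hext_has_derivative[OF sg p0] hext_has_derivative[OF sh gp0]] by simp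
  then have "(hext (\<lambda>x. x) has_derivative (\<lambda>u. Dh h (hext g p) (Dh g p u))) (at p)"
  proof (rule has_derivative_transform_within_open[OF _ open_punctured])
    fix x :: "'n euc1" assume "x \<in> -{0}"
    then have x: "x /\<^sub>R norm x \<in> usphere" using normalize_sphere by blast
    have "g (x /\<^sub>R norm x) \<in> usphere" using n[OF x] by simp
    then show "hext h (hext g x) = hext (\<lambda>x. x) x"
      using hext_sphere[of "g (x /\<^sub>R norm x)" h] hg[OF x] by (simp add: hext_def[of g] hext_def[of "\<lambda>x. x"])
  qed (use p0 in auto)
  from fun_cong[OF frechet_derivative_at[OF this], of u]
  have "Dh h (hext g p) (Dh g p u) = Dh (\<lambda>x. x) p u" by (simp add: Dh_def)
  then show "u = 0" using Dh_identity[OF p u] linear_0[OF linear_Dh[OF sh gp0]] z by simp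
qed

lemma SO2_inner: "Q \<in> SO2 \<Longrightarrow> (Q *v x) \<bullet> (Q *v y) = x \<bullet> y"
  using orthogonal_transformation_matrix[of "(*v) Q"] by (simp add: SO2_def rotation_matrix_def orthogonal_transformation_def)

lemma SO2_transpose: "Q \<in> SO2 \<Longrightarrow> Q *v (transpose Q *v x) = x" "Q \<in> SO2 \<Longrightarrow> transpose Q *v (Q *v x) = x"
  unfolding matrix_vector_mul_assoc by (simp_all add: SO2_def rotation_matrix_def orthogonal_matrix_def)

declare transpose_matrix_vector [simp del]

lemma matrix_vector_mult_minus: "A *v (- x) = - (A *v x)" for A :: "real^'m^'k"
  by (rule linear_neg[OF matrix_vector_mul_linear])

lemma SO2_det: "Q \<in> SO2 \<Longrightarrow> det Q = 1"
  by (simp add: SO2_def rotation_matrix_def)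

lemma det_cols_matrix_vector: "det_cols (\<lambda>j. Q *v R j) = det Q * det_cols R"
proof -
  have "(\<chi> i j. (Q *v R j) $ i) = Q ** (\<chi> i j. R j $ i)"
    by (simp add: vec_eq_iff matrix_matrix_mult_def matrix_vector_mult_def)
  then show ?thesis by (simp add: det_cols_def det_mul)
qed

lemma det_cols_scale: "det_cols (\<lambda>j. c j *\<^sub>R R j) = (\<Prod>j\<in>UNIV. c j) * det_cols R"
  unfolding det_cols_rows using det_rows_mul[of c R] by (simp add: scalar_mult_eq_scaleR)

text \<open>The determinant is bilinear and alternating in these two columns, and the pair arises
  from \<open>(e, q)\<close> by a matrix of determinant \<open>s * s + c * c\<close>.\<close>

lemma det_cols_pair:
  fixes S :: "'k::finite \<Rightarrow> real^('k option option)"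
  defines "D \<equiv> \<lambda>a b. det_cols (case_option a (case_option b S))"
  assumes sc: "s * s + c * c = 1"
  shows "D (s *\<^sub>R q - c *\<^sub>R e) (- (c *\<^sub>R q + s *\<^sub>R e)) = D e q"
proof -
  have l1: "linear (\<lambda>a. D a b)" for b
  proof -
    have eq: "case_option a (case_option b S) = (case_option 0 (case_option b S))(None := a)" for a
      by (auto simp: fun_eq_iff split: option.split)
    have "(\<lambda>a. D a b) = (\<lambda>a. det_cols ((case_option 0 (case_option b S))(None := a)))"
      unfolding D_def by (rule ext, rule arg_cong[OF eq])
    then show ?thesis by (simp only: linear_det_cols)
  qed
  have l2: "linear (\<lambda>b. D a b)" for a
  proof -
    have eq: "case_option a (case_option b S) = (case_option a (case_option 0 S))(Some None := b)" for b
      by (auto simp: fun_eq_iff split: option.split)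
    have "(\<lambda>b. D a b) = (\<lambda>b. det_cols ((case_option a (case_option 0 S))(Some None := b)))"
      unfolding D_def by (rule ext, rule arg_cong[OF eq])
    then show ?thesis by (simp only: linear_det_cols)
  qed
  have z: "D a a = 0" for a unfolding D_def by (rule det_cols_identical[of None "Some None"]) simp_all
  have "D (q + e) (q + e) = D q q + D q e + D e q + D e e" by (simp add: linear_add[OF l1] linear_add[OF l2])
  then have alt: "D q e = - D e q" by (simp add: z)
  have "D (s *\<^sub>R q - c *\<^sub>R e) (- (c *\<^sub>R q + s *\<^sub>R e)) = - (s * c * D q q) - s * s * D q e + c * c * D e q + c * s * D e e"
    by (simp add: linear_diff[OF l1] linear_cmul[OF l1] linear_neg[OF l2] linear_add[OF l2] linear_diff[OF l2] linear_cmul[OF l2] algebra_simps)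
  also have "\<dots> = (s * s + c * c) * D e q" by (simp add: z alt algebra_simps)
  finally show ?thesis by (simp add: sc)
qed

section \<open>Orientation and curvature of rotated and reparametrized round spheres\<close>

definition rnd :: "real \<Rightarrow> 'n::finite mat2 \<Rightarrow> ('n euc1 \<Rightarrow> 'n euc1) \<Rightarrow> 'n euc1 \<Rightarrow> 'n euc2" where
  "rnd r Q g p = Q *v iota r (g p)"

text \<open>The sign makes the normal point towards the centre: \<open>cos r *\<^sub>R rnd r Q g p +
  sin r *\<^sub>R rnd_normal r Q g p\<close> is \<open>- (Q *v e_last)\<close> for every
  \<open>p\<close>.\<close>

definition rnd_normal :: "real \<Rightarrow> 'n::finite mat2 \<Rightarrow> ('n euc1 \<Rightarrow> 'n euc1) \<Rightarrow> 'n euc1 \<Rightarrow> 'n euc2" where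
  "rnd_normal r Q g p = Q *v (- (cos r *\<^sub>R incl (g p) + sin r *\<^sub>R e_last))"

lemma smooth_rnd:
  fixes g :: "'n::finite euc1 \<Rightarrow> 'n euc1"
  assumes g: "smooth_map_on usphere g"
  shows "smooth_map_on usphere (rnd r Q g)" "p \<in> usphere \<Longrightarrow> Dh (rnd r Q g) p u = sin r *\<^sub>R (Q *v incl (Dh g p u))"
    and "smooth_map_on usphere (rnd_normal r Q g)" "p \<in> usphere \<Longrightarrow> Dh (rnd_normal r Q g) p u = - (cos r *\<^sub>R (Q *v incl (Dh g p u)))"
proof -
  have L: "bounded_linear (\<lambda>x. c *\<^sub>R (Q *v incl x))" for c
    by (rule bounded_linear_compose[OF bounded_linear_scaleR_right bounded_linear_compose[OF matrix_vector_mul_bounded_linear bounded_linear_incl]])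
  have e: "rnd r Q g = (\<lambda>p. sin r *\<^sub>R (Q *v incl (g p)) + Q *v (- (cos r *\<^sub>R e_last)))"
    by (simp add: rnd_def iota_def fun_eq_iff matrix_vector_mult_diff_distrib matrix_vector_mult_scaleR matrix_vector_mult_minus)
  have e': "rnd_normal r Q g = (\<lambda>p. (- cos r) *\<^sub>R (Q *v incl (g p)) + Q *v (- (sin r *\<^sub>R e_last)))"
    by (simp add: rnd_normal_def fun_eq_iff matrix_vector_right_distrib matrix_vector_mult_diff_distrib matrix_vector_mult_scaleR matrix_vector_mult_minus)
  show "smooth_map_on usphere (rnd r Q g)" "smooth_map_on usphere (rnd_normal r Q g)" unfolding e e' by (rule smooth_map_on_affine(1)[OF g L])+
  show "p \<in> usphere \<Longrightarrow> Dh (rnd r Q g) p u = sin r *\<^sub>R (Q *v incl (Dh g p u))"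
    unfolding e by (rule smooth_map_on_affine(2)[OF g L sphere_nonzero])
  show "p \<in> usphere \<Longrightarrow> Dh (rnd_normal r Q g) p u = - (cos r *\<^sub>R (Q *v incl (Dh g p u)))"
    unfolding e' using smooth_map_on_affine(2)[OF g L[of "- cos r"] sphere_nonzero] by simp
qed

text \<open>The rotation \<open>Q\<close> has determinant 1, the turn in the plane of
  \<open>g p\<close> and \<open>e_last\<close> is absorbed by \<open>det_cols_pair\<close>, each
  tangential column contributes a factor \<open>sin r\<close>, and the column \<open>e_last\<close>
  borders the frame of \<open>g\<close>. So orientation is inherited from \<open>g\<close>.\<close>

lemma det_frame_rnd:
  fixes g :: "'n::finite euc1 \<Rightarrow> 'n euc1"
  assumes Q: "Q \<in> SO2" and g: "smooth_map_on usphere g" and p: "p \<in> usphere"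
  shows "det_cols (frame_cols (rnd r Q g) p u (rnd_normal r Q g p)) = sin r ^ CARD('n) * det_cols (case_option (g p) (\<lambda>k. Dh g p (u k)))"
proof -
  define w where "w = (\<lambda>k. Dh g p (u k))"
  define S where "S = (\<lambda>k. sin r *\<^sub>R incl (w k))"
  define N where "N = case_option e_last (case_option (incl (g p)) (\<lambda>k. incl (w k)))"
  define c where "c = case_option 1 (case_option 1 (\<lambda>_::'n. sin r))"
  have "frame_cols (rnd r Q g) p u (rnd_normal r Q g p) = (\<lambda>j. Q *v case_option (sin r *\<^sub>R incl (g p) - cos r *\<^sub>R e_last)
      (case_option (- (cos r *\<^sub>R incl (g p) + sin r *\<^sub>R e_last)) S) j)"
    unfolding frame_cols_def
    by (auto simp: fun_eq_iff smooth_rnd(2)[OF g p] S_def w_def rnd_def rnd_normal_def iota_def matrix_vector_mult_scaleR split: option.split)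
  then have "det_cols (frame_cols (rnd r Q g) p u (rnd_normal r Q g p)) = det_cols (case_option (sin r *\<^sub>R incl (g p) - cos r *\<^sub>R e_last)
      (case_option (- (cos r *\<^sub>R incl (g p) + sin r *\<^sub>R e_last)) S))"
    by (simp only: det_cols_matrix_vector SO2_det[OF Q] mult_1)
  also have "\<dots> = det_cols (case_option e_last (case_option (incl (g p)) S))"
    by (rule det_cols_pair) (use sin_cos_squared_add[of r] in \<open>simp add: power2_eq_square\<close>)
  also have "case_option e_last (case_option (incl (g p)) S) = (\<lambda>j. c j *\<^sub>R N j)"
    by (auto simp: c_def N_def S_def fun_eq_iff split: option.split)
  also have "det_cols (\<lambda>j. c j *\<^sub>R N j) = sin r ^ CARD('n) * det_cols N"
    by (simp add: det_cols_scale prod_UNIV_option c_def)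
  also have "det_cols N = det_cols (case_option (g p) w)"
  proof -
    have "(\<chi> i j. N j $ i) = bordered (\<chi> i j. case_option (g p) w j $ i)"
      by (intro option_vec_eqI; simp add: N_def split: option.split)
    then show ?thesis by (simp add: det_cols_def det_bordered)
  qed
  finally show ?thesis by (simp add: w_def)
qed

lemma orient_cong:
  assumes "\<And>x. x \<in> usphere \<Longrightarrow> f x = f' x" "p \<in> usphere"
  shows "orient f p w = orient f' p w"
proof -
  have "Dh f p = Dh f' p" by (rule Dh_cong) (use assms in auto)
  then show ?thesis unfolding orient_def frame_matrix_def using assms by (simp cong: option.case_cong)
qed

context
  fixes Q :: "'n::finite mat2" and g :: "'n euc1 \<Rightarrow> 'n euc1" and r :: real
  assumes Q: "Q \<in> SO2" and r: "0 < r" "r < pi" and g: "g \<in> Diff_plus"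
begin

private lemma sr: "sin r > 0"
  using r by (rule sin_gt_zero)

private lemma gs: "smooth_map_on usphere g"
  by (rule Diff_plus_props(2)[OF g])

private lemma gg: "p \<in> usphere \<Longrightarrow> g p \<bullet> g p = 1"
  using Diff_plus_props(3)[OF g] by (simp add: norm_eq_1)

private lemma sc: "sin r * sin r + cos r * cos r = 1"
  using sin_cos_squared_add[of r] by (simp add: power2_eq_square)

lemma rnd_immersion: "immersion (restrict (rnd r Q g) usphere)"
  unfolding immersion_iff
proof (intro conjI ballI impI)
  have "rnd r Q g p \<bullet> rnd r Q g p = 1" if "p \<in> usphere" for p
    using gg[OF that] sc by (simp add: rnd_def SO2_inner[OF Q] iota_def inner_diff_left inner_diff_right)
  moreover have "smooth_map_on usphere (restrict (rnd r Q g) usphere)"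
    by (rule smooth_map_on_cong[OF smooth_rnd(1)[OF gs]]) auto
  ultimately show "restrict (rnd r Q g) usphere \<in> smooth_maps" by (auto simp: smooth_maps_def norm_eq_1)
  fix p u assume p: "p \<in> usphere" and u: "u \<in> tangent p" and z: "Dh (restrict (rnd r Q g) usphere) p u = 0"
  have "Dh (restrict (rnd r Q g) usphere) p = Dh (rnd r Q g) p" by (rule Dh_cong) (use p in auto)
  then have "sin r *\<^sub>R (Q *v incl (Dh g p u)) = 0" using z smooth_rnd(2)[OF gs p, of r Q u] by simp
  then have "(Q *v incl (Dh g p u)) \<bullet> (Q *v incl (Dh g p u)) = 0" using sr by simp
  then have "Dh g p u = 0" by (simp add: SO2_inner[OF Q])
  then show "u = 0" by (rule Diff_plus_props(4)[OF g p u])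
qed

lemma gauss_map_rnd:
  assumes p: "p \<in> usphere"
  shows "gauss_map (restrict (rnd r Q g) usphere) p = rnd_normal r Q g p"
proof (rule gauss_map_unique[OF rnd_immersion p])
  have D: "Dh (restrict (rnd r Q g) usphere) p = Dh (rnd r Q g) p" by (rule Dh_cong) (use p in auto)
  show "rnd_normal r Q g p \<bullet> restrict (rnd r Q g) usphere p = 0" "rnd_normal r Q g p \<bullet> rnd_normal r Q g p = 1"
    using p gg[OF p] sc by (simp_all add: rnd_def rnd_normal_def SO2_inner[OF Q] iota_def inner_diff_left inner_diff_right
      inner_add_left inner_add_right algebra_simps)
  show "rnd_normal r Q g p \<bullet> Dh (restrict (rnd r Q g) usphere) p u = 0" for u
    unfolding D smooth_rnd(2)[OF gs p] rnd_normal_def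
    using sphere_deriv_orthogonal[OF gs Diff_plus_props(3)[OF g] p, of u]
    by (simp add: SO2_inner[OF Q] inner_add_left inner_diff_left inner_diff_right inner_commute)
  obtain u where u: "pos_basis p u" using exists_frame[OF p, of id] by (auto simp: linear_id)
  have uT: "\<And>k. u k \<in> tangent p" using u by (simp add: pos_basis_iff)
  have "pos_basis (g p) (\<lambda>k. dS g p (u k))" using g p u by (auto simp: Diff_plus_def)
  then have "0 < det_cols (case_option (g p) (\<lambda>k. Dh g p (u k)))"
    by (simp add: pos_basis_iff dS_eq_Dh[OF gs p uT])
  then have "0 < det_cols (frame_cols (rnd r Q g) p u (rnd_normal r Q g p))"
    using sr by (simp add: det_frame_rnd[OF Q gs p])
  then have "0 < orient (rnd r Q g) p (rnd_normal r Q g p) * det_cols (case_option p u)"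
    using orient_frame[OF smooth_rnd(1)[OF gs] p uT] by simp
  then have "0 < orient (rnd r Q g) p (rnd_normal r Q g p)"
    using u by (simp add: pos_basis_iff zero_less_mult_iff)
  then show "0 < orient (restrict (rnd r Q g) usphere) p (rnd_normal r Q g p)"
    using orient_cong[of "restrict (rnd r Q g) usphere" "rnd r Q g" p] p by simp
qed

lemma rnd_curvature:
  assumes "cot r \<in> I"
  shows "restrict (rnd r Q g) usphere \<in> curvature_immersions I"
  unfolding curvature_immersions_def
proof (intro CollectI conjI ballI allI impI rnd_immersion)
  fix p \<kappa> assume p: "p \<in> usphere" and "principal_curvature (restrict (rnd r Q g) usphere) p \<kappa>"
  then obtain u where u: "u \<in> tangent p" "u \<noteq> 0"
    and e: "Dh (gauss_map (restrict (rnd r Q g) usphere)) p u = - \<kappa> *\<^sub>R Dh (restrict (rnd r Q g) usphere) p u"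
    unfolding principal_curvature_iff[OF rnd_immersion p] by blast
  have "Dh (restrict (rnd r Q g) usphere) p = Dh (rnd r Q g) p" by (rule Dh_cong) (use p in auto)
  moreover have "Dh (gauss_map (restrict (rnd r Q g) usphere)) p = Dh (rnd_normal r Q g) p"
    by (rule Dh_cong) (use p gauss_map_rnd in auto)
  ultimately have "cos r *\<^sub>R (Q *v incl (Dh g p u)) = (\<kappa> * sin r) *\<^sub>R (Q *v incl (Dh g p u))"
    using e by (simp add: smooth_rnd(2,4)[OF gs p])
  then have "(cos r - \<kappa> * sin r) *\<^sub>R (Q *v incl (Dh g p u)) = 0" by (simp add: scaleR_diff_left)
  moreover have "Q *v incl (Dh g p u) \<noteq> 0"
  proof
    assume "Q *v incl (Dh g p u) = 0"
    then have "(Q *v incl (Dh g p u)) \<bullet> (Q *v incl (Dh g p u)) = 0" by simp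
    then show False using Diff_plus_props(4)[OF g p u(1)] u(2) by (simp add: SO2_inner[OF Q])
  qed
  ultimately have "\<kappa> = cot r" using sr by (simp add: cot_def field_simps)
  then show "\<kappa> \<in> I" using assms by simp
qed

lemma rnd_shiftA:
  assumes p: "p \<in> usphere"
  shows "shiftA r (restrict (rnd r Q g) usphere) p = - (Q *v e_last)"
proof -
  have e: "(cos r * cos r) *\<^sub>R E + (sin r * sin r) *\<^sub>R E = E" for E :: "'n euc2"
    unfolding scaleR_add_left[symmetric] add.commute[of "cos r * cos r"] sc by simp
  show ?thesis
    unfolding shiftA_def gauss_map_rnd[OF p] using p e[of "Q *v e_last"]
    by (simp add: rnd_def rnd_normal_def iota_def matrix_vector_mult_diff_distrib matrix_vector_right_distrib
        matrix_vector_mult_scaleR matrix_vector_mult_minus algebra_simps)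
qed

end

section \<open>Recovering the reparametrization from a round immersion\<close>

definition proj :: "'n::finite euc2 \<Rightarrow> 'n euc1" where
  "proj y = (\<chi> k. y $ Some k)"

lemma bounded_linear_proj: "bounded_linear proj"
  unfolding linear_conv_bounded_linear[symmetric] by (rule linearI) (simp_all add: proj_def vec_eq_iff)

lemma incl_proj: "y \<bullet> e_last = 0 \<Longrightarrow> incl (proj y) = y"
  by (intro option_vec_eqI) (simp_all add: proj_def inner_option)

text \<open>The reparametrization \<open>g\<close> with \<open>f = Q \<circ> iota r \<circ> g\<close>, when \<open>f\<close> is such a map.\<close>

definition unround :: "real \<Rightarrow> 'n::finite mat2 \<Rightarrow> ('n euc1 \<Rightarrow> 'n euc2) \<Rightarrow> 'n euc1 \<Rightarrow> 'n euc1" where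
  "unround r Q f = restrict (\<lambda>p. inverse (sin r) *\<^sub>R proj (transpose Q *v f p)) usphere"

context
  fixes Q :: "'n::finite mat2" and f :: "'n euc1 \<Rightarrow> 'n euc2" and r :: real and c :: "'n euc2"
  assumes Q: "Q \<in> SO2" and r: "0 < r" "r < pi" and n: "CARD('n) \<ge> 2" and f: "immersion f"
    and c: "\<And>p. p \<in> usphere \<Longrightarrow> shiftA r f p = c" and Qc: "Q *v e_last = - c"
begin

private lemma sin_r: "sin r > 0"
  using r by (rule sin_gt_zero)

text \<open>As the parallel hypersurface is the point \<open>c\<close>,
  \<open>f p = cos r *\<^sub>R c - sin r *\<^sub>R shiftB r f p\<close>. The unit vector
  \<open>- shiftB r f p\<close> is orthogonal to \<open>c\<close>, so \<open>Q\<close> carries a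
  point of the equator to it, and this point is the value of \<open>unround r Q f\<close>.\<close>

lemma round_normal_form:
  assumes p: "p \<in> usphere"
  shows "f p = rnd r Q (unround r Q f) p" "gauss_map f p = rnd_normal r Q (unround r Q f) p"
    and "norm (unround r Q f p) = 1"
proof -
  interpret immersed_front f "gauss_map f" by (rule immersed_front_gauss_map[OF f])
  interpret sh: front "\<lambda>p. cos r *\<^sub>R f p + sin r *\<^sub>R gauss_map f p" "\<lambda>p. (- sin r) *\<^sub>R f p + cos r *\<^sub>R gauss_map f p"
    by (rule shifted_front) (rule front_axioms)
  have BB: "shiftB r f p \<bullet> shiftB r f p = 1" and cB: "c \<bullet> shiftB r f p = 0"
    using sh.n\<nu>[OF p] sh.f\<nu>[OF p] unfolding c[OF p, symmetric] by (simp_all add: shiftA_def shiftB_def)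
  have fAB: "f p = cos r *\<^sub>R c - sin r *\<^sub>R shiftB r f p" "gauss_map f p = sin r *\<^sub>R c + cos r *\<^sub>R shiftB r f p"
    using rotate_back(1,2)[of r "f p" "gauss_map f p"] unfolding c[OF p, symmetric] by (simp_all add: shiftA_def shiftB_def)
  define y where "y = transpose Q *v (- shiftB r f p)"
  have Qy: "Q *v y = - shiftB r f p" unfolding y_def by (rule SO2_transpose[OF Q])
  have "y \<bullet> e_last = (Q *v y) \<bullet> (Q *v e_last)" by (rule SO2_inner[OF Q, symmetric])
  also have "\<dots> = 0" unfolding Qy Qc using cB by (simp add: inner_commute)
  finally have ye: "incl (proj y) = y" by (rule incl_proj)
  have "transpose Q *v f p = sin r *\<^sub>R y - cos r *\<^sub>R e_last"
  proof -
    have "c = - (Q *v e_last)" by (simp add: Qc)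
    then have "transpose Q *v c = - e_last" by (simp only: matrix_vector_mult_minus SO2_transpose(2)[OF Q])
    then show ?thesis unfolding fAB y_def
      by (simp add: matrix_vector_mult_diff_distrib matrix_vector_mult_scaleR matrix_vector_mult_minus)
  qed
  moreover have "proj (sin r *\<^sub>R y - cos r *\<^sub>R e_last) = sin r *\<^sub>R proj y" by (simp add: proj_def vec_eq_iff)
  ultimately have g: "unround r Q f p = proj y" using p sin_r by (simp add: unround_def)
  show "f p = rnd r Q (unround r Q f) p" "gauss_map f p = rnd_normal r Q (unround r Q f) p"
    unfolding rnd_def rnd_normal_def iota_def g ye
    by (simp_all add: matrix_vector_mult_diff_distrib matrix_vector_right_distrib matrix_vector_mult_scaleR matrix_vector_mult_minus Qy Qc fAB)
  have "proj y \<bullet> proj y = incl (proj y) \<bullet> incl (proj y)" by simp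
  also have "\<dots> = (Q *v y) \<bullet> (Q *v y)" unfolding ye by (rule SO2_inner[OF Q, symmetric])
  also have "\<dots> = 1" unfolding Qy using BB by simp
  finally have "norm (proj y) = 1" by (simp add: norm_eq_1)
  then show "norm (unround r Q f p) = 1" by (simp add: g)
qed

lemma unround_smooth: "smooth_map_on usphere (unround r Q f)"
proof -
  have "bounded_linear (\<lambda>y. inverse (sin r) *\<^sub>R proj (transpose Q *v y))"
    by (rule bounded_linear_compose[OF bounded_linear_scaleR_right bounded_linear_compose[OF bounded_linear_proj matrix_vector_mul_bounded_linear]])
  from smooth_map_on_affine(1)[OF immersion_smooth[OF f] this, of 0] show ?thesis
    by (rule smooth_map_on_cong) (simp add: unround_def)
qed

text \<open>Being an immersion of the sphere into itself, the reparametrization is a diffeomorphism.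
  It preserves orientation because a frame of \<open>f\<close> completed by the Gauss map is
  positive, and \<open>det_frame_rnd\<close> transfers this sign.\<close>

lemma unround_Diff_plus: "unround r Q f \<in> Diff_plus"
proof -
  let ?g = "unround r Q f"
  have Df: "Dh f p u = sin r *\<^sub>R (Q *v incl (Dh ?g p u))" if p: "p \<in> usphere" for p u
  proof -
    have "Dh f p = Dh (rnd r Q ?g) p" by (rule Dh_cong) (use p round_normal_form(1) in auto)
    then show ?thesis by (simp add: smooth_rnd(2)[OF unround_smooth p])
  qed
  have inj: "u = 0" if p: "p \<in> usphere" and u: "u \<in> tangent p" and z: "Dh ?g p u = 0" for p u
  proof -
    have "Dh f p u = 0" unfolding Df[OF p] z by (simp add: linear_0[OF linear_incl])
    then show ?thesis using f p u unfolding immersion_iff by blast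
  qed
  have "\<exists>h. diffeomorphism usphere usphere ?g h"
    by (rule sphere_self_immersion_diffeo[OF n unround_smooth round_normal_form(3) inj])
  moreover have "?g \<in> usphere \<rightarrow>\<^sub>E usphere" using round_normal_form(3) by (auto simp: unround_def)
  moreover have "pos_basis (?g p) (\<lambda>i. dS ?g p (u i))" if p: "p \<in> usphere" and u: "pos_basis p u" for p u
  proof -
    have uT: "\<And>k. u k \<in> tangent p" using u by (simp add: pos_basis_iff)
    have "orient f p (gauss_map f p) > 0" by (rule gauss_map_props(4)[OF f p])
    also have "orient f p (gauss_map f p) = orient (rnd r Q ?g) p (rnd_normal r Q ?g p)"
      unfolding round_normal_form(2)[OF p] by (rule orient_cong) (use p round_normal_form(1) in auto)
    finally have "0 < orient (rnd r Q ?g) p (rnd_normal r Q ?g p) * det_cols (case_option p u)"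
      using u by (simp add: pos_basis_iff)
    also have "\<dots> = sin r ^ CARD('n) * det_cols (case_option (?g p) (\<lambda>k. Dh ?g p (u k)))"
      by (simp only: orient_frame[OF smooth_rnd(1)[OF unround_smooth] p uT, symmetric] det_frame_rnd[OF Q unround_smooth p])
    finally have "0 < det_cols (case_option (?g p) (\<lambda>k. Dh ?g p (u k)))"
      using sin_r by (simp add: zero_less_mult_iff)
    moreover have "Dh ?g p (u k) \<in> tangent (?g p)" for k
      using sphere_deriv_orthogonal[OF unround_smooth round_normal_form(3) p] by (simp add: tangent_def)
    ultimately show ?thesis by (simp add: pos_basis_iff dS_eq_Dh[OF unround_smooth p uT])
  qed
  ultimately show ?thesis unfolding Diff_plus_def by blast
qed

end

section \<open>The twisted product as the space of round immersions\<close>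

definition reflection :: "real^'m \<Rightarrow> real^'m^'m::finite" where
  "reflection v = (\<chi> i j. (if i = j then 1 else 0) - 2 / (v \<bullet> v) * (v $ i * v $ j))"

lemma reflection_vector: "reflection v *v x = x - (2 * (v \<bullet> x) / (v \<bullet> v)) *\<^sub>R v"
proof -
  have "(reflection v *v x) $ i = x $ i - (2 * (v \<bullet> x) / (v \<bullet> v)) * v $ i" for i
  proof -
    have "(reflection v *v x) $ i = (\<Sum>j\<in>UNIV. (if i = j then x $ j else 0) - (2 / (v \<bullet> v) * v $ i) * (v $ j * x $ j))"
      by (simp add: reflection_def matrix_vector_mult_def) (intro sum.cong, auto simp: algebra_simps)
    also have "\<dots> = x $ i - (2 / (v \<bullet> v) * v $ i) * (v \<bullet> x)"
      unfolding sum_subtractf sum_distrib_left[symmetric] by (simp add: inner_vec_def)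
    finally show ?thesis by (simp add: field_simps)
  qed
  then show ?thesis by (simp add: vec_eq_iff)
qed

lemma orthogonal_reflection:
  assumes "v \<noteq> 0"
  shows "orthogonal_matrix (reflection v)"
proof -
  have "(reflection v *v x) \<bullet> (reflection v *v y) = x \<bullet> y" for x y
    using assms unfolding reflection_vector by (simp add: inner_diff_left inner_diff_right inner_commute field_simps)
  then have "orthogonal_transformation ((*v) (reflection v))" by (simp add: orthogonal_transformation_def)
  then show ?thesis by (simp add: orthogonal_transformation_matrix)
qed

lemma continuous_on_reflection: "continuous_on (-{0}) (reflection :: real^'m \<Rightarrow> _)"
  unfolding reflection_def by (intro continuous_intros) auto

text \<open>A continuous function with values 1 and -1 on the connected punctured space is constant.
  Equal determinants make the product of two reflections a rotation.\<close>

lemma det_reflection_eq: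
  fixes v w :: "real^'m"
  assumes "CARD('m) \<ge> 2" "v \<noteq> 0" "w \<noteq> 0"
  shows "det (reflection v) = det (reflection w)"
proof -
  have "connected (-{0 :: real^'m})" using assms(1) by (intro connected_punctured_universe) simp
  moreover have "continuous_on (-{0 :: real^'m}) (\<lambda>v. det (reflection v))"
    by (rule continuous_on_compose2[OF _ continuous_on_reflection, of UNIV]) (auto simp: det_def intro!: continuous_intros)
  moreover have "(\<lambda>v. det (reflection v)) ` (-{0 :: real^'m}) \<subseteq> {1, -1}"
    using det_orthogonal_matrix[OF orthogonal_reflection] by auto
  then have "finite ((\<lambda>v. det (reflection v)) ` (-{0 :: real^'m}))" by (rule finite_subset) simp
  ultimately obtain a where a: "\<And>x::real^'m. x \<in> -{0} \<Longrightarrow> det (reflection x) = a"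
    using continuous_finite_range_constant[of "-{0 :: real^'m}" "\<lambda>v. det (reflection v)"] unfolding constant_on_def by blast
  show ?thesis using a[of v] a[of w] assms by simp
qed

lemma reflection_mult_SO2:
  fixes v w :: "'n::finite euc2"
  assumes "v \<noteq> 0" "w \<noteq> 0"
  shows "reflection v ** reflection w \<in> SO2"
proof -
  have "det (reflection v) = det (reflection w)" by (rule det_reflection_eq) (use assms in auto)
  then have "det (reflection v ** reflection w) = 1"
    using det_orthogonal_matrix[OF orthogonal_reflection[OF assms(2)]] by (auto simp: det_mul)
  then show ?thesis
    by (simp add: SO2_def rotation_matrix_def orthogonal_matrix_mul orthogonal_reflection assms)
qed

text \<open>A local section of the map \<open>Q \<mapsto> Q *v e_last\<close> from rotations to the
  unit sphere: the second reflection swaps the image of \<open>e_last\<close> under the first one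
  with \<open>b\<close>. It is continuous in \<open>b\<close> away from the single point
  \<open>reflection w *v e_last\<close>.\<close>

definition chart_rotation :: "'n::finite euc2 \<Rightarrow> 'n euc2 \<Rightarrow> 'n mat2" where
  "chart_rotation w b = reflection (b - (reflection w *v e_last)) ** reflection w"

lemma reflection_swap:
  fixes a b :: "real^'m"
  assumes "a \<bullet> a = 1" "b \<bullet> b = 1" "a \<noteq> b"
  shows "reflection (b - a) *v a = b"
proof -
  have ne: "a \<bullet> b \<noteq> 1"
  proof
    assume "a \<bullet> b = 1"
    then have "(a - b) \<bullet> (a - b) = 0" using assms by (simp add: inner_diff_left inner_diff_right inner_commute)
    then show False using assms(3) by simp
  qed
  have "(b - a) \<bullet> (b - a) = 2 - 2 * (a \<bullet> b)" "(b - a) \<bullet> a = (a \<bullet> b) - 1"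
    using assms by (simp_all add: inner_diff_left inner_diff_right inner_commute)
  moreover have "2 * ((a \<bullet> b) - 1) / (2 - 2 * (a \<bullet> b)) = - 1" using ne by (simp add: field_simps)
  ultimately show ?thesis unfolding reflection_vector by simp
qed

lemma chart_rotation:
  fixes w b :: "'n::finite euc2"
  assumes w: "w \<noteq> 0" and b: "b \<bullet> b = 1" and ne: "b \<noteq> reflection w *v e_last"
  shows "chart_rotation w b \<in> SO2" "chart_rotation w b *v e_last = b"
proof -
  show "chart_rotation w b \<in> SO2" unfolding chart_rotation_def by (rule reflection_mult_SO2) (use w ne in auto)
  have "(reflection w *v e_last) \<bullet> (reflection w *v e_last) = 1"
    using orthogonal_reflection[OF w] orthogonal_transformation_matrix[of "(*v) (reflection w)"]
    by (simp add: orthogonal_transformation_def)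
  then show "chart_rotation w b *v e_last = b"
    unfolding chart_rotation_def matrix_vector_mul_assoc[symmetric] by (rule reflection_swap[OF _ b]) (use ne in auto)
qed

lemma continuous_on_chart_rotation:
  "continuous_on (- {reflection w *v e_last}) (chart_rotation w)"
proof -
  have 1: "continuous_on (- {reflection w *v e_last}) (\<lambda>b. reflection (b - (reflection w *v e_last)))"
    by (rule continuous_on_compose2[OF continuous_on_reflection]) (auto intro!: continuous_intros)
  have "continuous_on UNIV (\<lambda>A::'a mat2. A ** reflection w)"
    unfolding matrix_matrix_mult_def by (intro continuous_intros)
  from continuous_on_compose2[OF this 1] show ?thesis unfolding chart_rotation_def by simp
qed

section \<open>The inverse map from round immersions to the twisted product\<close>

lemma continuous_map_open_cover:
  assumes "\<And>x. x \<in> topspace X \<Longrightarrow> \<exists>U. openin X U \<and> x \<in> U \<and> continuous_map (subtopology X U) Y f"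
  shows "continuous_map X Y f"
  unfolding continuous_map_def
proof (intro conjI allI impI funcsetI)
  fix x assume x: "x \<in> topspace X"
  then obtain U where "openin X U" "x \<in> U" "continuous_map (subtopology X U) Y f" using assms by blast
  then show "f x \<in> topspace Y" using x by (auto simp: continuous_map_def)
next
  fix V assume V: "openin Y V"
  show "openin X {x \<in> topspace X. f x \<in> V}"
  proof (subst openin_subopen, intro ballI)
    fix x assume x: "x \<in> {x \<in> topspace X. f x \<in> V}"
    then obtain U where U: "openin X U" "x \<in> U" "continuous_map (subtopology X U) Y f" using assms by blast
    have "openin (subtopology X U) {x \<in> topspace (subtopology X U). f x \<in> V}"
      by (rule openin_continuous_map_preimage[OF U(3) V])
    then have "openin X {x \<in> topspace (subtopology X U). f x \<in> V}" by (rule openin_trans_full[OF _ U(1)])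
    then show "\<exists>W. openin X W \<and> x \<in> W \<and> W \<subseteq> {x \<in> topspace X. f x \<in> V}"
      using x U(2) by (intro exI[of _ "{x \<in> topspace (subtopology X U). f x \<in> V}"]) auto
  qed
qed

lemma continuous_map_quotient_proj: "continuous_map X (quotient_topology X R) (\<lambda>x. R `` {x})"
  unfolding continuous_map_def by (auto simp: topspace_quotient_topology openin_quotient_topology intro: quotientI)

lemma continuous_map_from_quotient:
  assumes "continuous_map X Y (\<lambda>x. F (R `` {x}))"
  shows "continuous_map (quotient_topology X R) Y F"
  unfolding continuous_map_def
proof (intro conjI allI impI funcsetI)
  fix C assume "C \<in> topspace (quotient_topology X R)"
  then obtain x where "x \<in> topspace X" "C = R `` {x}" unfolding topspace_quotient_topology quotient_def by blast
  then show "F C \<in> topspace Y" using assms by (auto simp: continuous_map_def)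
next
  fix U assume U: "openin Y U"
  let ?W = "{C \<in> topspace (quotient_topology X R). F C \<in> U}"
  have "{x \<in> topspace X. R `` {x} \<in> ?W} = {x \<in> topspace X. F (R `` {x}) \<in> U}"
    by (auto simp: topspace_quotient_topology intro: quotientI)
  then have "openin X {x \<in> topspace X. R `` {x} \<in> ?W}" using openin_continuous_map_preimage[OF assms U] by simp
  then show "openin (quotient_topology X R) ?W"
    unfolding openin_quotient_topology by (auto simp: topspace_quotient_topology)
qed

text \<open>Two rotations with the same image of \<open>e_last\<close> differ by the element
  \<open>transpose Q ** Q'\<close> of its stabilizer; cancelling \<open>sin r\<close> in the common
  image gives the relation between the reparametrizations.\<close>

lemma twist_rel_rnd:
  fixes Q Q' :: "'n::finite mat2"
  assumes sr: "sin r \<noteq> 0" and Q: "Q \<in> SO2" "Q' \<in> SO2" and g: "g \<in> Diff_plus" "g' \<in> Diff_plus" and e: "Q *v e_last = Q' *v e_last"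
    and eq: "\<And>p. p \<in> usphere \<Longrightarrow> rnd r Q g p = rnd r Q' g' p"
  shows "((Q, g), (Q', g')) \<in> twist_rel"
proof -
  define P where "P = transpose Q ** Q'"
  have o: "orthogonal_matrix Q" "orthogonal_matrix Q'" "det Q = 1" "det Q' = 1"
    using Q by (auto simp: SO2_def rotation_matrix_def)
  have P2: "P \<in> SO2"
    using o by (simp add: P_def SO2_def rotation_matrix_def orthogonal_matrix_mul orthogonal_matrix_transpose det_mul det_transpose)
  have "P *v e_last = transpose Q *v (Q *v e_last)" by (simp only: P_def e matrix_vector_mul_assoc)
  then have P1: "P \<in> SO1" using P2 by (simp only: SO1_def SO2_transpose(2)[OF Q(1)] mem_Collect_eq simp_thms)
  have "Q ** transpose Q = mat 1" using o(1) by (simp add: orthogonal_matrix_def)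
  then have QP: "Q' = Q ** P" by (simp add: P_def matrix_mul_assoc)
  have "incl (g' x) = matrix_inv P *v incl (g x)" if x: "x \<in> usphere" for x
  proof -
    have "sin r *\<^sub>R (Q *v incl (g x)) = sin r *\<^sub>R (Q' *v incl (g' x))"
      using eq[OF x] by (simp add: rnd_def iota_def matrix_vector_mult_diff_distrib matrix_vector_mult_scaleR e)
    then have "Q *v incl (g x) = Q' *v incl (g' x)" using sr by simp
    then have "transpose Q *v (Q *v incl (g x)) = P *v incl (g' x)" by (simp only: P_def matrix_vector_mul_assoc)
    then have "incl (g x) = P *v incl (g' x)" by (simp only: SO2_transpose(2)[OF Q(1)])
    then show ?thesis by (simp add: matrix_vector_mul_assoc matrix_inv_SO2(2)[OF P2])
  qed
  then show ?thesis unfolding twist_rel_def using Q g P1 QP by blast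
qed

context admissible_dim
begin

abbreviation (input) pairs :: "('n mat2 \<times> ('n euc1 \<Rightarrow> 'n euc1)) topology" where
  "pairs \<equiv> prod_topology (top_of_set SO2) (subtopology smooth_topology Diff_plus)"

lemma r_bounds: "0 < r" "r < pi" "sin r > 0"
  using bounds[OF r] by (auto intro: sin_gt_zero)

lemma topspace_pairs: "topspace pairs = SO2 \<times> Diff_plus"
  using Diff_plus_props(1) by (auto simp: topspace_smooth_topology)

lemma topspace_twisted: "topspace (twisted_product :: ('n mat2 \<times> ('n euc1 \<Rightarrow> 'n euc1)) set topology) = (SO2 \<times> Diff_plus) // twist_rel"
  unfolding twisted_product_def topspace_quotient_topology topspace_pairs ..

lemma Psi_rnd: "Q \<in> SO2 \<Longrightarrow> g \<in> Diff_plus \<Longrightarrow> Psi r (twist_rel `` {(Q, g)}) = restrict (rnd r Q g) usphere"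
  unfolding Psi_class rnd_def ..

lemma continuous_map_Psi: "continuous_map (twisted_product :: ('n mat2 \<times> ('n euc1 \<Rightarrow> 'n euc1)) set topology) (immersion_space (cot ` J)) (Psi r)"
  unfolding twisted_product_def
proof (rule continuous_map_from_quotient)
  have s: "continuous_map pairs smooth_topology snd"
    by (rule continuous_map_into_fulltopology[OF continuous_map_snd])
  then have cs: "csmooth pairs (-{0}) (\<lambda>z. hext (snd z))" unfolding continuous_map_smooth_topology by (rule conjunct2)
  have q: "continuous_map pairs euclidean fst" by (rule continuous_map_into_fulltopology[OF continuous_map_fst])
  have Y: "restrict (rnd r (fst z) (snd z)) usphere \<in> Y" if "z \<in> topspace pairs" for z
    using that rnd_curvature[of "fst z" r "snd z" "cot ` J"] r_bounds r unfolding topspace_pairs Y_def by auto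
  have "continuous_map pairs (immersion_space (cot ` J)) (\<lambda>z. restrict (rnd r (fst z) (snd z)) usphere)"
    unfolding immersion_space_def continuous_map_in_subtopology
  proof
    show "continuous_map pairs smooth_topology (\<lambda>z. restrict (rnd r (fst z) (snd z)) usphere)"
      unfolding continuous_map_smooth_topology
    proof
      show "\<forall>z\<in>topspace pairs. restrict (rnd r (fst z) (snd z)) usphere \<in> smooth_maps"
        using Y Y_immersion unfolding immersion_def by blast
      have "csmooth pairs (-{0}) (\<lambda>z x. fst z *v (sin r *\<^sub>R incl (hext (snd z) x) - cos r *\<^sub>R e_last))"
        by (intro csmooth_matrix_vector csmooth_diff csmooth_scaleR csmooth_const csmooth_linear[OF cs bounded_linear_incl] q open_punctured)
      then show "csmooth pairs (-{0}) (\<lambda>z. hext (restrict (rnd r (fst z) (snd z)) usphere))"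
        by (rule csmooth_cong[OF _ open_punctured]) (simp add: hext_restrict, simp add: hext_def rnd_def iota_def)
    qed
    show "(\<lambda>z. restrict (rnd r (fst z) (snd z)) usphere) \<in> topspace pairs \<rightarrow>
        {f. immersion f \<and> (\<forall>p\<in>usphere. \<forall>\<kappa>. principal_curvature f p \<kappa> \<longrightarrow> \<kappa> \<in> cot ` J)}"
      using Y unfolding Y_def curvature_immersions_def by blast
  qed
  then show "continuous_map pairs (immersion_space (cot ` J)) (\<lambda>z. Psi r (twist_rel `` {z}))"
    by (rule continuous_map_eq) (use Psi_rnd topspace_pairs in force)
qed

text \<open>Any rotation that carries \<open>e_last\<close> to minus the centre may be chosen; for
  round immersions \<open>round_class_eq\<close> shows that the class does not depend on the
  choice.\<close>

definition round_class :: "('n euc1 \<Rightarrow> 'n euc2) \<Rightarrow> ('n mat2 \<times> ('n euc1 \<Rightarrow> 'n euc1)) set" where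
  "round_class f = twist_rel `` {let Q = SOME Q. Q \<in> SO2 \<and> Q *v e_last = - center f (gauss_map f) in (Q, unround r Q f)}"

lemma round_maps_center:
  assumes "f \<in> round_maps"
  shows "f \<in> Y" "immersion f" "p \<in> usphere \<Longrightarrow> shiftA r f p = center f (gauss_map f)"
proof -
  obtain c where f: "f \<in> Y" and c: "\<And>p. p \<in> usphere \<Longrightarrow> shiftA r f p = c" using assms by (auto simp: round_maps_def)
  show "f \<in> Y" "immersion f" using f Y_immersion by auto
  have "center f (gauss_map f) = c" by (rule round_center[OF f]) (rule c)
  then show "p \<in> usphere \<Longrightarrow> shiftA r f p = center f (gauss_map f)" using c by simp
qed

lemma round_class_eq:
  assumes f: "f \<in> round_maps" and Q: "Q \<in> SO2" "Q *v e_last = - center f (gauss_map f)"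
  shows "round_class f = twist_rel `` {(Q, unround r Q f)}"
    and "unround r Q f \<in> Diff_plus" "restrict (rnd r Q (unround r Q f)) usphere = f"
proof -
  note c = round_maps_center[OF f]
  have D: "unround r R f \<in> Diff_plus" and nf: "\<And>p. p \<in> usphere \<Longrightarrow> f p = rnd r R (unround r R f) p"
    if "R \<in> SO2" "R *v e_last = - center f (gauss_map f)" for R
    using unround_Diff_plus[OF that(1) r_bounds(1,2) n c(2,3) that(2)] round_normal_form(1)[OF that(1) r_bounds(1,2) n c(2,3) that(2)] by auto
  show "unround r Q f \<in> Diff_plus" by (rule D[OF Q])
  show "restrict (rnd r Q (unround r Q f)) usphere = f"
  proof
    fix p
    have "f \<in> extensional usphere" using c(2) by (auto simp: immersion_def smooth_maps_def PiE_iff)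
    then show "restrict (rnd r Q (unround r Q f)) usphere p = f p"
      using nf[OF Q] by (cases "p \<in> usphere") (auto simp: extensional_def)
  qed
  define R where "R = (SOME Q. Q \<in> SO2 \<and> Q *v e_last = - center f (gauss_map f))"
  have R: "R \<in> SO2 \<and> R *v e_last = - center f (gauss_map f)" unfolding R_def by (rule someI) (use Q in blast)
  have "((R, unround r R f), (Q, unround r Q f)) \<in> twist_rel"
    by (rule twist_rel_rnd[of r]) (use R Q r_bounds D nf in \<open>auto simp flip: nf\<close>)
  then have "twist_rel `` {(R, unround r R f)} = twist_rel `` {(Q, unround r Q f)}" by (rule equiv_class_eq[OF equiv_twist_rel])
  then show "round_class f = twist_rel `` {(Q, unround r Q f)}" by (simp add: round_class_def Let_def flip: R_def)
qed

lemma center_unit: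
  assumes f: "f \<in> Y"
  shows "center f (gauss_map f) \<bullet> center f (gauss_map f) = 1"
proof -
  obtain a b where "pinched_front f (gauss_map f) a b" using pinched[OF _ n] f unfolding Y_def by metis
  then show ?thesis using pinched_front.norm_center by (simp add: norm_eq_1)
qed

text \<open>Each \<open>chart_rotation\<close> misses one point. Reflecting \<open>e_last\<close>
  along itself and along an orthogonal axis gives the different missed points
  \<open>- e_last\<close> and \<open>e_last\<close>, so two charts cover the sphere.\<close>

lemma chart_axes:
  obtains w1 w2 :: "'n euc2" where "w1 \<noteq> 0" "w2 \<noteq> 0" "reflection w1 *v e_last \<noteq> reflection w2 *v e_last"
proof -
  obtain k0 :: 'n where True by blast
  have "reflection e_last *v e_last = - (e_last :: 'n euc2)" unfolding reflection_vector by (simp add: scaleR_2)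
  moreover have "reflection (axis (Some (Some k0)) 1) *v e_last = (e_last :: 'n euc2)"
    unfolding reflection_vector by (simp add: inner_axis')
  moreover have "- (e_last :: 'n euc2) \<noteq> e_last" by (simp add: vec_eq_iff) (metis e_last_nth(1) neg_equal_zero zero_neq_one)
  moreover have "(e_last :: 'n euc2) \<noteq> 0" by (metis e_last_nth(1) zero_index zero_neq_one)
  moreover have "axis (Some (Some k0)) 1 \<noteq> (0 :: 'n euc2)" by simp
  ultimately show ?thesis using that[of e_last "axis (Some (Some k0)) 1"] by simp
qed

lemma round_class_exists:
  assumes f: "f \<in> round_maps"
  obtains Q where "Q \<in> SO2" "Q *v e_last = - center f (gauss_map f)"
proof -
  obtain w1 w2 :: "'n euc2" where w: "w1 \<noteq> 0" "w2 \<noteq> 0" "reflection w1 *v e_last \<noteq> reflection w2 *v e_last" by (rule chart_axes)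
  have b: "(- center f (gauss_map f)) \<bullet> (- center f (gauss_map f)) = 1" using center_unit[OF round_maps_center(1)[OF f]] by simp
  show ?thesis
    using chart_rotation[OF w(1) b] chart_rotation[OF w(2) b] that w(3) by metis
qed

lemma Psi_class_of:
  assumes f: "f \<in> round_maps"
  shows "Psi r (round_class f) = f"
proof -
  obtain Q where Q: "Q \<in> SO2" "Q *v e_last = - center f (gauss_map f)" by (rule round_class_exists[OF f])
  note c = round_class_eq[OF f Q]
  show ?thesis unfolding c(1) Psi_rnd[OF Q(1) c(2)] by (rule c(3))
qed

lemma Psi_round:
  assumes C: "C \<in> topspace (twisted_product :: ('n mat2 \<times> ('n euc1 \<Rightarrow> 'n euc1)) set topology)"
  shows "Psi r C \<in> round_maps" "round_class (Psi r C) = C"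
proof -
  obtain Q g where Q: "Q \<in> SO2" and g: "g \<in> Diff_plus" and Ceq: "C = twist_rel `` {(Q, g)}"
    using C unfolding topspace_twisted quotient_def by auto
  note rn = Q r_bounds(1,2) g
  have e: "Psi r C = restrict (rnd r Q g) usphere" unfolding Ceq by (rule Psi_rnd[OF Q g])
  have Y: "Psi r C \<in> Y" unfolding e Y_def using r by (intro rnd_curvature[OF rn]) simp
  have c: "shiftA r (Psi r C) p = - (Q *v e_last)" if "p \<in> usphere" for p
    unfolding e by (rule rnd_shiftA[OF rn that])
  show R: "Psi r C \<in> round_maps" unfolding round_maps_def using Y c by blast
  have cen: "center (Psi r C) (gauss_map (Psi r C)) = - (Q *v e_last)" by (rule round_center[OF Y]) (rule c)
  then have Qe: "Q *v e_last = - center (Psi r C) (gauss_map (Psi r C))" by simp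
  note cl = round_class_eq[OF R Q Qe]
  have "((Q, unround r Q (Psi r C)), (Q, g)) \<in> twist_rel"
  proof (rule twist_rel_rnd[of r, OF _ Q Q cl(2) g HOL.refl[of "Q *v e_last"]])
    fix p :: "'n euc1" assume p: "p \<in> usphere"
    show "rnd r Q (unround r Q (Psi r C)) p = rnd r Q g p" using fun_cong[OF cl(3), of p] fun_cong[OF e, of p] p by simp
  qed (use r_bounds in simp)
  then have "round_class (Psi r C) = twist_rel `` {(Q, g)}" unfolding cl(1) by (rule equiv_class_eq[OF equiv_twist_rel])
  from trans[OF this Ceq[symmetric]] show "round_class (Psi r C) = C" .
qed

text \<open>Locally the rotation can be chosen continuously by \<open>chart_rotation\<close>, which
  gives a continuous map into the product before the quotient is taken. The classes agree on
  overlaps, so continuity follows from an open cover.\<close>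

lemma continuous_map_class_of:
  "continuous_map (subtopology (immersion_space (cot ` J)) round_maps) twisted_product round_class"
proof (rule continuous_map_open_cover)
  let ?Z = "subtopology (immersion_space (cot ` J)) round_maps"
  let ?c = "\<lambda>f. center f (gauss_map f)"
  have tZ: "f \<in> topspace ?Z \<longleftrightarrow> f \<in> round_maps" for f
    using round_maps_center(1) by (auto simp: topspace_immersion_space Y_def)
  have cc: "continuous_map ?Z euclidean ?c"
    by (rule continuous_map_from_subtopology[OF continuous_map_center[OF admissible_axioms n]])
  have csf: "csmooth ?Z (-{0}) (\<lambda>f. hext f)"
    by (rule csmooth_param[OF csmooth_immersion_space(1)[of "cot ` J"]]) (rule continuous_map_from_subtopology, simp)
  fix f0 assume f0: "f0 \<in> topspace ?Z"
  obtain w1 w2 :: "'n euc2" where w12: "w1 \<noteq> 0" "w2 \<noteq> 0" "reflection w1 *v e_last \<noteq> reflection w2 *v e_last" by (rule chart_axes)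
  obtain w :: "'n euc2" where w: "w \<noteq> 0" "- ?c f0 \<noteq> reflection w *v e_last" using w12 by metis
  have mc: "continuous_map ?Z euclidean (\<lambda>f. - ?c f)"
    by (rule continuous_map_compose_on[OF cc, of UNIV]) (auto intro!: continuous_intros)
  define U where "U = {f \<in> topspace ?Z. - ?c f \<in> - {reflection w *v e_last}}"
  have U: "openin ?Z U" unfolding U_def by (rule openin_continuous_map_preimage[OF mc]) auto
  have f0U: "f0 \<in> U" using f0 w(2) by (auto simp: U_def)
  let ?Q = "\<lambda>f. chart_rotation w (- ?c f)"
  let ?ZU = "subtopology ?Z U"
  have tU: "f \<in> topspace ?ZU \<longleftrightarrow> f \<in> U" for f by (auto simp: U_def)
  have ch: "?Q f \<in> SO2" "?Q f *v e_last = - ?c f" and rf: "f \<in> round_maps" if "f \<in> U" for f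
  proof -
    show f: "f \<in> round_maps" using that tZ by (auto simp: U_def)
    have b: "(- ?c f) \<bullet> (- ?c f) = 1" using center_unit[OF round_maps_center(1)[OF f]] by simp
    have "- ?c f \<noteq> reflection w *v e_last" using that by (auto simp: U_def)
    from chart_rotation[OF w(1) b this] show "?Q f \<in> SO2" "?Q f *v e_last = - ?c f" .
  qed
  have Qc: "continuous_map ?ZU euclidean ?Q"
    by (rule continuous_map_compose_on[OF continuous_map_from_subtopology[OF mc] continuous_on_chart_rotation[of w]]) (auto simp: U_def)
  then have Qtc: "continuous_map ?ZU euclidean (\<lambda>f. transpose (?Q f))"
    by (rule continuous_map_compose_on[of _ _ UNIV]) (auto simp: transpose_def intro!: continuous_intros)
  have "continuous_map ?ZU pairs (\<lambda>f. (?Q f, unround r (?Q f) f))"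
  proof (rule continuous_map_pairedI)
    show "continuous_map ?ZU (top_of_set SO2) ?Q"
      using Qc ch(1) tU by (auto simp: continuous_map_in_subtopology)
    have D: "unround r (?Q f) f \<in> Diff_plus" if "f \<in> U" for f by (rule round_class_eq(2)[OF rf[OF that] ch[OF that]])
    have "continuous_map ?ZU smooth_topology (\<lambda>f. unround r (?Q f) f)"
      unfolding continuous_map_smooth_topology
    proof
      show "\<forall>f\<in>topspace ?ZU. unround r (?Q f) f \<in> smooth_maps" using D tU Diff_plus_props(1) by blast
      have "csmooth ?ZU (-{0}) (\<lambda>f. hext f)"
        by (rule csmooth_param[OF csf]) (rule continuous_map_from_subtopology, simp)
      then have "csmooth ?ZU (-{0}) (\<lambda>f x. inverse (sin r) *\<^sub>R proj (transpose (?Q f) *v hext f x))"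
        by (intro csmooth_scaleR csmooth_const csmooth_linear[OF _ bounded_linear_proj] csmooth_matrix_vector Qtc open_punctured)
      then show "csmooth ?ZU (-{0}) (\<lambda>f. hext (unround r (?Q f) f))"
        by (rule csmooth_cong[OF _ open_punctured]) (simp add: unround_def hext_restrict, simp add: hext_def)
    qed
    then show "continuous_map ?ZU (subtopology smooth_topology Diff_plus) (\<lambda>f. unround r (?Q f) f)"
      using D tU by (auto simp: continuous_map_in_subtopology)
  qed
  from continuous_map_compose[OF this continuous_map_quotient_proj]
  have "continuous_map ?ZU twisted_product (\<lambda>f. twist_rel `` {(?Q f, unround r (?Q f) f)})"
    by (simp add: twisted_product_def o_def)
  then have "continuous_map ?ZU twisted_product round_class"
    by (rule continuous_map_eq) (use round_class_eq(1)[OF rf ch] tU in auto)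
  then show "\<exists>U. openin ?Z U \<and> f0 \<in> U \<and> continuous_map (subtopology ?Z U) twisted_product round_class"
    using U f0U by blast
qed

text \<open>The retraction is the class of the end of the deformation. Time is rescaled from
  \<open>{0..1}\<close> to the angle range \<open>{0..pi/2}\<close>.\<close>

theorem weak_homotopy_equivalence_Psi:
  "weak_homotopy_equivalence (twisted_product :: ('n mat2 \<times> ('n euc1 \<Rightarrow> 'n euc1)) set topology) (immersion_space (cot ` J)) (Psi r)"
proof (rule weak_homotopy_equivalence_retract)
  let ?Y = "immersion_space (cot ` J) :: ('n euc1 \<Rightarrow> 'n euc2) topology"
  have tY: "f \<in> topspace ?Y \<longleftrightarrow> f \<in> Y" for f by (simp add: topspace_immersion_space Y_def)
  show "continuous_map twisted_product ?Y (Psi r)" by (rule continuous_map_Psi)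
  have half: "continuous_map ?Y \<Phi> (\<lambda>f. (pi / 2, f))"
    unfolding \<Phi>_def by (intro continuous_map_pairedI) auto
  have "continuous_map ?Y (subtopology ?Y round_maps) (\<lambda>f. deform_map r (pi / 2, f))"
    using continuous_map_compose[OF half continuous_map_deform_map] deform_map_end tY
    by (auto simp: continuous_map_in_subtopology o_def)
  from continuous_map_compose[OF this continuous_map_class_of]
  show "continuous_map ?Y twisted_product (\<lambda>f. round_class (deform_map r (pi / 2, f)))" by (simp add: o_def)
  have "continuous_map (prod_topology (top_of_set {0..1::real}) ?Y) \<Phi> (\<lambda>z. (fst z * (pi / 2), snd z))"
    unfolding \<Phi>_def
  proof (rule continuous_map_pairedI)
    have "continuous_map (top_of_set {0..1::real}) (top_of_set {0..pi/2}) (\<lambda>s. s * (pi / 2))"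
      by (auto simp: continuous_map_in_subtopology mult_left_le_one_le intro!: continuous_intros)
    from continuous_map_compose[OF continuous_map_fst this]
    show "continuous_map (prod_topology (top_of_set {0..1::real}) ?Y) (top_of_set {0..pi/2}) (\<lambda>z. fst z * (pi / 2))" by (simp add: o_def)
  qed (rule continuous_map_snd)
  from continuous_map_compose[OF this continuous_map_deform_map]
  show "continuous_map (prod_topology (top_of_set {0..1::real}) ?Y) ?Y (\<lambda>z. deform_map r (fst z * (pi / 2), snd z))" by (simp add: o_def)
  show "round_class (deform_map r (pi / 2, Psi r C)) = C" if "C \<in> topspace twisted_product"
    for C :: "('n mat2 \<times> ('n euc1 \<Rightarrow> 'n euc1)) set"
    using Psi_round[OF that] deform_map_round[OF Psi_round(1)[OF that], of "pi / 2"] by simp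
  show "deform_map r (fst (0, f) * (pi / 2), snd (0, f)) = f" if "f \<in> topspace ?Y" for f
    using deformed_0(1) that tY by simp
  show "deform_map r (fst (1, f) * (pi / 2), snd (1, f)) = Psi r (round_class (deform_map r (pi / 2, f)))" if "f \<in> topspace ?Y" for f
    using Psi_class_of[OF deform_map_end] that tY by simp
  show "deform_map r (fst (s, Psi r C) * (pi / 2), snd (s, Psi r C)) = Psi r C" if "s \<in> {0..1}" "C \<in> topspace twisted_product"
    for s and C :: "('n mat2 \<times> ('n euc1 \<Rightarrow> 'n euc1)) set"
    using deform_map_round[OF Psi_round(1)[OF that(2)], of "s * (pi / 2)"] that(1) by (simp add: mult_left_le_one_le)
qed

end

theorem theorem0p9:
  fixes J :: "real set" and r :: real
  assumes "CARD('n::finite) \<ge> 2"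
    and "is_interval J" and "J \<subseteq> {0<..<pi}"
    and "J \<inter> (\<lambda>x. x + pi / 2) ` J = {}"
    and "r \<in> J"
  shows "weak_homotopy_equivalence
    (twisted_product :: ('n mat2 \<times> ('n euc1 \<Rightarrow> 'n euc1)) set topology)
    (immersion_space (cot ` J) :: ('n euc1 \<Rightarrow> 'n euc2) topology)
    (Psi r)"
proof -
  interpret admissible_dim J r "curvature_immersions (cot ` J) :: ('n euc1 \<Rightarrow> 'n euc2) set"
    "prod_topology (top_of_set {0..pi/2}) (immersion_space (cot ` J)) :: (real \<times> ('n euc1 \<Rightarrow> 'n euc2)) topology"
    by unfold_locales (use assms in auto)
  show ?thesis by (rule weak_homotopy_equivalence_Psi)
qed

end
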